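(* Let $N\ge1$, let $\mathbb{M}$ be a second-countable locally compact Hausdorff space, and let $\Phi$ be a stationary marked point process on $\mathbb{R}^N$ with marks in $\mathbb{M}$ whose ground process $\Phi_g$ has all finite moments. Assume that, for every compact set $\Lambda\subset\mathbb{R}^N$, the distribution $\Theta_{r_\Lambda(\Phi_g)}$ is absolutely continuous with respect to $\Theta_{r_\Lambda(\Psi)}$, where $\Psi$ is any homogeneous Poisson point process on $\mathbb{R}^N$ with intensity $\lambda\in(0,\infty)$, and that the Radon--Nikodym derivative $d\Theta_{r_\Lambda(\Phi_g)}/d\Theta_{r_\Lambda(\Psi)}$ is strictly positive $\Theta_{r_\Lambda(\Psi)}$-almost surely. Let $\kappa:\mathscr{F}(\mathbb{R}^N\times\mathbb{M})\to[0,\infty)$ be a (finite-valued) filtration function for which there exists a constant $c_\kappa>0$ such that for all $\sigma,\sigma'\in\mathscr{F}(\mathbb{R}^N\times\mathbb{M})$ $$|\kappa(\sigma)-\kappa(\sigma')|\le c_\kappa\, d_H(\pi(\sigma),\pi(\sigma')),$$ where $\pi:\mathbb{R}^N\times\mathbb{M}\to\mathbb{R}^N$ is the projection and $d_H$ is the Hausdorff distance in $\mathbb{R}^N$. Then, for every integer $q\ge0$, the support of the limiting verbose diagram measure $\nu_q'=\nu_q'(\kappa,\Phi)$ satisfies $$\mathrm{supp}(\nu_q')=\overline{R_q'(\kappa)},$$ where the closure is taken in $\Delta'$.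
   Context: **Limiting measure.** $\nu_q'=\nu_q'(\kappa,\Phi)$ is the unique Radon measure on $\Delta'$ such that for every convex averaging sequence $\{\Lambda_n\}_n$ in $\mathbb{R}^N$, $\frac{1}{\mathrm{vol}(\Lambda_n)}\mathbb{E}[\xi^{\kappa}_{\mathrm{Ver},q,\Lambda_n}]\xrightarrow{v}\nu_q'$ as $n\to\infty$ (its existence and uniqueness is a theorem valid for every stationary marked point process $\Phi$ whose ground process has all finite moments and every filtration function $\kappa$). **Realizable points.** $R_q'(\kappa)\subset\Delta'$ is the set of points $(b,d)\in\Delta'$ that belong to the degree-$q$ verbose diagram of $\mathbb{K}^\kappa(\Xi)$ for some nonempty finite simple marked point set $\Xi\subset\mathbb{R}^N\times\mathbb{M}$. **Distributions.** For a point process $\Phi$ on $S$, $\Theta_\Phi$ is its probability distribution on $\mathscr{N}(S)$. For Borel $\Lambda\subset\mathbb{R}^N$, $r_\Lambda:\mathscr{N}(\mathbb{R}^N)\to\mathscr{N}(\Lambda)$ is restriction: $r_\Lambda(\mu)(A)=\mu(A)$ for Borel $A\subset\Lambda$. **Measures.** For a second-countable locally compact Hausdorff space $S$, $\mathscr{R}(S)$ is the set of Radon measures on $S$ (Borel measures finite on compact sets); $\mu_n\xrightarrow{v}\mu$ (vague convergence) iff $\int f\,d\mu_n\to\int f\,d\mu$ for every continuous compactly supported $f:S\to\mathbb{R}$. $\mathscr{N}(S)\subset\mathscr{R}(S)$ is the set of integer-valued measures (sums of Dirac measures), identified with locally finite multisets. A point process on $S$ is an $\mathscr{N}(S)$-valued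 random variable (Borel $\sigma$-algebra of the vague topology). It is simple if a.s. every point has mass at most $1$. $\mathbb{E}[\xi](A):=\mathbb{E}[\xi(A)]$. $\mathrm{vol}$ is Lebesgue measure. **Marked point processes.** A marked point process on $\mathbb{R}^N$ with marks in $\mathbb{M}$ is a point process $\Phi$ on $\mathbb{R}^N\times\mathbb{M}$ whose ground process $\Phi_g(A):=\Phi(A\times\mathbb{M})$ is simple. The ground process has all finite moments if $\mathbb{E}[\Phi_g(A)^k]<\infty$ for all bounded Borel $A\subset\mathbb{R}^N$ and integers $k\ge1$. $\Phi$ is stationary if its distribution is invariant under the translations $\mu\mapsto\mu^{(v)}$, $\mu^{(v)}(A):=\mu(A+v)$, $A+v:=\{(x+v,m):(x,m)\in A\}$, $v\in\mathbb{R}^N$. For bounded Borel $\Lambda\subset\mathbb{R}^N$, $\Phi_\Lambda(\cdot):=\Phi(\cdot\cap(\Lambda\times\mathbb{M}))$; almost surely it is identified with a finite simple marked point set, i.e. a finite subset $X$ of $\mathbb{R}^N\times\mathbb{M}$ having at most one point over each $x\in\mathbb{R}^N$. **Convex averaging sequence.** A sequence $\{\Lambda_n\}_n$ of bounded convex Borel sets in $\mathbb{R}^N$ with $\Lambda_n\subset\Lambda_m$ for $n\le m$ and $\sup_n r(\Lambda_n)=\infty$, where $r(\Lambda)$ is the supremum of the radii of open balls contained in $\Lambda$. **Filtration functions.** $\mathscr{F}(S)$ is the set of nonempty finite subsets of $S$. A function $f$ on $\mathscr{F}(\mathbb{R}^N\times\mathbb{M})$ is measurable if for each $k\ge1$ there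 is a permutation-invariant measurable $\tilde f_k$ on $(\mathbb{R}^N\times\mathbb{M})^k$ with $f(\{x_1,\dots,x_k\})=\tilde f_k(x_1,\dots,x_k)$. A filtration function for marked point sets is a measurable $\kappa:\mathscr{F}(\mathbb{R}^N\times\mathbb{M})\to[0,\infty]$ such that: (1) $\kappa(\sigma)\le\kappa(\tau)$ if $\sigma\subset\tau$; (2) $\kappa(\sigma)=\kappa(\sigma+x)$ for all $x\in\mathbb{R}^N$, where $\sigma+x=\{(y+x,m):(y,m)\in\sigma\}$; (3) there is an increasing $\rho:[0,\infty]\to[0,\infty]$ with $\rho(t)<\infty$ for finite $t$ and $\|x-y\|\le\rho(\kappa(\{(x,m),(y,n)\}))$ for all $(x,m),(y,n)$. The $\kappa$-filtration on a finite simple marked point set $X$ is $\mathbb{K}^\kappa(X)=\{K^\kappa(X,t)\}_{t\ge0}$, $K^\kappa(X,t)=\{\emptyset\ne\sigma\subset X:\kappa(\sigma)\le t\}$; it is regarded as a filtration of $\bigcup_{t\ge0}K^\kappa(X,t)$. **Verbose diagrams.** Fix a coefficient field $\mathbb{F}$. Let $\mathbb{K}=\{K_t\}_{t\ge0}$ be an increasing right-continuous family of subcomplexes of a finite simplicial complex $K=\bigcup_tK_t$. Let $(C_*(K),\partial)$ be its (unreduced) simplicial chain complex over $\mathbb{F}$, and for a chain $x=\sum_i\lambda_i\sigma_i$ (distinct simplices) put $\ell_{\mathbb{K}}(x)=\max\{t_{\mathbb{K}}(\sigma_i):\lambda_i\ne0\}$, $\ell_{\mathbb{K}}(0)=-\infty$,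 where $t_{\mathbb{K}}(\sigma)=\inf\{t\ge0:\sigma\in K_t\}$. A finite set $\{x_1,\dots,x_k\}$ of chains is orthogonal if $\ell_{\mathbb{K}}(\sum\lambda_ix_i)=\max\{\ell_{\mathbb{K}}(x_i):\lambda_i\ne0\}$ for all $\lambda_i\in\mathbb{F}$ (with $\max\varnothing=-\infty$). View $\partial_{q+1}$ as a map $C_{q+1}(K)\to\mathrm{Ker}\,\partial_q$, of rank $r$. A singular value decomposition of $\partial_{q+1}$ is a pair $((y_1,\dots,y_n),(x_1,\dots,x_m))$ of ordered orthogonal bases of $C_{q+1}(K)$ and $\mathrm{Ker}\,\partial_q$ such that $(y_{r+1},\dots,y_n)$ is an orthogonal basis of $\mathrm{Ker}\,\partial_{q+1}$, $(x_1,\dots,x_r)$ is an orthogonal basis of $\mathrm{Im}\,\partial_{q+1}$, and $\partial_{q+1}y_i=x_i$ for $i\le r$; one always exists. The degree-$q$ verbose diagram is the multiset consisting of $(\ell_{\mathbb{K}}(x_i),\ell_{\mathbb{K}}(y_i))$ for $i\le r$ and $(\ell_{\mathbb{K}}(x_i),\infty)$ for $r<i\le m$; it does not depend on the decomposition chosen. It is a multiset in $\Delta':=\{(x,y)\in[0,\infty]^2:x\le y\}\setminus\{(\infty,\infty)\}$, where $[0,\infty]$ has the order topology and $\Delta'$ the subspace topology. $\xi^{\kappa}_{\mathrm{Ver},q,\Lambda}$ denotes the sum of Dirac measures (with multiplicity) at the points of the degree-$q$ verbose diagram of $\mathbb{K}^\kappa(\Phi_\Lambda)$; it is (almost surely defined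 as) a point process on $\Delta'$. *)

theory Defs
  imports "HOL-Probability.Probability" "HOL-Library.Poly_Mapping"
begin

section \<open>Radon measures, point processes, and their distributions\<close>

text \<open>Spaces are given as abstract topologies, because the same notions are needed for
  \<open>\<real>\<^sup>N \<times> \<bbbM>\<close>, for compact subsets of \<open>\<real>\<^sup>N\<close>, and for the set \<open>\<Delta>'\<close> below.\<close>

definition borel_of :: "'a topology \<Rightarrow> 'a measure" where
  "borel_of X = sigma (topspace X) {U. openin X U}"

definition radon_measures :: "'a topology \<Rightarrow> 'a measure set" where
  "radon_measures X =
     {\<mu>. sets \<mu> = sets (borel_of X) \<and> (\<forall>K. compactin X K \<longrightarrow> emeasure \<mu> K < \<infinity>)}"

definition Cc :: "'a topology \<Rightarrow> ('a \<Rightarrow> real) set" where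
  "Cc X = {f. continuous_map X euclideanreal f \<and>
              compactin X (X closure_of {x \<in> topspace X. f x \<noteq> 0})}"

definition vague_topology :: "'a topology \<Rightarrow> 'a measure topology" where
  "vague_topology X = topology_generated_by
     {{\<mu> \<in> radon_measures X. integral\<^sup>L \<mu> f \<in> U} | f U. f \<in> Cc X \<and> open U}"

definition vaguely_converges ::
  "'a topology \<Rightarrow> (nat \<Rightarrow> 'a measure) \<Rightarrow> 'a measure \<Rightarrow> bool" where
  "vaguely_converges X \<mu>s \<mu> \<longleftrightarrow>
     (\<forall>f \<in> Cc X. (\<lambda>n. integral\<^sup>L (\<mu>s n) f) \<longlonglongrightarrow> integral\<^sup>L \<mu> f)"

definition counting_measures :: "'a topology \<Rightarrow> 'a measure set" where
  "counting_measures X =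
     {\<mu> \<in> radon_measures X. \<forall>A \<in> sets \<mu>. \<exists>k. emeasure \<mu> A = ennreal_of_enat k}"

definition counting_space :: "'a topology \<Rightarrow> 'a measure measure" where
  "counting_space X = borel_of (subtopology (vague_topology X) (counting_measures X))"

definition point_process :: "'w measure \<Rightarrow> 'a topology \<Rightarrow> ('w \<Rightarrow> 'a measure) \<Rightarrow> bool" where
  "point_process P X \<Phi> \<longleftrightarrow> \<Phi> \<in> measurable P (counting_space X)"

definition simple_process :: "'w measure \<Rightarrow> 'a topology \<Rightarrow> ('w \<Rightarrow> 'a measure) \<Rightarrow> bool" where
  "simple_process P X \<Phi> \<longleftrightarrow> (AE \<omega> in P. \<forall>x \<in> topspace X. emeasure (\<Phi> \<omega>) {x} \<le> 1)"

definition law ::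
  "'w measure \<Rightarrow> 'a topology \<Rightarrow> ('w \<Rightarrow> 'a measure) \<Rightarrow> 'a measure measure" where
  "law P X \<Phi> = distr P (counting_space X) \<Phi>"

definition measure_support :: "'a topology \<Rightarrow> 'a measure \<Rightarrow> 'a set" where
  "measure_support X \<mu> =
     {x \<in> topspace X. \<forall>U. openin X U \<longrightarrow> x \<in> U \<longrightarrow> 0 < emeasure \<mu> U}"

text \<open>The Poisson probabilities are written out since \<^const>\<open>poisson_pmf\<close> is meaningful
  for positive rates only, and \<open>A\<close> may be a null set.\<close>

definition homogeneous_poisson_process ::
  "'w measure \<Rightarrow> real \<Rightarrow> ('w \<Rightarrow> 'a::euclidean_space measure) \<Rightarrow> bool" where
  "homogeneous_poisson_process P l \<Psi> \<longleftrightarrow>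
     point_process P euclidean \<Psi> \<and>
     (\<forall>A \<in> sets borel. bounded A \<longrightarrow> (\<forall>k::nat.
        measure P {\<omega> \<in> space P. emeasure (\<Psi> \<omega>) A = of_nat k} =
          (l * measure lborel A) ^ k / fact k * exp (- (l * measure lborel A)))) \<and>
     (\<forall>(I::nat set) A. finite I \<longrightarrow> (\<forall>i \<in> I. A i \<in> sets borel \<and> bounded (A i)) \<longrightarrow>
        disjoint_family_on A I \<longrightarrow>
        prob_space.indep_vars P (\<lambda>_. borel) (\<lambda>i \<omega>. emeasure (\<Psi> \<omega>) (A i)) I)"


section \<open>Marked point processes\<close>

definition ground :: "('a::euclidean_space \<times> 'm::topological_space) measure \<Rightarrow> 'a measure" where
  "ground \<mu> = distr \<mu> borel fst"

text \<open>If the mark space is not compact, local finiteness of the ground measure is not automatic.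
  It is part of the ground process being a point process.\<close>

definition marked_point_process ::
  "'w measure \<Rightarrow> ('w \<Rightarrow> ('a::euclidean_space \<times> 'm::topological_space) measure) \<Rightarrow> bool" where
  "marked_point_process P \<Phi> \<longleftrightarrow>
     point_process P euclidean \<Phi> \<and>
     point_process P euclidean (\<lambda>\<omega>. ground (\<Phi> \<omega>)) \<and>
     simple_process P euclidean (\<lambda>\<omega>. ground (\<Phi> \<omega>))"

definition ground_finite_moments ::
  "'w measure \<Rightarrow> ('w \<Rightarrow> ('a::euclidean_space \<times> 'm::topological_space) measure) \<Rightarrow> bool" where
  "ground_finite_moments P \<Phi> \<longleftrightarrow>
     (\<forall>A \<in> sets borel. bounded A \<longrightarrow>
        (\<forall>k\<ge>1. (\<integral>\<^sup>+\<omega>. emeasure (ground (\<Phi> \<omega>)) A ^ k \<partial>P) < \<infinity>))"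

text \<open>The translate satisfies \<open>emeasure (translate v \<mu>) A = emeasure \<mu> (A + v)\<close>,
  since \<open>A + v\<close> is the preimage of \<open>A\<close> under translation by \<open>-v\<close>.\<close>

definition translate ::
  "'a::euclidean_space \<Rightarrow> ('a \<times> 'm::topological_space) measure \<Rightarrow> ('a \<times> 'm) measure" where
  "translate v \<mu> = distr \<mu> borel (\<lambda>(x, m). (x - v, m))"

definition stationary ::
  "'w measure \<Rightarrow> ('w \<Rightarrow> ('a::euclidean_space \<times> 'm::topological_space) measure) \<Rightarrow> bool" where
  "stationary P \<Phi> \<longleftrightarrow>
     (\<forall>v. distr (law P euclidean \<Phi>) (counting_space euclidean) (translate v) = law P euclidean \<Phi>)"

definition marked_points ::
  "('a \<times> 'm) measure \<Rightarrow> 'a set \<Rightarrow> ('a \<times> 'm) set" where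
  "marked_points \<mu> \<Lambda> = {z. fst z \<in> \<Lambda> \<and> emeasure \<mu> {z} \<noteq> 0}"

definition finite_simple_marked_set :: "('a \<times> 'm) set \<Rightarrow> bool" where
  "finite_simple_marked_set X \<longleftrightarrow> finite X \<and> inj_on fst X"

definition inradius :: "'a::metric_space set \<Rightarrow> ennreal" where
  "inradius \<Lambda> = Sup {ennreal r | r x. 0 < r \<and> ball x r \<subseteq> \<Lambda>}"

definition convex_averaging_sequence :: "(nat \<Rightarrow> 'a::euclidean_space set) \<Rightarrow> bool" where
  "convex_averaging_sequence \<Lambda> \<longleftrightarrow>
     (\<forall>n. bounded (\<Lambda> n) \<and> convex (\<Lambda> n) \<and> \<Lambda> n \<in> sets borel) \<and>
     mono \<Lambda> \<and> (SUP n. inradius (\<Lambda> n)) = \<infinity>"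


section \<open>Filtration functions\<close>

definition finite_subsets :: "'a set set" where
  "finite_subsets = {\<sigma>. finite \<sigma> \<and> \<sigma> \<noteq> {}}"

definition measurable_set_function :: "('a::topological_space set \<Rightarrow> ennreal) \<Rightarrow> bool" where
  "measurable_set_function f \<longleftrightarrow>
     (\<forall>k::nat. 1 \<le> k \<longrightarrow> (\<exists>g \<in> borel_measurable (PiM {..<k} (\<lambda>_. borel :: 'a measure)).
        (\<forall>x \<in> space (PiM {..<k} (\<lambda>_. borel :: 'a measure)).
           (\<forall>p. p permutes {..<k} \<longrightarrow> g (x \<circ> p) = g x) \<and> f (x ` {..<k}) = g x)))"

definition filtration_function ::
  "(('a::euclidean_space \<times> 'm::topological_space) set \<Rightarrow> ennreal) \<Rightarrow> bool" where
  "filtration_function \<kappa> \<longleftrightarrow>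
     measurable_set_function \<kappa> \<and>
     (\<forall>\<sigma> \<in> finite_subsets. \<forall>\<tau> \<in> finite_subsets. \<sigma> \<subseteq> \<tau> \<longrightarrow> \<kappa> \<sigma> \<le> \<kappa> \<tau>) \<and>
     (\<forall>\<sigma> \<in> finite_subsets. \<forall>x. \<kappa> ((\<lambda>(y, m). (y + x, m)) ` \<sigma>) = \<kappa> \<sigma>) \<and>
     (\<exists>\<rho> :: ennreal \<Rightarrow> ennreal. mono \<rho> \<and> (\<forall>t<\<infinity>. \<rho> t < \<infinity>) \<and>
        (\<forall>x m y n. ennreal (norm (x - y)) \<le> \<rho> (\<kappa> {(x, m), (y, n)})))"

definition kappa_filtration :: "('v set \<Rightarrow> ennreal) \<Rightarrow> 'v set \<Rightarrow> real \<Rightarrow> 'v set set" where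
  "kappa_filtration \<kappa> X t = {\<sigma>. \<sigma> \<noteq> {} \<and> \<sigma> \<subseteq> X \<and> \<kappa> \<sigma> \<le> ennreal t}"

definition hausdorff_dist :: "'a::metric_space set \<Rightarrow> 'a set \<Rightarrow> real" where
  "hausdorff_dist A B = max (SUP a\<in>A. infdist a B) (SUP b\<in>B. infdist b A)"


section \<open>Simplicial chains over a field\<close>

text \<open>A chain is a finitely supported combination of simplices, a simplex being represented by
  its vertex set. Simplices are oriented by one fixed linear order on the type of vertices;
  another order only changes the signs of the basis simplices.\<close>

definition vertex_order :: "'v rel" where
  "vertex_order = (SOME r. linear_order r)"

definition vertex_position :: "'v set \<Rightarrow> 'v \<Rightarrow> nat" where
  "vertex_position \<sigma> v = card {w \<in> \<sigma>. w \<noteq> v \<and> (w, v) \<in> vertex_order}"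

definition chain_scale :: "'f::field \<Rightarrow> ('s \<Rightarrow>\<^sub>0 'f) \<Rightarrow> ('s \<Rightarrow>\<^sub>0 'f)" where
  "chain_scale a c = Poly_Mapping.map ((*) a) c"

lemma lookup_chain_scale [simp]:
  "Poly_Mapping.lookup (chain_scale a c) \<sigma> = a * Poly_Mapping.lookup c \<sigma>"
  by (simp add: chain_scale_def map.rep_eq when_def)

interpretation chain: vector_space "chain_scale :: 'f::field \<Rightarrow> ('s \<Rightarrow>\<^sub>0 'f) \<Rightarrow> ('s \<Rightarrow>\<^sub>0 'f)"
  by unfold_locales (auto intro!: poly_mapping_eqI simp: lookup_add algebra_simps)

definition chains :: "'v set set \<Rightarrow> nat \<Rightarrow> ('v set \<Rightarrow>\<^sub>0 'f::field) set" where
  "chains K q = {c. \<forall>\<sigma> \<in> Poly_Mapping.keys c. \<sigma> \<in> K \<and> card \<sigma> = Suc q}"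

definition boundary :: "nat \<Rightarrow> ('v set \<Rightarrow>\<^sub>0 'f::field) \<Rightarrow> ('v set \<Rightarrow>\<^sub>0 'f)" where
  "boundary q c = (if q = 0 then 0 else
     (\<Sum>\<sigma> \<in> Poly_Mapping.keys c. \<Sum>v \<in> \<sigma>.
        Poly_Mapping.single (\<sigma> - {v})
          ((-1) ^ vertex_position \<sigma> v * Poly_Mapping.lookup c \<sigma>)))"

definition cycles :: "'v set set \<Rightarrow> nat \<Rightarrow> ('v set \<Rightarrow>\<^sub>0 'f::field) set" where
  "cycles K q = {c \<in> chains K q. boundary q c = 0}"

definition boundaries :: "'v set set \<Rightarrow> nat \<Rightarrow> ('v set \<Rightarrow>\<^sub>0 'f::field) set" where
  "boundaries K q = boundary (Suc q) ` chains K (Suc q)"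


section \<open>Verbose diagrams\<close>

definition total_complex :: "(real \<Rightarrow> 'v set set) \<Rightarrow> 'v set set" where
  "total_complex K = (\<Union>t\<in>{0..}. K t)"

definition birth_time :: "(real \<Rightarrow> 'v set set) \<Rightarrow> 'v set \<Rightarrow> ereal" where
  "birth_time K \<sigma> = Inf {ereal t | t. 0 \<le> t \<and> \<sigma> \<in> K t}"

text \<open>Both suprema below are maxima over finite sets; over the empty set they are \<open>-\<infinity>\<close>.\<close>

definition level :: "(real \<Rightarrow> 'v set set) \<Rightarrow> ('v set \<Rightarrow>\<^sub>0 'f::field) \<Rightarrow> ereal" where
  "level K c = (SUP \<sigma> \<in> Poly_Mapping.keys c. birth_time K \<sigma>)"

definition orthogonal_chains ::
  "(real \<Rightarrow> 'v set set) \<Rightarrow> ('v set \<Rightarrow>\<^sub>0 'f::field) set \<Rightarrow> bool" where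
  "orthogonal_chains K S \<longleftrightarrow> finite S \<and>
     (\<forall>a. level K (\<Sum>x\<in>S. chain_scale (a x) x) = (SUP x\<in>{x \<in> S. a x \<noteq> 0}. level K x))"

definition orthogonal_basis ::
  "(real \<Rightarrow> 'v set set) \<Rightarrow> ('v set \<Rightarrow>\<^sub>0 'f::field) set \<Rightarrow> ('v set \<Rightarrow>\<^sub>0 'f) list \<Rightarrow> bool" where
  "orthogonal_basis K V bs \<longleftrightarrow>
     distinct bs \<and> chain.independent (set bs) \<and> chain.span (set bs) = V \<and>
     orthogonal_chains K (set bs)"

definition boundary_rank :: "'f::field itself \<Rightarrow> 'v set set \<Rightarrow> nat \<Rightarrow> nat" where
  "boundary_rank F K q = chain.dim (boundaries K q :: ('v set \<Rightarrow>\<^sub>0 'f) set)"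

definition singular_value_decomposition ::
  "(real \<Rightarrow> 'v set set) \<Rightarrow> nat \<Rightarrow>
     ('v set \<Rightarrow>\<^sub>0 'f::field) list \<Rightarrow> ('v set \<Rightarrow>\<^sub>0 'f) list \<Rightarrow> bool" where
  "singular_value_decomposition K q ys xs \<longleftrightarrow>
     (let C = total_complex K; r = boundary_rank TYPE('f) C q in
        orthogonal_basis K (chains C (Suc q)) ys \<and>
        orthogonal_basis K (cycles C q) xs \<and>
        orthogonal_basis K (cycles C (Suc q)) (drop r ys) \<and>
        orthogonal_basis K (boundaries C q) (take r xs) \<and>
        (\<forall>i<r. boundary (Suc q) (ys ! i) = xs ! i))"

text \<open>The diagram does not depend on the decomposition chosen.\<close>

definition verbose_diagram ::
  "'f::field itself \<Rightarrow> (real \<Rightarrow> 'v set set) \<Rightarrow> nat \<Rightarrow> (ereal \<times> ereal) multiset" where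
  "verbose_diagram F K q =
     (SOME D. \<exists>ys xs :: ('v set \<Rightarrow>\<^sub>0 'f) list. singular_value_decomposition K q ys xs \<and>
        D = mset (map (\<lambda>i. (level K (xs ! i),
                            if i < boundary_rank F (total_complex K) q
                            then level K (ys ! i) else \<infinity>))
                      [0..<length xs]))"

definition Delta' :: "(ereal \<times> ereal) set" where
  "Delta' = {(x, y). 0 \<le> x \<and> x \<le> y} - {(\<infinity>, \<infinity>)}"

abbreviation Delta'_top :: "(ereal \<times> ereal) topology" where
  "Delta'_top \<equiv> top_of_set Delta'"

definition diagram_measure :: "(ereal \<times> ereal) multiset \<Rightarrow> (ereal \<times> ereal) measure" where
  "diagram_measure D = measure_of Delta' (sets (borel_of Delta'_top))
     (\<lambda>A. of_nat (size (filter_mset (\<lambda>p. p \<in> A) D)))"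

definition verbose_process ::
  "'f::field itself \<Rightarrow> (('a \<times> 'm) set \<Rightarrow> ennreal) \<Rightarrow> ('w \<Rightarrow> ('a \<times> 'm) measure) \<Rightarrow>
     nat \<Rightarrow> 'a set \<Rightarrow> 'w \<Rightarrow> (ereal \<times> ereal) measure" where
  "verbose_process F \<kappa> \<Phi> q \<Lambda> \<omega> =
     diagram_measure (verbose_diagram F (kappa_filtration \<kappa> (marked_points (\<Phi> \<omega>) \<Lambda>)) q)"

definition expected_measure ::
  "'w measure \<Rightarrow> 'a topology \<Rightarrow> ('w \<Rightarrow> 'a measure) \<Rightarrow> 'a measure" where
  "expected_measure P X \<xi> =
     measure_of (topspace X) (sets (borel_of X)) (\<lambda>A. \<integral>\<^sup>+\<omega>. emeasure (\<xi> \<omega>) A \<partial>P)"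

text \<open>The property that characterises the limiting measure. A Radon measure on \<open>\<Delta>'\<close> is determined
  by its integrals over \<open>Cc\<close>, so at most one measure has it.\<close>

definition is_limiting_measure ::
  "'f::field itself \<Rightarrow> (('a::euclidean_space \<times> 'm::topological_space) set \<Rightarrow> ennreal) \<Rightarrow>
     'w measure \<Rightarrow> ('w \<Rightarrow> ('a \<times> 'm) measure) \<Rightarrow> nat \<Rightarrow> (ereal \<times> ereal) measure \<Rightarrow> bool" where
  "is_limiting_measure F \<kappa> P \<Phi> q \<nu> \<longleftrightarrow>
     \<nu> \<in> radon_measures Delta'_top \<and>
     (\<forall>\<Lambda>. convex_averaging_sequence \<Lambda> \<longrightarrow>
        vaguely_converges Delta'_top
          (\<lambda>n. scale_measure (1 / emeasure lborel (\<Lambda> n))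
             (expected_measure P Delta'_top (verbose_process F \<kappa> \<Phi> q (\<Lambda> n)))) \<nu>)"

definition realizable_points ::
  "'f::field itself \<Rightarrow> (('a \<times> 'm) set \<Rightarrow> ennreal) \<Rightarrow> nat \<Rightarrow> (ereal \<times> ereal) set" where
  "realizable_points F \<kappa> q = {p \<in> Delta'. \<exists>\<Xi>. \<Xi> \<noteq> {} \<and> finite_simple_marked_set \<Xi> \<and>
     p \<in># verbose_diagram F (kappa_filtration \<kappa> \<Xi>) q}"

end

theory Submission
  imports Defs
begin

text \<open>Every point of a diagram of the process over a window is almost surely realizable, so the mean
  diagrams, hence also their limit, give no mass to the complement of the closure. Conversely, let
  \<open>\<Xi>\<close> realize a point with finite death. Because \<open>\<kappa>\<close> is Lipschitz, small displacements of \<open>\<Xi>\<close> do not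
  change the ranks of the inclusions between the sublevel complexes at thresholds that \<open>\<kappa>\<close> avoids,
  and these ranks count the diagram points in a small box. A large cube is cut into tiles with a margin
  that prevents simplices below the largest threshold from connecting the pattern in one tile to
  anything outside; such clusters contribute to the box superadditively. By stationarity and
  comparison with the Poisson process every tile contains the pattern with the same positive
  probability, so the normalised mass of the box is bounded below. Infinite deaths occur in degree 0
  only and are limits of finite ones coming from two distant points.\<close>

section \<open>Vector spaces with ultrametric functions\<close>

no_notation vector_scalar_mult (infixl "*s" 70)

text \<open>\<open>verbose_diagram\<close> is a choice among singular value decompositions, so
  neither its locality nor its stability can be read off the definition. Both come from a count that
  no longer mentions the choice: for finite b, the points with birth \<le> a and death \<le> b
  number dim (Z(K_a) \<inter> B(K_b)). All pairs a, b are allowed, so inclusion-exclusion also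
  covers boxes that straddle the diagonal, where verbose diagrams have genuine points.

  Measurability is the second obstacle. The mean diagram is defined by integrals of functions that
  are only almost surely equal to measurable ones; without measurable versions these integrals need
  not be additive, and \<open>measure_of\<close> would not return them. Hence the enumeration of
  atoms by tuples.

  Vague convergence sees only compactly supported continuous functions, so the lower bound is proved
  for a compact box inside the open set and passed to the limit through a bump function. The bound
  is the probability of the pattern in one tile divided by the volume of that tile, the same for all
  cubes. The tile must be large compared with the pattern and with the reach of \<kappa> at the
  largest threshold, so its size depends on the point under study.\<close>

locale filtered_vector_space = vector_space scale
  for scale :: "'a::field \<Rightarrow> 'b::ab_group_add \<Rightarrow> 'b" (infixr "*s" 75)
begin


text \<open>The abstract form of \<open>level\<close>. The abstraction pays because a second
  function, \<open>least_lift\<close>, satisfies the same laws, although it takes the value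
  \<infinity> as well.\<close>

definition ultra :: "('b \<Rightarrow> ereal) \<Rightarrow> bool" where
  "ultra f \<longleftrightarrow> f 0 = -\<infinity> \<and> (\<forall>a x. a \<noteq> 0 \<longrightarrow> f (a *s x) = f x) \<and> (\<forall>x y. f (x + y) \<le> max (f x) (f y))"

text \<open>The condition of \<open>orthogonal_chains\<close> for an arbitrary value function. An
  empty supremum is \<open>-\<infinity>\<close> in \<open>ereal\<close>, which agrees with the value
  of the zero vector.\<close>

definition orth :: "('b \<Rightarrow> ereal) \<Rightarrow> 'b set \<Rightarrow> bool" where
  "orth f S \<longleftrightarrow> finite S \<and> (\<forall>a. f (\<Sum>x\<in>S. a x *s x) = (SUP x\<in>{x\<in>S. a x \<noteq> 0}. f x))"

lemma ultra_0: "ultra f \<Longrightarrow> f 0 = -\<infinity>"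
  by (simp add: ultra_def)

lemma ultra_scale: "ultra f \<Longrightarrow> a \<noteq> 0 \<Longrightarrow> f (a *s x) = f x"
  by (simp add: ultra_def)

lemma ultra_add: "ultra f \<Longrightarrow> f (x + y) \<le> max (f x) (f y)"
  by (simp add: ultra_def)

lemma ultra_minus: "ultra f \<Longrightarrow> f (- x) = f x"
  using ultra_scale[of f "-1" x] by simp

lemma ultra_diff: "ultra f \<Longrightarrow> f (x - y) \<le> max (f x) (f y)"
  using ultra_add[of f x "- y"] ultra_minus[of f y] by simp

lemma ultra_sum_le:
  assumes "finite S" "ultra f"
  shows "f (\<Sum>x\<in>S. a x *s x) \<le> (SUP x\<in>{x\<in>S. a x \<noteq> 0}. f x)"
  using assms
proof (induction S rule: finite_induct)
  case empty
  then show ?case by (simp add: ultra_0)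
next
  case (insert w S)
  have IH: "f (\<Sum>x\<in>S. a x *s x) \<le> (SUP x\<in>{x\<in>insert w S. a x \<noteq> 0}. f x)"
    using insert.IH[OF insert.prems] by (rule order_trans) (rule SUP_subset_mono, auto)
  have w: "f (a w *s w) \<le> (SUP x\<in>{x\<in>insert w S. a x \<noteq> 0}. f x)"
  proof (cases "a w = 0")
    case True
    then show ?thesis using insert.prems by (simp add: ultra_0)
  next
    case False
    then show ?thesis using insert.prems by (auto simp: ultra_scale intro: SUP_upper)
  qed
  have "f (\<Sum>x\<in>insert w S. a x *s x) \<le> max (f (a w *s w)) (f (\<Sum>x\<in>S. a x *s x))"
    using insert by (simp add: ultra_add)
  then show ?case using IH w by (meson max.boundedI order_trans)
qed

text \<open>The ultrametric inequality bounds a combination from above by the supremum. What is left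
  is that no cancellation occurs: every vector with a nonzero coefficient stays below the
  combination.\<close>

lemma orthI:
  assumes "ultra f" "finite S"
    and "\<And>a w. w \<in> S \<Longrightarrow> a w \<noteq> 0 \<Longrightarrow> f w \<le> f (\<Sum>x\<in>S. a x *s x)"
  shows "orth f S"
  unfolding orth_def
proof (intro conjI allI antisym)
  show "f (\<Sum>x\<in>S. a x *s x) \<le> (SUP x\<in>{x \<in> S. a x \<noteq> 0}. f x)" for a
    by (rule ultra_sum_le) fact+
  show "(SUP x\<in>{x \<in> S. a x \<noteq> 0}. f x) \<le> f (\<Sum>x\<in>S. a x *s x)" for a
    using assms(3) by (auto intro: SUP_least)
qed fact

lemma orthD:
  fixes a :: "'b \<Rightarrow> 'a"
  assumes "orth f S" "w \<in> S" "a w \<noteq> 0"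
  shows "f w \<le> f (\<Sum>x\<in>S. a x *s x)"
proof -
  have "f w \<le> (SUP x\<in>{x \<in> S. a x \<noteq> 0}. f x)"
    using assms by (intro SUP_upper) auto
  then show ?thesis using assms by (simp add: orth_def)
qed

text \<open>A vanishing combination has value \<open>-\<infinity>\<close>, and orthogonality puts
  every vector that occurs in it below that value.\<close>

lemma orth_independent:
  assumes "orth f S" "ultra f" "\<And>x. x \<in> S \<Longrightarrow> f x \<noteq> -\<infinity>"
  shows "independent S"
proof (rule local.independent_if_scalars_zero)
  show "finite S" using assms by (simp add: orth_def)
  fix a x assume 0: "(\<Sum>x\<in>S. a x *s x) = 0" and "x \<in> S"
  show "a x = 0"
  proof (rule ccontr)
    assume "a x \<noteq> 0"
    then have "f x \<le> f (\<Sum>x\<in>S. a x *s x)" using orthD[of f S x a] assms \<open>x \<in> S\<close> by auto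
    then show False using 0 assms \<open>x \<in> S\<close> by (simp add: ultra_0)
  qed
qed

text \<open>After division by its coefficient, \<open>w\<close> is compared with
  \<open>w + h\<close>, so minimality bounds \<open>f w\<close> by the value of the combination. The
  part \<open>h\<close> in the span of \<open>S\<close> is the combination minus a multiple of
  \<open>w\<close>, hence bounded by the same value, and orthogonality of \<open>S\<close> does the
  rest.\<close>

lemma orth_insert:
  assumes "ultra f" "orth f S" "w \<notin> S" and min: "\<And>h. h \<in> span S \<Longrightarrow> f w \<le> f (w + h)"
  shows "orth f (insert w S)"
proof (rule orthI)
  show "finite (insert w S)" using assms by (simp add: orth_def)
  fix a :: "'b \<Rightarrow> 'a" and v assume v: "v \<in> insert w S" "a v \<noteq> 0"
  define h where "h = (\<Sum>x\<in>S. a x *s x)"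
  have hS: "h \<in> span S" unfolding h_def by (auto intro: local.span_sum local.span_scale local.span_base)
  have sum: "(\<Sum>x\<in>insert w S. a x *s x) = a w *s w + h"
    using assms by (simp add: orth_def h_def)
  show "f v \<le> f (\<Sum>x\<in>insert w S. a x *s x)"
  proof (cases "a w = 0")
    case True
    then show ?thesis using v assms(2) unfolding sum h_def by (auto intro: orthD)
  next
    case False
    have "f (a w *s w + h) = f (a w *s (w + inverse (a w) *s h))"
      using False by (simp add: scale_right_distrib)
    also have "\<dots> = f (w + inverse (a w) *s h)"
      using False assms by (simp add: ultra_scale)
    finally have eq: "f (a w *s w + h) = f (w + inverse (a w) *s h)" .
    have w: "f w \<le> f (a w *s w + h)" unfolding eq by (intro min local.span_scale hS)
    show ?thesis
    proof (cases "v = w")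
      case True
      then show ?thesis using w sum by simp
    next
      case vw: False
      have "f v \<le> f h" using v vw assms(2) unfolding h_def by (auto intro: orthD)
      also have "h = (a w *s w + h) - a w *s w" by simp
      also have "f \<dots> \<le> max (f (a w *s w + h)) (f (a w *s w))"
        by (rule ultra_diff) fact
      also have "\<dots> = f (a w *s w + h)"
        using w False assms by (simp add: ultra_scale max_def)
      finally show ?thesis using sum by simp
    qed
  qed
qed fact

lemma ex_minimal:
  assumes "finite (f ` A)" "A \<noteq> {}"
  shows "\<exists>w\<in>A. \<forall>v\<in>A. f w \<le> (f v :: ereal)"
  using ex_min_if_finite[OF assms(1)] assms(2) by (metis (no_types, lifting) empty_is_image imageE image_eqI linorder_not_le)

text \<open>The finite spanning set keeps \<open>dim\<close> meaningful: it is the cardinality of a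
  basis, and \<open>card\<close> is 0 on infinite sets.\<close>

lemma card_indep_le_dim:
  assumes "V \<subseteq> span T" "finite T" "B \<subseteq> V" "independent B"
  shows "finite B \<and> card B \<le> dim V"
proof -
  obtain C where C: "B \<subseteq> C" "C \<subseteq> V" "independent C" "V \<subseteq> span C"
    using local.maximal_independent_subset_extend[OF assms(3,4)] by blast
  have "finite C" using local.independent_span_bound[OF assms(2) C(3)] C assms(1) by blast
  then show ?thesis
    using C local.basis_card_eq_dim[of C V] card_mono[of C B] finite_subset by auto
qed

text \<open>Greedy extension: a vector of least value outside the span is adjoined. Adding an
  element of the span leaves it outside, so least value there is exactly the minimality that
  \<open>orth_insert\<close> asks for.\<close>

lemma orth_extend:
  assumes f: "ultra f" "\<And>x. x \<in> V \<Longrightarrow> x \<noteq> 0 \<Longrightarrow> f x \<noteq> -\<infinity>"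
    and V: "subspace V" "V \<subseteq> span T" "finite T" "finite (f ` V)"
    and S: "orth f S" "independent S" "S \<subseteq> V"
  shows "\<exists>S'. S \<subseteq> S' \<and> orth f S' \<and> independent S' \<and> span S' = V"
  using S
proof (induction "dim V - card S" arbitrary: S rule: less_induct)
  case less
  show ?case
  proof (cases "span S = V")
    case True
    then show ?thesis using less.prems by blast
  next
    case False
    then have ne: "V - span S \<noteq> {}" using less.prems(3) V(1) local.span_minimal by blast
    obtain w where w: "w \<in> V - span S" "\<And>v. v \<in> V - span S \<Longrightarrow> f w \<le> f v"
      using ex_minimal[OF _ ne, of f] finite_subset[OF _ V(4)] by (metis Diff_subset image_mono)
    have wS: "w \<notin> S" using w local.span_base by blast
    have "orth f (insert w S)"
    proof (rule orth_insert[OF f(1) less.prems(1) wS])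
      fix h assume h: "h \<in> span S"
      then have "h \<in> V" using less.prems(3) V(1) local.span_minimal by blast
      moreover have "w + h \<notin> span S" using h w(1) by (metis DiffD2 add_diff_cancel_right' local.span_diff)
      ultimately show "f w \<le> f (w + h)" using w V(1) by (intro w(2)) (auto intro: local.subspace_add)
    qed
    moreover have ind: "independent (insert w S)" by (rule local.independent_insertI) (use w less.prems in auto)
    moreover have sub: "insert w S \<subseteq> V" using w less.prems by auto
    moreover have "dim V - card (insert w S) < dim V - card S"
      using card_indep_le_dim[OF V(2,3) sub ind] wS by auto
    ultimately obtain S' where "insert w S \<subseteq> S'" "orth f S'" "independent S'" "span S' = V"
      using less.hyps[of "insert w S"] by blast
    then show ?thesis by blast
  qed
qed

text \<open>Two filtrations of one space: \<open>f\<close> is constant off a hyperplane containing all vectors of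
  non-maximal \<open>f\<close>-value, so there it suffices to minimise \<open>g\<close>.\<close>

lemma common_orth_basis:
  assumes f: "ultra f" "\<And>x. x \<in> V \<Longrightarrow> x \<noteq> 0 \<Longrightarrow> f x \<noteq> -\<infinity>" and g: "ultra g"
    and V: "subspace V" "V \<subseteq> span T" "finite T" "finite (f ` V)" "finite (g ` V)"
  shows "\<exists>B. independent B \<and> span B = V \<and> orth f B \<and> orth g B"
  using V f(2)
proof (induction "dim V" arbitrary: V rule: less_induct)
  case less
  show ?case
  proof (cases "V = {0}")
    case True
    have "orth f {}" "orth g {}" using f g by (auto simp: orth_def ultra_0 bot_ereal_def)
    then show ?thesis using True local.independent_empty local.span_empty by blast
  next
    case False
    define M where "M = Max (f ` V)"
    define V' where "V' = {x\<in>V. x = 0 \<or> f x < M}"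
    have V0: "0 \<in> V" using less.prems(1) by (simp add: local.subspace_0)
    have leM: "f x \<le> M" if "x \<in> V" for x unfolding M_def using that less.prems(4) by auto
    have "M \<in> f ` V" unfolding M_def using V0 less.prems(4) by (intro Max_in) auto
    then obtain m where m: "m \<in> V" "f m = M" by auto
    obtain v where "v \<in> V" "v \<noteq> 0" using False V0 by blast
    then have Mbot: "M \<noteq> -\<infinity>" using less.prems(6)[of v] leM[of v] by auto
    have subV': "subspace V'"
      unfolding subspace_def
    proof (intro conjI ballI allI)
      show "0 \<in> V'" by (simp add: V'_def V0)
      fix x y assume xy: "x \<in> V'" "y \<in> V'"
      show "x + y \<in> V'"
      proof (cases "x = 0 \<or> y = 0")
        case True
        then show ?thesis using xy by auto
      next
        case False
        then have "f (x + y) < M" using le_less_trans[OF ultra_add[OF f(1), of x y]] xy by (auto simp: V'_def)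
        then show ?thesis using xy less.prems(1) by (auto simp: V'_def local.subspace_add)
      qed
    next
      fix c x assume "x \<in> V'"
      then show "c *s x \<in> V'" using less.prems(1) ultra_scale[OF f(1), of c x]
        by (cases "c = 0") (auto simp: V'_def local.subspace_scale V0)
    qed
    have mV': "m \<notin> V'" using m Mbot by (auto simp: V'_def ultra_0[OF f(1)])
    obtain B' where B': "B' \<subseteq> V'" "independent B'" "V' \<subseteq> span B'"
      using local.maximal_independent_subset[of V'] by blast
    have B'V: "B' \<subseteq> V" using B' by (auto simp: V'_def)
    obtain B where B: "B' \<subseteq> B" "B \<subseteq> V" "independent B" "V \<subseteq> span B"
      using local.maximal_independent_subset_extend[OF B'V B'(2)] by blast
    have finB: "finite B" using card_indep_le_dim[OF less.prems(2,3) B(2,3)] by simp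
    have "B \<noteq> B'"
    proof
      assume "B = B'"
      then have "m \<in> span B'" using B(4) m(1) by auto
      then show False using local.span_minimal[OF B'(1) subV'] mV' by auto
    qed
    \<comment> \<open>Since \<open>b\<close> is not in the basis of \<open>V'\<close>, the
      hyperplane spanned by the other basis vectors still contains \<open>V'\<close>. Off this
      hyperplane only the value \<open>M\<close> is possible for \<open>f\<close>.\<close>
    then obtain b where b: "b \<in> B" "b \<notin> B'" using B(1) by auto
    define H where "H = span (B - {b})"
    have HV: "H \<subseteq> V" unfolding H_def by (rule local.span_minimal) (use B(2) less.prems(1) in auto)
    have "V' \<subseteq> H" 
    proof -
      have "span B' \<subseteq> span (B - {b})" by (rule local.span_mono) (use B(1) b(2) in auto)
      then show ?thesis using B'(3) unfolding H_def by simp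
    qed
    have bH: "b \<notin> H" unfolding H_def using B(3) b(1) unfolding local.dependent_def by simp
    have indB: "independent (B - {b})" by (rule local.independent_mono[OF B(3)]) auto
    have dimV: "dim V = card B" using local.basis_card_eq_dim[OF B(2,4,3)] by simp
    have dimH: "dim H = card (B - {b})" unfolding H_def by (rule local.dim_span_eq_card_independent[OF indB])
    have card: "card (B - {b}) < card B" using finB b(1) by (rule card_Diff1_less)
    have fH: "finite (f ` H)" "finite (g ` H)" 
      by (rule finite_subset[OF image_mono[OF HV] less.prems(4)], rule finite_subset[OF image_mono[OF HV] less.prems(5)])
    obtain C where C: "independent C" "span C = H" "orth f C" "orth g C"
    proof -
      have "dim H < dim V" "subspace H" "H \<subseteq> span T"
        using dimV dimH card HV less.prems(2) by (auto simp: H_def local.subspace_span)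
      then show ?thesis
        using less.hyps[of H] fH HV less.prems(3,6) that by blast
    qed
    have ne: "V - H \<noteq> {}" using b bH B(2) by blast
    obtain w where w: "w \<in> V - H" "\<And>v. v \<in> V - H \<Longrightarrow> g w \<le> g v"
      using ex_minimal[OF _ ne, of g] finite_subset[OF _ less.prems(5)] by (metis Diff_subset image_mono)
    have wh: "w + h \<in> V - H" if "h \<in> span C" for h
    proof -
      have h: "h \<in> H" using that C(2) by simp
      have "w + h \<notin> H"
      proof
        assume "w + h \<in> H"
        then have "(w + h) - h \<in> H" using h local.span_diff unfolding H_def by blast
        then show False using w by simp
      qed
      moreover have "w + h \<in> V" using w h HV by (auto intro!: local.subspace_add[OF less.prems(1)])
      ultimately show ?thesis by simp
    qed
    have fM: "f v = M" if "v \<in> V - H" for v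
      using that \<open>V' \<subseteq> H\<close> leM[of v] by (fastforce simp: V'_def)
    have wC: "w \<notin> C" using w C(2) local.span_base[of w C] by auto
    have of': "orth f (insert w C)"
    proof (rule orth_insert[OF f(1) C(3) wC])
      show "f w \<le> f (w + h)" if "h \<in> span C" for h using fM[OF wh[OF that]] fM[OF w(1)] by simp
    qed
    have og: "orth g (insert w C)" by (rule orth_insert[OF g C(4) wC]) (intro w(2) wh)
    have ind: "independent (insert w C)" by (rule local.independent_insertI) (use w C in auto)
    have sub: "insert w C \<subseteq> V" using w HV C(2) local.span_base[of _ C] by auto
    have "card C = card (B - {b})" using C(2) dimH local.dim_span_eq_card_independent[OF C(1)] by simp
    then have "card (insert w C) = dim V" using wC C(3) card dimV finB b by (simp add: orth_def)
    then have "V \<subseteq> span (insert w C)"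
    proof -
      obtain D where D: "insert w C \<subseteq> D" "D \<subseteq> V" "independent D" "V \<subseteq> span D"
        using local.maximal_independent_subset_extend[OF sub ind] by blast
      have "finite D" "card D = dim V" using card_indep_le_dim[OF less.prems(2,3) D(2,3)] D local.basis_card_eq_dim by auto
      then have "insert w C = D" using D(1) \<open>card (insert w C) = dim V\<close> by (metis card_subset_eq)
      then show ?thesis using D by simp
    qed
    then have "span (insert w C) = V" using local.span_minimal[OF sub less.prems(1)] by auto
    then show ?thesis using of' og ind by blast
  qed
qed

text \<open>Coordinates with respect to \<open>S\<close> are unique, so a vector in both spans has
  its support in \<open>A\<close> and in \<open>B\<close>.\<close>

lemma span_Int_of_independent:
  assumes "independent S" "A \<subseteq> S" "B \<subseteq> S"
  shows "span A \<inter> span B = span (A \<inter> B)"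
proof
  show "span (A \<inter> B) \<subseteq> span A \<inter> span B" by (simp add: local.span_mono)
  show "span A \<inter> span B \<subseteq> span (A \<inter> B)"
  proof
    fix x assume x: "x \<in> span A \<inter> span B"
    have xS: "x \<in> span S" using x local.span_mono[OF assms(2)] by auto
    have ra: "representation S x = representation A x"
      by (rule local.representation_extend) (use x assms in auto)
    have rb: "representation S x = representation B x"
      by (rule local.representation_extend) (use x assms in auto)
    have iA: "independent A" by (rule local.independent_mono[OF assms(1,2)])
    have "x = (\<Sum>b | representation A x b \<noteq> 0. representation A x b *s b)"
      using local.sum_nonzero_representation_eq[OF iA] x by simp
    moreover have "b \<in> A \<inter> B" if "representation A x b \<noteq> 0" for b
      
      using that local.representation_ne_zero[of A x b] local.representation_ne_zero[of B x b] ra rb by simp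
    ultimately show "x \<in> span (A \<inter> B)"

      by (metis (mono_tags, lifting) local.span_base local.span_scale local.span_sum mem_Collect_eq)
  qed
qed

text \<open>In an orthogonal system a vector of value above \<open>a\<close> cannot occur in a
  combination of value at most \<open>a\<close>, so sublevel sets are spanned by the basis vectors
  they contain.\<close>

lemma orth_sublevel:
  assumes "ultra f" "orth f S"
  shows "{x \<in> span S. f x \<le> a} = span {x\<in>S. f x \<le> a}"
proof
  have fin: "finite S" using assms by (simp add: orth_def)
  show "{x \<in> span S. f x \<le> a} \<subseteq> span {x\<in>S. f x \<le> a}"
  proof
    fix x assume x: "x \<in> {x \<in> span S. f x \<le> a}"
    then obtain c where c: "x = (\<Sum>v\<in>S. c v *s v)" using local.span_finite[OF fin] by auto
    have "c v = 0" if "v \<in> S" "\<not> f v \<le> a" for v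
      using orthD[OF assms(2), of v c] that x c by force
    then have "x = (\<Sum>v\<in>{x\<in>S. f x \<le> a}. c v *s v)"
      unfolding c using fin by (intro sum.mono_neutral_right) auto
    then show "x \<in> span {x\<in>S. f x \<le> a}"
      by (auto intro: local.span_sum local.span_scale local.span_base)
  qed
  show "span {x\<in>S. f x \<le> a} \<subseteq> {x \<in> span S. f x \<le> a}"
  proof (rule local.span_minimal)
    show "{x\<in>S. f x \<le> a} \<subseteq> {x \<in> span S. f x \<le> a}" by (auto intro: local.span_base)
    show "subspace {x \<in> span S. f x \<le> a}"
      unfolding subspace_def
    proof (intro conjI ballI allI)
      show "0 \<in> {x \<in> span S. f x \<le> a}" using assms by (simp add: local.span_zero ultra_0)
      fix x y assume "x \<in> {x \<in> span S. f x \<le> a}" "y \<in> {x \<in> span S. f x \<le> a}"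
      then show "x + y \<in> {x \<in> span S. f x \<le> a}"
        using order_trans[OF ultra_add[OF assms(1), of x y]] by (auto intro: local.span_add)
    next
      fix c x assume x: "x \<in> {x \<in> span S. f x \<le> a}"
      show "c *s x \<in> {x \<in> span S. f x \<le> a}"
      proof (cases "c = 0")
        case True
        then show ?thesis using x assms by (simp add: local.span_zero ultra_0)
      next
        case False
        then show ?thesis using x assms by (simp add: local.span_scale ultra_scale)
      qed
    qed
  qed
qed

section \<open>Singular value decompositions of a filtered linear map\<close>

definition obasis :: "('b \<Rightarrow> ereal) \<Rightarrow> 'b set \<Rightarrow> 'b list \<Rightarrow> bool" where
  "obasis f V bs \<longleftrightarrow> distinct bs \<and> independent (set bs) \<and> span (set bs) = V \<and> orth f (set bs)"

text \<open>For the boundary map this is the time at which a cycle becomes a boundary. Outside the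
  image of \<open>D\<close> the infimum is over the empty set, so the value is \<infinity>.\<close>

definition least_lift :: "('b \<Rightarrow> ereal) \<Rightarrow> 'b set \<Rightarrow> ('b \<Rightarrow> 'b) \<Rightarrow> 'b \<Rightarrow> ereal" where
  "least_lift f V D x = (INF v\<in>{v\<in>V. D v = x}. f v)"

lemma least_lift_attained:
  assumes "finite (f ` V)" "x \<in> D ` V"
  shows "\<exists>v\<in>V. D v = x \<and> f v = least_lift f V D x"
proof -
  have ne: "{v\<in>V. D v = x} \<noteq> {}" using assms(2) by blast
  have "finite (f ` {v\<in>V. D v = x})" by (rule finite_subset[OF _ assms(1)]) auto
  from ex_minimal[OF this ne] obtain w where w: "w \<in> V" "D w = x" "\<And>v. v \<in> V \<Longrightarrow> D v = x \<Longrightarrow> f w \<le> f v"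
    by blast
  then have "f w = least_lift f V D x"
    unfolding least_lift_def by (intro antisym INF_greatest INF_lower) auto
  then show ?thesis using w by blast
qed

lemma least_lift_le: "v \<in> V \<Longrightarrow> D v = x \<Longrightarrow> least_lift f V D x \<le> f v"
  unfolding least_lift_def by (rule INF_lower) auto

text \<open>Optimal preimages can be scaled and added, because finitely many values make the infimum
  attained. Outside the image the value \<infinity> makes the ultrametric inequality
  trivial.\<close>

lemma ultra_least_lift:
  assumes D: "Vector_Spaces.linear scale scale D" and f: "ultra f" and V: "subspace V" and fin: "finite (f ` V)"
  shows "ultra (least_lift f V D)"
proof -
  interpret D: Vector_Spaces.linear scale scale D by fact
  let ?g = "least_lift f V D"
  have top: "?g x = \<infinity>" if "x \<notin> D ` V" for x
  proof -
    have "{v\<in>V. D v = x} = {}" using that by blast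
    then show ?thesis unfolding least_lift_def by (metis image_empty Inf_empty top_ereal_def)
  qed
  have "?g 0 \<le> f 0" by (rule least_lift_le) (simp_all add: local.subspace_0 V D.zero)
  then have z: "?g 0 = -\<infinity>" by (simp add: ultra_0[OF f])
  have sc1: "?g (a *s x) \<le> ?g x" if "a \<noteq> 0" for a x
  proof (cases "x \<in> D ` V")
    case True
    from least_lift_attained[OF fin this] obtain v where v: "v \<in> V" "D v = x" "f v = ?g x" by blast
    have "?g (a *s x) \<le> f (a *s v)"
      by (rule least_lift_le) (use v V in \<open>auto simp: D.scale local.subspace_scale\<close>)
    then show ?thesis using v that by (simp add: ultra_scale[OF f])
  qed (simp add: top)
  have sc: "?g (a *s x) = ?g x" if "a \<noteq> 0" for a x
  proof (rule antisym)
    have "?g (inverse a *s (a *s x)) \<le> ?g (a *s x)" by (rule sc1) (use that in simp)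
    then show "?g x \<le> ?g (a *s x)" using that by simp
  qed (rule sc1[OF that])
  have ad: "?g (x + y) \<le> max (?g x) (?g y)" for x y
  proof (cases "x \<in> D ` V \<and> y \<in> D ` V")
    case True
    then obtain v w where v: "v \<in> V" "D v = x" "f v = ?g x" and w: "w \<in> V" "D w = y" "f w = ?g y"
      using least_lift_attained[OF fin] by metis
    have "?g (x + y) \<le> f (v + w)"
      by (rule least_lift_le) (use v w V in \<open>auto simp: D.add local.subspace_add\<close>)
    also have "\<dots> \<le> max (f v) (f w)" by (rule ultra_add[OF f])
    finally show ?thesis using v w by simp
  qed (auto simp: top)
  show ?thesis unfolding ultra_def using z sc ad by blast
qed

text \<open>The image of \<open>D\<close> carries two functions: \<open>f\<close>, the birth, and
  \<open>g = least_lift f V D\<close>, the death. A basis \<open>X\<close> orthogonal for both is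
  lifted to optimal preimages \<open>y x\<close>, so that \<open>f (y x) = g x\<close>; an
  orthogonal basis of the kernel completes these to a basis of \<open>V\<close>, and
  \<open>X\<close> is extended to one of \<open>Z\<close>. The lifts stay orthogonal to the kernel
  because any combination with them lies over a combination of \<open>X\<close>, whose
  \<open>g\<close>-value is a lower bound for the \<open>f\<close>-value of every preimage.\<close>

lemma svd_exists:
  assumes D: "Vector_Spaces.linear scale scale D" and f: "ultra f"
    and V: "subspace V" "V \<subseteq> span T" "finite T" "finite (f ` V)" "\<And>x. x \<in> V \<Longrightarrow> x \<noteq> 0 \<Longrightarrow> f x \<noteq> -\<infinity>"
    and Z: "subspace Z" "Z \<subseteq> span T'" "finite T'" "finite (f ` Z)" "\<And>x. x \<in> Z \<Longrightarrow> x \<noteq> 0 \<Longrightarrow> f x \<noteq> -\<infinity>"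
    and DV: "D ` V \<subseteq> Z"
  shows "\<exists>ys xs. obasis f V ys \<and> obasis f Z xs \<and> obasis f {v\<in>V. D v = 0} (drop (dim (D ` V)) ys) \<and>
    obasis f (D ` V) (take (dim (D ` V)) xs) \<and> (\<forall>i<dim (D ` V). D (ys ! i) = xs ! i)"
proof -
  interpret D: Vector_Spaces.linear scale scale D by fact
  define g where "g = least_lift f V D"
  have g: "ultra g" unfolding g_def by (rule ultra_least_lift) fact+
  have fB: "finite (f ` D ` V)" by (rule finite_subset[OF image_mono[OF DV] Z(4)])
  have "g ` D ` V \<subseteq> f ` V" unfolding g_def using least_lift_attained[OF V(4)] by (metis (no_types, lifting) image_eqI image_subsetI)
  then have gB: "finite (g ` D ` V)" using V(4) finite_subset by blast
  have subB: "subspace (D ` V)" by (rule D.subspace_image) fact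
  have BT: "D ` V \<subseteq> span T'" using DV Z(2) by blast
  obtain X where X: "independent X" "span X = D ` V" "orth f X" "orth g X"
    using common_orth_basis[OF f _ g subB BT Z(3) fB gB] Z(5) DV by (metis subsetD)
  have finX: "finite X" using X by (simp add: orth_def)
  have XB: "X \<subseteq> D ` V" using X(2) local.span_superset by blast
  have XZ: "X \<subseteq> Z" using XB DV by blast
  have r: "dim (D ` V) = card X" using X local.dim_span_eq_card_independent by metis
  obtain X' where X': "X \<subseteq> X'" "orth f X'" "independent X'" "span X' = Z"
    using orth_extend[OF f Z(5) Z(1-4) X(3) X(1) XZ] by blast
  have "\<forall>x\<in>X. \<exists>v. v \<in> V \<and> D v = x \<and> f v = g x"
    unfolding g_def using XB least_lift_attained[OF V(4)] by (meson subsetD)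
  then obtain y where y: "\<And>x. x \<in> X \<Longrightarrow> y x \<in> V" "\<And>x. x \<in> X \<Longrightarrow> D (y x) = x" "\<And>x. x \<in> X \<Longrightarrow> f (y x) = g x"
    by metis
  have injy: "inj_on y X" by (rule inj_on_inverseI[of _ D]) (rule y(2))
  define K where "K = {v\<in>V. D v = 0}"
  have KV: "K \<subseteq> V" by (auto simp: K_def)
  have subK: "subspace K"
    using V(1) unfolding K_def by (auto simp: local.subspace_def D.add D.scale D.zero)
  have fK: "finite (f ` K)" by (rule finite_subset[OF image_mono[OF KV] V(4)])
  have o0: "orth f {}" using f by (auto simp: orth_def ultra_0 bot_ereal_def)
  have KT: "K \<subseteq> span T" using KV V(2) by blast
  obtain S where S: "orth f S" "independent S" "span S = K"
    using orth_extend[OF f _ subK KT V(3) fK o0 local.independent_empty] V(5) KV by blast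
  have finS: "finite S" using S by (simp add: orth_def)
  have SK: "S \<subseteq> K" using S(3) local.span_superset by blast
  have X0: "x \<noteq> 0" if "x \<in> X" for x using that X(1) local.dependent_zero by blast
  have disj: "y ` X \<inter> S = {}"
  proof -
    have "y x \<notin> S" if "x \<in> X" for x
    proof
      assume "y x \<in> S"
      then have "D (y x) = 0" using SK by (auto simp: K_def)
      then show False using y(2)[OF that] X0[OF that] by simp
    qed
    then show ?thesis by blast
  qed
  have YSV: "y ` X \<union> S \<subseteq> V" using y(1) SK KV by blast
  have orthYS: "orth f (y ` X \<union> S)"
  proof (rule orthI[OF f])
    show "finite (y ` X \<union> S)" using finX finS by simp
    fix a :: "'b \<Rightarrow> 'a" and w assume w: "w \<in> y ` X \<union> S" "a w \<noteq> 0"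
    define u where "u = (\<Sum>v\<in>y ` X. a v *s v)"
    define k where "k = (\<Sum>v\<in>S. a v *s v)"
    have sum: "(\<Sum>v\<in>y ` X \<union> S. a v *s v) = u + k"
      unfolding u_def k_def by (rule sum.union_disjoint) (use finX finS disj in auto)
    have kK: "k \<in> K" unfolding k_def using S(3) by (metis (no_types, lifting) local.span_base local.span_scale local.span_sum)
    have uV: "u \<in> V" unfolding u_def using y(1) V(1) by (auto intro!: local.subspace_sum local.subspace_scale)
    have Du: "D (u + k) = (\<Sum>x\<in>X. a (y x) *s x)"
    proof -
      have "u = (\<Sum>x\<in>X. a (y x) *s y x)" unfolding u_def by (rule sum.reindex_cong[OF injy]) auto
      then have "D u = (\<Sum>x\<in>X. a (y x) *s x)" by (simp add: D.sum D.scale y(2))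
      then show ?thesis using kK by (simp add: D.add K_def)
    qed
    have Y: "f (y x) \<le> f (u + k)" if "x \<in> X" "a (y x) \<noteq> 0" for x
    proof -
      have "f (y x) = g x" by (rule y(3)[OF that(1)])
      also have "\<dots> \<le> g (\<Sum>x\<in>X. a (y x) *s x)" using orthD[OF X(4) that(1), of "\<lambda>x. a (y x)"] that(2) by simp
      also have "\<dots> \<le> f (u + k)" unfolding g_def
        by (rule least_lift_le) (use uV kK KV V(1) Du in \<open>auto intro: local.subspace_add\<close>)
      finally show ?thesis .
    qed
    \<comment> \<open>With this bound the kernel part \<open>k = (u + k) - u\<close> cannot exceed
      the whole combination, so the kernel vectors are controlled by their own
      orthogonality.\<close>
    have fu: "f u \<le> f (u + k)"
    proof -
      have "f u \<le> (SUP v\<in>{v\<in>y ` X. a v \<noteq> 0}. f v)"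
        unfolding u_def by (rule ultra_sum_le) (use finX f in auto)
      also have "\<dots> \<le> f (u + k)" by (rule SUP_least) (use Y in auto)
      finally show ?thesis .
    qed
    show "f w \<le> f (\<Sum>v\<in>y ` X \<union> S. a v *s v)"
    proof (cases "w \<in> S")
      case True
      have "f w \<le> f k" unfolding k_def by (rule orthD[where a=a, OF S(1) True w(2)])
      also have "k = (u + k) - u" by simp
      also have "f \<dots> \<le> max (f (u + k)) (f u)" by (rule ultra_diff[OF f])
      also have "\<dots> = f (u + k)" using fu by simp
      finally show ?thesis unfolding sum .
    next
      case False
      then show ?thesis using w Y unfolding sum by blast
    qed
  qed
  have indYS: "independent (y ` X \<union> S)"
  proof (rule orth_independent[OF orthYS f])
    fix v assume v: "v \<in> y ` X \<union> S"
    have "v \<noteq> 0"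
    proof
      assume "v = 0"
      moreover have "0 \<notin> S" using S(2) local.dependent_zero by blast
      ultimately obtain x where "x \<in> X" "y x = 0" using v by auto
      then show False using y(2) X0 D.zero by metis
    qed
    then show "f v \<noteq> -\<infinity>" using V(5) v YSV by blast
  qed
  have spanYS: "span (y ` X \<union> S) = V"
  proof
    show "span (y ` X \<union> S) \<subseteq> V" by (rule local.span_minimal[OF YSV V(1)])
    show "V \<subseteq> span (y ` X \<union> S)"
    proof
      fix v assume v: "v \<in> V"
      then have "D v \<in> span X" using X(2) by blast
      also have "X = D ` y ` X" using y(2) by (force simp: image_image)
      also have "span (D ` y ` X) = D ` span (y ` X)" by (rule D.span_image)
      finally obtain u where u: "u \<in> span (y ` X)" "D v = D u" by blast
      have uV: "u \<in> V" using u(1) local.span_minimal[OF _ V(1), of "y ` X"] y(1) by blast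
      have "v - u \<in> K" using v uV u(2) V(1) by (auto simp: K_def D.diff local.subspace_diff)
      then have "v - u \<in> span (y ` X \<union> S)" using S(3) local.span_mono[of S "y ` X \<union> S"] by blast
      moreover have "u \<in> span (y ` X \<union> S)" using u(1) local.span_mono[of "y ` X" "y ` X \<union> S"] by blast
      ultimately have "(v - u) + u \<in> span (y ` X \<union> S)" by (rule local.span_add)
      then show "v \<in> span (y ` X \<union> S)" by simp
    qed
  qed
  obtain xl where xl: "set xl = X" "distinct xl" using finite_distinct_list[OF finX] by blast
  have "finite (X' - X)" using X'(2) by (simp add: orth_def)
  then obtain xl' where xl': "set xl' = X' - X" "distinct xl'" using finite_distinct_list by blast
  obtain sl where sl: "set sl = S" "distinct sl" using finite_distinct_list[OF finS] by blast
  have len: "length xl = dim (D ` V)" using xl r distinct_card by metis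
  define ys where "ys = map y xl @ sl"
  define xs where "xs = xl @ xl'"
  have "obasis f V ys"
    unfolding obasis_def ys_def using xl sl injy disj indYS spanYS orthYS
    by (auto simp: distinct_map)
  moreover have "obasis f Z xs"
  proof -
    have "set xs = X'" using xl xl' X'(1) by (auto simp: xs_def)
    moreover have "distinct xs" using xl xl' by (auto simp: xs_def)
    ultimately show ?thesis using X' by (simp add: obasis_def)
  qed
  moreover have "obasis f {v\<in>V. D v = 0} (drop (dim (D ` V)) ys)"
    unfolding K_def[symmetric] using S sl len by (simp add: obasis_def ys_def)
  moreover have "obasis f (D ` V) (take (dim (D ` V)) xs)"
    using X xl len by (simp add: obasis_def xs_def)
  moreover have "\<forall>i<dim (D ` V). D (ys ! i) = xs ! i"
    using xl y(2) by (auto simp: ys_def xs_def nth_append len[symmetric])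
  ultimately show ?thesis by blast
qed

text \<open>The births alone: the basis elements of value at most \<open>a\<close> span the sublevel
  set, and distinctness of the list turns them into indices.\<close>

lemma obasis_dim_sublevel:
  assumes "ultra f" "obasis f Z xs"
  shows "dim {z\<in>Z. f z \<le> a} = card {i. i < length xs \<and> f (xs ! i) \<le> a}"
proof -
  have xs: "distinct xs" "independent (set xs)" "span (set xs) = Z" "orth f (set xs)"
    using assms(2) by (auto simp: obasis_def)
  have "dim {z\<in>Z. f z \<le> a} = dim (span {x\<in>set xs. f x \<le> a})"
    using orth_sublevel[OF assms(1) xs(4), of a] xs(3) by simp
  also have "\<dots> = card {x\<in>set xs. f x \<le> a}"
    by (rule local.dim_span_eq_card_independent, rule local.independent_mono[OF xs(2)]) auto
  also have "{x\<in>set xs. f x \<le> a} = (!) xs ` {i. i < length xs \<and> f (xs ! i) \<le> a}"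
    by (auto simp: in_set_conv_nth)
  also have "card \<dots> = card {i. i < length xs \<and> f (xs ! i) \<le> a}"
    by (rule card_image) (use xs(1) in \<open>auto simp: inj_on_def nth_eq_iff_index_eq\<close>)
  finally show ?thesis .
qed

text \<open>The sublevel set of \<open>Z\<close> and the image of the sublevel set of
  \<open>V\<close> are spanned by subfamilies of the same independent list \<open>xs\<close>; their
  intersection is therefore spanned by the common entries. The left side does not refer to the
  decomposition, which is why the diagram is well determined by such dimensions.\<close>

lemma svd_dim_sublevel:
  assumes D: "Vector_Spaces.linear scale scale D" and f: "ultra f"
    and ys: "obasis f V ys" and xs: "obasis f Z xs"
    and ker: "obasis f {v\<in>V. D v = 0} (drop r ys)" and im: "obasis f (D ` V) (take r xs)"
    and r: "r = dim (D ` V)" and Di: "\<And>i. i < r \<Longrightarrow> D (ys ! i) = xs ! i"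
  shows "r \<le> length xs" "r \<le> length ys"
    "dim ({z\<in>Z. f z \<le> a} \<inter> D ` {v\<in>V. f v \<le> b}) = card {i. i < r \<and> f (xs ! i) \<le> a \<and> f (ys ! i) \<le> b}"
proof -
  interpret D: Vector_Spaces.linear scale scale D by fact
  have X: "distinct xs" "independent (set xs)" "span (set xs) = Z" "orth f (set xs)"
    and Y: "distinct ys" "span (set ys) = V" "orth f (set ys)"
    and I: "distinct (take r xs)" "independent (set (take r xs))" "span (set (take r xs)) = D ` V"
    and K: "span (set (drop r ys)) = {v\<in>V. D v = 0}"
    using xs ys im ker by (auto simp: obasis_def)
  have "r = card (set (take r xs))" using r I local.dim_span_eq_card_independent by metis
  also have "\<dots> = length (take r xs)" using I(1) distinct_card by blast
  finally show rx: "r \<le> length xs" by simp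
  have "D ` V = span (D ` set ys)" using Y(2) by (simp add: D.span_image)
  then have "r \<le> card (D ` set ys)" unfolding r by (intro local.dim_le_card) auto
  also have "\<dots> \<le> length ys" by (meson card_image_le card_length finite_set order_trans)
  finally show ry: "r \<le> length ys" .
  have D0: "D (ys ! i) = 0" if "r \<le> i" "i < length ys" for i
  proof -
    have "ys ! i \<in> set (drop r ys)" using that by (auto simp: in_set_conv_nth intro!: exI[of _ "i - r"])
    then show ?thesis using K local.span_base by blast
  qed
  have A: "{z\<in>Z. f z \<le> a} = span ((!) xs ` {i. i < length xs \<and> f (xs ! i) \<le> a})"
  proof -
    have "{x\<in>set xs. f x \<le> a} = (!) xs ` {i. i < length xs \<and> f (xs ! i) \<le> a}"
      by (auto simp: in_set_conv_nth)
    then show ?thesis using orth_sublevel[OF f X(4), of a] X(3) by simp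
  qed
  have B: "D ` {v\<in>V. f v \<le> b} = span ((!) xs ` {i. i < r \<and> f (ys ! i) \<le> b})"
  proof -
    have "{v\<in>V. f v \<le> b} = span {x\<in>set ys. f x \<le> b}" using orth_sublevel[OF f Y(3), of b] Y(2) by simp
    then have "D ` {v\<in>V. f v \<le> b} = span (D ` {x\<in>set ys. f x \<le> b})" by (simp add: D.span_image)
    \<comment> \<open>The entries of \<open>ys\<close> from index \<open>r\<close> on are sent to 0,
      so the two generating sets agree only after 0 is adjoined to both.\<close>
    also have "span (D ` {x\<in>set ys. f x \<le> b}) = span (insert 0 (D ` {x\<in>set ys. f x \<le> b}))" by simp
    also have "insert 0 (D ` {x\<in>set ys. f x \<le> b}) = insert 0 ((!) xs ` {i. i < r \<and> f (ys ! i) \<le> b})"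
    proof (intro equalityI subsetI)
      fix z assume "z \<in> insert 0 (D ` {x\<in>set ys. f x \<le> b})"
      then consider "z = 0" | i where "i < length ys" "f (ys ! i) \<le> b" "z = D (ys ! i)"
        by (auto simp: in_set_conv_nth)
      then show "z \<in> insert 0 ((!) xs ` {i. i < r \<and> f (ys ! i) \<le> b})"
      proof cases
        case 2
        then show ?thesis using D0[of i] Di[of i] by (cases "r \<le> i") auto
      qed simp
    next
      fix z assume "z \<in> insert 0 ((!) xs ` {i. i < r \<and> f (ys ! i) \<le> b})"
      then consider "z = 0" | i where "i < r" "f (ys ! i) \<le> b" "z = xs ! i" by auto
      then show "z \<in> insert 0 (D ` {x\<in>set ys. f x \<le> b})"
      proof cases
        case 2
        then have "ys ! i \<in> {x\<in>set ys. f x \<le> b}" "z = D (ys ! i)" using ry Di by auto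
        then show ?thesis by blast
      qed simp
    qed
    finally show ?thesis by simp
  qed
  define P where "P = {i. i < length xs \<and> f (xs ! i) \<le> a}"
  define R where "R = {i. i < r \<and> f (ys ! i) \<le> b}"
  have inj: "inj_on ((!) xs) {..<length xs}" using X(1) by (auto simp: inj_on_def nth_eq_iff_index_eq)
  have PR: "P \<subseteq> {..<length xs}" "R \<subseteq> {..<length xs}" using rx by (auto simp: P_def R_def)
  have "{z\<in>Z. f z \<le> a} \<inter> D ` {v\<in>V. f v \<le> b} = span ((!) xs ` P \<inter> (!) xs ` R)"
    unfolding A B P_def[symmetric] R_def[symmetric]
    by (rule span_Int_of_independent[OF X(2)]) (use PR in auto)
  also have "(!) xs ` P \<inter> (!) xs ` R = (!) xs ` (P \<inter> R)"
    using inj_on_image_Int[OF inj PR] by simp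
  finally have "dim ({z\<in>Z. f z \<le> a} \<inter> D ` {v\<in>V. f v \<le> b}) = dim (span ((!) xs ` (P \<inter> R)))" by simp
  also have "\<dots> = card ((!) xs ` (P \<inter> R))"
    by (rule local.dim_span_eq_card_independent, rule local.independent_mono[OF X(2)]) (use PR in auto)
  also have "\<dots> = card (P \<inter> R)"
    by (rule card_image, rule inj_on_subset[OF inj]) (use PR in auto)
  also have "P \<inter> R = {i. i < r \<and> f (xs ! i) \<le> a \<and> f (ys ! i) \<le> b}"
    using rx by (auto simp: P_def R_def)
  finally show "dim ({z\<in>Z. f z \<le> a} \<inter> D ` {v\<in>V. f v \<le> b}) = card {i. i < r \<and> f (xs ! i) \<le> a \<and> f (ys ! i) \<le> b}" .
qed

end

section \<open>Chains, cycles and boundaries\<close>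

interpretation fchain: filtered_vector_space "chain_scale :: 'f::field \<Rightarrow> ('s \<Rightarrow>\<^sub>0 'f) \<Rightarrow> ('s \<Rightarrow>\<^sub>0 'f)"
  by unfold_locales

abbreviation chain_linear :: "(('s \<Rightarrow>\<^sub>0 'f::field) \<Rightarrow> ('r \<Rightarrow>\<^sub>0 'f)) \<Rightarrow> bool" where
  "chain_linear \<equiv> Vector_Spaces.linear chain_scale chain_scale"

lemma chain_linearI:
  assumes "\<And>x y. g (x + y) = g x + g y" "\<And>a x. g (chain_scale a x) = chain_scale a (g x)"
  shows "chain_linear g"
  by (simp add: Vector_Spaces.linear_def module_hom_def module_hom_axioms_def assms chain.vector_space_axioms chain.module_axioms)

text \<open>The boundary, the cone operator, relabelling and restriction to a vertex set are all
  instances, so identities between them reduce to single simplices.\<close>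

definition lin_ext :: "('s \<Rightarrow> ('r \<Rightarrow>\<^sub>0 'f)) \<Rightarrow> ('s \<Rightarrow>\<^sub>0 'f::field) \<Rightarrow> ('r \<Rightarrow>\<^sub>0 'f)" where
  "lin_ext t c = (\<Sum>\<sigma>\<in>Poly_Mapping.keys c. chain_scale (Poly_Mapping.lookup c \<sigma>) (t \<sigma>))"

lemma lin_ext_superset:
  assumes "finite S" "Poly_Mapping.keys c \<subseteq> S"
  shows "lin_ext t c = (\<Sum>\<sigma>\<in>S. chain_scale (Poly_Mapping.lookup c \<sigma>) (t \<sigma>))"
  unfolding lin_ext_def
  by (rule sum.mono_neutral_left) (use assms in \<open>auto simp: in_keys_iff\<close>)

lemma keys_chain_scale: "Poly_Mapping.keys (chain_scale a c) \<subseteq> Poly_Mapping.keys c"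
  by (auto simp: in_keys_iff)

lemma keys_chain_scale_eq: "a \<noteq> 0 \<Longrightarrow> Poly_Mapping.keys (chain_scale a c) = Poly_Mapping.keys c"
  by (auto simp: in_keys_iff)

lemma linear_lin_ext:
  fixes t :: "'s \<Rightarrow> ('r \<Rightarrow>\<^sub>0 'f::field)"
  shows "chain_linear (lin_ext t)"
proof (rule chain_linearI)
  fix x y :: "'s \<Rightarrow>\<^sub>0 'f" and a :: 'f
  let ?S = "Poly_Mapping.keys x \<union> Poly_Mapping.keys y"
  have S: "finite ?S" by simp
  have "Poly_Mapping.keys (x + y) \<subseteq> ?S" by (rule Poly_Mapping.keys_add)
  then show "lin_ext t (x + y) = lin_ext t x + lin_ext t y"
    using lin_ext_superset[OF S, of "x + y" t] lin_ext_superset[OF S, of x t] lin_ext_superset[OF S, of y t]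
    by (simp add: lookup_add chain.scale_left_distrib sum.distrib)
  show "lin_ext t (chain_scale a x) = chain_scale a (lin_ext t x)"
    using lin_ext_superset[OF finite_keys keys_chain_scale, of t a x]
    by (simp add: lin_ext_def chain.scale_sum_right)
qed

lemma lin_ext_single [simp]: "lin_ext t (Poly_Mapping.single \<sigma> a) = chain_scale a (t \<sigma>)"
  by (cases "a = 0") (auto simp: lin_ext_def)

lemma chain_expand: "c = (\<Sum>\<sigma>\<in>Poly_Mapping.keys c. chain_scale (Poly_Mapping.lookup c \<sigma>) (Poly_Mapping.single \<sigma> 1))"
proof (rule poly_mapping_eqI)
  fix \<tau>
  have "(\<Sum>\<sigma>\<in>Poly_Mapping.keys c. Poly_Mapping.lookup c \<sigma> * (1 when \<sigma> = \<tau>)) = Poly_Mapping.lookup c \<tau>"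
    by (auto simp: when_def if_distrib[of "(*) _"] in_keys_iff cong: if_cong)
  then show "Poly_Mapping.lookup c \<tau> = Poly_Mapping.lookup (\<Sum>\<sigma>\<in>Poly_Mapping.keys c. chain_scale (Poly_Mapping.lookup c \<sigma>) (Poly_Mapping.single \<sigma> 1)) \<tau>"
    by (simp add: lookup_sum lookup_single)
qed

text \<open>Agreement is asked only on the support of the chain at hand. This matters because the
  identities proved this way hold only for simplices that are finite, lie in a given vertex set, or
  are mapped injectively.\<close>

lemma chain_linear_eqI:
  assumes g: "chain_linear g" and h: "chain_linear h"
    and eq: "\<And>\<sigma>. \<sigma> \<in> Poly_Mapping.keys c \<Longrightarrow> g (Poly_Mapping.single \<sigma> 1) = h (Poly_Mapping.single \<sigma> 1)"
  shows "g c = h c"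
proof -
  interpret g: Vector_Spaces.linear chain_scale chain_scale g by fact
  interpret h: Vector_Spaces.linear chain_scale chain_scale h by fact
  let ?e = "\<Sum>\<sigma>\<in>Poly_Mapping.keys c. chain_scale (Poly_Mapping.lookup c \<sigma>) (Poly_Mapping.single \<sigma> 1)"
  have "g ?e = h ?e" by (simp add: g.sum h.sum g.scale h.scale eq)
  then show ?thesis using chain_expand[of c] by simp
qed

lemma chain_linear_compose: "chain_linear g \<Longrightarrow> chain_linear h \<Longrightarrow> chain_linear (\<lambda>x. g (h x))"
  using Vector_Spaces.linear_compose[of chain_scale chain_scale h chain_scale g] by (simp add: o_def)

lemma chain_linear_add: "chain_linear g \<Longrightarrow> chain_linear h \<Longrightarrow> chain_linear (\<lambda>x. g x + h x)"
  by (rule chain_linearI)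
    (simp_all add: Vector_Spaces.linear_iff algebra_simps chain.scale_right_distrib)

lemma chain_linear_id: "chain_linear (\<lambda>x. x)"
  by (rule chain_linearI) simp_all

lemma chain_linear_zero: "chain_linear (\<lambda>x. 0)"
  by (rule chain_linearI) simp_all

section \<open>Orientation of simplices and the boundary operator\<close>

lemma linear_order_vertex_order: "linear_order (vertex_order :: 'v rel)"
proof -
  \<comment> \<open>Every type carries a well-order, so the choice behind
    \<open>vertex_order\<close> has a witness.\<close>
  obtain r :: "'v rel" where "well_order_on UNIV r" using well_order_on by blast
  then have "linear_order r" by (simp add: well_order_on_def)
  then show ?thesis unfolding vertex_order_def by (rule someI)
qed

definition before :: "'v \<Rightarrow> 'v \<Rightarrow> bool" where
  "before w v \<longleftrightarrow> w \<noteq> v \<and> (w, v) \<in> vertex_order"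

lemma before_total: "v \<noteq> w \<Longrightarrow> before v w \<or> before w v"
  using linear_order_vertex_order by (auto simp: before_def linear_order_on_def total_on_def)

lemma before_antisym: "before v w \<Longrightarrow> \<not> before w v"
  using linear_order_vertex_order
  by (auto simp: before_def linear_order_on_def partial_order_on_def antisym_def)

lemma before_trans:
  assumes "before u v" "before v w"
  shows "before u w"
proof -
  have "trans (vertex_order :: 'a rel)"
    using linear_order_vertex_order[where 'v='a] by (simp add: linear_order_on_def partial_order_on_def preorder_on_def)
  then have "(u, w) \<in> vertex_order" using assms unfolding before_def by (auto elim: transE)
  moreover have "u \<noteq> w" using before_antisym[OF assms(1)] assms(2) by auto
  ultimately show ?thesis by (simp add: before_def)
qed

lemma vertex_position_eq: "vertex_position \<sigma> v = card {w \<in> \<sigma>. before w v}"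
  by (simp add: vertex_position_def before_def)

text \<open>On a single vertex it yields the empty simplex, so by itself it is the augmented
  boundary. The complex is unreduced because \<open>boundary 0\<close> is zero and chains contain
  only nonempty simplices.\<close>

definition face_sum :: "'v set \<Rightarrow> ('v set \<Rightarrow>\<^sub>0 'f::field)" where
  "face_sum \<sigma> = (\<Sum>v\<in>\<sigma>. Poly_Mapping.single (\<sigma> - {v}) ((-1) ^ vertex_position \<sigma> v))"

lemma chain_scale_single [simp]: "chain_scale a (Poly_Mapping.single \<sigma> b) = Poly_Mapping.single \<sigma> (a * b)"
  by (rule poly_mapping_eqI) (simp add: lookup_single when_def)

lemma boundary_Suc: "boundary (Suc q) = lin_ext face_sum"
proof
  show "boundary (Suc q) c = lin_ext face_sum c" for c :: "'a set \<Rightarrow>\<^sub>0 'b"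
    unfolding boundary_def lin_ext_def face_sum_def chain.scale_sum_right chain_scale_single
    by (simp only: nat.distinct if_False mult.commute[of _ "Poly_Mapping.lookup c _"])
qed

lemma boundary_0: "boundary 0 = (\<lambda>c. 0)"
  by (simp add: boundary_def fun_eq_iff)

lemma linear_boundary: "chain_linear (boundary q)"
  by (cases q) (simp_all add: boundary_Suc boundary_0 linear_lin_ext chain_linear_zero)

lemma vertex_position_Diff:
  assumes "finite \<sigma>" "v \<in> \<sigma>" "w \<noteq> v"
  shows "vertex_position \<sigma> w = vertex_position (\<sigma> - {v}) w + (if before v w then 1 else 0)"
proof -
  have "{u \<in> \<sigma>. before u w} = (if before v w then insert v else id) {u \<in> \<sigma> - {v}. before u w}"
    using assms by auto
  then have "card {u \<in> \<sigma>. before u w} = card ((if before v w then insert v else id) {u \<in> \<sigma> - {v}. before u w})"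
    by simp
  then show ?thesis unfolding vertex_position_eq using assms(1) by simp
qed

text \<open>Each codimension-two face arises from an ordered pair of deleted vertices, once in each
  order. Deleting the earlier vertex first lowers the position of the later one by one, while
  deleting the later first changes nothing; so the two terms have opposite signs.\<close>

lemma face_sum_face_sum:
  assumes "finite \<sigma>"
  shows "lin_ext face_sum (face_sum \<sigma>) = (0 :: 'v set \<Rightarrow>\<^sub>0 'f::field)"
proof -
  interpret L: Vector_Spaces.linear chain_scale chain_scale "lin_ext (face_sum :: 'v set \<Rightarrow> ('v set \<Rightarrow>\<^sub>0 'f))"
    by (rule linear_lin_ext)
  define g :: "'v \<times> 'v \<Rightarrow> ('v set \<Rightarrow>\<^sub>0 'f)" where
    "g p = Poly_Mapping.single (\<sigma> - {fst p} - {snd p}) ((-1) ^ vertex_position \<sigma> (fst p) * (-1) ^ vertex_position (\<sigma> - {fst p}) (snd p))" for p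
  define P where "P = (SIGMA v:\<sigma>. \<sigma> - {v})"
  define P1 where "P1 = {p\<in>P. before (fst p) (snd p)}"
  define P2 where "P2 = {p\<in>P. before (snd p) (fst p)}"
  have fin: "finite P" unfolding P_def using assms by auto
  have "lin_ext face_sum (face_sum \<sigma>) = (\<Sum>v\<in>\<sigma>. \<Sum>w\<in>\<sigma> - {v}. g (v, w))"
  proof -
    have "lin_ext face_sum (face_sum \<sigma>) = (\<Sum>v\<in>\<sigma>. chain_scale ((-1 :: 'f) ^ vertex_position \<sigma> v) (face_sum (\<sigma> - {v})))"
      unfolding face_sum_def[of \<sigma>] L.sum lin_ext_single ..
    moreover have "chain_scale ((-1 :: 'f) ^ vertex_position \<sigma> v) (face_sum (\<sigma> - {v})) = (\<Sum>w\<in>\<sigma> - {v}. g (v, w))" for v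
      unfolding face_sum_def chain.scale_sum_right chain_scale_single g_def fst_conv snd_conv ..
    ultimately show ?thesis by simp
  qed
  also have "\<dots> = sum g P"
    using sum.Sigma[of \<sigma> "\<lambda>v. \<sigma> - {v}" "\<lambda>v w. g (v, w)"] assms by (simp add: P_def)
  also have "P = P1 \<union> P2" 
  proof -
    have "before (fst p) (snd p) \<or> before (snd p) (fst p)" if "p \<in> P" for p
      using that before_total[of "fst p" "snd p"] by (auto simp: P_def)
    then show ?thesis unfolding P1_def P2_def by blast
  qed
  also have "sum g (P1 \<union> P2) = sum g P1 + sum g P2"
  proof (rule sum.union_disjoint)
    show "P1 \<inter> P2 = {}" unfolding P1_def P2_def by (blast dest: before_antisym)
  qed (use fin in \<open>simp_all add: P1_def P2_def\<close>)
  also have "sum g P2 = (\<Sum>p\<in>P1. g (prod.swap p))"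
    by (rule sum.reindex_bij_witness[of _ prod.swap prod.swap]) (auto simp add: P1_def P2_def P_def)
  also have "\<dots> = (\<Sum>p\<in>P1. - g p)"
  proof (rule sum.cong)
    fix p assume p: "p \<in> P1"
    obtain v w where vw: "p = (v, w)" by (cases p)
    have v: "v \<in> \<sigma>" "w \<in> \<sigma>" "v \<noteq> w" "before v w"
      using p by (auto simp: vw P1_def P_def)
    note v = v before_antisym[OF v(4)]
    have e: "\<sigma> - {w} - {v} = \<sigma> - {v} - {w}" by auto
    have 1: "vertex_position \<sigma> w = Suc (vertex_position (\<sigma> - {v}) w)"
      and 2: "vertex_position \<sigma> v = vertex_position (\<sigma> - {w}) v"
      using vertex_position_Diff[OF assms v(1), of w] vertex_position_Diff[OF assms v(2), of v] v by simp_all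
    have "(-1) ^ vertex_position \<sigma> w * (-1) ^ vertex_position (\<sigma> - {w}) v
       = - ((-1) ^ vertex_position \<sigma> v * (-1) ^ vertex_position (\<sigma> - {v}) w :: 'f)"
      unfolding 1 2 by (simp add: mult.commute)
    then show "g (prod.swap p) = - g p"
      unfolding vw g_def fst_conv snd_conv swap_simp e single_uminus[symmetric] by (rule arg_cong)
  qed simp
  finally show ?thesis by (simp add: sum_negf)
qed

lemma boundary_boundary:
  assumes "\<And>\<sigma>. \<sigma> \<in> Poly_Mapping.keys c \<Longrightarrow> finite \<sigma>"
  shows "boundary q (boundary (Suc q) c) = 0"
proof (cases q)
  case (Suc n)
  have "lin_ext face_sum (lin_ext face_sum c) = (\<lambda>c. 0) c"
    by (rule chain_linear_eqI[OF chain_linear_compose[OF linear_lin_ext linear_lin_ext] chain_linear_zero])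
      (use assms in \<open>simp add: face_sum_face_sum\<close>)
  then show ?thesis by (simp add: Suc boundary_Suc)
qed (simp add: boundary_0)

lemma keys_lin_ext: "Poly_Mapping.keys (lin_ext t c) \<subseteq> (\<Union>\<sigma>\<in>Poly_Mapping.keys c. Poly_Mapping.keys (t \<sigma>))"
proof
  fix \<tau> assume "\<tau> \<in> Poly_Mapping.keys (lin_ext t c)"
  then have "(\<Sum>\<sigma>\<in>Poly_Mapping.keys c. Poly_Mapping.lookup c \<sigma> * Poly_Mapping.lookup (t \<sigma>) \<tau>) \<noteq> 0"
    by (simp add: in_keys_iff lin_ext_def lookup_sum)
  then obtain \<sigma> where "\<sigma> \<in> Poly_Mapping.keys c" "Poly_Mapping.lookup c \<sigma> * Poly_Mapping.lookup (t \<sigma>) \<tau> \<noteq> 0"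
    by (rule sum.not_neutral_contains_not_neutral)
  then show "\<tau> \<in> (\<Union>\<sigma>\<in>Poly_Mapping.keys c. Poly_Mapping.keys (t \<sigma>))" by (auto simp: in_keys_iff)
qed

lemma keys_face_sum: "Poly_Mapping.keys (face_sum \<sigma> :: 'v set \<Rightarrow>\<^sub>0 'f::field) \<subseteq> (\<lambda>v. \<sigma> - {v}) ` \<sigma>"
proof
  fix \<tau> assume "\<tau> \<in> Poly_Mapping.keys (face_sum \<sigma> :: 'v set \<Rightarrow>\<^sub>0 'f::field)"
  then have "(\<Sum>v\<in>\<sigma>. ((-1) ^ vertex_position \<sigma> v when \<sigma> - {v} = \<tau>)) \<noteq> (0::'f)"
    by (simp add: in_keys_iff face_sum_def lookup_sum lookup_single)
  then obtain v where "v \<in> \<sigma>" "((-1) ^ vertex_position \<sigma> v when \<sigma> - {v} = \<tau>) \<noteq> (0::'f)"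
    by (rule sum.not_neutral_contains_not_neutral)
  then show "\<tau> \<in> (\<lambda>v. \<sigma> - {v}) ` \<sigma>" by (auto simp: when_def split: if_splits)
qed

definition simplicial :: "'v set set \<Rightarrow> bool" where
  "simplicial K \<longleftrightarrow> (\<forall>\<sigma>\<in>K. \<forall>\<tau>. \<tau> \<noteq> {} \<longrightarrow> \<tau> \<subseteq> \<sigma> \<longrightarrow> \<tau> \<in> K)"

lemma subspace_chains: "chain.subspace (chains K q :: ('v set \<Rightarrow>\<^sub>0 'f::field) set)"
  unfolding chain.subspace_def
proof (intro conjI ballI allI)
  show "0 \<in> chains K q" by (simp add: chains_def)
  show "x + y \<in> chains K q" if "x \<in> chains K q" "y \<in> chains K q" for x y :: "'v set \<Rightarrow>\<^sub>0 'f"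
    using that Poly_Mapping.keys_add[of x y] unfolding chains_def by blast
  show "chain_scale a x \<in> chains K q" if "x \<in> chains K q" for a and x :: "'v set \<Rightarrow>\<^sub>0 'f"
    using that keys_chain_scale[of a x] unfolding chains_def by blast
qed

lemma boundary_in_chains:
  assumes "simplicial K" "c \<in> chains K (Suc q)"
  shows "boundary (Suc q) c \<in> chains K q"
proof -
  have "\<tau> \<in> K \<and> card \<tau> = Suc q" if "\<tau> \<in> Poly_Mapping.keys (lin_ext face_sum c)" for \<tau>
  proof -
    from that keys_lin_ext obtain \<sigma> where "\<sigma> \<in> Poly_Mapping.keys c" "\<tau> \<in> Poly_Mapping.keys (face_sum \<sigma> :: 'a set \<Rightarrow>\<^sub>0 'b)" by fast
    then obtain v where v: "v \<in> \<sigma>" "\<tau> = \<sigma> - {v}" "\<sigma> \<in> K" "card \<sigma> = Suc (Suc q)"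
      using keys_face_sum assms(2) unfolding chains_def by blast
    then have c: "card \<tau> = Suc q" by simp
    then have "\<tau> \<noteq> {}" by auto
    moreover have "\<tau> \<subseteq> \<sigma>" using v by auto
    ultimately have "\<tau> \<in> K" using v(3) assms(1) by (simp add: simplicial_def)
    with c show ?thesis by simp
  qed
  then show ?thesis unfolding boundary_Suc chains_def by blast
qed

lemma subspace_cycles: "chain.subspace (cycles K q :: ('v set \<Rightarrow>\<^sub>0 'f::field) set)"
proof -
  interpret B: Vector_Spaces.linear chain_scale chain_scale "boundary q :: ('v set \<Rightarrow>\<^sub>0 'f) \<Rightarrow> _" by (rule linear_boundary)
  show ?thesis using subspace_chains[of K q, where 'f='f]
    by (auto simp: chain.subspace_def cycles_def B.add B.scale B.zero)
qed

lemma subspace_boundaries: "chain.subspace (boundaries K q :: ('v set \<Rightarrow>\<^sub>0 'f::field) set)"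
proof -
  interpret B: Vector_Spaces.linear chain_scale chain_scale "boundary (Suc q) :: ('v set \<Rightarrow>\<^sub>0 'f) \<Rightarrow> _" by (rule linear_boundary)
  show ?thesis unfolding boundaries_def by (rule B.subspace_image[OF subspace_chains])
qed

lemma boundaries_subset_cycles:
  assumes "simplicial K"
  shows "boundaries K q \<subseteq> cycles K q"
proof
  fix x :: "'a set \<Rightarrow>\<^sub>0 'b" assume "x \<in> boundaries K q"
  then obtain c where c: "c \<in> chains K (Suc q)" "x = boundary (Suc q) c" by (auto simp: boundaries_def)
  have "finite \<sigma>" if "\<sigma> \<in> Poly_Mapping.keys c" for \<sigma>
    using that c(1) by (auto simp: chains_def intro: card_ge_0_finite)
  then show "x \<in> cycles K q"
    using boundary_in_chains[OF assms c(1)] boundary_boundary[of c q] c(2) by (simp add: cycles_def)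
qed

lemma chains_subset_span:
  "chains K q \<subseteq> chain.span ((\<lambda>\<sigma>. Poly_Mapping.single \<sigma> 1) ` {\<sigma>\<in>K. card \<sigma> = Suc q})"
proof
  fix c :: "'a set \<Rightarrow>\<^sub>0 'b" assume c: "c \<in> chains K q"
  have "(\<Sum>\<sigma>\<in>Poly_Mapping.keys c. chain_scale (Poly_Mapping.lookup c \<sigma>) (Poly_Mapping.single \<sigma> 1))
     \<in> chain.span ((\<lambda>\<sigma>. Poly_Mapping.single \<sigma> 1) ` {\<sigma>\<in>K. card \<sigma> = Suc q})"
    by (intro chain.span_sum chain.span_scale chain.span_base) (use c in \<open>auto simp: chains_def\<close>)
  then show "c \<in> chain.span ((\<lambda>\<sigma>. Poly_Mapping.single \<sigma> 1) ` {\<sigma>\<in>K. card \<sigma> = Suc q})"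
    unfolding chain_expand[of c, symmetric] .
qed

text \<open>Finiteness of \<open>K\<close> bounds the number of basis simplices and hence the
  dimension of the larger set, without which monotonicity of \<open>dim\<close> could fail.\<close>

lemma chain_dim_mono:
  fixes A :: "('v set \<Rightarrow>\<^sub>0 'f::field) set"
  assumes "finite K" "A \<subseteq> B" "B \<subseteq> chains K q"
  shows "chain.dim A \<le> chain.dim B"
proof -
  let ?T = "(\<lambda>\<sigma>. Poly_Mapping.single \<sigma> (1::'f)) ` {\<sigma>\<in>K. card \<sigma> = Suc q}"
  obtain C where C: "C \<subseteq> A" "chain.independent C" "A \<subseteq> chain.span C" "card C = chain.dim A"
    using chain.basis_exists by blast
  have "B \<subseteq> chain.span ?T" using assms(3) chains_subset_span by blast
  from fchain.card_indep_le_dim[OF this _ _ C(2)] assms C show ?thesis by auto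
qed

lemma chain_dim_le_card:
  fixes A :: "('v set \<Rightarrow>\<^sub>0 'f::field) set"
  assumes "finite K" "A \<subseteq> chains K q"
  shows "chain.dim A \<le> card {\<sigma>\<in>K. card \<sigma> = Suc q}"
proof -
  let ?T = "(\<lambda>\<sigma>. Poly_Mapping.single \<sigma> (1::'f)) ` {\<sigma>\<in>K. card \<sigma> = Suc q}"
  have "chain.dim A \<le> card ?T"
    by (rule chain.dim_le_card) (use assms chains_subset_span in auto)
  also have "\<dots> \<le> card {\<sigma>\<in>K. card \<sigma> = Suc q}" by (rule card_image_le) (use assms in auto)
  finally show ?thesis .
qed

section \<open>Acyclicity, relabelling and disjoint unions\<close>

context filtered_vector_space begin

lemma dim_direct_sum:
  assumes A: "subspace A" "A \<subseteq> span S" and B: "subspace B" "B \<subseteq> span S" and S: "finite S"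
    and AB: "A \<inter> B = {0}"
  shows "dim {x + y |x y. x \<in> A \<and> y \<in> B} = dim A + dim B"
proof -
  obtain a where a: "a \<subseteq> A" "independent a" "A \<subseteq> span a" "card a = dim A" using local.basis_exists by blast
  obtain b where b: "b \<subseteq> B" "independent b" "B \<subseteq> span b" "card b = dim B" using local.basis_exists by blast
  have fa: "finite a" using card_indep_le_dim[OF A(2) S a(1,2)] by simp
  have fb: "finite b" using card_indep_le_dim[OF B(2) S b(1,2)] by simp
  have a0: "0 \<notin> a" and b0: "0 \<notin> b" using a(2) b(2) local.dependent_zero by auto
  have disj: "a \<inter> b = {}" 
  proof -
    have "a \<inter> b \<subseteq> {0}" using a(1) b(1) unfolding AB[symmetric] by (rule Int_mono)
    then show ?thesis using a0 by auto
  qed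
  have "independent (a \<union> b)"
  proof (rule local.independent_if_scalars_zero)
    show "finite (a \<union> b)" using fa fb by simp
    fix f :: "'b \<Rightarrow> 'a" and x assume 0: "(\<Sum>x\<in>a \<union> b. f x *s x) = 0" and x: "x \<in> a \<union> b"
    define u where "u = (\<Sum>x\<in>a. f x *s x)"
    define w where "w = (\<Sum>x\<in>b. f x *s x)"
    have uw: "u + w = 0" using 0 sum.union_disjoint[OF fa fb disj, of "\<lambda>x. f x *s x"] by (simp add: u_def w_def)
    have uA: "u \<in> A" unfolding u_def using a(1) A(1) by (auto intro!: local.subspace_sum local.subspace_scale)
    have wB: "w \<in> B" unfolding w_def using b(1) B(1) by (auto intro!: local.subspace_sum local.subspace_scale)
    have "u = - w" using uw by (simp add: eq_neg_iff_add_eq_0)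
    then have "u \<in> A \<inter> B" using uA local.subspace_neg[OF B(1) wB] by simp
    then have "u = 0" using AB by simp
    moreover have "w = 0" using uw \<open>u = 0\<close> by simp
    ultimately have "\<forall>x\<in>a. f x = 0" "\<forall>x\<in>b. f x = 0"
      using local.independentD[OF a(2) fa order_refl, of f] local.independentD[OF b(2) fb order_refl, of f]
      unfolding u_def[symmetric] w_def[symmetric] by simp_all
    then show "f x = 0" using x by blast
  qed
  moreover have "{x + y |x y. x \<in> A \<and> y \<in> B} \<subseteq> span (a \<union> b)"
  proof -
    have "x \<in> span (a \<union> b)" if "x \<in> A" for x using that a(3) local.span_mono[of a "a \<union> b"] by auto
    moreover have "x \<in> span (a \<union> b)" if "x \<in> B" for x using that b(3) local.span_mono[of b "a \<union> b"] by auto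
    ultimately show ?thesis by (auto intro: local.span_add)
  qed
  moreover have "a \<union> b \<subseteq> {x + y |x y. x \<in> A \<and> y \<in> B}"
  proof
    fix x assume x: "x \<in> a \<union> b"
    have "0 \<in> A" "0 \<in> B" using A(1) B(1) local.subspace_0 by auto
    have "\<exists>u v. x = u + v \<and> u \<in> A \<and> v \<in> B"
    proof (cases "x \<in> a")
      case True
      then have "x = x + 0 \<and> x \<in> A \<and> 0 \<in> B" using a(1) \<open>0 \<in> B\<close> by auto
      then show ?thesis by metis
    next
      case False
      then have "x = 0 + x \<and> 0 \<in> A \<and> x \<in> B" using b(1) x \<open>0 \<in> A\<close> by auto
      then show ?thesis by metis
    qed
    then show "x \<in> {x + y |x y. x \<in> A \<and> y \<in> B}" by blast
  qed
  ultimately have "dim {x + y |x y. x \<in> A \<and> y \<in> B} = card (a \<union> b)"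
    by (intro local.basis_card_eq_dim[symmetric])
  also have "\<dots> = card a + card b" by (rule card_Un_disjoint[OF fa fb disj])
  finally show ?thesis using a(4) b(4) by simp
qed

end

section \<open>Acyclicity of the full simplex in positive degrees\<close>

lemma before_irrefl: "\<not> before x x"
  by (simp add: before_def)

definition full_complex :: "'v set \<Rightarrow> 'v set set" where
  "full_complex X = {\<sigma>. \<sigma> \<noteq> {} \<and> \<sigma> \<subseteq> X}"

lemma ex_first_vertex:
  assumes "finite X" "X \<noteq> {}"
  shows "\<exists>v\<in>X. \<forall>w\<in>X. w \<noteq> v \<longrightarrow> before v w"
  using assms
proof (induction X rule: finite_ne_induct)
  case (insert x F)
  then obtain v where v: "v \<in> F" "\<And>w. w \<in> F \<Longrightarrow> w \<noteq> v \<Longrightarrow> before v w" by auto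
  consider "before x v" | "before v x" using before_total[of x v] v(1) insert.hyps by auto
  then show ?case
  proof cases
    case 1
    have "before x w" if "w \<in> F" for w using before_trans[OF 1 v(2)[OF that]] 1 by (cases "w = v") auto
    then show ?thesis by auto
  next
    case 2
    then show ?thesis using v by auto
  qed
qed auto

text \<open>Coning off at a vertex \<open>v0\<close> is a chain homotopy from the identity to zero,
  so a cycle is the boundary of its cone. Taking \<open>v0\<close> first in the vertex order makes
  its position 0 in every simplex, so the cone needs no sign. In degree 0 the homotopy identity
  involves the empty simplex, which the unreduced complex does not have.\<close>

lemma full_complex_acyclic:
  assumes X: "finite X" and q: "0 < q"
  shows "cycles (full_complex X) q \<subseteq> (boundaries (full_complex X) q :: ('v set \<Rightarrow>\<^sub>0 'f::field) set)"
proof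
  fix z :: "'v set \<Rightarrow>\<^sub>0 'f" assume z: "z \<in> cycles (full_complex X) q"
  obtain n where n: "q = Suc n" using q by (cases q) auto
  have zc: "z \<in> chains (full_complex X) q" and zb: "lin_ext face_sum z = 0"
    using z by (auto simp: cycles_def n boundary_Suc)
  show "z \<in> boundaries (full_complex X) q"
  proof (cases "X = {}")
    case True
    then have "Poly_Mapping.keys z = {}" using zc by (auto simp: chains_def full_complex_def)
    then have "z = 0" by simp
    then show ?thesis using chain.subspace_0[OF subspace_boundaries] by simp
  next
    case False
    then obtain v0 where v0: "v0 \<in> X" "\<And>w. w \<in> X \<Longrightarrow> w \<noteq> v0 \<Longrightarrow> before v0 w"
      using ex_first_vertex[OF X] by blast
    define t :: "'v set \<Rightarrow> ('v set \<Rightarrow>\<^sub>0 'f)"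
      where "t \<sigma> = (if v0 \<in> \<sigma> then 0 else Poly_Mapping.single (insert v0 \<sigma>) 1)" for \<sigma>
    interpret T: Vector_Spaces.linear chain_scale chain_scale "lin_ext t" by (rule linear_lin_ext)
    have pos0: "vertex_position \<sigma> v0 = 0" if "\<sigma> \<subseteq> X" for \<sigma>
    proof -
      have "{w \<in> \<sigma>. before w v0} = {}"

      proof -
        have "\<not> before w v0" if "w \<in> \<sigma>" for w
          using v0(2)[of w] before_antisym[of v0 w] that \<open>\<sigma> \<subseteq> X\<close> by (auto simp: before_def[of v0 v0])
        then show ?thesis by auto
      qed
      then show ?thesis by (simp only: vertex_position_eq card.empty)
    qed
    \<comment> \<open>If \<open>v0\<close> is a vertex of \<sigma>, the cone on \<sigma> is 0 and
      only the cone on the face opposite \<open>v0\<close> survives. Otherwise the face of the cone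
      opposite \<open>v0\<close> is \<sigma>, and the other faces cancel.\<close>
    have key: "lin_ext face_sum (t \<sigma>) + lin_ext t (face_sum \<sigma>) = Poly_Mapping.single \<sigma> 1"
      if \<sigma>: "\<sigma> \<subseteq> X" for \<sigma>
    proof (cases "v0 \<in> \<sigma>")
      case True
      have fin: "finite \<sigma>" using \<sigma> X finite_subset by blast
      have "lin_ext t (face_sum \<sigma>) = (\<Sum>v\<in>\<sigma>. chain_scale ((-1) ^ vertex_position \<sigma> v) (t (\<sigma> - {v})))"
        unfolding face_sum_def T.sum lin_ext_single ..
      also have "\<dots> = (\<Sum>v\<in>\<sigma>. if v = v0 then Poly_Mapping.single \<sigma> 1 else 0)"
        by (rule sum.cong) (use True pos0[OF \<sigma>] in \<open>auto simp: t_def insert_absorb\<close>)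
      also have "\<dots> = Poly_Mapping.single \<sigma> 1" using True fin by simp
      finally show ?thesis using True by (simp add: t_def lin_ext_def)
    next
      case False
      have fin: "finite \<sigma>" using \<sigma> X finite_subset by blast
      have pos: "vertex_position (insert v0 \<sigma>) v = Suc (vertex_position \<sigma> v)" if "v \<in> \<sigma>" for v

      proof -
        have "v \<noteq> v0" "v \<in> X" using that False \<sigma> by auto
        then show ?thesis using vertex_position_Diff[of "insert v0 \<sigma>" v0 v] fin False v0(2)[of v] by simp
      qed
      have "lin_ext face_sum (t \<sigma>) = (face_sum (insert v0 \<sigma>) :: 'v set \<Rightarrow>\<^sub>0 'f)"
        using False by (simp add: t_def)
      also have "\<dots> = Poly_Mapping.single \<sigma> 1 + (\<Sum>v\<in>\<sigma>. Poly_Mapping.single (insert v0 \<sigma> - {v}) ((-1) ^ vertex_position (insert v0 \<sigma>) v))"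
        unfolding face_sum_def using fin False pos0[of "insert v0 \<sigma>"] \<sigma> v0(1) by simp
      also have "(\<Sum>v\<in>\<sigma>. Poly_Mapping.single (insert v0 \<sigma> - {v}) ((-1) ^ vertex_position (insert v0 \<sigma>) v))
          = (\<Sum>v\<in>\<sigma>. - chain_scale ((-1) ^ vertex_position \<sigma> v) (t (\<sigma> - {v})))"
      proof (rule sum.cong)
        fix v assume v: "v \<in> \<sigma>"
        have "insert v0 \<sigma> - {v} = insert v0 (\<sigma> - {v})" using v False by auto
        then show "Poly_Mapping.single (insert v0 \<sigma> - {v}) ((-1) ^ vertex_position (insert v0 \<sigma>) v)
          = - chain_scale ((-1) ^ vertex_position \<sigma> v) (t (\<sigma> - {v}))"
          using False pos[OF v] by (simp add: t_def single_uminus)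
      qed simp
      also have "\<dots> = - lin_ext t (face_sum \<sigma>)"
        unfolding face_sum_def T.sum lin_ext_single by (simp add: sum_negf)
      finally show ?thesis by simp
    qed
    have lin: "chain_linear (\<lambda>x. lin_ext face_sum (lin_ext t x) + lin_ext t (lin_ext face_sum x))"
      by (intro chain_linear_add chain_linear_compose[OF linear_lin_ext linear_lin_ext])
    have "lin_ext face_sum (lin_ext t z) + lin_ext t (lin_ext face_sum z) = z"
      by (rule chain_linear_eqI[OF lin chain_linear_id])
        (use zc key in \<open>auto simp: chains_def full_complex_def\<close>)
    then have "boundary (Suc q) (lin_ext t z) = z" using zb by (simp add: boundary_Suc T.zero)
    moreover have "lin_ext t z \<in> chains (full_complex X) (Suc q)"
    proof -
      have "\<tau> \<in> full_complex X \<and> card \<tau> = Suc (Suc q)" if "\<tau> \<in> Poly_Mapping.keys (lin_ext t z)" for \<tau>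
      proof -
        have "\<tau> \<in> (\<Union>\<sigma>\<in>Poly_Mapping.keys z. Poly_Mapping.keys (t \<sigma>))"
          using that keys_lin_ext[of t z] by (rule subsetD[rotated])
        then obtain \<sigma> where s: "\<sigma> \<in> Poly_Mapping.keys z" "\<tau> \<in> Poly_Mapping.keys (t \<sigma>)" by auto
        then have "v0 \<notin> \<sigma>" "\<tau> = insert v0 \<sigma>" by (auto simp: t_def split: if_splits)
        moreover have "\<sigma> \<subseteq> X" "card \<sigma> = Suc q" using s(1) zc by (auto simp: chains_def full_complex_def)
        moreover have "finite \<sigma>" using \<open>\<sigma> \<subseteq> X\<close> X finite_subset by auto
        ultimately show ?thesis using v0(1) by (auto simp: full_complex_def)
      qed
      then show ?thesis unfolding chains_def by blast
    qed
    ultimately show ?thesis unfolding boundaries_def by (metis image_eqI)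
  qed
qed

section \<open>Invariance under relabelling of vertices\<close>

definition inversions :: "('v \<Rightarrow> 'w) \<Rightarrow> 'v set \<Rightarrow> ('v \<times> 'v) set" where
  "inversions f \<sigma> = {(v, w). v \<in> \<sigma> \<and> w \<in> \<sigma> \<and> before v w \<and> before (f w) (f v)}"

text \<open>The chosen orders on the two vertex types are unrelated, so an injection reorders the
  vertices of a simplex. The parity of \<open>inversions\<close> is the sign of this reordering and
  makes the map commute with the boundary.\<close>

definition relabel :: "('v \<Rightarrow> 'w) \<Rightarrow> ('v set \<Rightarrow>\<^sub>0 'f::field) \<Rightarrow> ('w set \<Rightarrow>\<^sub>0 'f)" where
  "relabel f = lin_ext (\<lambda>\<sigma>. Poly_Mapping.single (f ` \<sigma>) ((-1) ^ card (inversions f \<sigma>)))"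

text \<open>Let \<open>A\<close> be the vertices before \<open>v\<close> and \<open>B\<close> those
  whose images come before \<open>f v\<close>. The inversions involving \<open>v\<close> correspond
  to the symmetric difference of \<open>A\<close> and \<open>B\<close>, whose size has the parity of
  \<open>card A + card B\<close>, and these two cardinalities are the positions of \<open>v\<close>
  and \<open>f v\<close>.\<close>

lemma inversions_sign:
  fixes f :: "'v \<Rightarrow> 'w"
  assumes fin: "finite \<sigma>" and inj: "inj_on f \<sigma>" and v: "v \<in> \<sigma>"
  shows "(-1 :: 'f::field) ^ card (inversions f \<sigma>) * (-1) ^ vertex_position (f ` \<sigma>) (f v)
    = (-1) ^ vertex_position \<sigma> v * (-1) ^ card (inversions f (\<sigma> - {v}))"
proof -
  define A where "A = {w \<in> \<sigma>. before w v}"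
  define B where "B = {w \<in> \<sigma>. before (f w) (f v)}"
  have fAB: "finite A" "finite B" using fin by (auto simp: A_def B_def)
  have "{u \<in> f ` \<sigma>. before u (f v)} = f ` B" by (auto simp: B_def)
  moreover have "card (f ` B) = card B" by (rule card_image, rule inj_on_subset[OF inj]) (auto simp: B_def)
  ultimately have posf: "vertex_position (f ` \<sigma>) (f v) = card B" unfolding vertex_position_eq by simp
  have neq: "f w \<noteq> f v" if "w \<in> \<sigma>" "w \<noteq> v" for w using inj v that by (auto simp: inj_on_def)
  have AB: "(w, v) \<in> inversions f \<sigma> \<longleftrightarrow> w \<in> A - B" for w
    using v neq[of w] before_total[of "f w" "f v"] before_antisym[of "f w" "f v"] before_irrefl[of v]
    by (auto simp: inversions_def A_def B_def before_def)
  have BA: "(v, w) \<in> inversions f \<sigma> \<longleftrightarrow> w \<in> B - A" for w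
    using v before_total[of w v] before_antisym[of w v]
    by (auto simp: inversions_def A_def B_def before_def)
  have un: "inversions f \<sigma> = inversions f (\<sigma> - {v}) \<union> (\<lambda>w. (w, v)) ` (A - B) \<union> Pair v ` (B - A)" (is "_ = ?R")
  proof (rule set_eqI)
    fix p :: "'v \<times> 'v"
    obtain x y where p: "p = (x, y)" by (cases p)
    consider "x \<noteq> v" "y \<noteq> v" | "y = v" | "x = v" "y \<noteq> v" by blast
    then show "p \<in> inversions f \<sigma> \<longleftrightarrow> p \<in> ?R"
    proof cases
      case 1
      then show ?thesis by (auto simp: p inversions_def)
    next
      case 2
      have "(v, v) \<notin> inversions f \<sigma>" using before_irrefl[of v] by (simp add: inversions_def)
      then have "v \<notin> B - A" using BA by blast
      then show ?thesis using 2 AB[of x] by (auto simp: p inversions_def[of f "\<sigma> - {v}"])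
    next
      case 3
      then show ?thesis using BA[of y] by (auto simp: p inversions_def[of f "\<sigma> - {v}"])
    qed
  qed
  have fi: "finite (inversions f (\<sigma> - {v}))"
    by (rule finite_subset[of _ "\<sigma> \<times> \<sigma>"]) (use fin in \<open>auto simp: inversions_def\<close>)
  have vv: "v \<notin> A" by (simp add: A_def before_irrefl)
  have "card (inversions f \<sigma>) = card (inversions f (\<sigma> - {v}) \<union> (\<lambda>w. (w, v)) ` (A - B)) + card (Pair v ` (B - A))"
    unfolding un by (rule card_Un_disjoint) (use fi fAB vv in \<open>auto simp: inversions_def\<close>)
  also have "card (inversions f (\<sigma> - {v}) \<union> (\<lambda>w. (w, v)) ` (A - B)) = card (inversions f (\<sigma> - {v})) + card ((\<lambda>w. (w, v)) ` (A - B))"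
    by (rule card_Un_disjoint) (use fi fAB in \<open>auto simp: inversions_def\<close>)
  also have "card ((\<lambda>w. (w, v)) ` (A - B)) = card (A - B)" by (rule card_image) (auto simp: inj_on_def)
  also have "card (Pair v ` (B - A)) = card (B - A)" by (rule card_image) (auto simp: inj_on_def)
  finally have c: "card (inversions f \<sigma>) = card (inversions f (\<sigma> - {v})) + card (A - B) + card (B - A)" .
  have "card A = card (A - B) + card (A \<inter> B)"
    using card_Diff_subset_Int[of A B] fAB by (simp add: card_mono)
  moreover have "card B = card (B - A) + card (A \<inter> B)"
    using card_Diff_subset_Int[of B A] fAB by (simp add: card_mono Int_commute)
  ultimately have "card (inversions f \<sigma>) + vertex_position (f ` \<sigma>) (f v) =
    (vertex_position \<sigma> v + card (inversions f (\<sigma> - {v}))) + 2 * card (B - A)"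
    using c posf by (simp add: vertex_position_eq A_def[symmetric])
  then have "(-1 :: 'f) ^ (card (inversions f \<sigma>) + vertex_position (f ` \<sigma>) (f v)) =
    (-1) ^ ((vertex_position \<sigma> v + card (inversions f (\<sigma> - {v}))) + 2 * card (B - A))" by simp
  then show ?thesis by (simp add: power_add)
qed

lemma relabel_face_sum:
  assumes fin: "finite \<sigma>" and inj: "inj_on f \<sigma>"
  shows "relabel f (face_sum \<sigma>) = chain_scale ((-1 :: 'f::field) ^ card (inversions f \<sigma>)) (face_sum (f ` \<sigma>))"
proof -
  interpret R: Vector_Spaces.linear chain_scale chain_scale "relabel f :: ('a set \<Rightarrow>\<^sub>0 'f) \<Rightarrow> _"
    unfolding relabel_def by (rule linear_lin_ext)
  have "relabel f (face_sum \<sigma>) = (\<Sum>v\<in>\<sigma>. Poly_Mapping.single (f ` (\<sigma> - {v})) ((-1 :: 'f) ^ vertex_position \<sigma> v * (-1) ^ card (inversions f (\<sigma> - {v}))))"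
    unfolding face_sum_def R.sum by (simp add: relabel_def)
  also have "\<dots> = (\<Sum>v\<in>\<sigma>. Poly_Mapping.single (f ` \<sigma> - {f v}) ((-1 :: 'f) ^ card (inversions f \<sigma>) * (-1) ^ vertex_position (f ` \<sigma>) (f v)))"
  proof (rule sum.cong)
    fix v assume v: "v \<in> \<sigma>"
    have "f ` (\<sigma> - {v}) = f ` \<sigma> - {f v}" using inj v by (auto simp: inj_on_def)
    then show "Poly_Mapping.single (f ` (\<sigma> - {v})) ((-1 :: 'f) ^ vertex_position \<sigma> v * (-1) ^ card (inversions f (\<sigma> - {v})))
      = Poly_Mapping.single (f ` \<sigma> - {f v}) ((-1) ^ card (inversions f \<sigma>) * (-1) ^ vertex_position (f ` \<sigma>) (f v))"
      using inversions_sign[OF fin inj v, where 'f='f] by simp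
  qed simp
  also have "\<dots> = (\<Sum>u\<in>f ` \<sigma>. Poly_Mapping.single (f ` \<sigma> - {u}) ((-1 :: 'f) ^ card (inversions f \<sigma>) * (-1) ^ vertex_position (f ` \<sigma>) u))"
    by (subst sum.reindex[OF inj]) simp
  also have "\<dots> = chain_scale ((-1 :: 'f) ^ card (inversions f \<sigma>)) (face_sum (f ` \<sigma>))"
    unfolding face_sum_def chain.scale_sum_right by simp
  finally show ?thesis .
qed

lemma relabel_boundary:
  assumes "\<And>\<sigma>. \<sigma> \<in> Poly_Mapping.keys c \<Longrightarrow> finite \<sigma>" "\<And>\<sigma>. \<sigma> \<in> Poly_Mapping.keys c \<Longrightarrow> inj_on f \<sigma>"
  shows "relabel f (boundary q c) = boundary q (relabel f c)"
proof (cases q)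
  case 0
  then show ?thesis by (simp add: boundary_0 relabel_def lin_ext_def)
next
  case (Suc n)
  have l: "chain_linear (\<lambda>c. relabel f (lin_ext face_sum c))" "chain_linear (\<lambda>c. lin_ext face_sum (relabel f c))"
    unfolding relabel_def by (intro chain_linear_compose[OF linear_lin_ext linear_lin_ext])+
  have "relabel f (lin_ext face_sum c) = lin_ext face_sum (relabel f c)"
    by (rule chain_linear_eqI[OF l]) (use assms in \<open>simp add: relabel_face_sum\<close>, simp add: relabel_def)
  then show ?thesis by (simp add: Suc boundary_Suc)
qed

lemma relabel_in_chains:
  assumes "c \<in> chains K q" "\<And>\<sigma>. \<sigma> \<in> K \<Longrightarrow> inj_on f \<sigma>"
  shows "relabel f c \<in> chains ((`) f ` K) q"
proof -
  have "\<tau> \<in> (`) f ` K \<and> card \<tau> = Suc q" if t: "\<tau> \<in> Poly_Mapping.keys (relabel f c)" for \<tau>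
  proof -
    obtain \<sigma> where s: "\<sigma> \<in> Poly_Mapping.keys c" "\<tau> = f ` \<sigma>"
      using subsetD[OF keys_lin_ext t[unfolded relabel_def]] by (auto split: if_splits)
    then have "\<sigma> \<in> K" "card \<sigma> = Suc q" using assms(1) by (auto simp: chains_def)
    then show ?thesis using s(2) assms(2)[of \<sigma>] by (auto simp: card_image)
  qed
  then show ?thesis unfolding chains_def by blast
qed

text \<open>Injectivity on \<open>V\<close> makes distinct simplices have distinct images, so each
  coefficient of \<open>c\<close> reappears, up to sign, in the relabelled chain.\<close>

lemma relabel_eq_0:
  assumes c: "relabel f c = (0 :: _ \<Rightarrow>\<^sub>0 'f::field)" and inj: "inj_on f V" and V: "\<And>\<sigma>. \<sigma> \<in> Poly_Mapping.keys c \<Longrightarrow> \<sigma> \<subseteq> V"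
  shows "c = 0"
proof (rule ccontr)
  assume "c \<noteq> 0"
  then obtain \<tau> where t: "\<tau> \<in> Poly_Mapping.keys c" by fastforce
  have "0 = Poly_Mapping.lookup (relabel f c) (f ` \<tau>)" by (simp add: c)
  also have "\<dots> = (\<Sum>\<sigma>\<in>Poly_Mapping.keys c. Poly_Mapping.lookup c \<sigma> * ((-1) ^ card (inversions f \<sigma>) when f ` \<sigma> = f ` \<tau>))"
    by (simp add: relabel_def lin_ext_def lookup_sum lookup_single del: chain_scale_single)
  also have "\<dots> = (\<Sum>\<sigma>\<in>Poly_Mapping.keys c. if \<sigma> = \<tau> then Poly_Mapping.lookup c \<tau> * (-1) ^ card (inversions f \<tau>) else 0)"
    by (rule sum.cong) (use V t in \<open>auto simp: when_def inj_on_image_eq_iff[OF inj]\<close>)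
  also have "\<dots> = Poly_Mapping.lookup c \<tau> * (-1) ^ card (inversions f \<tau>)" using t by simp
  finally have "Poly_Mapping.lookup c \<tau> = 0" by simp
  then show False using t by (simp add: in_keys_iff)
qed

text \<open>Relabelling is an injective chain map, so it carries a basis of the intersection to an
  independent set. The inequality suffices: the same statement for the inverse injection gives
  equality.\<close>

lemma rank_relabel_le:
  assumes "finite V" "K \<subseteq> Pow V" "L \<subseteq> Pow V" "inj_on f V"
  shows "chain.dim (cycles K q \<inter> boundaries L q :: ('v set \<Rightarrow>\<^sub>0 'f::field) set)
    \<le> chain.dim (cycles ((`) f ` K) q \<inter> boundaries ((`) f ` L) q :: ('w set \<Rightarrow>\<^sub>0 'f) set)"
proof -
  let ?A = "cycles K q \<inter> boundaries L q :: ('v set \<Rightarrow>\<^sub>0 'f) set"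
  let ?B = "cycles ((`) f ` K) q \<inter> boundaries ((`) f ` L) q :: ('w set \<Rightarrow>\<^sub>0 'f) set"
  interpret R: Vector_Spaces.linear chain_scale chain_scale "relabel f :: ('v set \<Rightarrow>\<^sub>0 'f) \<Rightarrow> ('w set \<Rightarrow>\<^sub>0 'f)"
    unfolding relabel_def by (rule linear_lin_ext)
  have fin: "finite \<sigma>" "inj_on f \<sigma>" if "\<sigma> \<subseteq> V" for \<sigma>
    using that assms(1,4) by (auto intro: finite_subset inj_on_subset)
  have bd: "relabel f (boundary n c) = boundary n (relabel f c)" if "c \<in> chains M n" "M \<subseteq> Pow V" for n M and c :: "'v set \<Rightarrow>\<^sub>0 'f"
    by (rule relabel_boundary) (use that fin in \<open>auto simp: chains_def\<close>)
  have ch: "relabel f c \<in> chains ((`) f ` M) n" if "c \<in> chains M n" "M \<subseteq> Pow V" for n M and c :: "'v set \<Rightarrow>\<^sub>0 'f"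
    by (rule relabel_in_chains[OF that(1)]) (use that fin in auto)
  have sub: "relabel f ` ?A \<subseteq> ?B"
  proof
    fix y assume "y \<in> relabel f ` ?A"
    then obtain c where c: "c \<in> chains K q" "boundary q c = 0" "c \<in> boundaries L q" "y = relabel f c"
      by (auto simp: cycles_def)
    obtain d where d: "d \<in> chains L (Suc q)" "c = boundary (Suc q) d" using c(3) by (auto simp: boundaries_def)
    have "boundary q y = 0" using bd[OF c(1) assms(2)] c(2,4) by (simp add: R.zero)
    moreover have "y = boundary (Suc q) (relabel f d)" using bd[OF d(1) assms(3)] d(2) c(4) by simp
    ultimately show "y \<in> ?B" using ch[OF c(1) assms(2)] ch[OF d(1) assms(3)] c(4)
      by (auto simp: cycles_def boundaries_def)
  qed
  obtain C where C: "C \<subseteq> ?A" "chain.independent C" "?A \<subseteq> chain.span C" "card C = chain.dim ?A"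
    by (rule chain.basis_exists)
  have subA: "chain.subspace ?A" by (rule chain.subspace_inter[OF subspace_cycles subspace_boundaries])
  have "inj_on (relabel f) (chain.span C)"
  proof (rule inj_onI)
    fix x y assume xy: "x \<in> chain.span C" "y \<in> chain.span C" and e: "relabel f x = relabel f y"
    have "x \<in> ?A" "y \<in> ?A"
      by (rule subsetD[OF chain.span_minimal[OF C(1) subA] xy(1)], rule subsetD[OF chain.span_minimal[OF C(1) subA] xy(2)])
    then have "x - y \<in> chains K q" by (intro chain.subspace_diff[OF subspace_chains]) (simp_all add: cycles_def)
    moreover have "relabel f (x - y) = 0" using e by (simp add: R.diff)
    ultimately have "x - y = 0" using assms(2) by (intro relabel_eq_0[OF _ assms(4)]) (auto simp: chains_def)
    then show "x = y" by simp
  qed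
  then have ind: "chain.independent (relabel f ` C)" and inj: "inj_on (relabel f) C"
    by (rule R.independent_injective_image[OF C(2)], rule inj_on_subset[OF _ chain.span_superset])
  have "finite ((`) f ` K)" using finite_subset[OF assms(2)] assms(1) by simp
  moreover have "?B \<subseteq> chains ((`) f ` K) q" by (auto simp: cycles_def)
  ultimately have "chain.dim (relabel f ` C) \<le> chain.dim ?B"
    by (rule chain_dim_mono[OF _ order_trans[OF image_mono[OF C(1)] sub]])
  moreover have "chain.dim (relabel f ` C) = card C"
    using chain.dim_eq_card_independent[OF ind] card_image[OF inj] by simp
  ultimately show ?thesis using C(4) by simp
qed

lemma rank_relabel:
  assumes "finite V" "K \<subseteq> Pow V" "L \<subseteq> Pow V" "inj_on f V"
  shows "chain.dim (cycles ((`) f ` K) q \<inter> boundaries ((`) f ` L) q :: ('w set \<Rightarrow>\<^sub>0 'f::field) set)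
    = chain.dim (cycles K q \<inter> boundaries L q :: ('v set \<Rightarrow>\<^sub>0 'f) set)"
proof (rule antisym)
  let ?g = "inv_into V f"
  have g: "?g ` f ` \<sigma> = \<sigma>" if "\<sigma> \<subseteq> V" for \<sigma>
    using inv_into_image_cancel[OF assms(4) that] .
  have bk: "(`) ?g ` (`) f ` M = M" if "M \<subseteq> Pow V" for M
  proof -
    have "?g ` f ` \<sigma> = \<sigma>" if "\<sigma> \<in> M" for \<sigma> using g[of \<sigma>] that \<open>M \<subseteq> Pow V\<close> by auto
    then show ?thesis by (simp add: image_image)
  qed
  have "chain.dim (cycles ((`) f ` K) q \<inter> boundaries ((`) f ` L) q :: ('w set \<Rightarrow>\<^sub>0 'f) set)
    \<le> chain.dim (cycles ((`) ?g ` (`) f ` K) q \<inter> boundaries ((`) ?g ` (`) f ` L) q :: ('v set \<Rightarrow>\<^sub>0 'f) set)"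
    by (rule rank_relabel_le[of "f ` V"]) (use assms in \<open>auto intro: inj_on_inv_into\<close>)
  then show "chain.dim (cycles ((`) f ` K) q \<inter> boundaries ((`) f ` L) q :: ('w set \<Rightarrow>\<^sub>0 'f) set)
    \<le> chain.dim (cycles K q \<inter> boundaries L q :: ('v set \<Rightarrow>\<^sub>0 'f) set)"
    by (simp add: bk assms)
qed (rule rank_relabel_le[OF assms])

section \<open>Restriction of chains and disjoint unions of complexes\<close>

definition chain_restrict :: "'v set \<Rightarrow> ('v set \<Rightarrow>\<^sub>0 'f::field) \<Rightarrow> ('v set \<Rightarrow>\<^sub>0 'f)" where
  "chain_restrict V = lin_ext (\<lambda>\<sigma>. if \<sigma> \<subseteq> V then Poly_Mapping.single \<sigma> 1 else 0)"

lemma linear_chain_restrict: "chain_linear (chain_restrict V)"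
  unfolding chain_restrict_def by (rule linear_lin_ext)

lemma lookup_chain_restrict:
  "Poly_Mapping.lookup (chain_restrict V c) \<tau> = (if \<tau> \<subseteq> V then Poly_Mapping.lookup c \<tau> else 0)"
proof -
  have "Poly_Mapping.lookup (chain_restrict V c) \<tau> =
    (\<Sum>\<sigma>\<in>Poly_Mapping.keys c. if \<sigma> = \<tau> then (if \<tau> \<subseteq> V then Poly_Mapping.lookup c \<tau> else 0) else 0)"
    unfolding chain_restrict_def lin_ext_def lookup_sum lookup_chain_scale
    by (rule sum.cong) (simp_all add: lookup_single when_def)
  also have "\<dots> = (if \<tau> \<subseteq> V then Poly_Mapping.lookup c \<tau> else 0)"
    by (simp add: in_keys_iff)
  finally show ?thesis .
qed

text \<open>When every simplex lies inside \<open>V\<close> or misses it, a nonempty face lies in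
  \<open>V\<close> exactly if its simplex does. So restriction is a chain map.\<close>

lemma chain_restrict_boundary:
  fixes c :: "'v set \<Rightarrow>\<^sub>0 'f::field"
  assumes "c \<in> chains K q" "\<And>\<sigma>. \<sigma> \<in> K \<Longrightarrow> \<sigma> \<subseteq> V \<or> \<sigma> \<inter> V = {}"
  shows "chain_restrict V (boundary q c) = boundary q (chain_restrict V c)"
proof (cases q)
  case 0
  then show ?thesis by (simp add: boundary_0 chain_restrict_def lin_ext_def)
next
  case (Suc n)
  have "chain_restrict V (lin_ext face_sum c) = lin_ext face_sum (chain_restrict V c)"
  proof (rule chain_linear_eqI[OF chain_linear_compose[OF linear_chain_restrict linear_lin_ext]
        chain_linear_compose[OF linear_lin_ext linear_chain_restrict]])
    fix \<sigma> assume "\<sigma> \<in> Poly_Mapping.keys c"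
    then have s: "\<sigma> \<subseteq> V \<or> \<sigma> \<inter> V = {}" "card \<sigma> = Suc (Suc n)"
      using assms by (auto simp: chains_def Suc)
    have k: "Poly_Mapping.lookup (face_sum \<sigma> :: 'v set \<Rightarrow>\<^sub>0 'f) \<tau> = 0" if "\<tau> \<notin> (\<lambda>v. \<sigma> - {v}) ` \<sigma>" for \<tau>
      using keys_face_sum[of \<sigma>, where 'f='f] that by (meson in_keys_iff subsetD)
    have "chain_restrict V (face_sum \<sigma>) = (if \<sigma> \<subseteq> V then face_sum \<sigma> else (0 :: 'v set \<Rightarrow>\<^sub>0 'f))"
    proof (rule poly_mapping_eqI)
      fix \<tau>
      show "Poly_Mapping.lookup (chain_restrict V (face_sum \<sigma>)) \<tau> =
        Poly_Mapping.lookup (if \<sigma> \<subseteq> V then face_sum \<sigma> else (0 :: 'v set \<Rightarrow>\<^sub>0 'f)) \<tau>"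
      proof (cases "\<tau> \<in> (\<lambda>v. \<sigma> - {v}) ` \<sigma>")
        case True
        then obtain v where v: "v \<in> \<sigma>" "\<tau> = \<sigma> - {v}" by auto
        have "card \<tau> = Suc n" using v s(2) by simp
        \<comment> \<open>The empty face would count as a subset of every \<open>V\<close>; it does
          not occur here, since the simplex has at least two vertices.\<close>
        then have "\<tau> \<noteq> {}" by auto
        then show ?thesis using s(1) v(2) by (auto simp: lookup_chain_restrict)
      qed (simp add: lookup_chain_restrict k)
    qed
    moreover have "chain_restrict V (Poly_Mapping.single \<sigma> (1::'f)) = (if \<sigma> \<subseteq> V then Poly_Mapping.single \<sigma> 1 else 0)"
      unfolding chain_restrict_def by simp
    moreover have "lin_ext face_sum (0 :: 'v set \<Rightarrow>\<^sub>0 'f) = (0 :: 'v set \<Rightarrow>\<^sub>0 'f)" by (simp add: lin_ext_def)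
    ultimately show "chain_restrict V (lin_ext face_sum (Poly_Mapping.single \<sigma> (1::'f))) =
      lin_ext face_sum (chain_restrict V (Poly_Mapping.single \<sigma> 1))"
      by simp
  qed
  then show ?thesis by (simp add: Suc boundary_Suc)
qed

lemma chain_restrict_in_chains:
  assumes "c \<in> chains K q" "\<And>\<sigma>. \<sigma> \<in> K \<Longrightarrow> \<sigma> \<noteq> {} \<Longrightarrow> \<sigma> \<subseteq> V \<Longrightarrow> \<sigma> \<in> K'"
  shows "chain_restrict V c \<in> chains K' q"
proof -
  have "\<sigma> \<in> K' \<and> card \<sigma> = Suc q" if "\<sigma> \<in> Poly_Mapping.keys (chain_restrict V c)" for \<sigma>
  proof -
    have "\<sigma> \<subseteq> V" "\<sigma> \<in> Poly_Mapping.keys c"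
      using that by (auto simp: in_keys_iff lookup_chain_restrict split: if_splits)
    moreover from this have "\<sigma> \<in> K" "card \<sigma> = Suc q" using assms(1) by (auto simp: chains_def)
    ultimately show ?thesis using assms(2)[of \<sigma>] by fastforce
  qed
  then show ?thesis unfolding chains_def by blast
qed

lemma chains_mono: "K \<subseteq> L \<Longrightarrow> chains K q \<subseteq> chains L q"
  unfolding chains_def by auto

text \<open>The restrictions to \<open>V1\<close> and \<open>V2\<close> are chain maps whose sum is
  the identity on chains of the union. They split the space of cycles that bound into a direct sum,
  and dimensions add.\<close>

lemma rank_disjoint_union:
  assumes fin: "finite V1" "finite V2" and disj: "V1 \<inter> V2 = {}"
    and K: "K1 \<subseteq> Pow V1" "K2 \<subseteq> Pow V2" and L: "L1 \<subseteq> Pow V1" "L2 \<subseteq> Pow V2"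
  shows "chain.dim (cycles (K1 \<union> K2) q \<inter> boundaries (L1 \<union> L2) q :: ('v set \<Rightarrow>\<^sub>0 'f::field) set)
    = chain.dim (cycles K1 q \<inter> boundaries L1 q :: ('v set \<Rightarrow>\<^sub>0 'f) set)
    + chain.dim (cycles K2 q \<inter> boundaries L2 q :: ('v set \<Rightarrow>\<^sub>0 'f) set)"
proof -
  let ?A = "\<lambda>K L. cycles K q \<inter> boundaries L q :: ('v set \<Rightarrow>\<^sub>0 'f) set"
  have sub: "chain.subspace (?A K L)" for K L
    by (rule chain.subspace_inter[OF subspace_cycles subspace_boundaries])
  have r0: "chain_restrict V (0 :: 'v set \<Rightarrow>\<^sub>0 'f) = 0" for V by (simp add: chain_restrict_def lin_ext_def)
  have restr: "chain_restrict V c \<in> ?A K L"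
    if c: "c \<in> ?A K' L'"
      and K: "\<And>\<sigma>. \<sigma> \<in> K' \<Longrightarrow> \<sigma> \<subseteq> V \<or> \<sigma> \<inter> V = {}" "\<And>\<sigma>. \<sigma> \<in> K' \<Longrightarrow> \<sigma> \<noteq> {} \<Longrightarrow> \<sigma> \<subseteq> V \<Longrightarrow> \<sigma> \<in> K"
      and L: "\<And>\<sigma>. \<sigma> \<in> L' \<Longrightarrow> \<sigma> \<subseteq> V \<or> \<sigma> \<inter> V = {}" "\<And>\<sigma>. \<sigma> \<in> L' \<Longrightarrow> \<sigma> \<noteq> {} \<Longrightarrow> \<sigma> \<subseteq> V \<Longrightarrow> \<sigma> \<in> L"
    for c V K L K' L'
  proof -
    have c1: "c \<in> chains K' q" "boundary q c = 0" using c by (auto simp: cycles_def)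
    obtain d where d: "d \<in> chains L' (Suc q)" "c = boundary (Suc q) d" using c by (auto simp: boundaries_def)
    have "boundary q (chain_restrict V c) = 0"
      using chain_restrict_boundary[OF c1(1) K(1)] c1(2) by (simp add: r0)
    moreover have "chain_restrict V c = boundary (Suc q) (chain_restrict V d)"
      using chain_restrict_boundary[OF d(1) L(1)] d(2) by simp
    moreover have "chain_restrict V c \<in> chains K q" by (rule chain_restrict_in_chains[OF c1(1) K(2)])
    moreover have "chain_restrict V d \<in> chains L (Suc q)" by (rule chain_restrict_in_chains[OF d(1) L(2)])
    ultimately show ?thesis by (auto simp: cycles_def boundaries_def)
  qed
  have mono: "?A K L \<subseteq> ?A (K \<union> K') (L \<union> L')" for K L K' L'
  proof (rule Int_mono)
    show "cycles K q \<subseteq> (cycles (K \<union> K') q :: ('v set \<Rightarrow>\<^sub>0 'f) set)"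
      unfolding cycles_def using chains_mono[of K "K \<union> K'" q, where 'b='f] by auto
    show "boundaries L q \<subseteq> (boundaries (L \<union> L') q :: ('v set \<Rightarrow>\<^sub>0 'f) set)"
      unfolding boundaries_def by (rule image_mono, rule chains_mono) simp
  qed
  have sep: "\<sigma> \<subseteq> V1 \<or> \<sigma> \<inter> V1 = {}" "\<sigma> \<subseteq> V2 \<or> \<sigma> \<inter> V2 = {}"
    if "\<sigma> \<in> M1 \<union> M2" "M1 \<subseteq> Pow V1" "M2 \<subseteq> Pow V2" for \<sigma> M1 M2
    using that disj by auto
  have mem: "\<sigma> \<subseteq> V1 \<Longrightarrow> \<sigma> \<in> M1" "\<sigma> \<subseteq> V2 \<Longrightarrow> \<sigma> \<in> M2"
    if "\<sigma> \<in> M1 \<union> M2" "M1 \<subseteq> Pow V1" "M2 \<subseteq> Pow V2" "\<sigma> \<noteq> {}" for \<sigma> M1 M2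
  proof -
    have "\<not> (\<sigma> \<subseteq> V1 \<and> \<sigma> \<subseteq> V2)" using that(4) disj by auto
    then show "\<sigma> \<subseteq> V1 \<Longrightarrow> \<sigma> \<in> M1" "\<sigma> \<subseteq> V2 \<Longrightarrow> \<sigma> \<in> M2" using that(1-3) by auto
  qed
  have "?A (K1 \<union> K2) (L1 \<union> L2) = {x + y |x y. x \<in> ?A K1 L1 \<and> y \<in> ?A K2 L2}"
  proof (intro equalityI subsetI)
    fix c assume c: "c \<in> ?A (K1 \<union> K2) (L1 \<union> L2)"
    have "chain_restrict V1 c \<in> ?A K1 L1"
      by (rule restr[OF c sep(1)[OF _ K] mem(1)[OF _ K] sep(1)[OF _ L] mem(1)[OF _ L]])
    moreover have "chain_restrict V2 c \<in> ?A K2 L2"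
      by (rule restr[OF c sep(2)[OF _ K] mem(2)[OF _ K] sep(2)[OF _ L] mem(2)[OF _ L]])
    moreover have "c = chain_restrict V1 c + chain_restrict V2 c"
    proof (rule poly_mapping_eqI)
      fix \<tau>
      show "Poly_Mapping.lookup c \<tau> = Poly_Mapping.lookup (chain_restrict V1 c + chain_restrict V2 c) \<tau>"
      proof (cases "\<tau> \<in> Poly_Mapping.keys c")
        case True
        then have "\<tau> \<in> K1 \<union> K2" "card \<tau> = Suc q" using c by (auto simp: cycles_def chains_def)
        then have "\<tau> \<subseteq> V1 \<or> \<tau> \<subseteq> V2" "\<tau> \<noteq> {}" using K by auto
        then have "\<tau> \<subseteq> V1 \<and> \<not> \<tau> \<subseteq> V2 \<or> \<not> \<tau> \<subseteq> V1 \<and> \<tau> \<subseteq> V2" using disj by blast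
        then show ?thesis by (auto simp: lookup_add lookup_chain_restrict)
      qed (simp add: lookup_add lookup_chain_restrict in_keys_iff)
    qed
    ultimately show "c \<in> {x + y |x y. x \<in> ?A K1 L1 \<and> y \<in> ?A K2 L2}" by blast
  next
    fix c assume "c \<in> {x + y |x y. x \<in> ?A K1 L1 \<and> y \<in> ?A K2 L2}"
    then obtain x y where c: "c = x + y" and x: "x \<in> ?A K1 L1" and y: "y \<in> ?A K2 L2" by blast
    have "x \<in> ?A (K1 \<union> K2) (L1 \<union> L2)" by (rule subsetD[OF mono x])
    moreover have "y \<in> ?A (K1 \<union> K2) (L1 \<union> L2)"
      using subsetD[OF mono y, of K1 L1] by (simp add: Un_commute)
    ultimately show "c \<in> ?A (K1 \<union> K2) (L1 \<union> L2)" unfolding c by (rule chain.subspace_add[OF sub])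
  qed
  moreover have "chain.dim {x + y |x y. x \<in> ?A K1 L1 \<and> y \<in> ?A K2 L2} = chain.dim (?A K1 L1) + chain.dim (?A K2 L2)"
  proof (rule fchain.dim_direct_sum[OF sub _ sub])
    let ?S = "(\<lambda>\<sigma>. Poly_Mapping.single \<sigma> (1::'f)) ` {\<sigma>\<in>K1 \<union> K2. card \<sigma> = Suc q}"
    have "K1 \<union> K2 \<subseteq> Pow V1 \<union> Pow V2" using K by auto
    then have "finite (K1 \<union> K2)" by (rule finite_subset) (use fin in auto)
    then show "finite ?S" by auto
    have ch: "chains (K1 \<union> K2) q \<subseteq> chain.span ?S" by (rule chains_subset_span)
    have a: "?A K L \<subseteq> chains K q" for K L by (auto simp: cycles_def)
    show "?A K1 L1 \<subseteq> chain.span ?S" "?A K2 L2 \<subseteq> chain.span ?S"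
      by (rule order_trans[OF order_trans[OF a chains_mono] ch], simp)+
    show "?A K1 L1 \<inter> ?A K2 L2 = {0}"
    proof (intro equalityI subsetI)
      fix c assume c: "c \<in> ?A K1 L1 \<inter> ?A K2 L2"
      have "Poly_Mapping.keys c = {}"
      proof (rule equals0I)
        fix \<sigma> assume "\<sigma> \<in> Poly_Mapping.keys c"
        then have "\<sigma> \<in> K1" "\<sigma> \<in> K2" "card \<sigma> = Suc q" using c by (auto simp: cycles_def chains_def)
        then have "\<sigma> \<subseteq> V1 \<inter> V2" "\<sigma> \<noteq> {}" using K by auto
        then show False using disj by auto
      qed
      then show "c \<in> {0}" by simp
    next
      fix c :: "'v set \<Rightarrow>\<^sub>0 'f" assume "c \<in> {0}"
      then show "c \<in> ?A K1 L1 \<inter> ?A K2 L2" using chain.subspace_0[OF sub[of K1 L1]] chain.subspace_0[OF sub[of K2 L2]] by simp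
    qed
  qed
  ultimately show ?thesis by simp
qed

section \<open>Diagram points counted by ranks\<close>

definition sublevel_complex :: "(real \<Rightarrow> 'v set set) \<Rightarrow> ereal \<Rightarrow> 'v set set" where
  "sublevel_complex K a = {\<sigma> \<in> total_complex K. birth_time K \<sigma> \<le> a}"

lemma level_le_iff: "level K c \<le> a \<longleftrightarrow> (\<forall>\<sigma>\<in>Poly_Mapping.keys c. birth_time K \<sigma> \<le> a)"
  by (simp add: level_def SUP_le_iff)

lemma birth_time_nonneg: "0 \<le> birth_time K \<sigma>"
  unfolding birth_time_def by (rule Inf_greatest) auto

lemma level_nonneg:
  assumes "c \<noteq> 0"
  shows "0 \<le> level K c"
proof -
  obtain \<sigma> where "\<sigma> \<in> Poly_Mapping.keys c" using assms by fastforce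
  then have "birth_time K \<sigma> \<le> level K c" unfolding level_def by (rule SUP_upper)
  with birth_time_nonneg show ?thesis by (rule order_trans)
qed

lemma ultra_level: "fchain.ultra (level K :: ('v set \<Rightarrow>\<^sub>0 'f::field) \<Rightarrow> ereal)"
  unfolding fchain.ultra_def
proof (intro conjI allI impI)
  show "level K (0 :: 'v set \<Rightarrow>\<^sub>0 'f) = -\<infinity>" by (simp add: level_def bot_ereal_def)
  show "level K (chain_scale a x) = level K x" if "a \<noteq> 0" for a and x :: "'v set \<Rightarrow>\<^sub>0 'f"
    by (simp add: level_def keys_chain_scale_eq[OF that])
  show "level K (x + y) \<le> max (level K x) (level K y)" for x y :: "'v set \<Rightarrow>\<^sub>0 'f"
  proof -
    have "birth_time K \<sigma> \<le> max (level K x) (level K y)" if s: "\<sigma> \<in> Poly_Mapping.keys (x + y)" for \<sigma>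
    proof -
      consider "\<sigma> \<in> Poly_Mapping.keys x" | "\<sigma> \<in> Poly_Mapping.keys y"
        using subsetD[OF Poly_Mapping.keys_add s] by auto
      then show ?thesis
        using level_le_iff[of K x "level K x"] level_le_iff[of K y "level K y"] by cases (auto simp: le_max_iff_disj)
    qed
    then show ?thesis by (simp add: level_le_iff)
  qed
qed

lemma orthogonal_basis_eq: "orthogonal_basis K = fchain.obasis (level K)"
  unfolding fun_eq_iff orthogonal_basis_def fchain.obasis_def orthogonal_chains_def fchain.orth_def by simp

lemma cycles_sublevel:
  "{z \<in> cycles (total_complex K) q. level K z \<le> a} = cycles (sublevel_complex K a) q"
  by (auto simp: cycles_def chains_def level_le_iff sublevel_complex_def)

lemma boundaries_sublevel:
  "boundary (Suc q) ` {y \<in> chains (total_complex K) (Suc q). level K y \<le> b} =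
    (boundaries (sublevel_complex K b) q :: ('v set \<Rightarrow>\<^sub>0 'f::field) set)"
proof -
  have "{y \<in> chains (total_complex K) (Suc q). level K y \<le> b} = (chains (sublevel_complex K b) (Suc q) :: ('v set \<Rightarrow>\<^sub>0 'f) set)"
    by (auto simp: chains_def level_le_iff sublevel_complex_def)
  then show ?thesis by (simp add: boundaries_def)
qed

lemma finite_levels:
  assumes "finite (total_complex K)"
  shows "finite (level K ` chains (total_complex K) q)"
proof (rule finite_subset)
  show "level K ` chains (total_complex K) q \<subseteq> (\<lambda>S. SUP \<sigma>\<in>S. birth_time K \<sigma>) ` Pow (total_complex K)"
    by (auto simp: level_def chains_def)
qed (use assms in simp)

text \<open>This gives the choice in \<open>verbose_diagram\<close> a witness; without it nothing
  could be said about the chosen multiset. The boundary map on finitely generated filtered chains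
  meets the conditions of \<open>svd_exists\<close>.\<close>

lemma singular_value_decomposition_exists:
  assumes fin: "finite (total_complex K)" and simp: "simplicial (total_complex K)"
  shows "\<exists>ys xs :: ('v set \<Rightarrow>\<^sub>0 'f::field) list. singular_value_decomposition K q ys xs"
proof -
  let ?C = "total_complex K"
  let ?V = "chains ?C (Suc q) :: ('v set \<Rightarrow>\<^sub>0 'f) set" and ?Z = "cycles ?C q :: ('v set \<Rightarrow>\<^sub>0 'f) set"
  let ?T = "\<lambda>n. (\<lambda>\<sigma>. Poly_Mapping.single \<sigma> (1::'f)) ` {\<sigma>\<in>?C. card \<sigma> = Suc n}"
  have ZC: "?Z \<subseteq> chains ?C q" by (auto simp: cycles_def)
  have nb: "level K x \<noteq> -\<infinity>" if "x \<noteq> 0" for x :: "'v set \<Rightarrow>\<^sub>0 'f"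
    using level_nonneg[OF that, of K] by auto
  have fT: "finite (?T n)" for n using fin by simp
  have "\<exists>ys xs. fchain.obasis (level K) ?V ys \<and> fchain.obasis (level K) ?Z xs \<and>
    fchain.obasis (level K) {v\<in>?V. boundary (Suc q) v = 0} (drop (chain.dim (boundary (Suc q) ` ?V)) ys) \<and>
    fchain.obasis (level K) (boundary (Suc q) ` ?V) (take (chain.dim (boundary (Suc q) ` ?V)) xs) \<and>
    (\<forall>i<chain.dim (boundary (Suc q) ` ?V). boundary (Suc q) (ys ! i) = xs ! i)"
    by (rule fchain.svd_exists[OF linear_boundary ultra_level subspace_chains chains_subset_span fT finite_levels[OF fin] nb
        subspace_cycles order_trans[OF ZC chains_subset_span] fT finite_subset[OF image_mono[OF ZC] finite_levels[OF fin]] nb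
        boundaries_subset_cycles[OF simp, of q, unfolded boundaries_def]])
  then show ?thesis
    unfolding singular_value_decomposition_def Let_def orthogonal_basis_eq boundary_rank_def boundaries_def
      cycles_def[of _ "Suc q"] by blast
qed

text \<open>Everything later about diagrams rests on these counts, which are free of the chosen
  decomposition. The joint count excludes \<open>b = \<infinity>\<close>, because an essential class
  has death \<infinity> without being a boundary; the count of births alone covers that
  case.\<close>

lemma verbose_diagram_counts:
  fixes F :: "'f::field itself" and K :: "real \<Rightarrow> 'v set set"
  assumes fin: "finite (total_complex K)" and simp: "simplicial (total_complex K)"
  shows "b \<noteq> \<infinity> \<Longrightarrow> size {#p \<in># verbose_diagram F K q. fst p \<le> a \<and> snd p \<le> b#} =
      chain.dim (cycles (sublevel_complex K a) q \<inter> boundaries (sublevel_complex K b) q :: ('v set \<Rightarrow>\<^sub>0 'f) set)"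
    and "size {#p \<in># verbose_diagram F K q. fst p \<le> a#} =
      chain.dim (cycles (sublevel_complex K a) q :: ('v set \<Rightarrow>\<^sub>0 'f) set)"
proof -
  let ?C = "total_complex K"
  define P where "P D \<longleftrightarrow> (\<exists>ys xs :: ('v set \<Rightarrow>\<^sub>0 'f) list. singular_value_decomposition K q ys xs \<and>
        D = mset (map (\<lambda>i. (level K (xs ! i), if i < boundary_rank F ?C q then level K (ys ! i) else \<infinity>)) [0..<length xs]))" for D
  have "\<exists>D. P D" unfolding P_def using singular_value_decomposition_exists[OF fin simp, where 'f='f] by blast
  then have "P (SOME D. P D)" by (rule someI_ex)
  then have "P (verbose_diagram F K q)" unfolding verbose_diagram_def P_def .
  then obtain ys xs :: "('v set \<Rightarrow>\<^sub>0 'f) list" where svd: "singular_value_decomposition K q ys xs"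
    and D: "verbose_diagram F K q = mset (map (\<lambda>i. (level K (xs ! i), if i < boundary_rank F ?C q then level K (ys ! i) else \<infinity>)) [0..<length xs])"
    unfolding P_def by blast
  define r where "r = chain.dim (boundary (Suc q) ` (chains ?C (Suc q) :: ('v set \<Rightarrow>\<^sub>0 'f) set))"
  have r: "boundary_rank F ?C q = r" "boundary_rank TYPE('f) ?C q = r" by (simp_all add: r_def boundary_rank_def boundaries_def)
  have s: "fchain.obasis (level K) (chains ?C (Suc q)) ys" "fchain.obasis (level K) (cycles ?C q) xs"
    "fchain.obasis (level K) {v \<in> chains ?C (Suc q). boundary (Suc q) v = 0} (drop r ys)"
    "fchain.obasis (level K) (boundary (Suc q) ` chains ?C (Suc q)) (take r xs)"
    "\<And>i. i < r \<Longrightarrow> boundary (Suc q) (ys ! i) = xs ! i"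
    using svd unfolding singular_value_decomposition_def Let_def orthogonal_basis_eq r(2)
    by (simp_all add: boundaries_def cycles_def)
  note S = fchain.svd_dim_sublevel[OF linear_boundary ultra_level s(1-4) r_def s(5)]
  have sz: "size (filter_mset Q (verbose_diagram F K q)) =
    card {i. i < length xs \<and> Q (level K (xs ! i), if i < r then level K (ys ! i) else \<infinity>)}" for Q
    unfolding D r(1) mset_filter[symmetric] size_mset length_filter_conv_card
    by (rule arg_cong[where f=card]) auto
  show "size {#p \<in># verbose_diagram F K q. fst p \<le> a#} =
      chain.dim (cycles (sublevel_complex K a) q :: ('v set \<Rightarrow>\<^sub>0 'f) set)"
    unfolding sz cycles_sublevel[symmetric] using fchain.obasis_dim_sublevel[OF ultra_level s(2), of a] by simp
  assume "b \<noteq> \<infinity>"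
  then have "{i. i < length xs \<and> fst (level K (xs ! i), if i < r then level K (ys ! i) else \<infinity>) \<le> a
      \<and> snd (level K (xs ! i), if i < r then level K (ys ! i) else \<infinity>) \<le> b} =
    {i. i < r \<and> level K (xs ! i) \<le> a \<and> level K (ys ! i) \<le> b}"
    using S(1) by auto
  then show "size {#p \<in># verbose_diagram F K q. fst p \<le> a \<and> snd p \<le> b#} =
      chain.dim (cycles (sublevel_complex K a) q \<inter> boundaries (sublevel_complex K b) q :: ('v set \<Rightarrow>\<^sub>0 'f) set)"
    unfolding sz cycles_sublevel[symmetric] boundaries_sublevel[symmetric] using S(3)[of a b] by simp
qed

text \<open>Thresholds are extended reals so that negative and infinite ones behave as expected:
  below 0 the complex is empty, whereas \<open>kappa_filtration\<close> at a negative time would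
  still contain the simplices of value 0, since \<open>ennreal\<close> truncates.\<close>

definition kappa_complex :: "('v set \<Rightarrow> ennreal) \<Rightarrow> 'v set \<Rightarrow> ereal \<Rightarrow> 'v set set" where
  "kappa_complex \<kappa> X a = {\<sigma>. \<sigma> \<noteq> {} \<and> \<sigma> \<subseteq> X \<and> enn2ereal (\<kappa> \<sigma>) \<le> a}"

text \<open>The dimension of the cycles at \<open>a\<close> that bound at \<open>b\<close>. No order
  between \<open>a\<close> and \<open>b\<close> is imposed, as counting points near the diagonal
  uses both orders.\<close>

definition kappa_rank :: "'f::field itself \<Rightarrow> ('v set \<Rightarrow> ennreal) \<Rightarrow> 'v set \<Rightarrow> nat \<Rightarrow> ereal \<Rightarrow> ereal \<Rightarrow> nat" where
  "kappa_rank F \<kappa> X q a b =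
     chain.dim (cycles (kappa_complex \<kappa> X a) q \<inter> boundaries (kappa_complex \<kappa> X b) q :: ('v set \<Rightarrow>\<^sub>0 'f) set)"

lemma total_complex_kappa:
  assumes "finite X" "\<forall>\<sigma>\<in>finite_subsets. \<kappa> \<sigma> < \<infinity>"
  shows "total_complex (kappa_filtration \<kappa> X) = full_complex X"
proof -
  have "\<exists>t\<ge>0. \<kappa> \<sigma> \<le> ennreal t" if "\<sigma> \<noteq> {}" "\<sigma> \<subseteq> X" for \<sigma>
  proof -
    have "\<sigma> \<in> finite_subsets" using that finite_subset[OF that(2) assms(1)] by (simp add: finite_subsets_def)
    then have "\<kappa> \<sigma> < top" using assms(2) by simp
    then have "\<kappa> \<sigma> \<le> ennreal (enn2real (\<kappa> \<sigma>))" by simp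
    then show ?thesis using enn2real_nonneg by (intro exI[of _ "enn2real (\<kappa> \<sigma>)"]) simp
  qed
  then show ?thesis by (auto simp: total_complex_def kappa_filtration_def full_complex_def)
qed

text \<open>A finite value of \<kappa> is itself one of the admissible real times, so the infimum is
  attained.\<close>

lemma birth_time_kappa:
  assumes "\<sigma> \<noteq> {}" "\<sigma> \<subseteq> X" "\<kappa> \<sigma> < \<infinity>"
  shows "birth_time (kappa_filtration \<kappa> X) \<sigma> = enn2ereal (\<kappa> \<sigma>)"
proof -
  obtain r where r: "0 \<le> r" "\<kappa> \<sigma> = ennreal r" using assms(3) by (cases "\<kappa> \<sigma>") auto
  have "birth_time (kappa_filtration \<kappa> X) \<sigma> = Inf {ereal t |t. r \<le> t}"
    unfolding birth_time_def
    by (rule arg_cong[where f=Inf]) (use assms r in \<open>auto simp: kappa_filtration_def ennreal_le_iff2\<close>)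
  also have "\<dots> = ereal r"
    by (rule antisym[OF Inf_lower Inf_greatest]) auto
  finally show ?thesis using r by simp
qed

lemma simplicial_full_complex: "simplicial (full_complex X)"
  by (auto simp: simplicial_def full_complex_def)

lemma finite_full_complex: "finite X \<Longrightarrow> finite (full_complex X)"
  by (rule finite_subset[of _ "Pow X"]) (auto simp: full_complex_def)

lemma sublevel_complex_kappa:
  assumes "finite X" "\<forall>\<sigma>\<in>finite_subsets. \<kappa> \<sigma> < \<infinity>"
  shows "sublevel_complex (kappa_filtration \<kappa> X) a = kappa_complex \<kappa> X a"
proof -
  have "birth_time (kappa_filtration \<kappa> X) \<sigma> = enn2ereal (\<kappa> \<sigma>)" if "\<sigma> \<noteq> {}" "\<sigma> \<subseteq> X" for \<sigma>
  proof (rule birth_time_kappa[OF that])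
    have "\<sigma> \<in> finite_subsets" using that finite_subset[OF that(2) assms(1)] by (simp add: finite_subsets_def)
    then show "\<kappa> \<sigma> < \<infinity>" using assms(2) by simp
  qed
  then have "\<sigma> \<in> sublevel_complex (kappa_filtration \<kappa> X) a \<longleftrightarrow> \<sigma> \<in> kappa_complex \<kappa> X a" for \<sigma>
    unfolding sublevel_complex_def total_complex_kappa[OF assms] full_complex_def kappa_complex_def mem_Collect_eq
    by metis
  then show ?thesis by (rule set_eqI)
qed

lemma kappa_diagram_counts:
  fixes F :: "'f::field itself" and X :: "'v set"
  assumes X: "finite X" and \<kappa>: "\<forall>\<sigma>\<in>finite_subsets. \<kappa> \<sigma> < \<infinity>"
  shows "b \<noteq> \<infinity> \<Longrightarrow> size {#p \<in># verbose_diagram F (kappa_filtration \<kappa> X) q. fst p \<le> a \<and> snd p \<le> b#} = kappa_rank F \<kappa> X q a b"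
    and "size {#p \<in># verbose_diagram F (kappa_filtration \<kappa> X) q. fst p \<le> a#} =
      chain.dim (cycles (kappa_complex \<kappa> X a) q :: ('v set \<Rightarrow>\<^sub>0 'f) set)"
proof -
  have t: "finite (total_complex (kappa_filtration \<kappa> X))" "simplicial (total_complex (kappa_filtration \<kappa> X))"
  proof -
    have "total_complex (kappa_filtration \<kappa> X) = full_complex X" by (rule total_complex_kappa[OF X \<kappa>])
    then show "finite (total_complex (kappa_filtration \<kappa> X))" "simplicial (total_complex (kappa_filtration \<kappa> X))"
      using X by (simp_all add: finite_full_complex simplicial_full_complex)
  qed
  show "b \<noteq> \<infinity> \<Longrightarrow> size {#p \<in># verbose_diagram F (kappa_filtration \<kappa> X) q. fst p \<le> a \<and> snd p \<le> b#} = kappa_rank F \<kappa> X q a b"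
    using verbose_diagram_counts(1)[OF t, where F=F and q=q and a=a and b=b] by (simp add: kappa_rank_def sublevel_complex_kappa[OF X \<kappa>])
  show "size {#p \<in># verbose_diagram F (kappa_filtration \<kappa> X) q. fst p \<le> a#} =
      chain.dim (cycles (kappa_complex \<kappa> X a) q :: ('v set \<Rightarrow>\<^sub>0 'f) set)"
    using verbose_diagram_counts(2)[OF t, where F=F and q=q and a=a] by (simp add: sublevel_complex_kappa[OF X \<kappa>])
qed

section \<open>Points of a diagram in half-open boxes\<close>

definition box_count :: "'f::field itself \<Rightarrow> ('v set \<Rightarrow> ennreal) \<Rightarrow> 'v set \<Rightarrow> nat \<Rightarrow> ereal \<Rightarrow> ereal \<Rightarrow> ereal \<Rightarrow> ereal \<Rightarrow> nat" where
  "box_count F \<kappa> X q a1 a2 b1 b2 =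
     size {#p \<in># verbose_diagram F (kappa_filtration \<kappa> X) q. a1 < fst p \<and> fst p \<le> a2 \<and> b1 < snd p \<and> snd p \<le> b2#}"

text \<open>Inclusion-exclusion for the four lower-left quadrants at the corners of the box. It is
  stated additively because subtraction of natural numbers truncates; half-open boxes are what makes
  it exact.\<close>

lemma size_box_mset:
  fixes D :: "('a::linorder \<times> 'b::linorder) multiset"
  assumes "a1 \<le> a2" "b1 \<le> b2"
  shows "size {#p \<in># D. a1 < fst p \<and> fst p \<le> a2 \<and> b1 < snd p \<and> snd p \<le> b2#}
      + size {#p \<in># D. fst p \<le> a1 \<and> snd p \<le> b2#} + size {#p \<in># D. fst p \<le> a2 \<and> snd p \<le> b1#}
    = size {#p \<in># D. fst p \<le> a2 \<and> snd p \<le> b2#} + size {#p \<in># D. fst p \<le> a1 \<and> snd p \<le> b1#}"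
  by (induction D) (use assms in auto)

lemma box_count_rank:
  assumes "finite X" "\<forall>\<sigma>\<in>finite_subsets. \<kappa> \<sigma> < \<infinity>" "a1 \<le> a2" "b1 \<le> b2" "b2 \<noteq> \<infinity>"
  shows "box_count F \<kappa> X q a1 a2 b1 b2 + kappa_rank F \<kappa> X q a1 b2 + kappa_rank F \<kappa> X q a2 b1
    = kappa_rank F \<kappa> X q a2 b2 + kappa_rank F \<kappa> X q a1 b1"
proof -
  have "b1 \<noteq> \<infinity>" using assms by auto
  then show ?thesis
    using size_box_mset[OF assms(3,4), of "verbose_diagram F (kappa_filtration \<kappa> X) q"]
    unfolding box_count_def
    by (simp only: kappa_diagram_counts(1)[OF assms(1,2) \<open>b1 \<noteq> \<infinity>\<close>] kappa_diagram_counts(1)[OF assms(1,2,5)])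
qed

text \<open>If no simplex of the complex at the largest threshold crosses between \<open>Y\<close> and its complement,
  the diagram below that threshold splits.\<close>

lemma box_count_split:
  assumes X: "finite X" "Y \<subseteq> X" and \<kappa>: "\<forall>\<sigma>\<in>finite_subsets. \<kappa> \<sigma> < \<infinity>"
    and ab: "a1 \<le> a2" "b1 \<le> b2" "b2 \<noteq> \<infinity>" "a2 \<le> T" "b2 \<le> T"
    and sep: "\<And>\<sigma>. \<sigma> \<in> kappa_complex \<kappa> X T \<Longrightarrow> \<sigma> \<subseteq> Y \<or> \<sigma> \<inter> Y = {}"
  shows "box_count F \<kappa> X q a1 a2 b1 b2 = box_count F \<kappa> Y q a1 a2 b1 b2 + box_count F \<kappa> (X - Y) q a1 a2 b1 b2"
proof -
  have fY: "finite Y" "finite (X - Y)" using X finite_subset by auto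
  have spl: "kappa_complex \<kappa> X t = kappa_complex \<kappa> Y t \<union> kappa_complex \<kappa> (X - Y) t" if "t \<le> T" for t
  proof (intro equalityI subsetI)
    fix \<sigma> assume s: "\<sigma> \<in> kappa_complex \<kappa> X t"
    then have "\<sigma> \<in> kappa_complex \<kappa> X T" using that by (auto simp: kappa_complex_def)
    from sep[OF this] s show "\<sigma> \<in> kappa_complex \<kappa> Y t \<union> kappa_complex \<kappa> (X - Y) t"
      by (auto simp: kappa_complex_def)
  next
    fix \<sigma> assume "\<sigma> \<in> kappa_complex \<kappa> Y t \<union> kappa_complex \<kappa> (X - Y) t"
    then show "\<sigma> \<in> kappa_complex \<kappa> X t" using X(2) by (auto simp: kappa_complex_def)
  qed
  have P: "kappa_complex \<kappa> Z t \<subseteq> Pow Z" for Z t by (auto simp: kappa_complex_def)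
  have rk: "kappa_rank F \<kappa> X q a b = kappa_rank F \<kappa> Y q a b + kappa_rank F \<kappa> (X - Y) q a b" if "a \<le> T" "b \<le> T" for a b
    unfolding kappa_rank_def spl[OF that(1)] spl[OF that(2)]
    by (rule rank_disjoint_union[OF fY _ P P P P]) auto
  have T: "a1 \<le> T" "b1 \<le> T" using ab by auto
  show ?thesis
    using box_count_rank[OF X(1) \<kappa> ab(1-3), where F=F and q=q] box_count_rank[OF fY(1) \<kappa> ab(1-3), where F=F and q=q] box_count_rank[OF fY(2) \<kappa> ab(1-3), where F=F and q=q]
    by (simp add: rk T ab(4,5))
qed

text \<open>A box count need not be monotone in the vertex set, so the clusters are split off one at
  a time and the nonnegative count of the remainder is dropped only at the end. Separation passes to
  the remainder because its complex is a subcomplex.\<close>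

lemma box_count_superadditive:
  assumes "finite I" and X: "finite X" and \<kappa>: "\<forall>\<sigma>\<in>finite_subsets. \<kappa> \<sigma> < \<infinity>"
    and ab: "a1 \<le> a2" "b1 \<le> b2" "b2 \<noteq> \<infinity>" "a2 \<le> T" "b2 \<le> T"
    and Y: "\<And>i. i \<in> I \<Longrightarrow> Y i \<subseteq> X" "disjoint_family_on Y I"
    and sep: "\<And>i \<sigma>. i \<in> I \<Longrightarrow> \<sigma> \<in> kappa_complex \<kappa> X T \<Longrightarrow> \<sigma> \<subseteq> Y i \<or> \<sigma> \<inter> Y i = {}"
  shows "(\<Sum>i\<in>I. box_count F \<kappa> (Y i) q a1 a2 b1 b2) \<le> box_count F \<kappa> X q a1 a2 b1 b2"
  using assms(1) X Y sep
proof (induction I arbitrary: X rule: finite_induct)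
  case (insert i I)
  have split: "box_count F \<kappa> X q a1 a2 b1 b2 = box_count F \<kappa> (Y i) q a1 a2 b1 b2 + box_count F \<kappa> (X - Y i) q a1 a2 b1 b2"
    by (rule box_count_split[OF insert.prems(1) _ \<kappa> ab]) (use insert.prems in auto)
  have "(\<Sum>i\<in>I. box_count F \<kappa> (Y i) q a1 a2 b1 b2) \<le> box_count F \<kappa> (X - Y i) q a1 a2 b1 b2"
  proof (rule insert.IH)
    show "finite (X - Y i)" using insert.prems(1) by simp
    show "Y j \<subseteq> X - Y i" if "j \<in> I" for j
    proof -
      have "j \<noteq> i" using that insert.hyps by auto
      then have "Y j \<inter> Y i = {}" using insert.prems(3) that unfolding disjoint_family_on_def by auto
      then show ?thesis using insert.prems(2)[of j] that by auto
    qed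
    show "disjoint_family_on Y I" using insert.prems(3) by (rule disjoint_family_on_mono[rotated]) auto
    show "\<sigma> \<subseteq> Y j \<or> \<sigma> \<inter> Y j = {}" if "j \<in> I" "\<sigma> \<in> kappa_complex \<kappa> (X - Y i) T" for j \<sigma>
    proof -
      have "\<sigma> \<in> kappa_complex \<kappa> X T" using that(2) by (auto simp: kappa_complex_def)
      then show ?thesis using insert.prems(4)[of j \<sigma>] that(1) by simp
    qed
  qed
  then show ?case using insert.hyps split by simp
qed simp

text \<open>Only four thresholds enter the box count, so the two complexes have to correspond at
  these alone. The values of \<kappa> in between may change, which is the room used for perturbing a
  pattern.\<close>

lemma box_count_relabel:
  assumes X: "finite X" and \<kappa>: "\<forall>\<sigma>\<in>finite_subsets. \<kappa> \<sigma> < \<infinity>"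
    and \<kappa>': "\<forall>\<sigma>\<in>finite_subsets. \<kappa>' \<sigma> < \<infinity>"
    and f: "inj_on f X" and ab: "a1 \<le> a2" "b1 \<le> b2" "b2 \<noteq> \<infinity>"
    and eq: "\<And>\<sigma> t. \<sigma> \<subseteq> X \<Longrightarrow> \<sigma> \<noteq> {} \<Longrightarrow> t \<in> {a1, a2, b1, b2} \<Longrightarrow> enn2ereal (\<kappa>' (f ` \<sigma>)) \<le> t \<longleftrightarrow> enn2ereal (\<kappa> \<sigma>) \<le> t"
  shows "box_count F \<kappa>' (f ` X) q a1 a2 b1 b2 = box_count F \<kappa> X q a1 a2 b1 b2"
proof -
  have im: "kappa_complex \<kappa>' (f ` X) t = (`) f ` kappa_complex \<kappa> X t" if "t \<in> {a1, a2, b1, b2}" for t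
  proof (intro equalityI subsetI)
    fix \<tau> assume t: "\<tau> \<in> kappa_complex \<kappa>' (f ` X) t"
    then obtain \<sigma> where s: "\<sigma> \<subseteq> X" "\<tau> = f ` \<sigma>" by (auto simp: kappa_complex_def subset_image_iff)
    then have "\<sigma> \<in> kappa_complex \<kappa> X t" using t eq[OF s(1) _ that] by (auto simp: kappa_complex_def)
    then show "\<tau> \<in> (`) f ` kappa_complex \<kappa> X t" using s(2) by (rule rev_image_eqI)
  next
    fix \<tau> assume "\<tau> \<in> (`) f ` kappa_complex \<kappa> X t"
    then obtain \<sigma> where s: "\<sigma> \<in> kappa_complex \<kappa> X t" "\<tau> = f ` \<sigma>" by auto
    then show "\<tau> \<in> kappa_complex \<kappa>' (f ` X) t" using eq[of \<sigma> t] that by (auto simp: kappa_complex_def)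
  qed
  have P: "kappa_complex \<kappa> X t \<subseteq> Pow X" for t by (auto simp: kappa_complex_def)
  have rk: "kappa_rank F \<kappa>' (f ` X) q s t = kappa_rank F \<kappa> X q s t" if "s \<in> {a1, a2, b1, b2}" "t \<in> {a1, a2, b1, b2}" for s t
    unfolding kappa_rank_def im[OF that(1)] im[OF that(2)] by (rule rank_relabel[OF X P P f])
  have fX: "finite (f ` X)" using X by simp
  show ?thesis
    using box_count_rank[OF X \<kappa> ab, where F=F and q=q] box_count_rank[OF fX \<kappa>' ab, where F=F and q=q] by (simp add: rk)
qed

section \<open>Radon and counting measures\<close>

lemma Hausdorff_space_top_of_set: "Hausdorff_space (top_of_set (S :: 'a::t2_space set))"
proof (rule Hausdorff_space_subtopology)
  show "Hausdorff_space (euclidean :: 'a topology)"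
    unfolding Hausdorff_space_def disjnt_def using hausdorff by simp blast
qed

text \<open>Urysohn's function is taken to vanish off \<open>U \<inter> V\<close>, where
  \<open>V\<close> is a neighbourhood of \<open>K\<close> inside a closed compact set
  \<open>L\<close>; its support then stays in \<open>L\<close>.\<close>

lemma ex_Cc_bump:
  assumes X: "locally_compact_space X" "Hausdorff_space X"
    and K: "compactin X K" and U: "openin X U" and KU: "K \<subseteq> U"
  shows "\<exists>f\<in>Cc X. (\<forall>x\<in>topspace X. 0 \<le> f x \<and> f x \<le> 1) \<and> (\<forall>x\<in>K. f x = 1) \<and> (\<forall>x\<in>topspace X - U. f x = 0)"
proof -
  obtain V L where VL: "openin X V" "compactin X L" "closedin X L" "K \<subseteq> V" "V \<subseteq> L"
    using locally_compact_space_compact_closed_compact[of X] X K by blast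
  have "completely_regular_space X" using X by (simp add: locally_compact_regular_imp_completely_regular_space)
  moreover have "closedin X (topspace X - (U \<inter> V))" using U VL by (intro closedin_diff) auto
  moreover have "disjnt K (topspace X - (U \<inter> V))" using KU VL by (auto simp: disjnt_def)
  ultimately obtain f where f: "continuous_map X (subtopology euclidean {0..1::real}) f"
    "f ` (topspace X - (U \<inter> V)) \<subseteq> {0}" "f ` K \<subseteq> {1}"
    using Urysohn_completely_regular_compact_closed[of 0 1 X K "topspace X - (U \<inter> V)"] K by auto
  have cont: "continuous_map X euclideanreal f" and ran: "\<And>x. x \<in> topspace X \<Longrightarrow> f x \<in> {0..1}"
    using f(1) by (auto simp: continuous_map_in_subtopology)
  have "{x \<in> topspace X. f x \<noteq> 0} \<subseteq> L" using f(2) VL by auto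
  then have "X closure_of {x \<in> topspace X. f x \<noteq> 0} \<subseteq> L" using VL(3) by (rule closure_of_minimal)
  then have "compactin X (X closure_of {x \<in> topspace X. f x \<noteq> 0})"
    by (rule closed_compactin[OF VL(2) _ closedin_closure_of])
  then have "f \<in> Cc X" using cont by (simp add: Cc_def)
  moreover have "\<forall>x\<in>topspace X - U. f x = 0" using f(2) by auto
  ultimately show ?thesis using ran f(3) by (intro bexI[of _ f]) auto
qed

lemma space_borel_of [simp]: "space (borel_of X) = topspace X"
  unfolding borel_of_def by (rule space_measure_of) (auto dest: openin_subset)

lemma sets_borel_of: "sets (borel_of X) = sigma_sets (topspace X) {U. openin X U}"
  unfolding borel_of_def by (rule sets_measure_of) (auto dest: openin_subset)

lemma sets_borel_of_openin: "openin X U \<Longrightarrow> U \<in> sets (borel_of X)"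
  by (auto simp: sets_borel_of)

lemma sets_borel_of_closedin: "closedin X U \<Longrightarrow> U \<in> sets (borel_of X)"
  using sets_borel_of_openin[of X "topspace X - U"] sets.Diff[of "topspace X" "borel_of X" "topspace X - U"]
    sets.top[of "borel_of X"] closedin_subset[of X U]
  by (simp add: closedin_def double_diff)

lemma sets_borel_of_euclidean: "sets (borel_of euclidean) = sets borel"
  by (simp add: sets_borel_of borel_def)

lemma sets_borel_of_top_of_set: "sets (borel_of (top_of_set S)) = sets (restrict_space borel S)"
proof -
  have "sets (restrict_space borel S) = {id -` A \<inter> S |A. A \<in> sigma_sets UNIV {U. open U}}"
    by (auto simp add: sets_restrict_space borel_def)
  also have "\<dots> = sigma_sets S {id -` A \<inter> S |A. A \<in> {U. open U}}"
    by (rule sigma_sets_vimage_commute) simp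
  also have "{id -` A \<inter> S |A. A \<in> {U. open U}} = {U. openin (top_of_set S) U}" by (auto simp: openin_open)
  finally show ?thesis by (simp add: sets_borel_of)
qed

section \<open>Vague topology and measurability of evaluation maps\<close>

lemma radon_measuresD:
  assumes "\<mu> \<in> radon_measures X"
  shows "sets \<mu> = sets (borel_of X)" "space \<mu> = topspace X" "compactin X K \<Longrightarrow> emeasure \<mu> K < \<infinity>"
  using assms sets_eq_imp_space_eq[of \<mu> "borel_of X"] by (auto simp: radon_measures_def)

lemma topspace_vague_topology: "topspace (vague_topology X) = radon_measures X"
proof
  show "topspace (vague_topology X) \<subseteq> radon_measures X" by (auto simp: vague_topology_def)
  have "(\<lambda>x. 0) \<in> Cc X" by (simp add: Cc_def)
  then show "radon_measures X \<subseteq> topspace (vague_topology X)"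
    unfolding vague_topology_def topology_generated_by_topspace
    by (auto intro!: exI[of _ "radon_measures X"] exI[of _ "\<lambda>x. 0::real"] exI[of _ UNIV])
qed

lemma counting_measures_subset: "counting_measures X \<subseteq> radon_measures X"
  by (auto simp: counting_measures_def)

lemma space_counting_space: "space (counting_space X) = counting_measures X"
  using counting_measures_subset by (auto simp: counting_space_def topspace_vague_topology)

lemma openin_vague: "f \<in> Cc X \<Longrightarrow> open U \<Longrightarrow> openin (vague_topology X) {\<mu> \<in> radon_measures X. integral\<^sup>L \<mu> f \<in> U}"
  unfolding vague_topology_def by (rule topology_generated_by_Basis) blast

lemma measurable_integral_Cc:
  assumes "f \<in> Cc X"
  shows "(\<lambda>\<mu>. integral\<^sup>L \<mu> f) \<in> borel_measurable (counting_space X)"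
proof (rule borel_measurableI)
  fix U :: "real set" assume "open U"
  then have "openin (subtopology (vague_topology X) (counting_measures X)) ({\<mu> \<in> radon_measures X. integral\<^sup>L \<mu> f \<in> U} \<inter> counting_measures X)"
    using openin_vague[OF assms] by (auto simp: openin_subtopology)
  then have "{\<mu> \<in> radon_measures X. integral\<^sup>L \<mu> f \<in> U} \<inter> counting_measures X \<in> sets (counting_space X)"
    unfolding counting_space_def by (rule sets_borel_of_openin)
  moreover have "(\<lambda>\<mu>. integral\<^sup>L \<mu> f) -` U \<inter> space (counting_space X) = {\<mu> \<in> radon_measures X. integral\<^sup>L \<mu> f \<in> U} \<inter> counting_measures X"
    using counting_measures_subset by (auto simp: space_counting_space)
  ultimately show "(\<lambda>\<mu>. integral\<^sup>L \<mu> f) -` U \<inter> space (counting_space X) \<in> sets (counting_space X)" by simp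
qed

lemma Cc_measurable:
  assumes "f \<in> Cc X"
  shows "f \<in> borel_measurable (borel_of X)"
proof (rule borel_measurableI)
  fix U :: "real set" assume "open U"
  then have "openin X {x \<in> topspace X. f x \<in> U}"
    using assms by (auto simp: Cc_def continuous_map_def)
  moreover have "f -` U \<inter> space (borel_of X) = {x \<in> topspace X. f x \<in> U}" by auto
  ultimately show "f -` U \<inter> space (borel_of X) \<in> sets (borel_of X)" by (simp add: sets_borel_of_openin)
qed

lemma Cc_bounded_support:
  assumes "f \<in> Cc X" "Hausdorff_space X"
  shows "\<exists>K B. compactin X K \<and> K \<in> sets (borel_of X) \<and> (\<forall>x\<in>topspace X - K. f x = 0) \<and> (\<forall>x\<in>topspace X. \<bar>f x\<bar> \<le> B)"
proof -
  define K where "K = X closure_of {x \<in> topspace X. f x \<noteq> 0}"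
  have K: "compactin X K" "closedin X K" using assms by (auto simp: K_def Cc_def)
  have "{x \<in> topspace X. f x \<noteq> 0} \<subseteq> K" unfolding K_def by (rule closure_of_subset) auto
  then have 0: "\<forall>x\<in>topspace X - K. f x = 0" by auto
  have "compactin euclideanreal (f ` K)"
    by (rule image_compactin[OF K(1)]) (use assms(1) in \<open>simp add: Cc_def\<close>)
  then have "bounded (f ` K)" by (simp add: compact_imp_bounded)
  then obtain B where B: "\<forall>x\<in>K. \<bar>f x\<bar> \<le> B" by (auto simp: bounded_iff)
  have "\<bar>f x\<bar> \<le> max B 0" if "x \<in> topspace X" for x
    using B 0 that by (cases "x \<in> K") auto
  then show ?thesis using K 0 sets_borel_of_closedin by blast
qed

lemma Cc_integrable:
  assumes f: "f \<in> Cc X" and X: "Hausdorff_space X" and \<mu>: "\<mu> \<in> radon_measures X"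
  shows "integrable \<mu> f"
proof -
  obtain K B where K: "compactin X K" "K \<in> sets (borel_of X)" "\<forall>x\<in>topspace X - K. f x = 0" "\<forall>x\<in>topspace X. \<bar>f x\<bar> \<le> B"
    using Cc_bounded_support[OF f X] by blast
  note m = radon_measuresD[OF \<mu>]
  have fm: "f \<in> borel_measurable \<mu>"
    using Cc_measurable[OF f] by (simp add: measurable_cong_sets[OF m(1)])
  have "integrable \<mu> (\<lambda>x. indicator K x * B)"
    using m(3)[OF K(1)] K(2) m(1) by (intro integrable_mult_left integrable_real_indicator) auto
  then show ?thesis
    by (rule Bochner_Integration.integrable_bound[OF _ fm])
      (rule AE_I2, use K m(2) in \<open>auto simp: indicator_def\<close>)
qed

lemma nn_integral_Cc:
  assumes f: "f \<in> Cc X" and X: "Hausdorff_space X" and \<mu>: "\<mu> \<in> radon_measures X" and nn: "\<And>x. x \<in> topspace X \<Longrightarrow> 0 \<le> f x"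
  shows "(\<integral>\<^sup>+x. ennreal (f x) \<partial>\<mu>) = ennreal (integral\<^sup>L \<mu> f)"
  by (rule nn_integral_eq_integral[OF Cc_integrable[OF f X \<mu>]]) (rule AE_I2, use nn radon_measuresD(2)[OF \<mu>] in auto)

text \<open>Local compactness supplies neighbourhoods with compact hulls inside \<open>U\<close>,
  and the Lindelof property leaves countably many. Two sequences are kept: the open
  \<open>V n\<close> exhaust \<open>U\<close>, the compact \<open>L n\<close> are where bump
  functions can be made equal to 1.\<close>

lemma open_countable_union_compact:
  fixes S :: "'a::{second_countable_topology, t2_space} set"
  assumes lc: "locally_compact_space (top_of_set S)" and U: "openin (top_of_set S) U"
  obtains V L where "\<And>n::nat. openin (top_of_set S) (V n)" "\<And>n. compactin (top_of_set S) (L n)"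
    "\<And>n. V n \<subseteq> L n" "\<And>n. L n \<subseteq> U" "\<And>m n. m \<le> n \<Longrightarrow> V m \<subseteq> V n" "\<And>m n. m \<le> n \<Longrightarrow> L m \<subseteq> L n" "(\<Union>n. V n) = U"
proof -
  let ?X = "top_of_set S"
  have H: "Hausdorff_space ?X" by (rule Hausdorff_space_top_of_set)
  define \<F> where "\<F> = {V. openin ?X V \<and> (\<exists>L. compactin ?X L \<and> V \<subseteq> L \<and> L \<subseteq> U)}"
  have cov: "\<Union>\<F> = U"
  proof (intro equalityI subsetI)
    fix x assume x: "x \<in> U"
    have "neighbourhood_base_of (\<lambda>C. compactin ?X C) ?X"
      using locally_compact_Hausdorff_or_regular[of ?X] lc H by (simp add: locally_compact_space_neighbourhood_base)
    then obtain V L where "openin ?X V" "compactin ?X L" "x \<in> V" "V \<subseteq> L" "L \<subseteq> U"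
      using U x unfolding neighbourhood_base_of by meson
    then show "x \<in> \<Union>\<F>" unfolding \<F>_def by blast
  qed (auto simp: \<F>_def)
  obtain \<G> where G: "\<G> \<subseteq> \<F>" "countable \<G>" "\<Union>\<G> = \<Union>\<F>"
    using Lindelof_openin[of \<F> S] unfolding \<F>_def by blast
  have "{} \<in> \<F>" by (auto simp: \<F>_def intro: exI[of _ "{}"])
  define G' where "G' = from_nat_into (insert {} \<G>)"
  have G'r: "range G' = insert {} \<G>" unfolding G'_def by (rule range_from_nat_into) (use G in auto)
  have "G' i \<in> \<F>" for i using G'r G(1) \<open>{} \<in> \<F>\<close> by (metis insert_subset rangeI subsetD)
  then have "\<forall>i. \<exists>L. compactin ?X L \<and> G' i \<subseteq> L \<and> L \<subseteq> U" and op: "\<And>i. openin ?X (G' i)"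
    by (auto simp: \<F>_def)
  then obtain L where L: "\<And>i. compactin ?X (L i)" "\<And>i. G' i \<subseteq> L i" "\<And>i. L i \<subseteq> U" by metis
  show ?thesis
  proof (rule that[of "\<lambda>n. \<Union>i\<le>n. G' i" "\<lambda>n. \<Union>i\<le>n. L i"])
    show "openin ?X (\<Union>i\<le>n. G' i)" for n using op by (intro openin_Union) auto
    show "compactin ?X (\<Union>i\<le>n. L i)" for n using L(1) by (intro compactin_Union) auto
    show "(\<Union>i\<le>n. G' i) \<subseteq> (\<Union>i\<le>n. L i)" for n using L(2) by blast
    show "(\<Union>i\<le>n. L i) \<subseteq> U" for n using L(3) by blast
    show "(\<Union>i\<le>m. G' i) \<subseteq> (\<Union>i\<le>n. G' i)" "(\<Union>i\<le>m. L i) \<subseteq> (\<Union>i\<le>n. L i)" if "m \<le> n" for m n :: nat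
      using that by (intro UN_mono; auto)+
    have "(\<Union>n. \<Union>i\<le>n. G' i) = \<Union>(range G')" by auto
    then show "(\<Union>n. \<Union>i\<le>n. G' i) = U" using G'r G(3) cov by simp
  qed
qed

text \<open>The integral of the \<open>n\<close>-th bump function lies between the masses of
  \<open>V n\<close> and \<open>U\<close>, so the mass of \<open>U\<close> is the supremum of the
  integrals even though the functions need not increase. Each integral is vaguely continuous in the
  measure.\<close>

lemma measurable_emeasure_open:
  fixes S :: "'a::{second_countable_topology, t2_space} set"
  assumes lc: "locally_compact_space (top_of_set S)" and U: "openin (top_of_set S) U"
  shows "(\<lambda>\<mu>. emeasure \<mu> U) \<in> borel_measurable (counting_space (top_of_set S))"
proof -
  let ?X = "top_of_set S"
  have H: "Hausdorff_space ?X" by (rule Hausdorff_space_top_of_set)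
  obtain V L where VL: "\<And>n::nat. openin ?X (V n)" "\<And>n. compactin ?X (L n)"
    "\<And>n. V n \<subseteq> L n" "\<And>n. L n \<subseteq> U" "\<And>m n. m \<le> n \<Longrightarrow> V m \<subseteq> V n" "\<And>m n. m \<le> n \<Longrightarrow> L m \<subseteq> L n" "(\<Union>n. V n) = U"
    using open_countable_union_compact[OF lc U] by metis
  have "\<exists>f\<in>Cc ?X. (\<forall>x\<in>topspace ?X. 0 \<le> f x \<and> f x \<le> 1) \<and> (\<forall>x\<in>L n. f x = 1) \<and> (\<forall>x\<in>topspace ?X - U. f x = 0)" for n
    by (rule ex_Cc_bump[OF lc H VL(2) U VL(4)])
  then have "\<forall>n. \<exists>g. g \<in> Cc ?X \<and> (\<forall>x\<in>S. 0 \<le> g x \<and> g x \<le> 1) \<and> (\<forall>x\<in>L n. g x = 1) \<and> (\<forall>x\<in>S - U. g x = 0)"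
    by (simp add: Bex_def)
  from choice[OF this] obtain f where
    f: "\<forall>n. f n \<in> Cc ?X \<and> (\<forall>x\<in>S. 0 \<le> f n x \<and> f n x \<le> 1) \<and> (\<forall>x\<in>L n. f n x = 1) \<and> (\<forall>x\<in>S - U. f n x = 0)" ..
  have f: "\<And>n. f n \<in> Cc ?X" "\<And>n x. x \<in> S \<Longrightarrow> 0 \<le> f n x \<and> f n x \<le> 1"
    "\<And>n x. x \<in> L n \<Longrightarrow> f n x = 1" "\<And>n x. x \<in> S - U \<Longrightarrow> f n x = 0"
    using f by auto
  have eq: "emeasure \<mu> U = (SUP n. ennreal (integral\<^sup>L \<mu> (f n)))" if "\<mu> \<in> space (counting_space ?X)" for \<mu>
  proof -
    have \<mu>: "\<mu> \<in> radon_measures ?X" using that counting_measures_subset by (auto simp: space_counting_space)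
    note m = radon_measuresD[OF \<mu>]
    have US: "U \<subseteq> S" using openin_subset[OF U] by simp
    have Vm: "V n \<in> sets \<mu>" "U \<in> sets \<mu>" for n using VL(1) U m(1) by (auto intro: sets_borel_of_openin)
    have i: "ennreal (integral\<^sup>L \<mu> (f n)) = (\<integral>\<^sup>+x. ennreal (f n x) \<partial>\<mu>)" for n
      using nn_integral_Cc[OF f(1) H \<mu>] f(2) by simp
    show ?thesis
    proof (rule antisym)
      have "emeasure \<mu> U = (SUP n. emeasure \<mu> (V n))"
      proof -
        have "range V \<subseteq> sets \<mu>" using Vm(1) by auto
        from SUP_emeasure_incseq[OF this] show ?thesis using VL(5) by (simp add: incseq_def VL(7))
      qed
      also have "\<dots> \<le> (SUP n. ennreal (integral\<^sup>L \<mu> (f n)))"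
      proof (rule SUP_mono)
        fix n
        have "emeasure \<mu> (V n) = (\<integral>\<^sup>+x. indicator (V n) x \<partial>\<mu>)" using Vm by simp
        also have "\<dots> \<le> (\<integral>\<^sup>+x. ennreal (f n x) \<partial>\<mu>)"
          by (rule nn_integral_mono) (use f(3)[of _ n] VL(3)[of n] in \<open>auto simp: indicator_def\<close>)
        finally show "\<exists>n'\<in>UNIV. emeasure \<mu> (V n) \<le> ennreal (integral\<^sup>L \<mu> (f n'))" using i by auto
      qed
      finally show "emeasure \<mu> U \<le> (SUP n. ennreal (integral\<^sup>L \<mu> (f n)))" .
      show "(SUP n. ennreal (integral\<^sup>L \<mu> (f n))) \<le> emeasure \<mu> U"
      proof (rule SUP_least)
        fix n
        have "(\<integral>\<^sup>+x. ennreal (f n x) \<partial>\<mu>) \<le> (\<integral>\<^sup>+x. indicator U x \<partial>\<mu>)"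
        proof (rule nn_integral_mono)
          fix x assume "x \<in> space \<mu>"
          then have "x \<in> S" using m(2) by simp
          then show "ennreal (f n x) \<le> indicator U x" using f(2)[of x n] f(4)[of x n] by (auto simp: indicator_def)
        qed
        then show "ennreal (integral\<^sup>L \<mu> (f n)) \<le> emeasure \<mu> U" using i Vm by simp
      qed
    qed
  qed
  have "(\<lambda>\<mu>. SUP n. ennreal (integral\<^sup>L \<mu> (f n))) \<in> borel_measurable (counting_space ?X)"
    using measurable_integral_Cc[OF f(1)] by measurable
  then show ?thesis by (rule measurable_cong[THEN iffD1, rotated]) (simp add: eq)
qed

text \<open>The passage to complements subtracts masses and so needs finiteness. Therefore the
  Dynkin argument runs inside each relatively compact \<open>V n\<close>, and the limit over
  \<open>n\<close> is taken afterwards.\<close>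

lemma measurable_emeasure_counting_space:
  fixes S :: "'a::{second_countable_topology, t2_space} set"
  assumes lc: "locally_compact_space (top_of_set S)" and A: "A \<in> sets (borel_of (top_of_set S))"
  shows "(\<lambda>\<mu>. emeasure \<mu> A) \<in> borel_measurable (counting_space (top_of_set S))"
proof -
  let ?X = "top_of_set S" and ?C = "counting_space (top_of_set S)"
  have H: "Hausdorff_space ?X" by (rule Hausdorff_space_top_of_set)
  have op: "openin ?X S" by simp
  obtain V L where VL: "\<And>n::nat. openin ?X (V n)" "\<And>n. compactin ?X (L n)"
    "\<And>n. V n \<subseteq> L n" "\<And>n. L n \<subseteq> S" "\<And>m n. m \<le> n \<Longrightarrow> V m \<subseteq> V n" "\<And>m n. m \<le> n \<Longrightarrow> L m \<subseteq> L n" "(\<Union>n. V n) = S"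
    using open_countable_union_compact[OF lc op] by metis
  have rad: "\<mu> \<in> radon_measures ?X" if "\<mu> \<in> space ?C" for \<mu>
    using that counting_measures_subset by (auto simp: space_counting_space)
  have Vset: "V n \<in> sets (borel_of ?X)" for n using VL(1) by (rule sets_borel_of_openin)
  have fin: "emeasure \<mu> (V n) < \<infinity>" if "\<mu> \<in> space ?C" for \<mu> n
  proof -
    have "L n \<in> sets (borel_of ?X)" using VL(2) H by (intro sets_borel_of_closedin compactin_imp_closedin)
    then have "emeasure \<mu> (V n) \<le> emeasure \<mu> (L n)"
      using VL(3) radon_measuresD(1)[OF rad[OF that]] by (intro emeasure_mono) auto
    also have "\<dots> < \<infinity>" by (rule radon_measuresD(3)[OF rad[OF that] VL(2)])
    finally show ?thesis .
  qed
  have pow: "{U. openin ?X U} \<subseteq> Pow S" using openin_subset[of ?X] by auto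
  have ist: "Int_stable {U. openin ?X U}" by (auto simp: Int_stable_def)
  have step: "(\<lambda>\<mu>. emeasure \<mu> (B \<inter> V n)) \<in> borel_measurable ?C" if "B \<in> sigma_sets S {U. openin ?X U}" for B n
    using ist pow that
  proof (induction B rule: sigma_sets_induct_disjoint)
    case (basic B)
    then show ?case using VL(1) by (intro measurable_emeasure_open[OF lc]) auto
  next
    case empty
    then show ?case by simp
  next
    case (compl B)
    have B: "B \<in> sets (borel_of ?X)" using compl(1) by (simp add: sets_borel_of)
    have "emeasure \<mu> ((S - B) \<inter> V n) = emeasure \<mu> (V n) - emeasure \<mu> (B \<inter> V n)" if "\<mu> \<in> space ?C" for \<mu>
    proof -
      have "(S - B) \<inter> V n = V n - B \<inter> V n" using openin_subset[OF VL(1)[of n]] by auto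
      moreover have "emeasure \<mu> (B \<inter> V n) \<le> emeasure \<mu> (V n)"
        using Vset radon_measuresD(1)[OF rad[OF that]] by (intro emeasure_mono) auto
      moreover have "emeasure \<mu> (V n - B \<inter> V n) = emeasure \<mu> (V n) - emeasure \<mu> (B \<inter> V n)"
        by (rule emeasure_Diff) (use fin[OF that, of n] Vset B radon_measuresD(1)[OF rad[OF that]] \<open>emeasure \<mu> (B \<inter> V n) \<le> emeasure \<mu> (V n)\<close> in auto)
      ultimately show ?thesis by simp
    qed
    moreover have "(\<lambda>\<mu>. emeasure \<mu> (V n) - emeasure \<mu> (B \<inter> V n)) \<in> borel_measurable ?C"
      using measurable_emeasure_open[OF lc VL(1)[of n]] compl(2) by measurable
    ultimately show ?case by (subst measurable_cong) auto
  next
    case (union B)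
    have B: "B i \<in> sets (borel_of ?X)" for i using union(2) by (auto simp: sets_borel_of)
    have "emeasure \<mu> ((\<Union>i. B i) \<inter> V n) = suminf (\<lambda>i. emeasure \<mu> (B i \<inter> V n))" if "\<mu> \<in> space ?C" for \<mu>
    proof -
      have "(\<Union>i. B i) \<inter> V n = (\<Union>i. B i \<inter> V n)" by auto
      moreover have "disjoint_family (\<lambda>i. B i \<inter> V n)" using union(1) by (auto simp: disjoint_family_on_def)
      moreover have "range (\<lambda>i. B i \<inter> V n) \<subseteq> sets \<mu>" using B Vset radon_measuresD(1)[OF rad[OF that]] by auto
      ultimately show ?thesis by (simp add: suminf_emeasure)
    qed
    moreover have "(\<lambda>\<mu>. suminf (\<lambda>i. emeasure \<mu> (B i \<inter> V n))) \<in> borel_measurable ?C"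
      using union(3) by measurable
    ultimately show ?case by (subst measurable_cong) auto
  qed
  have "emeasure \<mu> A = (SUP n. emeasure \<mu> (A \<inter> V n))" if "\<mu> \<in> space ?C" for \<mu>
  proof -
    have "A \<subseteq> S" using sets.sets_into_space[OF A] by simp
    then have "A = (\<Union>n. A \<inter> V n)" using VL(7) by auto
    moreover have "(SUP n. emeasure \<mu> (A \<inter> V n)) = emeasure \<mu> (\<Union>n. A \<inter> V n)"
    proof (rule SUP_emeasure_incseq)
      show "range (\<lambda>n. A \<inter> V n) \<subseteq> sets \<mu>" using A Vset radon_measuresD(1)[OF rad[OF that]] by auto
      show "incseq (\<lambda>n. A \<inter> V n)" unfolding incseq_def using VL(5) by (intro allI impI Int_mono order_refl)
    qed
    ultimately show ?thesis by simp
  qed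
  moreover have "(\<lambda>\<mu>. SUP n. emeasure \<mu> (A \<inter> V n)) \<in> borel_measurable ?C"
    using step A by (intro borel_measurable_SUP) (auto simp: sets_borel_of)
  ultimately show ?thesis by (subst measurable_cong) auto
qed

section \<open>Atoms of counting measures and cylinder neighbourhoods\<close>

lemma enat_less_1: "ennreal_of_enat k < 1 \<Longrightarrow> ennreal_of_enat k = 0"
  by (cases k) auto

text \<open>Off its atoms an integer-valued measure vanishes near each point, hence everywhere by the
  Lindelof property.\<close>

lemma counting_measure_atomic:
  fixes \<mu> :: "'a::{second_countable_topology, t2_space} measure"
  assumes s: "sets \<mu> = sets borel" and fin: "emeasure \<mu> UNIV < \<infinity>"
    and int: "\<And>A. A \<in> sets borel \<Longrightarrow> \<exists>k. emeasure \<mu> A = ennreal_of_enat k"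
  defines "D \<equiv> {x. emeasure \<mu> {x} \<noteq> 0}"
  shows "finite D" "emeasure \<mu> (- D) = 0"
proof -
  \<comment> \<open>Integrality makes every atom weigh at least 1, so the finite total mass bounds
    their number.\<close>
  have one: "1 \<le> emeasure \<mu> {x}" if "x \<in> D" for x
    using int[of "{x}"] that enat_less_1 by (force simp: D_def not_less[symmetric])
  obtain n :: nat where n: "emeasure \<mu> UNIV \<le> of_nat n"
    using fin ennreal_Ex_less_of_nat[of "emeasure \<mu> UNIV"] by (auto intro: less_imp_le)
  have "finite D \<and> card D \<le> n"
  proof (rule finite_if_finite_subsets_card_bdd)
    fix G assume G: "G \<subseteq> D" "finite G"
    have "of_nat (card G) = (\<Sum>x\<in>G. 1::ennreal)" by simp
    also have "\<dots> \<le> (\<Sum>x\<in>G. emeasure \<mu> {x})" by (rule sum_mono) (use one G in auto)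
    also have "\<dots> = emeasure \<mu> G" by (rule emeasure_eq_sum_singleton[symmetric]) (use G s in auto)
    also have "\<dots> \<le> emeasure \<mu> UNIV" by (rule emeasure_mono) (use s in auto)
    also have "\<dots> \<le> of_nat n" by (rule n)
    finally show "card G \<le> n" by (simp add: of_nat_le_iff)
  qed
  then show fD: "finite D" by simp
  then have Dm: "D \<in> sets \<mu>" using s by (simp add: borel_closed finite_imp_closed)
  define \<F> where "\<F> = {U. open U \<and> emeasure \<mu> (U - D) = 0}"
  have "\<Union>\<F> = UNIV"
  proof -
    have "\<exists>U\<in>\<F>. x \<in> U" for x
    proof -
      obtain A where A: "\<And>i. open (A i)" "\<And>i. x \<in> A i" "decseq A" "(\<Inter>i. A i) = {x}"
      proof -
        obtain B :: "nat \<Rightarrow> 'a set" where B: "\<And>i. open (B i)" "\<And>i. x \<in> B i"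
          "\<And>S. open S \<Longrightarrow> x \<in> S \<Longrightarrow> eventually (\<lambda>i. B i \<subseteq> S) sequentially"
          using countable_basis_at_decseq[of x] by metis
        show thesis
        proof (rule that[of "\<lambda>i. \<Inter>j\<le>i. B j"])
          show "open (\<Inter>j\<le>i. B j)" "x \<in> (\<Inter>j\<le>i. B j)" for i using B by auto
          show "decseq (\<lambda>i. \<Inter>j\<le>i. B j)" unfolding decseq_def by (auto intro: order_trans)
          show "(\<Inter>i. \<Inter>j\<le>i. B j) = {x}"
          proof (intro equalityI subsetI)
            fix y assume y: "y \<in> (\<Inter>i. \<Inter>j\<le>i. B j)"
            show "y \<in> {x}"
            proof (rule ccontr)
              assume "y \<notin> {x}"
              then obtain S where "open S" "x \<in> S" "y \<notin> S" using t1_space[of x y] by auto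
              then obtain i where "B i \<subseteq> S" using B(3) eventually_sequentially by (metis order_refl)
              then show False using y \<open>y \<notin> S\<close> by auto
            qed
          qed (use B in auto)
        qed
      qed
      \<comment> \<open>The neighbourhoods shrink to \<open>{x}\<close>, and \<open>{x} - D\<close>
        is null; by continuity from above the masses tend to 0, and integers tending to 0 vanish
        from some index on.\<close>
      have "(\<lambda>i. emeasure \<mu> (A i - D)) \<longlonglongrightarrow> emeasure \<mu> (\<Inter>i. A i - D)"
      proof (rule Lim_emeasure_decseq)
        show "range (\<lambda>i. A i - D) \<subseteq> sets \<mu>" using A(1) Dm s by auto
        show "decseq (\<lambda>i. A i - D)" using A(3) by (auto simp: decseq_def)
        show "emeasure \<mu> (A i - D) \<noteq> \<infinity>" for i
        proof -
          have "emeasure \<mu> (A i - D) \<le> emeasure \<mu> UNIV" by (rule emeasure_mono) (use s in auto)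
          then show ?thesis using fin by auto
        qed
      qed
      also have "emeasure \<mu> (\<Inter>i. A i - D) = 0"
      proof -
        have "(\<Inter>i. A i - D) = {x} - D" using A(4) by auto
        moreover have "emeasure \<mu> ({x} - D) = 0"
        proof (cases "x \<in> D")
          case True
          then show ?thesis by (simp add: insert_Diff_if)
        next
          case False
          then have "{x} - D = {x}" by blast
          then show ?thesis using False by (simp add: D_def)
        qed
        ultimately show ?thesis by simp
      qed
      finally have "\<forall>\<^sub>F i in sequentially. emeasure \<mu> (A i - D) < 1" by (rule order_tendstoD) simp
      then obtain i where "emeasure \<mu> (A i - D) < 1" by (meson eventually_sequentially order_refl)
      moreover obtain k where "emeasure \<mu> (A i - D) = ennreal_of_enat k" using int[of "A i - D"] A(1) Dm s by auto
      ultimately have "emeasure \<mu> (A i - D) = 0" using enat_less_1 by simp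
      then show ?thesis using A(1,2) unfolding \<F>_def by blast
    qed
    then show ?thesis by auto
  qed
  moreover obtain \<G> where G: "\<G> \<subseteq> \<F>" "countable \<G>" "\<Union>\<G> = \<Union>\<F>"
    using Lindelof[of \<F>] unfolding \<F>_def by blast
  ultimately have "- D = (\<Union>U\<in>\<G>. U - D)" by auto
  moreover have "(\<Union>U\<in>\<G>. U - D) \<in> null_sets \<mu>"
  proof (rule null_sets_UN'[OF G(2)])
    fix U assume "U \<in> \<G>"
    then have "open U" "emeasure \<mu> (U - D) = 0" using G(1) by (auto simp: \<F>_def)
    then show "U - D \<in> null_sets \<mu>" using Dm s by (intro null_setsI) auto
  qed
  ultimately show "emeasure \<mu> (- D) = 0" by auto
qed

lemma measurable_ident_top_of_set:
  "sets \<mu> = sets (borel_of (top_of_set S)) \<Longrightarrow> (\<lambda>x. x) \<in> measurable \<mu> borel"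
  by (simp add: sets_borel_of_top_of_set measurable_restrict_space1 cong: measurable_cong_sets)

text \<open>The measure is pushed forward along the inclusion of \<open>S\<close>, which turns it
  into a finite Borel measure on the whole type, where the atomic decomposition applies.\<close>

lemma counting_measure_compact_atoms:
  fixes \<mu> :: "'a::{second_countable_topology, t2_space} measure"
  assumes S: "compact S" and \<mu>: "\<mu> \<in> counting_measures (top_of_set S)"
  defines "D \<equiv> {x \<in> S. emeasure \<mu> {x} \<noteq> 0}"
  shows "finite D" "\<And>A. A \<in> sets borel \<Longrightarrow> emeasure \<mu> (A \<inter> S) = (\<Sum>x\<in>D \<inter> A. emeasure \<mu> {x})"
    "emeasure \<mu> S < \<infinity>" "\<And>A. A \<in> sets borel \<Longrightarrow> \<exists>k::nat. emeasure \<mu> (A \<inter> S) = of_nat k"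
proof -
  have rad: "\<mu> \<in> radon_measures (top_of_set S)" using \<mu> counting_measures_subset by auto
  note m = radon_measuresD[OF rad]
  have id: "(\<lambda>x. x) \<in> measurable \<mu> borel" using m(1) by (rule measurable_ident_top_of_set)
  define \<mu>' where "\<mu>' = distr \<mu> borel (\<lambda>x. x)"
  have e: "emeasure \<mu>' A = emeasure \<mu> (A \<inter> S)" if "A \<in> sets borel" for A
    unfolding \<mu>'_def by (subst emeasure_distr[OF id that]) (simp add: m(2))
  have AS: "A \<inter> S \<in> sets \<mu>" if "A \<in> sets borel" for A
    using that unfolding m(1) sets_borel_of_top_of_set by (auto simp: sets_restrict_space)
  show fin: "emeasure \<mu> S < \<infinity>" using m(3)[of S] S by (simp add: compactin_subtopology)
  have int: "\<exists>k. emeasure \<mu> (A \<inter> S) = ennreal_of_enat k" if "A \<in> sets borel" for A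
    using \<mu> AS[OF that] by (auto simp: counting_measures_def)
  have le: "emeasure \<mu> (A \<inter> S) < \<infinity>" if "A \<in> sets borel" for A
  proof -
    have "emeasure \<mu> (A \<inter> S) \<le> emeasure \<mu> S" by (rule emeasure_mono) (use AS[of UNIV] in auto)
    then show ?thesis using fin by (rule le_less_trans)
  qed
  show "\<exists>k::nat. emeasure \<mu> (A \<inter> S) = of_nat k" if A: "A \<in> sets borel" for A
  proof -
    obtain k where "emeasure \<mu> (A \<inter> S) = ennreal_of_enat k" using int[OF A] by blast
    then show ?thesis using le[OF A] by (cases k) auto
  qed
  have at: "finite {x. emeasure \<mu>' {x} \<noteq> 0}" "emeasure \<mu>' (- {x. emeasure \<mu>' {x} \<noteq> 0}) = 0"
    by (rule counting_measure_atomic; use e fin int in \<open>simp add: \<mu>'_def\<close>)+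
  have D: "{x. emeasure \<mu>' {x} \<noteq> 0} = D"
    using e by (auto simp: D_def Int_insert_left)
  show fD: "finite D" using at(1) D by simp
  show "emeasure \<mu> (A \<inter> S) = (\<Sum>x\<in>D \<inter> A. emeasure \<mu> {x})" if A: "A \<in> sets borel" for A
  proof -
    have Dm: "D \<in> sets borel" using fD by (simp add: borel_closed finite_imp_closed)
    have "emeasure \<mu>' A = emeasure \<mu>' (D \<inter> A) + emeasure \<mu>' (A - D)"
      by (subst plus_emeasure) (use A Dm in \<open>auto simp: \<mu>'_def intro: arg_cong\<close>)
    also have "emeasure \<mu>' (A - D) = 0"
    proof -
      have "emeasure \<mu>' (A - D) \<le> emeasure \<mu>' (- D)" by (rule emeasure_mono) (use Dm in \<open>auto simp: \<mu>'_def\<close>)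
      then show ?thesis using at(2) D by simp
    qed
    also have "emeasure \<mu>' (D \<inter> A) = (\<Sum>x\<in>D \<inter> A. emeasure \<mu>' {x})"
      by (rule emeasure_eq_sum_singleton) (use fD in \<open>auto simp: \<mu>'_def\<close>)
    also have "\<dots> = (\<Sum>x\<in>D \<inter> A. emeasure \<mu> {x})"
      by (rule sum.cong) (auto simp: e D_def Int_insert_left)
    finally show ?thesis using e[OF A] by simp
  qed
qed

text \<open>Balls of half the distance to the nearest other point of \<open>D\<close> are disjoint.
  Taking the neighbourhoods from a given basis will keep the resulting cylinder sets countable in
  number.\<close>

lemma finite_set_disjoint_basic_nbhds:
  fixes D :: "'a::metric_space set"
  assumes B: "topological_basis B" and D: "finite D" and b: "\<And>x. x \<in> D \<Longrightarrow> open (b x) \<and> x \<in> b x"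
  shows "\<exists>b'. (\<forall>x\<in>D. b' x \<in> B \<and> x \<in> b' x \<and> b' x \<subseteq> b x) \<and> disjoint_family_on b' D"
proof -
  have "\<forall>x. \<exists>d>0. \<forall>y\<in>D. y \<noteq> x \<longrightarrow> d \<le> dist x y" using finite_set_avoid[OF D] by blast
  then obtain d where d: "\<And>x. 0 < d x" "\<And>x y. y \<in> D \<Longrightarrow> y \<noteq> x \<Longrightarrow> d x \<le> dist x y" by metis
  have "\<exists>c. x \<in> D \<longrightarrow> c \<in> B \<and> x \<in> c \<and> c \<subseteq> b x \<inter> ball x (d x / 2)" for x
  proof (cases "x \<in> D")
    case True
    then have "open (b x \<inter> ball x (d x / 2))" "x \<in> b x \<inter> ball x (d x / 2)" using b[of x] d(1)[of x] by auto
    from topological_basisE[OF B this] show ?thesis by metis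
  qed auto
  then obtain b' where b': "\<And>x. x \<in> D \<Longrightarrow> b' x \<in> B \<and> x \<in> b' x \<and> b' x \<subseteq> b x \<inter> ball x (d x / 2)" by metis
  have "b' x \<inter> b' y = {}" if xy: "x \<in> D" "y \<in> D" "x \<noteq> y" for x y
  proof (rule equals0I)
    fix z assume "z \<in> b' x \<inter> b' y"
    then have "z \<in> ball x (d x / 2)" "z \<in> ball y (d y / 2)" using b'[OF xy(1)] b'[OF xy(2)] by auto
    then have "dist x z < d x / 2" "dist y z < d y / 2" by simp_all
    moreover have "d x \<le> dist x y" "d y \<le> dist x y" using d(2)[of y x] d(2)[of x y] xy by (auto simp: dist_commute)
    moreover have "dist x y \<le> dist x z + dist y z" by (rule dist_triangle2)
    ultimately show False by linarith
  qed
  then have "disjoint_family_on b' D" by (auto simp: disjoint_family_on_def)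
  then show ?thesis using b' by blast
qed

text \<open>For disjoint neighbourhoods, prescribing the mass in each of them and the same total
  mass forces zero mass elsewhere, since on a compact \<open>S\<close> the atoms of
  \<open>\<mu>0\<close> already carry its finite total. So membership is decided by finitely many
  evaluations.\<close>

definition cylinder_nbhd :: "'a::topological_space set \<Rightarrow> 'a measure \<Rightarrow> ('a \<Rightarrow> 'a set) \<Rightarrow> 'a measure set" where
  "cylinder_nbhd S \<mu>0 b = {\<mu> \<in> counting_measures (top_of_set S).
     (\<forall>x\<in>{x\<in>S. emeasure \<mu>0 {x} \<noteq> 0}. emeasure \<mu> (b x \<inter> S) = emeasure \<mu>0 {x}) \<and> emeasure \<mu> S = emeasure \<mu>0 S}"

text \<open>On a cylinder neighbourhood every test function is uniformly close to one fixed step function.\<close>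

lemma cylinder_nbhd_integral:
  fixes S :: "'a::{second_countable_topology, t2_space} set"
  assumes S: "compact S" and \<mu>0: "\<mu>0 \<in> counting_measures (top_of_set S)"
    and f: "f \<in> Cc (top_of_set S)" and \<mu>: "\<mu> \<in> cylinder_nbhd S \<mu>0 b"
  defines "D \<equiv> {x\<in>S. emeasure \<mu>0 {x} \<noteq> 0}"
  assumes b: "\<And>x. x \<in> D \<Longrightarrow> open (b x)" "disjoint_family_on b D"
    and close: "\<And>x y. x \<in> D \<Longrightarrow> y \<in> b x \<inter> S \<Longrightarrow> \<bar>f y - f x\<bar> \<le> e" and e: "0 \<le> e"
  shows "\<bar>integral\<^sup>L \<mu> f - (\<Sum>x\<in>D. f x * measure \<mu>0 {x})\<bar> \<le> e * measure \<mu>0 S"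
proof -
  have c: "\<mu> \<in> counting_measures (top_of_set S)" and bD: "\<And>x. x \<in> D \<Longrightarrow> emeasure \<mu> (b x \<inter> S) = emeasure \<mu>0 {x}"
    and tot: "emeasure \<mu> S = emeasure \<mu>0 S"
    using \<mu> by (auto simp: cylinder_nbhd_def D_def)
  have rad: "\<mu> \<in> radon_measures (top_of_set S)" using c counting_measures_subset by auto
  note m = radon_measuresD[OF rad]
  have sp: "space \<mu> = S" using m(2) by simp
  note at0 = counting_measure_compact_atoms[OF S \<mu>0, folded D_def]
  note at = counting_measure_compact_atoms[OF S c]
  have fin: "emeasure \<mu> S \<noteq> \<infinity>" using at(3) by simp
  interpret fm: finite_measure \<mu> by (rule finite_measureI) (simp add: sp fin[simplified])
  have bS: "b x \<inter> S \<in> sets \<mu>" if "x \<in> D" for x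
    using b(1)[OF that] unfolding m(1) sets_borel_of_top_of_set by (auto simp: sets_restrict_space)
  define s where "s y = (\<Sum>x\<in>D. f x * indicator (b x \<inter> S) y)" for y
  have AE: "AE y in \<mu>. \<bar>f y - s y\<bar> \<le> e"
  proof (rule AE_I')
    let ?U = "\<Union>x\<in>D. b x \<inter> S"
    have U: "?U \<in> sets \<mu>" using bS at0(1) by (intro sets.finite_UN) auto
    have "emeasure \<mu> ?U = (\<Sum>x\<in>D. emeasure \<mu> (b x \<inter> S))"
      by (rule sum_emeasure[symmetric]) (use bS at0(1) b(2) in \<open>auto simp: disjoint_family_on_def\<close>)
    also have "\<dots> = (\<Sum>x\<in>D. emeasure \<mu>0 {x})" by (rule sum.cong) (simp_all add: bD)
    also have "\<dots> = emeasure \<mu>0 S" using at0(2)[of UNIV] by simp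
    finally have "emeasure \<mu> ?U = emeasure \<mu> S" using tot by simp
    then have "emeasure \<mu> (S - ?U) = 0"
      using emeasure_compl[OF U] fin sp by (simp add: top.not_eq_extremum)
    then show "S - ?U \<in> null_sets \<mu>" using U sets.compl_sets[OF U] by (simp add: null_sets_def sp)
    show "{y \<in> space \<mu>. \<not> \<bar>f y - s y\<bar> \<le> e} \<subseteq> S - ?U"
    proof
      fix y assume y: "y \<in> {y \<in> space \<mu>. \<not> \<bar>f y - s y\<bar> \<le> e}"
      have "y \<notin> ?U"
      proof
        assume "y \<in> ?U"
        then obtain x where x: "x \<in> D" "y \<in> b x \<inter> S" by blast
        have "s y = (\<Sum>z\<in>D. if z = x then f x else 0)" unfolding s_def
        proof (rule sum.cong)
          fix z assume z: "z \<in> D"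
          have "y \<notin> b z" if "z \<noteq> x" using b(2) z x that by (auto simp: disjoint_family_on_def)
          then show "f z * indicator (b z \<inter> S) y = (if z = x then f x else 0)" using x by (auto simp: indicator_def)
        qed simp
        then have "s y = f x" using x at0(1) by simp
        then show False using y close[OF x] by simp
      qed
      then show "y \<in> S - ?U" using y sp by simp
    qed
  qed
  have fi: "integrable \<mu> f" by (rule Cc_integrable[OF f Hausdorff_space_top_of_set rad])
  have si: "integrable \<mu> s" unfolding s_def
    by (intro Bochner_Integration.integrable_sum integrable_mult_right integrable_real_indicator) (use bS fm.emeasure_finite in \<open>auto simp: less_top[symmetric]\<close>)
  have sint: "integral\<^sup>L \<mu> s = (\<Sum>x\<in>D. f x * measure \<mu>0 {x})"
  proof -
    have "integral\<^sup>L \<mu> s = (\<Sum>x\<in>D. integral\<^sup>L \<mu> (\<lambda>y. f x * indicator (b x \<inter> S) y))" unfolding s_def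
      by (rule Bochner_Integration.integral_sum, intro integrable_mult_right integrable_real_indicator)
        (use bS fm.emeasure_finite in \<open>auto simp: less_top[symmetric]\<close>)
    also have "\<dots> = (\<Sum>x\<in>D. f x * measure \<mu>0 {x})"
    proof (rule sum.cong)
      fix x assume x: "x \<in> D"
      have "measure \<mu> (b x \<inter> S) = measure \<mu>0 {x}" using bD[OF x] by (simp add: measure_def)
      moreover have "(b x \<inter> S) \<inter> space \<mu> = b x \<inter> S" using sp by auto
      ultimately show "integral\<^sup>L \<mu> (\<lambda>y. f x * indicator (b x \<inter> S) y) = f x * measure \<mu>0 {x}" by simp
    qed simp
    finally show ?thesis .
  qed
  have "\<bar>integral\<^sup>L \<mu> f - integral\<^sup>L \<mu> s\<bar> = \<bar>integral\<^sup>L \<mu> (\<lambda>y. f y - s y)\<bar>"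
    using fi si by simp
  also have "\<dots> \<le> integral\<^sup>L \<mu> (\<lambda>y. \<bar>f y - s y\<bar>)" by (rule integral_abs_bound)
  also have "\<dots> \<le> integral\<^sup>L \<mu> (\<lambda>y. e)"
    by (rule integral_mono_AE) (use fi si AE in \<open>auto intro!: Bochner_Integration.integrable_diff\<close>)
  also have "\<dots> = e * measure \<mu>0 S" using sp tot by (simp add: measure_def)
  finally show ?thesis unfolding sint .
qed

lemma cylinder_nbhd_self:
  fixes S :: "'a::{second_countable_topology, t2_space} set"
  assumes S: "compact S" and \<mu>0: "\<mu>0 \<in> counting_measures (top_of_set S)"
  defines "D \<equiv> {x\<in>S. emeasure \<mu>0 {x} \<noteq> 0}"
  assumes b: "\<And>x. x \<in> D \<Longrightarrow> open (b x) \<and> x \<in> b x" "disjoint_family_on b D"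
  shows "\<mu>0 \<in> cylinder_nbhd S \<mu>0 b"
proof -
  have "emeasure \<mu>0 (b x \<inter> S) = emeasure \<mu>0 {x}" if x: "x \<in> D" for x
  proof -
    have "D \<inter> b x = {x}" using b x by (auto simp: disjoint_family_on_def)
    then show ?thesis
      using counting_measure_compact_atoms(2)[OF S \<mu>0, of "b x"] b(1)[OF x] by (simp add: D_def[symmetric])
  qed
  then show ?thesis using \<mu>0 by (simp add: cylinder_nbhd_def D_def)
qed

text \<open>Induction over the generation of the topology. Demanding the inclusion for all finer
  disjoint families \<open>b'\<close> makes the property stable under intersections, and leaves
  freedom to choose \<open>b'\<close> from a countable basis later.\<close>

lemma vague_open_contains_cylinder:
  fixes S :: "'a::euclidean_space set"
  assumes S: "compact S" and T: "openin (vague_topology (top_of_set S)) T"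
    and \<mu>0: "\<mu>0 \<in> counting_measures (top_of_set S)" "\<mu>0 \<in> T"
  defines "D \<equiv> {x\<in>S. emeasure \<mu>0 {x} \<noteq> 0}"
  shows "\<exists>b. (\<forall>x\<in>D. open (b x) \<and> x \<in> b x) \<and>
    (\<forall>b'. (\<forall>x\<in>D. open (b' x) \<and> x \<in> b' x \<and> b' x \<subseteq> b x) \<and> disjoint_family_on b' D \<longrightarrow> cylinder_nbhd S \<mu>0 b' \<subseteq> T)"
    (is "?good T")
proof -
  have "generate_topology_on {{\<mu> \<in> radon_measures (top_of_set S). integral\<^sup>L \<mu> f \<in> U} | f U. f \<in> Cc (top_of_set S) \<and> open U} T"
    using T unfolding vague_topology_def by (simp add: openin_topology_generated_by_iff)
  then show ?thesis using \<mu>0(2)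
  proof (induction T rule: generate_topology_on.induct)
    case Empty
    then show ?case by simp
  next
    case (Int A B)
    have "\<mu>0 \<in> A" "\<mu>0 \<in> B" using Int.prems by simp_all
    from Int.IH(1)[OF this(1)] obtain b1 where b1: "(\<forall>x\<in>D. open (b1 x) \<and> x \<in> b1 x) \<and>
      (\<forall>b'. (\<forall>x\<in>D. open (b' x) \<and> x \<in> b' x \<and> b' x \<subseteq> b1 x) \<and> disjoint_family_on b' D \<longrightarrow> cylinder_nbhd S \<mu>0 b' \<subseteq> A)" ..
    from Int.IH(2)[OF \<open>\<mu>0 \<in> B\<close>] obtain b2 where b2: "(\<forall>x\<in>D. open (b2 x) \<and> x \<in> b2 x) \<and>
      (\<forall>b'. (\<forall>x\<in>D. open (b' x) \<and> x \<in> b' x \<and> b' x \<subseteq> b2 x) \<and> disjoint_family_on b' D \<longrightarrow> cylinder_nbhd S \<mu>0 b' \<subseteq> B)" ..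
    show ?case
    proof (intro exI[of _ "\<lambda>x. b1 x \<inter> b2 x"] conjI allI impI)
      show "\<forall>x\<in>D. open (b1 x \<inter> b2 x) \<and> x \<in> b1 x \<inter> b2 x" using b1[THEN conjunct1] b2[THEN conjunct1] by auto
      fix b' assume "(\<forall>x\<in>D. open (b' x) \<and> x \<in> b' x \<and> b' x \<subseteq> b1 x \<inter> b2 x) \<and> disjoint_family_on b' D"
      then have "(\<forall>x\<in>D. open (b' x) \<and> x \<in> b' x \<and> b' x \<subseteq> b1 x) \<and> disjoint_family_on b' D"
        "(\<forall>x\<in>D. open (b' x) \<and> x \<in> b' x \<and> b' x \<subseteq> b2 x) \<and> disjoint_family_on b' D" by simp_all
      then show "cylinder_nbhd S \<mu>0 b' \<subseteq> A \<inter> B"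
        using b1[THEN conjunct2, rule_format, of b'] b2[THEN conjunct2, rule_format, of b'] by simp
    qed
  next
    case (UN K)
    then obtain k where k: "k \<in> K" "\<mu>0 \<in> k" by blast
    from UN.IH[OF k] obtain b where b: "(\<forall>x\<in>D. open (b x) \<and> x \<in> b x) \<and>
      (\<forall>b'. (\<forall>x\<in>D. open (b' x) \<and> x \<in> b' x \<and> b' x \<subseteq> b x) \<and> disjoint_family_on b' D \<longrightarrow> cylinder_nbhd S \<mu>0 b' \<subseteq> k)" ..
    show ?case
    proof (intro exI[of _ b] conjI allI impI)
      show "\<forall>x\<in>D. open (b x) \<and> x \<in> b x" by (rule b[THEN conjunct1])
      fix b' assume "(\<forall>x\<in>D. open (b' x) \<and> x \<in> b' x \<and> b' x \<subseteq> b x) \<and> disjoint_family_on b' D"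
      then have "cylinder_nbhd S \<mu>0 b' \<subseteq> k" using b[THEN conjunct2, rule_format, of b'] by simp
      then show "cylinder_nbhd S \<mu>0 b' \<subseteq> \<Union>K" using k(1) by auto
    qed
  next
    case (Basis s)
    then obtain f U where fU: "f \<in> Cc (top_of_set S)" "open U" "s = {\<mu> \<in> radon_measures (top_of_set S). integral\<^sup>L \<mu> f \<in> U}"
      by blast
    then have "integral\<^sup>L \<mu>0 f \<in> U" using Basis.prems by simp
    then obtain \<epsilon> where \<epsilon>: "0 < \<epsilon>" "ball (integral\<^sup>L \<mu>0 f) \<epsilon> \<subseteq> U" using fU(2) open_contains_ball by blast
    \<comment> \<open>Both \<open>\<mu>0\<close> and a nearby measure have integrals within
      \<open>e\<close> times the common mass of one fixed sum, so twice that product must stay below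
      \<epsilon>. The added 2 keeps the denominator positive when the mass is 0.\<close>
    define e where "e = \<epsilon> / (2 * measure \<mu>0 S + 2)"
    have e0: "0 < e" using \<epsilon>(1) by (simp add: e_def add_nonneg_pos)
    have e2: "2 * (e * measure \<mu>0 S) < \<epsilon>"
    proof -
      have p: "0 < 2 * measure \<mu>0 S + 2" by (simp add: add_nonneg_pos)
      have "2 * (e * measure \<mu>0 S) < e * (2 * measure \<mu>0 S + 2)" using e0 by (simp add: algebra_simps)
      also have "\<dots> = \<epsilon>" unfolding e_def using p by simp
      finally show ?thesis .
    qed
    have "\<exists>c. open c \<and> {y \<in> S. f y \<in> ball (f x) e} = S \<inter> c" for x
    proof -
      have "openin (top_of_set S) {y \<in> topspace (top_of_set S). f y \<in> ball (f x) e}"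
        using fU(1) by (auto simp: Cc_def continuous_map_def)
      then show ?thesis by (simp add: openin_open)
    qed
    then obtain c where c: "\<And>x. open (c x)" "\<And>x. {y \<in> S. f y \<in> ball (f x) e} = S \<inter> c x" by metis
    show ?case
    proof (intro exI[of _ c] conjI allI impI ballI)
      fix x assume "x \<in> D"
      show "open (c x)" by (rule c(1))
      have "x \<in> {y \<in> S. f y \<in> ball (f x) e}" using \<open>x \<in> D\<close> e0 by (simp add: D_def)
      then show "x \<in> c x" unfolding c(2) by blast
    next
      fix b' assume b': "(\<forall>x\<in>D. open (b' x) \<and> x \<in> b' x \<and> b' x \<subseteq> c x) \<and> disjoint_family_on b' D"
      have close: "\<bar>f y - f x\<bar> \<le> e" if "x \<in> D" "y \<in> b' x \<inter> S" for x y
      proof -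
        have "y \<in> S \<inter> c x" using that b' by auto
        then show ?thesis unfolding c(2)[symmetric] by (simp add: dist_real_def abs_minus_commute)
      qed
      have bnd: "\<bar>integral\<^sup>L \<mu> f - (\<Sum>x\<in>D. f x * measure \<mu>0 {x})\<bar> \<le> e * measure \<mu>0 S" if "\<mu> \<in> cylinder_nbhd S \<mu>0 b'" for \<mu>
        unfolding D_def
        by (rule cylinder_nbhd_integral[OF S \<mu>0(1) fU(1) that]) (use b' close e0 in \<open>auto simp: D_def\<close>)
      have self: "\<mu>0 \<in> cylinder_nbhd S \<mu>0 b'"
        by (rule cylinder_nbhd_self[OF S \<mu>0(1)]) (use b' in \<open>auto simp: D_def\<close>)
      show "cylinder_nbhd S \<mu>0 b' \<subseteq> s"
      proof
        fix \<mu> assume \<mu>: "\<mu> \<in> cylinder_nbhd S \<mu>0 b'"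
        have "\<bar>integral\<^sup>L \<mu>0 f - integral\<^sup>L \<mu> f\<bar> < \<epsilon>" using bnd[OF \<mu>] bnd[OF self] e2 by linarith
        then have "integral\<^sup>L \<mu> f \<in> U" using \<epsilon>(2) by (auto simp: dist_real_def)
        moreover have "\<mu> \<in> radon_measures (top_of_set S)"
          using \<mu> counting_measures_subset by (auto simp: cylinder_nbhd_def)
        ultimately show "\<mu> \<in> s" unfolding fU(3) by simp
      qed
    qed
  qed
qed

text \<open>On a compact set the vague Borel sets are generated by evaluations: every vaguely open
  set is a union of cylinder sets built from a countable basis and natural numbers, hence a
  countable union of sets described by finitely many evaluations.\<close>

lemma measurable_counting_space_compact:
  fixes S :: "'a::euclidean_space set"
  assumes S: "compact S" and g: "\<And>\<omega>. \<omega> \<in> space M \<Longrightarrow> g \<omega> \<in> counting_measures (top_of_set S)"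
    and ev: "\<And>A. A \<in> sets borel \<Longrightarrow> (\<lambda>\<omega>. emeasure (g \<omega>) (A \<inter> S)) \<in> borel_measurable M"
  shows "g \<in> measurable M (counting_space (top_of_set S))"
proof -
  let ?C = "counting_measures (top_of_set S)" and ?Y = "subtopology (vague_topology (top_of_set S)) (counting_measures (top_of_set S))"
  obtain B :: "'a set set" where B: "countable B" "topological_basis B" using ex_countable_basis by blast
  have Bo: "open c" if "c \<in> B" for c using topological_basis_open[OF B(2) that] .
  define cyl where "cyl c = {\<mu> \<in> ?C. (\<forall>(b, k)\<in>fst c. emeasure \<mu> (b \<inter> S) = of_nat k) \<and> emeasure \<mu> S = of_nat (snd c)}"
    for c :: "('a set \<times> nat) set \<times> nat"
  \<comment> \<open>A code is a finite set of basic open sets with prescribed masses, together with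
    the total mass.\<close>
  define codes where "codes = {c. finite c \<and> c \<subseteq> B \<times> (UNIV :: nat set)} \<times> (UNIV :: nat set)"
  have "countable {c. finite c \<and> c \<subseteq> B \<times> (UNIV :: nat set)}"
    using B(1) by (intro countable_Collect_finite_subset countable_SIGMA) auto
  then have cc: "countable codes" unfolding codes_def by (intro countable_SIGMA) auto
  have cm: "{\<omega> \<in> space M. g \<omega> \<in> cyl c} \<in> sets M" if c: "c \<in> codes" for c
  proof -
    have fin: "finite (fst c)" "fst c \<subseteq> B \<times> UNIV" using c by (auto simp: codes_def)
    have eq: "{\<omega> \<in> space M. g \<omega> \<in> cyl c} =
      {\<omega> \<in> space M. (\<forall>p\<in>fst c. emeasure (g \<omega>) (fst p \<inter> S) = of_nat (snd p)) \<and> emeasure (g \<omega>) (UNIV \<inter> S) = of_nat (snd c)}"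
      using g by (auto simp: cyl_def)
    have "(\<lambda>\<omega>. emeasure (g \<omega>) (fst p \<inter> S)) \<in> borel_measurable M" if "p \<in> fst c" for p
      using that fin(2) Bo by (intro ev borel_open) auto
    then have 1: "{\<omega> \<in> space M. \<forall>p\<in>fst c. emeasure (g \<omega>) (fst p \<inter> S) = of_nat (snd p)} \<in> sets M"
      by (intro sets.sets_Collect_finite_All fin(1) borel_measurable_eq borel_measurable_const)
    have 2: "{\<omega> \<in> space M. emeasure (g \<omega>) (UNIV \<inter> S) = of_nat (snd c)} \<in> sets M"
      by (intro borel_measurable_eq borel_measurable_const ev) simp
    have "{\<omega> \<in> space M. g \<omega> \<in> cyl c} =
      {\<omega> \<in> space M. \<forall>p\<in>fst c. emeasure (g \<omega>) (fst p \<inter> S) = of_nat (snd p)} \<inter>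
      {\<omega> \<in> space M. emeasure (g \<omega>) (UNIV \<inter> S) = of_nat (snd c)}" unfolding eq by auto
    then show ?thesis using sets.Int[OF 1 2] by simp
  qed
  have main: "g -` W \<inter> space M \<in> sets M" if W: "openin ?Y W" for W
  proof -
    obtain T where T: "openin (vague_topology (top_of_set S)) T" "W = T \<inter> ?C" using W by (auto simp: openin_subtopology)
    have ex: "\<exists>c\<in>codes. \<mu>0 \<in> cyl c \<and> cyl c \<subseteq> W" if \<mu>0: "\<mu>0 \<in> W" for \<mu>0
    proof -
      have m0: "\<mu>0 \<in> ?C" "\<mu>0 \<in> T" using \<mu>0 T(2) by auto
      define D where "D = {x\<in>S. emeasure \<mu>0 {x} \<noteq> 0}"
      note at = counting_measure_compact_atoms[OF S m0(1), folded D_def]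
      from vague_open_contains_cylinder[OF S T(1) m0, folded D_def] obtain b where b: "(\<forall>x\<in>D. open (b x) \<and> x \<in> b x) \<and>
        (\<forall>b'. (\<forall>x\<in>D. open (b' x) \<and> x \<in> b' x \<and> b' x \<subseteq> b x) \<and> disjoint_family_on b' D \<longrightarrow> cylinder_nbhd S \<mu>0 b' \<subseteq> T)" ..
      obtain b' where b': "\<forall>x\<in>D. b' x \<in> B \<and> x \<in> b' x \<and> b' x \<subseteq> b x" "disjoint_family_on b' D"
        using finite_set_disjoint_basic_nbhds[OF B(2) at(1), of b] b[THEN conjunct1] by auto
      have "\<exists>k::nat. x \<in> D \<longrightarrow> emeasure \<mu>0 {x} = of_nat k" for x
      proof (cases "x \<in> D")
        case True
        then have "{x} \<inter> S = {x}" by (auto simp: D_def)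
        then show ?thesis using at(4)[of "{x}"] by auto
      qed auto
      then obtain k where k: "\<And>x. x \<in> D \<Longrightarrow> emeasure \<mu>0 {x} = of_nat (k x)" by metis
      obtain n where n: "emeasure \<mu>0 S = of_nat n" using at(4)[of UNIV] by auto
      define c where "c = ((\<lambda>x. (b' x, k x)) ` D, n)"
      have cyl: "cyl c = cylinder_nbhd S \<mu>0 b'"
        unfolding cyl_def cylinder_nbhd_def D_def[symmetric] c_def using k n by auto
      have "c \<in> codes" using at(1) b'(1) by (auto simp: codes_def c_def)
      moreover have "\<mu>0 \<in> cyl c" unfolding cyl
        by (rule cylinder_nbhd_self[OF S m0(1)]) (use b' Bo in \<open>auto simp: D_def\<close>)
      moreover have "cyl c \<subseteq> W"
      proof -
        have "cylinder_nbhd S \<mu>0 b' \<subseteq> T" by (rule b[THEN conjunct2, rule_format]) (use b' Bo in auto)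
        then show ?thesis unfolding T(2) cyl by (auto simp: cylinder_nbhd_def)
      qed
      ultimately show ?thesis by blast
    qed
    have "g -` W \<inter> space M = (\<Union>c\<in>{c\<in>codes. cyl c \<subseteq> W}. {\<omega> \<in> space M. g \<omega> \<in> cyl c})"
      using ex by blast
    also have "\<dots> \<in> sets M"
      by (rule sets.countable_UN') (use cc cm in \<open>auto intro: countable_subset[OF _ cc]\<close>)
    finally show ?thesis .
  qed
  have sub: "{U. openin ?Y U} \<subseteq> Pow (topspace ?Y)" using openin_subset[of ?Y] by blast
  have top: "topspace ?Y = ?C" using counting_measures_subset by (auto simp: topspace_vague_topology)
  show ?thesis unfolding counting_space_def borel_of_def
    by (rule measurable_measure_of[OF sub]) (use main g top in auto)
qed

lemma measurable_emeasure_euclidean: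
  fixes A :: "'a::{second_countable_topology, t2_space} set"
  assumes "locally_compact_space (euclidean :: 'a topology)" "A \<in> sets borel"
  shows "(\<lambda>\<mu>. emeasure \<mu> A) \<in> borel_measurable (counting_space euclidean)"
  using measurable_emeasure_counting_space[of UNIV A] assms
  by (simp add: subtopology_UNIV sets_borel_of_euclidean)

lemma counting_measures_euclideanD:
  assumes "\<mu> \<in> counting_measures euclidean"
  shows "sets \<mu> = sets borel" "compact K \<Longrightarrow> emeasure \<mu> K < \<infinity>"
    "A \<in> sets borel \<Longrightarrow> \<exists>k. emeasure \<mu> A = ennreal_of_enat k"
  using assms by (auto simp: counting_measures_def radon_measures_def sets_borel_of_euclidean)

lemma
  fixes S :: "'a::{second_countable_topology, t2_space} set"
  assumes S: "compact S" and \<mu>: "\<mu> \<in> counting_measures euclidean"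
  shows restrict_counting_measures: "restrict_space \<mu> S \<in> counting_measures (top_of_set S)"
    and emeasure_restrict_counting: "A \<subseteq> S \<Longrightarrow> emeasure (restrict_space \<mu> S) A = emeasure \<mu> A"
proof -
  note m = counting_measures_euclideanD[OF \<mu>]
  have sp: "space \<mu> = UNIV" using sets_eq_imp_space_eq[OF m(1)] by simp
  have Sm: "S \<in> sets borel" using S by (simp add: compact_imp_closed borel_closed)
  have e: "emeasure (restrict_space \<mu> S) A = emeasure \<mu> A" if "A \<subseteq> S" for A
    by (rule emeasure_restrict_space) (use Sm sp m(1) that in auto)
  then show "A \<subseteq> S \<Longrightarrow> emeasure (restrict_space \<mu> S) A = emeasure \<mu> A" .
  have s: "sets (restrict_space \<mu> S) = sets (borel_of (top_of_set S))"
    by (simp add: sets_borel_of_top_of_set sets_restrict_space m(1))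
  show "restrict_space \<mu> S \<in> counting_measures (top_of_set S)"
    unfolding counting_measures_def radon_measures_def
  proof (intro CollectI conjI allI impI ballI)
    show "sets (restrict_space \<mu> S) = sets (borel_of (top_of_set S))" by (rule s)
    show "emeasure (restrict_space \<mu> S) K < \<infinity>" if "compactin (top_of_set S) K" for K
      using that m(2)[of K] e[of K] by (simp add: compactin_subtopology)
    show "\<exists>k. emeasure (restrict_space \<mu> S) A = ennreal_of_enat k" if "A \<in> sets (restrict_space \<mu> S)" for A
    proof -
      have "A \<subseteq> S" "A \<in> sets borel"
        using that Sm by (auto simp: sets_restrict_space m(1))
      then show ?thesis using m(3) e by auto
    qed
  qed
qed

text \<open>The laws in the comparison with the Poisson process are image measures under restriction
  to a compact set; they can be evaluated on events only once restriction is measurable.\<close>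

lemma measurable_restrict_process:
  fixes \<Psi> :: "'w \<Rightarrow> 'a::euclidean_space measure"
  assumes S: "compact S" and \<Psi>: "point_process P euclidean \<Psi>"
  shows "(\<lambda>\<omega>. restrict_space (\<Psi> \<omega>) S) \<in> measurable P (counting_space (top_of_set S))"
proof (rule measurable_counting_space_compact[OF S])
  have m: "\<Psi> \<in> measurable P (counting_space euclidean)" using \<Psi> by (simp add: point_process_def)
  have c: "\<Psi> \<omega> \<in> counting_measures euclidean" if "\<omega> \<in> space P" for \<omega>
    using measurable_space[OF m that] by (simp add: space_counting_space)
  show "restrict_space (\<Psi> \<omega>) S \<in> counting_measures (top_of_set S)" if "\<omega> \<in> space P" for \<omega>
    by (rule restrict_counting_measures[OF S c[OF that]])
  fix A :: "'a set" assume A: "A \<in> sets borel"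
  have "A \<inter> S \<in> sets borel" using A S by (simp add: compact_imp_closed borel_closed)
  then have "(\<lambda>\<omega>. emeasure (\<Psi> \<omega>) (A \<inter> S)) \<in> borel_measurable P"
    using measurable_compose[OF m measurable_emeasure_euclidean[OF locally_compact_space_euclidean]] by simp
  then show "(\<lambda>\<omega>. emeasure (restrict_space (\<Psi> \<omega>) S) (A \<inter> S)) \<in> borel_measurable P"
    by (rule measurable_cong[THEN iffD1, rotated]) (simp add: emeasure_restrict_counting[OF S c])
qed

section \<open>Positive probability of a prescribed configuration\<close>

lemma poisson_configuration_prob:
  fixes \<Psi> :: "'u \<Rightarrow> 'a::euclidean_space measure"
  assumes Q: "prob_space Q" and l: "0 < l" and \<Psi>: "homogeneous_poisson_process Q l \<Psi>"
    and S: "compact S" and D: "finite D" and \<delta>: "0 < \<delta>" and disj: "disjoint_family_on (\<lambda>x. ball x \<delta>) D"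
  shows "0 < measure Q {\<omega>\<in>space Q. (\<forall>x\<in>D. emeasure (\<Psi> \<omega>) (ball x \<delta>) = 1) \<and> emeasure (\<Psi> \<omega>) (S - (\<Union>x\<in>D. ball x \<delta>)) = 0}"
proof -
  interpret Q: prob_space Q by fact
  obtain h where h: "bij_betw h {0..<card D} D" using ex_bij_betw_nat_finite[OF D] by blast
  define n where "n = card D"
  \<comment> \<open>The balls receive the indices below \<open>n\<close> and the rest of
    \<open>S\<close> the index \<open>n\<close>, giving one disjoint family for the independence
    property, whose index sets consist of natural numbers.\<close>
  define A where "A i = (if i < n then ball (h i) \<delta> else S - (\<Union>x\<in>D. ball x \<delta>))" for i
  define T where "T i = (if i < n then {1} else {0::ennreal})" for i
  have hD: "h i \<in> D" if "i < n" for i using h that by (auto simp: bij_betw_def n_def)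
  have Sb: "S \<in> sets borel" "bounded S" using S by (auto simp: compact_imp_closed borel_closed compact_imp_bounded)
  have Am: "A i \<in> sets borel \<and> bounded (A i)" for i
  proof -
    have "open (\<Union>x\<in>D. ball x \<delta>)" by auto
    then show ?thesis using Sb by (auto simp: A_def intro: bounded_subset)
  qed
  have dj: "disjoint_family_on A {0..n}"
    unfolding disjoint_family_on_def
  proof (intro ballI impI)
    fix i j assume ij: "i \<in> {0..n}" "j \<in> {0..n}" "i \<noteq> j"
    show "A i \<inter> A j = {}"
    proof (cases "i < n \<and> j < n")
      case True
      then have "h i \<noteq> h j" using h ij by (auto simp: bij_betw_def n_def inj_on_def)
      then show ?thesis using disj hD True by (auto simp: A_def disjoint_family_on_def)
    next
      case False
      then show ?thesis using hD ij by (auto simp: A_def)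
    qed
  qed
  have ind: "Q.indep_vars (\<lambda>_. borel) (\<lambda>i \<omega>. emeasure (\<Psi> \<omega>) (A i)) {0..n}"
    using \<Psi> Am dj unfolding homogeneous_poisson_process_def by simp
  have pois: "measure Q {\<omega> \<in> space Q. emeasure (\<Psi> \<omega>) (A i) = of_nat k} =
      (l * measure lborel (A i)) ^ k / fact k * exp (- (l * measure lborel (A i)))" for i and k :: nat
    using \<Psi> Am unfolding homogeneous_poisson_process_def by blast
  \<comment> \<open>A ball has positive volume, so one point in it has positive probability; for the
    rest of \<open>S\<close> the probability of no point is an exponential, positive whatever the
    volume.\<close>
  have pos: "0 < measure Q ((\<lambda>\<omega>. emeasure (\<Psi> \<omega>) (A i)) -` T i \<inter> space Q)" for i
  proof (cases "i < n")
    case True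
    have "0 < measure lborel (ball (h i) \<delta>)" using \<delta> by (rule content_ball_pos)
    then have "0 < measure Q {\<omega> \<in> space Q. emeasure (\<Psi> \<omega>) (A i) = of_nat 1}"
      unfolding pois using l True by (simp add: A_def)
    moreover have "{\<omega> \<in> space Q. emeasure (\<Psi> \<omega>) (A i) = of_nat 1} = (\<lambda>\<omega>. emeasure (\<Psi> \<omega>) (A i)) -` T i \<inter> space Q"
      using True by (auto simp: T_def)
    ultimately show ?thesis by simp
  next
    case False
    have "0 < measure Q {\<omega> \<in> space Q. emeasure (\<Psi> \<omega>) (A i) = of_nat 0}"
      unfolding pois by simp
    moreover have "{\<omega> \<in> space Q. emeasure (\<Psi> \<omega>) (A i) = of_nat 0} = (\<lambda>\<omega>. emeasure (\<Psi> \<omega>) (A i)) -` T i \<inter> space Q"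
      using False by (auto simp: T_def)
    ultimately show ?thesis by simp
  qed
  have "measure Q (\<Inter>i\<in>{0..n}. (\<lambda>\<omega>. emeasure (\<Psi> \<omega>) (A i)) -` T i \<inter> space Q) =
    (\<Prod>i\<in>{0..n}. measure Q ((\<lambda>\<omega>. emeasure (\<Psi> \<omega>) (A i)) -` T i \<inter> space Q))"
    by (rule Q.indep_varsD_finite[OF ind]) (auto simp: T_def)
  also have "\<dots> > 0" by (rule prod_pos) (use pos in auto)
  also have "(\<Inter>i\<in>{0..n}. (\<lambda>\<omega>. emeasure (\<Psi> \<omega>) (A i)) -` T i \<inter> space Q) =
    {\<omega>\<in>space Q. (\<forall>x\<in>D. emeasure (\<Psi> \<omega>) (ball x \<delta>) = 1) \<and> emeasure (\<Psi> \<omega>) (S - (\<Union>x\<in>D. ball x \<delta>)) = 0}"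
  proof -
    have "(\<forall>i\<in>{0..n}. emeasure (\<Psi> \<omega>) (A i) \<in> T i) \<longleftrightarrow>
      (\<forall>i<n. emeasure (\<Psi> \<omega>) (ball (h i) \<delta>) = 1) \<and> emeasure (\<Psi> \<omega>) (S - (\<Union>x\<in>D. ball x \<delta>)) = 0" for \<omega>
    proof -
      have "{0..n} = insert n {..<n}" by auto
      then show ?thesis by (auto simp: A_def T_def)
    qed
    moreover have "(\<forall>i<n. emeasure (\<Psi> \<omega>) (ball (h i) \<delta>) = 1) \<longleftrightarrow> (\<forall>x\<in>D. emeasure (\<Psi> \<omega>) (ball x \<delta>) = 1)" for \<omega>
    proof -
      have "D = h ` {..<n}" using h by (auto simp: bij_betw_def n_def lessThan_atLeast0)
      then show ?thesis by auto
    qed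
    ultimately have eq: "(\<forall>i\<in>{0..n}. emeasure (\<Psi> \<omega>) (A i) \<in> T i) \<longleftrightarrow>
      (\<forall>x\<in>D. emeasure (\<Psi> \<omega>) (ball x \<delta>) = 1) \<and> emeasure (\<Psi> \<omega>) (S - (\<Union>x\<in>D. ball x \<delta>)) = 0" for \<omega> by simp
    have "(\<Inter>i\<in>{0..n}. (\<lambda>\<omega>. emeasure (\<Psi> \<omega>) (A i)) -` T i \<inter> space Q) = {\<omega>\<in>space Q. \<forall>i\<in>{0..n}. emeasure (\<Psi> \<omega>) (A i) \<in> T i}"
      by auto
    then show ?thesis unfolding eq by simp
  qed
  finally show ?thesis .
qed

text \<open>If \<open>E\<close> were null for \<open>N\<close>, the density would vanish almost
  everywhere on \<open>E\<close>, against its positivity. This moves positive probabilities from the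
  Poisson law to the law of the ground process.\<close>

lemma RN_deriv_positive_imp_positive:
  assumes M: "finite_measure M" and ac: "absolutely_continuous M N" and s: "sets N = sets M"
    and pos: "AE x in M. 0 < RN_deriv M N x" and E: "E \<in> sets M" "0 < emeasure M E"
  shows "0 < emeasure N E"
proof (rule ccontr)
  interpret M: finite_measure M by fact
  assume "\<not> 0 < emeasure N E"
  then have "0 = emeasure (density M (RN_deriv M N)) E" using M.density_RN_deriv[OF ac s] by simp
  also have "\<dots> = (\<integral>\<^sup>+x. RN_deriv M N x * indicator E x \<partial>M)" by (rule emeasure_density) (use E in auto)
  finally have "AE x in M. RN_deriv M N x * indicator E x = 0"
    by (subst (asm) eq_commute, subst (asm) nn_integral_0_iff_AE) (use E in auto)
  with pos have "AE x in M. x \<notin> E" by eventually_elim (auto simp: indicator_def split: if_splits)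
  moreover have "{x \<in> space M. \<not> x \<notin> E} = E" using sets.sets_into_space[OF E(1)] by auto
  ultimately have "emeasure M E = 0" using AE_iff_measurable[OF E(1), of "\<lambda>x. x \<notin> E"] by simp
  then show False using E(2) by simp
qed

text \<open>The configuration is expressed as an event on the space of counting measures on
  \<open>S\<close>, where the two laws are compared. The balls lie in \<open>S\<close>, so the
  restricted measures count the same points in them as the original ones.\<close>

lemma configuration_prob_positive:
  fixes \<Psi> :: "'u \<Rightarrow> 'a::euclidean_space measure" and \<Gamma> :: "'w \<Rightarrow> 'a measure"
  assumes Q: "prob_space Q" and l: "0 < l" and \<Psi>: "homogeneous_poisson_process Q l \<Psi>"
    and P: "prob_space P" and \<Gamma>: "point_process P euclidean \<Gamma>" and S: "compact S"
    and ac: "absolutely_continuous (law Q (top_of_set S) (\<lambda>\<omega>. restrict_space (\<Psi> \<omega>) S)) (law P (top_of_set S) (\<lambda>\<omega>. restrict_space (\<Gamma> \<omega>) S))"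
    and RN: "AE \<mu> in law Q (top_of_set S) (\<lambda>\<omega>. restrict_space (\<Psi> \<omega>) S).
             0 < RN_deriv (law Q (top_of_set S) (\<lambda>\<omega>. restrict_space (\<Psi> \<omega>) S)) (law P (top_of_set S) (\<lambda>\<omega>. restrict_space (\<Gamma> \<omega>) S)) \<mu>"
    and D: "finite D" and \<delta>: "0 < \<delta>" and disj: "disjoint_family_on (\<lambda>x. ball x \<delta>) D" and DS: "\<And>x. x \<in> D \<Longrightarrow> ball x \<delta> \<subseteq> S"
  shows "0 < emeasure P {\<omega>\<in>space P. (\<forall>x\<in>D. emeasure (\<Gamma> \<omega>) (ball x \<delta>) = 1) \<and> emeasure (\<Gamma> \<omega>) (S - (\<Union>x\<in>D. ball x \<delta>)) = 0}"
proof -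
  let ?C = "counting_space (top_of_set S)"
  define E where "E = {\<mu> \<in> space ?C. (\<forall>x\<in>D. emeasure \<mu> (ball x \<delta>) = 1) \<and> emeasure \<mu> (S - (\<Union>x\<in>D. ball x \<delta>)) = 0}"
  have lc: "locally_compact_space (top_of_set S)"
    using S by (intro compact_imp_locally_compact_space) (simp add: compact_space_subtopology)
  have bm: "(\<lambda>\<mu>. emeasure \<mu> (ball x \<delta>)) \<in> borel_measurable ?C" if "x \<in> D" for x
    by (rule measurable_emeasure_open[OF lc]) (use DS[OF that] in \<open>simp add: openin_open_eq[symmetric] openin_open, auto intro: exI[of _ "ball x \<delta>"]\<close>)
  have cm: "(\<lambda>\<mu>. emeasure \<mu> (S - (\<Union>x\<in>D. ball x \<delta>))) \<in> borel_measurable ?C"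
  proof (rule measurable_emeasure_counting_space[OF lc], rule sets_borel_of_closedin, rule closedin_diff)
    have "S \<inter> (\<Union>x\<in>D. ball x \<delta>) = (\<Union>x\<in>D. ball x \<delta>)" using DS by blast
    moreover have "openin (top_of_set S) (S \<inter> (\<Union>x\<in>D. ball x \<delta>))" by (rule openin_open_Int) auto
    ultimately show "openin (top_of_set S) (\<Union>x\<in>D. ball x \<delta>)" by simp
  qed simp
  have Em: "E \<in> sets ?C" unfolding E_def
  proof (rule sets.sets_Collect_conj)
    show "{\<mu> \<in> space ?C. \<forall>x\<in>D. emeasure \<mu> (ball x \<delta>) = 1} \<in> sets ?C"
      by (intro sets.sets_Collect_finite_All D borel_measurable_eq borel_measurable_const bm)
    show "{\<mu> \<in> space ?C. emeasure \<mu> (S - (\<Union>x\<in>D. ball x \<delta>)) = 0} \<in> sets ?C"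
      by (intro borel_measurable_eq borel_measurable_const cm)
  qed
  have key: "emeasure (law M (top_of_set S) (\<lambda>\<omega>. restrict_space (X \<omega>) S)) E =
      emeasure M {\<omega>\<in>space M. (\<forall>x\<in>D. emeasure (X \<omega>) (ball x \<delta>) = 1) \<and> emeasure (X \<omega>) (S - (\<Union>x\<in>D. ball x \<delta>)) = 0}"
    if X: "point_process M euclidean X" for M and X :: "'z \<Rightarrow> 'a measure"
  proof -
    have rm: "(\<lambda>\<omega>. restrict_space (X \<omega>) S) \<in> measurable M ?C" by (rule measurable_restrict_process[OF S X])
    have c: "X \<omega> \<in> counting_measures euclidean" if "\<omega> \<in> space M" for \<omega>
      using X that measurable_space[of X M "counting_space euclidean"] by (simp add: point_process_def space_counting_space)
    have "emeasure (law M (top_of_set S) (\<lambda>\<omega>. restrict_space (X \<omega>) S)) E = emeasure M ((\<lambda>\<omega>. restrict_space (X \<omega>) S) -` E \<inter> space M)"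
      unfolding law_def by (rule emeasure_distr[OF rm Em])
    also have "(\<lambda>\<omega>. restrict_space (X \<omega>) S) -` E \<inter> space M =
      {\<omega>\<in>space M. (\<forall>x\<in>D. emeasure (X \<omega>) (ball x \<delta>) = 1) \<and> emeasure (X \<omega>) (S - (\<Union>x\<in>D. ball x \<delta>)) = 0}"
    proof -
      have "restrict_space (X \<omega>) S \<in> E \<longleftrightarrow> (\<forall>x\<in>D. emeasure (X \<omega>) (ball x \<delta>) = 1) \<and> emeasure (X \<omega>) (S - (\<Union>x\<in>D. ball x \<delta>)) = 0"
        if w: "\<omega> \<in> space M" for \<omega>
        using measurable_space[OF rm w] DS emeasure_restrict_counting[OF S c[OF w]] by (simp add: E_def)
      then show ?thesis by auto
    qed
    finally show ?thesis .
  qed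
  have PQ: "point_process Q euclidean \<Psi>" using \<Psi> by (simp add: homogeneous_poisson_process_def)
  have "prob_space (law Q (top_of_set S) (\<lambda>\<omega>. restrict_space (\<Psi> \<omega>) S))"
    unfolding law_def by (rule prob_space.prob_space_distr[OF Q measurable_restrict_process[OF S PQ]])
  then have fin: "finite_measure (law Q (top_of_set S) (\<lambda>\<omega>. restrict_space (\<Psi> \<omega>) S))" by (rule prob_space.finite_measure)
  have "0 < emeasure (law Q (top_of_set S) (\<lambda>\<omega>. restrict_space (\<Psi> \<omega>) S)) E"
    unfolding key[OF PQ] using poisson_configuration_prob[OF Q l \<Psi> S D \<delta> disj] by (simp add: measure_def enn2real_positive_iff)
  then have "0 < emeasure (law P (top_of_set S) (\<lambda>\<omega>. restrict_space (\<Gamma> \<omega>) S)) E"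
    by (intro RN_deriv_positive_imp_positive[OF fin ac _ RN]) (use Em in \<open>simp_all add: law_def\<close>)
  then show ?thesis unfolding key[OF \<Gamma>] .
qed

section \<open>Translations of marked measures\<close>

lemma translate_properties:
  fixes \<mu> :: "('a::euclidean_space \<times> 'm::{second_countable_topology, t2_space}) measure"
  assumes "sets \<mu> = sets borel" "A \<in> sets borel"
  shows "emeasure (translate v \<mu>) A = emeasure \<mu> {(x, m). (x - v, m) \<in> A}"
proof -
  have "continuous_on UNIV (\<lambda>(x::'a, m::'m). (x - v, m))" by (auto simp: split_beta intro!: continuous_intros)
  then have m: "(\<lambda>(x::'a, m::'m). (x - v, m)) \<in> measurable \<mu> borel"
    using borel_measurable_continuous_onI measurable_cong_sets[OF assms(1) refl] by blast
  have "space \<mu> = UNIV" using sets_eq_imp_space_eq[OF assms(1)] by simp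
  then show ?thesis unfolding translate_def
    by (subst emeasure_distr[OF m assms(2)]) (auto intro!: arg_cong[where f="emeasure \<mu>"])
qed

text \<open>A translation maps \<open>Cc\<close> to itself by precomposition, so it is vaguely
  continuous. Arguing by continuity avoids the description by cylinder sets, which was obtained for
  compact spaces.\<close>

lemma measurable_translate:
  fixes v :: "'a::euclidean_space"
  shows "(translate v :: ('a \<times> 'm::{second_countable_topology, t2_space}) measure \<Rightarrow> _) \<in>
    measurable (counting_space euclidean) (counting_space euclidean)"
proof -
  let ?X = "euclidean :: ('a \<times> 'm) topology"
  let ?g = "\<lambda>(x::'a, m::'m). (x - v, m)" and ?h = "\<lambda>(x::'a, m::'m). (x + v, m)"
  have cg: "continuous_on UNIV ?g" and ch: "continuous_on UNIV ?h"
    by (auto simp: split_beta intro!: continuous_intros)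
  have gm: "?g \<in> measurable \<mu> borel" if "sets \<mu> = sets borel" for \<mu> :: "('a \<times> 'm) measure"
    using borel_measurable_continuous_onI[OF cg] measurable_cong_sets[OF that refl] by blast
  have vim: "?g -` K = ?h ` K" for K
  proof (intro equalityI subsetI)
    fix p assume "p \<in> ?g -` K"
    then have "?g p \<in> K" "p = ?h (?g p)" by (auto simp: split_beta)
    then show "p \<in> ?h ` K" by (rule rev_image_eqI)
  qed (auto simp: split_beta)
  have Cc: "(\<lambda>p. f (?g p)) \<in> Cc ?X" if f: "f \<in> Cc ?X" for f
  proof -
    have cf: "continuous_on UNIV f" and K: "compact (closure {p. f p \<noteq> 0})" using f by (auto simp: Cc_def)
    have "continuous_on UNIV (\<lambda>p. f (?g p))"
      by (rule continuous_on_compose2[OF cf cg]) auto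
    moreover have "compact (closure {p. f (?g p) \<noteq> 0})"
    proof -
      have kh: "compact (?h ` closure {p. f p \<noteq> 0})"
        by (rule compact_continuous_image[OF continuous_on_subset[OF ch] K]) simp
      have "{p. f (?g p) \<noteq> 0} \<subseteq> ?h ` closure {p. f p \<noteq> 0}"
        unfolding vim[symmetric] using closure_subset[of "{p. f p \<noteq> 0}"] by auto
      then have "closure {p. f (?g p) \<noteq> 0} \<subseteq> ?h ` closure {p. f p \<noteq> 0}"
        by (rule closure_minimal) (rule compact_imp_closed[OF kh])
      then show ?thesis using kh by (metis closed_closure compact_Int_closed inf.absorb2)
    qed
    ultimately show ?thesis by (simp add: Cc_def)
  qed
  have rad: "translate v \<mu> \<in> radon_measures ?X" if \<mu>: "\<mu> \<in> radon_measures ?X" for \<mu>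
  proof -
    have s: "sets \<mu> = sets borel" using \<mu> by (simp add: radon_measures_def sets_borel_of_euclidean)
    have "emeasure (translate v \<mu>) K < \<infinity>" if "compact K" for K
    proof -
      have "emeasure (translate v \<mu>) K = emeasure \<mu> {(x, m). (x - v, m) \<in> K}"
        by (rule translate_properties[OF s]) (simp add: that compact_imp_closed borel_closed)
      also have "{(x, m). (x - v, m) \<in> K} = ?h ` K" unfolding vim[symmetric] by auto
      also have "emeasure \<mu> (?h ` K) < \<infinity>"
      proof -
        have "compact (?h ` K)" by (rule compact_continuous_image[OF continuous_on_subset[OF ch] that]) simp
        then show ?thesis using \<mu> by (simp add: radon_measures_def)
      qed
      finally show ?thesis .
    qed
    then show ?thesis by (simp add: radon_measures_def translate_def sets_borel_of_euclidean)
  qed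
  have cnt: "translate v \<mu> \<in> counting_measures ?X" if \<mu>: "\<mu> \<in> counting_measures ?X" for \<mu>
  proof -
    note m = counting_measures_euclideanD[OF \<mu>]
    have "\<exists>k. emeasure (translate v \<mu>) A = ennreal_of_enat k" if A: "A \<in> sets borel" for A
    proof -
      have "?g -` A \<inter> space \<mu> \<in> sets \<mu>" by (rule measurable_sets[OF gm[OF m(1)] A])
      moreover have "?g -` A \<inter> space \<mu> = {(x, m). (x - v, m) \<in> A}"
        using sets_eq_imp_space_eq[OF m(1)] by auto
      ultimately have "{(x, m). (x - v, m) \<in> A} \<in> sets borel" using m(1) by simp
      then show ?thesis unfolding translate_properties[OF m(1) A] by (rule m(3))
    qed
    moreover have "translate v \<mu> \<in> radon_measures ?X" using rad \<mu> counting_measures_subset by blast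
    ultimately show ?thesis by (simp add: counting_measures_def translate_def)
  qed
  have cont: "continuous_map (vague_topology ?X) (vague_topology ?X) (translate v)"
    \<comment> \<open>Only the target topology is unfolded, so that preimages have to be examined
      for generating sets alone.\<close>
    unfolding vague_topology_def[of ?X, THEN arg_cong[where f="\<lambda>Y. continuous_map (vague_topology ?X) Y (translate v)"]]
      continuous_on_generated_topo_iff
  proof (intro conjI allI impI)
    fix U assume "U \<in> {{\<mu> \<in> radon_measures ?X. integral\<^sup>L \<mu> f \<in> U} | f U. f \<in> Cc ?X \<and> open U}"
    then obtain f V where fV: "f \<in> Cc ?X" "open V" "U = {\<mu> \<in> radon_measures ?X. integral\<^sup>L \<mu> f \<in> V}" by blast
    have int: "integral\<^sup>L (translate v \<mu>) f = integral\<^sup>L \<mu> (\<lambda>p. f (?g p))" if \<mu>: "\<mu> \<in> radon_measures ?X" for \<mu>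
    proof -
      have s: "sets \<mu> = sets borel" using \<mu> by (simp add: radon_measures_def sets_borel_of_euclidean)
      have "f \<in> borel_measurable borel" using Cc_measurable[OF fV(1)] measurable_cong_sets[OF sets_borel_of_euclidean refl] by blast
      then show ?thesis unfolding translate_def by (rule integral_distr[OF gm[OF s]])
    qed
    have "translate v -` U \<inter> topspace (vague_topology ?X) = {\<mu> \<in> radon_measures ?X. integral\<^sup>L \<mu> (\<lambda>p. f (?g p)) \<in> V}"
      using rad int unfolding topspace_vague_topology fV(3) by auto
    then show "openin (vague_topology ?X) (translate v -` U \<inter> topspace (vague_topology ?X))"
      using openin_vague[OF Cc[OF fV(1)] fV(2)] by simp
  next
    have "translate v ` topspace (vague_topology ?X) \<subseteq> topspace (vague_topology ?X)"
      using rad unfolding topspace_vague_topology by blast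
    then show "translate v ` topspace (vague_topology ?X) \<subseteq> \<Union>{{\<mu> \<in> radon_measures ?X. integral\<^sup>L \<mu> f \<in> U} | f U. f \<in> Cc ?X \<and> open U}"
      unfolding vague_topology_def by simp
  qed
  let ?Y = "subtopology (vague_topology ?X) (counting_measures ?X)"
  have top: "topspace ?Y = counting_measures ?X" using counting_measures_subset by (auto simp: topspace_vague_topology)
  have contY: "continuous_map ?Y ?Y (translate v)"
    using continuous_map_from_subtopology[OF cont] cnt top by (auto simp: continuous_map_in_subtopology)
  have sub: "{U. openin ?Y U} \<subseteq> Pow (topspace ?Y)" using openin_subset[of ?Y] by blast
  show ?thesis unfolding counting_space_def borel_of_def
  proof (rule measurable_measure_of[OF sub])
    show "translate v \<in> space (sigma (topspace ?Y) {U. openin ?Y U}) \<rightarrow> topspace ?Y"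
      unfolding space_measure_of[OF sub] using cnt top by auto
    fix y assume "y \<in> {U. openin ?Y U}"
    then have "openin ?Y {x \<in> topspace ?Y. translate v x \<in> y}" using contY by (simp add: continuous_map_def)
    moreover have "translate v -` y \<inter> space (sigma (topspace ?Y) {U. openin ?Y U}) = {x \<in> topspace ?Y. translate v x \<in> y}"
      unfolding space_measure_of[OF sub] by auto
    ultimately show "translate v -` y \<inter> space (sigma (topspace ?Y) {U. openin ?Y U}) \<in> sets (sigma (topspace ?Y) {U. openin ?Y U})"
      using sets_borel_of_openin[of ?Y "{x \<in> topspace ?Y. translate v x \<in> y}"] unfolding borel_of_def by (simp only:)
  qed
qed

section \<open>Measurability of diagrams\<close>

text \<open>The counterpart of \<open>rank_relabel_le\<close> for cycles alone; the diagram count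
  with no bound on the death is a dimension of cycles.\<close>

lemma cycles_relabel_le:
  assumes "finite V" "K \<subseteq> Pow V" "inj_on f V"
  shows "chain.dim (cycles K q :: ('v set \<Rightarrow>\<^sub>0 'f::field) set) \<le> chain.dim (cycles ((`) f ` K) q :: ('w set \<Rightarrow>\<^sub>0 'f) set)"
proof -
  let ?A = "cycles K q :: ('v set \<Rightarrow>\<^sub>0 'f) set" and ?B = "cycles ((`) f ` K) q :: ('w set \<Rightarrow>\<^sub>0 'f) set"
  interpret R: Vector_Spaces.linear chain_scale chain_scale "relabel f :: ('v set \<Rightarrow>\<^sub>0 'f) \<Rightarrow> ('w set \<Rightarrow>\<^sub>0 'f)"
    unfolding relabel_def by (rule linear_lin_ext)
  have fin: "finite \<sigma>" "inj_on f \<sigma>" if "\<sigma> \<subseteq> V" for \<sigma>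
    using that assms(1,3) by (auto intro: finite_subset inj_on_subset)
  have sub: "relabel f ` ?A \<subseteq> ?B"
  proof
    fix y assume "y \<in> relabel f ` ?A"
    then obtain c where c: "c \<in> chains K q" "boundary q c = 0" "y = relabel f c" by (auto simp: cycles_def)
    have "relabel f (boundary q c) = boundary q (relabel f c)"
      by (rule relabel_boundary) (use c(1) assms(2) fin in \<open>auto simp: chains_def\<close>)
    moreover have "relabel f c \<in> chains ((`) f ` K) q"
      by (rule relabel_in_chains[OF c(1)]) (use assms(2) fin in auto)
    ultimately show "y \<in> ?B" using c(2,3) by (auto simp: cycles_def R.zero)
  qed
  obtain C where C: "C \<subseteq> ?A" "chain.independent C" "?A \<subseteq> chain.span C" "card C = chain.dim ?A"
    by (rule chain.basis_exists)
  have "inj_on (relabel f) (chain.span C)"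
  proof (rule inj_onI)
    fix x y assume xy: "x \<in> chain.span C" "y \<in> chain.span C" and e: "relabel f x = relabel f y"
    have "x \<in> ?A" "y \<in> ?A"
      by (rule subsetD[OF chain.span_minimal[OF C(1) subspace_cycles] xy(1)], rule subsetD[OF chain.span_minimal[OF C(1) subspace_cycles] xy(2)])
    then have "x - y \<in> chains K q" by (intro chain.subspace_diff[OF subspace_chains]) (simp_all add: cycles_def)
    moreover have "relabel f (x - y) = 0" using e by (simp add: R.diff)
    ultimately have "x - y = 0" using assms(2) by (intro relabel_eq_0[OF _ assms(3)]) (auto simp: chains_def)
    then show "x = y" by simp
  qed
  then have ind: "chain.independent (relabel f ` C)" and inj: "inj_on (relabel f) C"
    by (rule R.independent_injective_image[OF C(2)], rule inj_on_subset[OF _ chain.span_superset])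
  have "finite ((`) f ` K)" using finite_subset[OF assms(2)] assms(1) by simp
  moreover have "?B \<subseteq> chains ((`) f ` K) q" by (auto simp: cycles_def)
  ultimately have "chain.dim (relabel f ` C) \<le> chain.dim ?B"
    by (rule chain_dim_mono[OF _ order_trans[OF image_mono[OF C(1)] sub]])
  moreover have "chain.dim (relabel f ` C) = card C"
    using chain.dim_eq_card_independent[OF ind] card_image[OF inj] by simp
  ultimately show ?thesis using C(4) by simp
qed

lemma cycles_relabel:
  assumes "finite V" "K \<subseteq> Pow V" "inj_on f V"
  shows "chain.dim (cycles ((`) f ` K) q :: ('w set \<Rightarrow>\<^sub>0 'f::field) set) = chain.dim (cycles K q :: ('v set \<Rightarrow>\<^sub>0 'f) set)"
proof (rule antisym)
  let ?g = "inv_into V f"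
  have "?g ` f ` \<sigma> = \<sigma>" if "\<sigma> \<in> K" for \<sigma>
    using inv_into_image_cancel[OF assms(3)] that assms(2) by auto
  then have bk: "(`) ?g ` (`) f ` K = K" by (simp add: image_image)
  have "chain.dim (cycles ((`) f ` K) q :: ('w set \<Rightarrow>\<^sub>0 'f) set) \<le> chain.dim (cycles ((`) ?g ` (`) f ` K) q :: ('v set \<Rightarrow>\<^sub>0 'f) set)"
    by (rule cycles_relabel_le[of "f ` V"]) (use assms in \<open>auto intro: inj_on_inv_into\<close>)
  then show "chain.dim (cycles ((`) f ` K) q :: ('w set \<Rightarrow>\<^sub>0 'f) set) \<le> chain.dim (cycles K q :: ('v set \<Rightarrow>\<^sub>0 'f) set)"
    by (simp only: bk)
qed (rule cycles_relabel_le[OF assms])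

lemma size_filter_mset_indicator:
  "of_nat (size {#p \<in># D. p \<in> A#}) = (\<Sum>p\<in>set_mset D. of_nat (count D p) * indicator A p :: ennreal)"
proof -
  have "size {#p \<in># D. p \<in> A#} = (\<Sum>p\<in>set_mset {#p \<in># D. p \<in> A#}. count {#p \<in># D. p \<in> A#} p)"
    by (rule size_multiset_overloaded_eq)
  also have "\<dots> = (\<Sum>p\<in>set_mset D. if p \<in> A then count D p else 0)"
    by (rule sum.mono_neutral_cong_left) auto
  finally have "of_nat (size {#p \<in># D. p \<in> A#}) = (\<Sum>p\<in>set_mset D. of_nat (if p \<in> A then count D p else 0) :: ennreal)"
    by (simp only: of_nat_sum)
  also have "\<dots> = (\<Sum>p\<in>set_mset D. of_nat (count D p) * indicator A p)"
    by (rule sum.cong) (auto simp: indicator_def)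
  finally show ?thesis .
qed

lemma size_filter_mset_suminf:
  fixes A :: "nat \<Rightarrow> 'a set"
  assumes "disjoint_family A"
  shows "suminf (\<lambda>i. of_nat (size {#p \<in># D. p \<in> A i#})) = (of_nat (size {#p \<in># D. p \<in> \<Union> (range A)#}) :: ennreal)"
proof -
  have ind: "suminf (\<lambda>i. indicator (A i) p) = (indicator (\<Union>i. A i) p :: ennreal)" for p
    by (rule suminf_indicator[OF assms])
  have "(suminf (\<lambda>i. \<Sum>p\<in>set_mset D. of_nat (count D p) * indicator (A i) p :: ennreal))
     = (\<Sum>p\<in>set_mset D. suminf (\<lambda>i. of_nat (count D p) * indicator (A i) p))"
    by (rule suminf_sum) simp
  also have "\<dots> = (\<Sum>p\<in>set_mset D. of_nat (count D p) * indicator (\<Union>i. A i) p)"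
    by (simp add: ind)
  finally show ?thesis unfolding size_filter_mset_indicator .
qed

lemma
  shows sets_diagram_measure: "sets (diagram_measure D) = sets (borel_of Delta'_top)"
    and emeasure_diagram_measure: "A \<in> sets (borel_of Delta'_top) \<Longrightarrow> emeasure (diagram_measure D) A = of_nat (size {#p \<in># D. p \<in> A#})"
proof -
  have sub: "sets (borel_of Delta'_top) \<subseteq> Pow Delta'" using sets.space_closed[of "borel_of Delta'_top"] by simp
  have sa: "sigma_algebra Delta' (sets (borel_of Delta'_top))" using sets.sigma_algebra_axioms[of "borel_of Delta'_top"] by simp
  show "sets (diagram_measure D) = sets (borel_of Delta'_top)"
    unfolding diagram_measure_def using sets_measure_of[OF sub] sigma_algebra.sigma_sets_eq[OF sa] by simp
  show "A \<in> sets (borel_of Delta'_top) \<Longrightarrow> emeasure (diagram_measure D) A = of_nat (size {#p \<in># D. p \<in> A#})"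
    unfolding diagram_measure_def
  proof (rule emeasure_measure_of_sigma[OF sa])
    show "positive (sets (borel_of Delta'_top)) (\<lambda>A. of_nat (size {#p \<in># D. p \<in> A#}))" by (simp add: positive_def)
    show "countably_additive (sets (borel_of Delta'_top)) (\<lambda>A. of_nat (size {#p \<in># D. p \<in> A#}))"
      by (rule countably_additiveI) (rule size_filter_mset_suminf)
  qed
qed

text \<open>The generators are the quadrants on which diagram counts are dimensions. They include
  infinite corners, so the whole plane is itself a quadrant.\<close>

lemma Dynkin_ereal_pairs:
  fixes A :: "(ereal \<times> ereal) set"
  assumes A: "A \<in> sets borel"
    and gen: "\<And>(a::ereal) (b::ereal). Q ({..a} \<times> {..b})" and compl: "\<And>A. A \<in> sets borel \<Longrightarrow> Q A \<Longrightarrow> Q (- A)"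
    and un: "\<And>A :: nat \<Rightarrow> _. (\<And>i. A i \<in> sets borel) \<Longrightarrow> disjoint_family A \<Longrightarrow> (\<And>i. Q (A i)) \<Longrightarrow> Q (\<Union>i. A i)"
    and empty: "Q {}"
  shows "Q A"
proof -
  define G where "G = {{..a} \<times> {..b} | (a::ereal) (b::ereal). True}"
  let ?M = "sigma UNIV G"
  have "fst \<in> borel_measurable ?M" unfolding borel_measurable_iff_Iic_ereal
  proof
    fix a :: ereal
    have "fst -` {..a} \<inter> space ?M = {..a} \<times> {..\<infinity>}" by auto
    then show "fst -` {..a} \<inter> space ?M \<in> sets ?M" by (auto simp: G_def)
  qed
  moreover have "snd \<in> borel_measurable ?M" unfolding borel_measurable_iff_Iic_ereal
  proof
    fix a :: ereal
    have "snd -` {..a} \<inter> space ?M = {..\<infinity>} \<times> {..a}" by auto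
    then show "snd -` {..a} \<inter> space ?M \<in> sets ?M" by (auto simp: G_def)
  qed
  ultimately have "(\<lambda>p. (fst p, snd p)) \<in> borel_measurable ?M" by (rule borel_measurable_Pair)
  from measurable_sets[OF this A] have AG: "A \<in> sigma_sets UNIV G" by simp
  have GB: "B \<in> sets borel" if "B \<in> sigma_sets UNIV G" for B
    using that
  proof (induction rule: sigma_sets.induct)
    case (Basic a)
    then obtain x y where "a = {..x} \<times> {..y}" by (auto simp: G_def)
    then show ?case by (simp add: borel_closed closed_Times)
  next
    case (Compl a)
    then show ?case using sets.compl_sets[of a borel] by simp
  qed auto
  have "Int_stable G"
  proof (rule Int_stableI)
    fix a b assume "a \<in> G" "b \<in> G"
    then obtain x y x' y' where "a = {..x} \<times> {..y}" "b = {..x'} \<times> {..y'}" by (auto simp: G_def)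
    then have "a \<inter> b = {..min x x'} \<times> {..min y y'}" by auto
    then show "a \<inter> b \<in> G" by (auto simp: G_def)
  qed
  moreover have "G \<subseteq> Pow UNIV" by simp
  ultimately show ?thesis using AG
  proof (induction rule: sigma_sets_induct_disjoint)
    case (basic A)
    then show ?case using gen by (auto simp: G_def)
  next
    case empty
    show ?case by (rule assms(5))
  next
    case (compl A)
    then show ?case using assms(3)[OF GB] by (simp add: Compl_eq_Diff_UNIV)
  next
    case (union A)
    then show ?case using assms(4)[of A] GB by blast
  qed
qed

text \<open>The coordinates in \<open>I\<close> are renumbered to a tuple of length
  \<open>card I\<close>. Repeated entries do no harm: the measurable representative of \<kappa>
  describes it on every tuple, not only on injective ones.\<close>

lemma measurable_kappa_component:
  fixes \<kappa> :: "'p::topological_space set \<Rightarrow> ennreal"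
  assumes \<kappa>: "measurable_set_function \<kappa>" and I: "I \<subseteq> {..<n::nat}" "I \<noteq> {}"
  shows "(\<lambda>x. \<kappa> (x ` I)) \<in> borel_measurable (PiM {..<n} (\<lambda>_. borel))"
proof -
  have fI: "finite I" using finite_subset[OF I(1)] by simp
  have cI: "1 \<le> card I" using I fI by (simp add: Suc_leI card_gt_0_iff)
  obtain g where g0: "g \<in> borel_measurable (PiM {..<card I} (\<lambda>_. borel :: 'p measure))"
    "\<forall>x\<in>space (PiM {..<card I} (\<lambda>_. borel :: 'p measure)).
       (\<forall>p. p permutes {..<card I} \<longrightarrow> g (x \<circ> p) = g x) \<and> \<kappa> (x ` {..<card I}) = g x"
    using \<kappa>[unfolded measurable_set_function_def, THEN spec, THEN mp, OF cI] by (elim bexE)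
  have g: "g \<in> borel_measurable (PiM {..<card I} (\<lambda>_. borel :: 'p measure))"
    "\<And>x. x \<in> space (PiM {..<card I} (\<lambda>_. borel :: 'p measure)) \<Longrightarrow> \<kappa> (x ` {..<card I}) = g x"
    using g0(1) bspec[OF g0(2)] by simp_all
  obtain e where e: "bij_betw e {0..<card I} I" using ex_bij_betw_nat_finite[OF fI] by blast
  define r where "r x = (\<lambda>i\<in>{..<card I}. x (e i))" for x :: "nat \<Rightarrow> 'p"
  have eI: "e i \<in> {..<n}" if "i \<in> {..<card I}" for i using e that I(1) by (auto simp: bij_betw_def)
  have rm: "r \<in> measurable (PiM {..<n} (\<lambda>_. borel)) (PiM {..<card I} (\<lambda>_. borel))"
    unfolding r_def by (rule measurable_restrict) (rule measurable_component_singleton[OF eI])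
  have "\<kappa> (x ` I) = g (r x)" if "x \<in> space (PiM {..<n} (\<lambda>_. borel))" for x
  proof -
    have "r x \<in> space (PiM {..<card I} (\<lambda>_. borel))" by (rule measurable_space[OF rm that])
    then have "g (r x) = \<kappa> (r x ` {..<card I})" by (rule g(2)[symmetric])
    also have "r x ` {..<card I} = x ` I"
    proof -
      have "r x ` {..<card I} = x ` e ` {..<card I}" by (simp add: r_def image_image)
      also have "e ` {..<card I} = I" using e by (simp add: bij_betw_def lessThan_atLeast0)
      finally show ?thesis .
    qed
    finally show ?thesis by simp
  qed
  moreover have "(\<lambda>x. g (r x)) \<in> borel_measurable (PiM {..<n} (\<lambda>_. borel))" by (rule measurable_compose[OF rm g(1)])
  ultimately show ?thesis by (rule measurable_cong[THEN iffD2])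
qed

text \<open>On injective tuples the rank is a function of the two sublevel complexes pulled back to the
  index set, and these take finitely many values.\<close>

lemma measurable_complex_function:
  fixes \<kappa> :: "'p::topological_space set \<Rightarrow> ennreal" and R :: "nat set set \<Rightarrow> nat set set \<Rightarrow> nat"
  assumes \<kappa>: "measurable_set_function \<kappa>"
  shows "(\<lambda>x. R (kappa_complex (\<lambda>I. \<kappa> (x ` I)) {..<n} a) (kappa_complex (\<lambda>I. \<kappa> (x ` I)) {..<n} b))
    \<in> measurable (PiM {..<n} (\<lambda>_. borel)) (count_space UNIV)"
proof -
  let ?N = "PiM {..<n} (\<lambda>_. borel :: 'p measure)"
  let ?L = "\<lambda>x a. kappa_complex (\<lambda>I. \<kappa> (x ` I)) {..<n} a"
  have Lm: "(\<lambda>x. ?L x a) \<in> measurable ?N (count_space (Pow (Pow {..<n})))" for a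
  proof (subst measurable_count_space_eq2)
    show "finite (Pow (Pow {..<n}))" by simp
    have ran: "(\<lambda>x. ?L x a) \<in> space ?N \<rightarrow> Pow (Pow {..<n})" by (auto simp: kappa_complex_def)
    have "(\<lambda>x. ?L x a) -` {L} \<inter> space ?N \<in> sets ?N" if L: "L \<in> Pow (Pow {..<n})" for L
    proof -
      have each: "{x \<in> space ?N. I \<in> ?L x a \<longleftrightarrow> I \<in> L} \<in> sets ?N" if "I \<in> Pow {..<n}" for I
      proof (cases "I = {}")
        case True
        then show ?thesis by (cases "{} \<in> L") (simp_all add: kappa_complex_def)
      next
        case False
        then have m: "(\<lambda>x. \<kappa> (x ` I)) \<in> borel_measurable ?N" using measurable_kappa_component[OF \<kappa>] that by simp
        have "(\<lambda>x. enn2ereal (\<kappa> (x ` I))) \<in> borel_measurable ?N" using m by measurable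
        then have s: "{x \<in> space ?N. enn2ereal (\<kappa> (x ` I)) \<le> a} \<in> sets ?N" by measurable
        have "{x \<in> space ?N. I \<in> ?L x a} = {x \<in> space ?N. enn2ereal (\<kappa> (x ` I)) \<le> a}"
          using False that by (auto simp: kappa_complex_def)
        then have s1: "{x \<in> space ?N. I \<in> ?L x a} \<in> sets ?N" using s by simp
        then have s2: "{x \<in> space ?N. \<not> I \<in> ?L x a} \<in> sets ?N" by (rule sets.sets_Collect_neg)
        show ?thesis using s1 s2 by (cases "I \<in> L") simp_all
      qed
      have "{x \<in> space ?N. \<forall>I\<in>Pow {..<n}. I \<in> ?L x a \<longleftrightarrow> I \<in> L} \<in> sets ?N"
        by (rule sets.sets_Collect_finite_All[OF each]) simp_all
      moreover have "(\<lambda>x. ?L x a) -` {L} \<inter> space ?N = {x \<in> space ?N. \<forall>I\<in>Pow {..<n}. I \<in> ?L x a \<longleftrightarrow> I \<in> L}"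
      proof -
        have "?L x a = L \<longleftrightarrow> (\<forall>I\<in>Pow {..<n}. I \<in> ?L x a \<longleftrightarrow> I \<in> L)" for x
        proof -
          have sub: "?L x a \<subseteq> Pow {..<n}" by (auto simp: kappa_complex_def)
          have "I \<in> ?L x a \<longleftrightarrow> I \<in> L" if "\<forall>I\<in>Pow {..<n}. I \<in> ?L x a \<longleftrightarrow> I \<in> L" for I
          proof (cases "I \<in> Pow {..<n}")
            case True
            then show ?thesis using that by simp
          next
            case False
            then have "I \<notin> ?L x a" "I \<notin> L" using sub L by auto
            then show ?thesis by simp
          qed
          then show ?thesis by (metis (no_types, lifting) set_eqI)
        qed
        then show ?thesis unfolding vimage_def Int_def mem_Collect_eq singleton_iff by (simp add: conj_commute)
      qed
      ultimately show ?thesis by simp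
    qed
    then show "(\<lambda>x. ?L x a) \<in> space ?N \<rightarrow> Pow (Pow {..<n}) \<and> (\<forall>L\<in>Pow (Pow {..<n}). (\<lambda>x. ?L x a) -` {L} \<inter> space ?N \<in> sets ?N)"
      using ran by blast
  qed
  have fin: "countable (Pow (Pow {..<n}))" by (simp add: countable_finite)
  show ?thesis
  proof (rule measurable_compose_countable'[where g="\<lambda>x. ?L x a" and f="\<lambda>L x. R L (?L x b)" and I="Pow (Pow {..<n})"])
    show "(\<lambda>x. R L (?L x b)) \<in> measurable ?N (count_space UNIV)" if "L \<in> Pow (Pow {..<n})" for L
      by (rule measurable_compose[OF Lm]) simp
    show "(\<lambda>x. ?L x a) \<in> measurable ?N (count_space (Pow (Pow {..<n})))" by (rule Lm)
  qed (rule fin)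
qed

lemma inj_image_kappa_complex:
  "kappa_complex \<kappa> (f ` V) a = (`) f ` kappa_complex (\<lambda>I. \<kappa> (f ` I)) V a"
  by (auto simp: kappa_complex_def subset_image_iff image_iff)

text \<open>On injective tuples the complex is a relabelling of one on the fixed index set, so
  counts over quadrants are dimensions that take measurable values there. Complements are obtained
  by subtracting from the finite total, disjoint unions by summing.\<close>

lemma measurable_diagram_count:
  fixes \<kappa> :: "'p::{second_countable_topology, t2_space} set \<Rightarrow> ennreal" and F :: "'f::field itself" and n :: nat
  assumes \<kappa>: "measurable_set_function \<kappa>" "\<forall>\<sigma>\<in>finite_subsets. \<kappa> \<sigma> < \<infinity>" and A: "A \<in> sets borel"
  defines "W \<equiv> {x \<in> space (PiM {..<n} (\<lambda>_. borel)). inj_on x {..<n}}"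
  shows "(\<lambda>x. of_nat (size {#p \<in># verbose_diagram F (kappa_filtration \<kappa> (x ` {..<n})) q. p \<in> A#}) :: ennreal)
    \<in> borel_measurable (restrict_space (PiM {..<n} (\<lambda>_. borel)) W)"
    (is "?f A \<in> borel_measurable ?M")
  using A
proof (rule Dynkin_ereal_pairs[where Q="\<lambda>A. ?f A \<in> borel_measurable ?M"])
  let ?N = "PiM {..<n} (\<lambda>_. borel :: 'p measure)"
  let ?L = "\<lambda>x a. kappa_complex (\<lambda>I. \<kappa> (x ` I)) {..<n} a"
  let ?D = "\<lambda>x. verbose_diagram F (kappa_filtration \<kappa> (x ` {..<n})) q"
  have W: "inj_on x {..<n}" "finite (x ` {..<n})" if "x \<in> space ?M" for x
    using that by (auto simp: W_def space_restrict_space)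
  have P: "?L x a \<subseteq> Pow {..<n}" for x a by (auto simp: kappa_complex_def)
  have gen: "?f ({..a} \<times> {..b}) \<in> borel_measurable ?M" for a b
  proof (cases "b = \<infinity>")
    case True
    define R where "R L L' = chain.dim (cycles L q :: (nat set \<Rightarrow>\<^sub>0 'f) set)" for L L' :: "nat set set"
    have "size {#p \<in># ?D x. p \<in> {..a} \<times> {..b}#} = R (?L x a) (?L x b)" if "x \<in> space ?M" for x
      using kappa_diagram_counts(2)[OF W(2)[OF that] \<kappa>(2), where F=F and q=q and a=a]
        cycles_relabel[OF _ P[of x a] W(1)[OF that], where 'f='f and q=q]
      by (simp add: mem_Times_iff True inj_image_kappa_complex R_def)
    moreover have "(\<lambda>x. of_nat (R (?L x a) (?L x b)) :: ennreal) \<in> borel_measurable ?M"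
      by (rule measurable_restrict_space1, rule measurable_compose[OF measurable_complex_function[OF \<kappa>(1)]]) simp
    ultimately show ?thesis by (simp cong: measurable_cong)
  next
    case False
    define R where "R L L' = chain.dim (cycles L q \<inter> boundaries L' q :: (nat set \<Rightarrow>\<^sub>0 'f) set)" for L L'
    have "size {#p \<in># ?D x. p \<in> {..a} \<times> {..b}#} = R (?L x a) (?L x b)" if "x \<in> space ?M" for x
      using kappa_diagram_counts(1)[OF W(2)[OF that] \<kappa>(2) False, where F=F and q=q and a=a]
        rank_relabel[OF _ P P W(1)[OF that], where 'f='f and q=q]
      by (simp add: mem_Times_iff inj_image_kappa_complex R_def kappa_rank_def)
    moreover have "(\<lambda>x. of_nat (R (?L x a) (?L x b)) :: ennreal) \<in> borel_measurable ?M"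
      by (rule measurable_restrict_space1, rule measurable_compose[OF measurable_complex_function[OF \<kappa>(1)]]) simp
    ultimately show ?thesis by (simp cong: measurable_cong)
  qed
  then show "?f ({..a} \<times> {..b}) \<in> borel_measurable ?M" for a b .
  have top: "?f UNIV \<in> borel_measurable ?M"
  proof -
    have "{..\<infinity>} \<times> {..\<infinity>} = (UNIV :: (ereal \<times> ereal) set)" by auto
    then show ?thesis using gen[of \<infinity> \<infinity>] by simp
  qed
  show "?f (- B) \<in> borel_measurable ?M" if "B \<in> sets borel" "?f B \<in> borel_measurable ?M" for B
  proof -
    have "?f (- B) x = ?f UNIV x - ?f B x" for x
    proof -
      have "size (?D x) = size {#p \<in># ?D x. p \<in> B#} + size {#p \<in># ?D x. p \<notin> B#}"
        by (metis multiset_partition size_union)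
      then show ?thesis by simp
    qed
    then show ?thesis using borel_measurable_minus_ennreal[OF top that(2)] by presburger
  qed
  show "?f (\<Union>i. B i) \<in> borel_measurable ?M"
    if "\<And>i. B i \<in> sets borel" "disjoint_family B" "\<And>i. ?f (B i) \<in> borel_measurable ?M" for B :: "nat \<Rightarrow> _"
    unfolding size_filter_mset_suminf[OF that(2), symmetric] by (rule borel_measurable_suminf_order) (rule that(3))
  show "?f {} \<in> borel_measurable ?M" by simp
qed

text \<open>Quantifiers over the atoms are eliminated one coordinate at a time: a nonnegative function is
  positive at some atom iff its integral is positive.\<close>

lemma measurable_exists_atom_tuple:
  fixes U :: "'w \<Rightarrow> 'p::{second_countable_topology, t2_space} measure"
  assumes U: "U \<in> measurable M (subprob_algebra borel)"
    and atoms: "\<And>\<omega>. \<omega> \<in> space M \<Longrightarrow> finite {y. emeasure (U \<omega>) {y} \<noteq> 0}"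
      "\<And>\<omega>. \<omega> \<in> space M \<Longrightarrow> emeasure (U \<omega>) (- {y. emeasure (U \<omega>) {y} \<noteq> 0}) = 0"
    and G: "G \<in> borel_measurable (M \<Otimes>\<^sub>M PiM {..<k::nat} (\<lambda>_. borel))"
  shows "{\<omega> \<in> space M. \<exists>x\<in>PiE {..<k} (\<lambda>_. {y. emeasure (U \<omega>) {y} \<noteq> 0}). (0::ennreal) < G (\<omega>, x)} \<in> sets M"
  using G
proof (induction k arbitrary: G)
  case 0
  have "(\<lambda>\<omega>. (\<omega>, \<lambda>_::nat. undefined :: 'p)) \<in> measurable M (M \<Otimes>\<^sub>M PiM {..<0} (\<lambda>_. borel))"
    by (intro measurable_Pair measurable_ident_sets[OF refl] measurable_const) (unfold space_PiM lessThan_0 PiE_empty_domain, simp)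
  then have "(\<lambda>\<omega>. G (\<omega>, \<lambda>_. undefined)) \<in> borel_measurable M" by (rule measurable_compose[OF _ "0.prems"])
  then show ?case by simp
next
  case (Suc k)
  let ?D = "\<lambda>\<omega>. {y. emeasure (U \<omega>) {y} \<noteq> 0}"
  define G' where "G' z = (\<integral>\<^sup>+y. G (fst z, (snd z)(k := y)) \<partial>U (fst z))" for z
  have ins: "{..<Suc k} = insert k {..<k}" by auto
  have upd: "(\<lambda>p. (fst (fst p), (snd (fst p))(k := snd p))) \<in>
    measurable ((M \<Otimes>\<^sub>M PiM {..<k} (\<lambda>_. borel :: 'p measure)) \<Otimes>\<^sub>M borel) (M \<Otimes>\<^sub>M PiM {..<Suc k} (\<lambda>_. borel))"
  proof (rule measurable_Pair)
    have "(\<lambda>p. (snd (fst p), snd p)) \<in> measurable ((M \<Otimes>\<^sub>M PiM {..<k} (\<lambda>_. borel :: 'p measure)) \<Otimes>\<^sub>M borel) (PiM {..<k} (\<lambda>_. borel) \<Otimes>\<^sub>M borel)"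
      by measurable
    from measurable_compose[OF this measurable_add_dim[of k "{..<k}" "\<lambda>_. borel"]]
    show "(\<lambda>p. (snd (fst p))(k := snd p)) \<in> measurable ((M \<Otimes>\<^sub>M PiM {..<k} (\<lambda>_. borel :: 'p measure)) \<Otimes>\<^sub>M borel) (PiM {..<Suc k} (\<lambda>_. borel))"
      unfolding ins by simp
  qed measurable
  have fm: "(\<lambda>(z, y). G (fst z, (snd z)(k := y))) \<in> borel_measurable ((M \<Otimes>\<^sub>M PiM {..<k} (\<lambda>_. borel)) \<Otimes>\<^sub>M borel)"
    using measurable_compose[OF upd Suc.prems] by (simp add: split_beta')
  have G'm: "G' \<in> borel_measurable (M \<Otimes>\<^sub>M PiM {..<k} (\<lambda>_. borel))"
    unfolding G'_def
    by (rule nn_integral_measurable_subprob_algebra2[OF fm measurable_compose[OF measurable_fst U]])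
  \<comment> \<open>With no mass off the atoms the integral is a finite sum with nonzero weights,
    which vanishes only if every term does.\<close>
  have pos: "0 < G' (\<omega>, x) \<longleftrightarrow> (\<exists>y\<in>?D \<omega>. 0 < G (\<omega>, x(k := y)))" if w: "\<omega> \<in> space M" for \<omega> x
  proof -
    have s: "sets (U \<omega>) = sets borel" using sets_kernel[OF U w] .
    have x: "(\<omega>, x) \<in> space (M \<Otimes>\<^sub>M PiM {..<k} (\<lambda>_. borel))" if "x \<in> space (PiM {..<k} (\<lambda>_. borel :: 'p measure))"
      using w that by (simp add: space_pair_measure)
    have Dm: "- ?D \<omega> \<in> sets borel" "?D \<omega> \<in> sets borel" using atoms(1)[OF w] by (simp_all add: borel_closed finite_imp_closed borel_open)
    have "G' (\<omega>, x) = (\<integral>\<^sup>+y. G (\<omega>, x(k := y)) * indicator (?D \<omega>) y \<partial>U \<omega>)"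
      unfolding G'_def fst_conv snd_conv
    proof (rule nn_integral_cong_AE, rule AE_I')
      show "- ?D \<omega> \<in> null_sets (U \<omega>)" using atoms(2)[OF w] Dm s by (simp add: null_sets_def)
      show "{y \<in> space (U \<omega>). G (\<omega>, x(k := y)) \<noteq> G (\<omega>, x(k := y)) * indicator (?D \<omega>) y} \<subseteq> - ?D \<omega>"
        by (auto simp: indicator_def)
    qed
    also have "\<dots> = (\<integral>\<^sup>+y. (\<Sum>z\<in>?D \<omega>. G (\<omega>, x(k := z)) * indicator {z} y) \<partial>U \<omega>)"
    proof (rule nn_integral_cong)
      fix y
      have "(\<Sum>z\<in>?D \<omega>. G (\<omega>, x(k := z)) * indicator {z} y) = (\<Sum>z\<in>?D \<omega>. if z = y then G (\<omega>, x(k := y)) else 0)"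
        by (rule sum.cong) (auto simp: indicator_def)
      also have "\<dots> = G (\<omega>, x(k := y)) * indicator (?D \<omega>) y"
        unfolding sum.delta[OF atoms(1)[OF w]] by (simp add: indicator_def)
      finally show "G (\<omega>, x(k := y)) * indicator (?D \<omega>) y = (\<Sum>z\<in>?D \<omega>. G (\<omega>, x(k := z)) * indicator {z} y)" by simp
    qed
    also have "\<dots> = (\<Sum>z\<in>?D \<omega>. \<integral>\<^sup>+y. G (\<omega>, x(k := z)) * indicator {z} y \<partial>U \<omega>)"
      by (rule nn_integral_sum) (use s in \<open>auto intro!: borel_measurable_times borel_measurable_indicator\<close>)
    also have "\<dots> = (\<Sum>z\<in>?D \<omega>. G (\<omega>, x(k := z)) * emeasure (U \<omega>) {z})"
      by (rule sum.cong) (use s in \<open>auto simp: nn_integral_cmult_indicator\<close>)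
    finally have e: "G' (\<omega>, x) = (\<Sum>z\<in>?D \<omega>. G (\<omega>, x(k := z)) * emeasure (U \<omega>) {z})" .
    have "G' (\<omega>, x) = 0 \<longleftrightarrow> (\<forall>z\<in>?D \<omega>. G (\<omega>, x(k := z)) * emeasure (U \<omega>) {z} = 0)"
      unfolding e by (rule sum_nonneg_eq_0_iff[OF atoms(1)[OF w]]) simp
    also have "\<dots> \<longleftrightarrow> (\<forall>z\<in>?D \<omega>. G (\<omega>, x(k := z)) = 0)" by auto
    finally show ?thesis by (auto simp: zero_less_iff_neq_zero)
  qed
  have "(\<exists>x\<in>PiE {..<Suc k} (\<lambda>_. ?D \<omega>). 0 < G (\<omega>, x)) \<longleftrightarrow> (\<exists>x\<in>PiE {..<k} (\<lambda>_. ?D \<omega>). 0 < G' (\<omega>, x))"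
    if w: "\<omega> \<in> space M" for \<omega>
    unfolding ins PiE_insert_eq pos[OF w] by auto
  then have "{\<omega> \<in> space M. \<exists>x\<in>PiE {..<Suc k} (\<lambda>_. ?D \<omega>). 0 < G (\<omega>, x)} =
    {\<omega> \<in> space M. \<exists>x\<in>PiE {..<k} (\<lambda>_. ?D \<omega>). 0 < G' (\<omega>, x)}" by auto
  then show ?case using Suc.IH[OF G'm] by simp
qed

section \<open>Marked points and almost sure measurability of the diagram\<close>

lemma measurable_fst_borel: "fst \<in> measurable (borel :: ('a::topological_space \<times> 'b::topological_space) measure) borel"
  by (rule borel_measurable_continuous_onI) (intro continuous_intros)

lemma emeasure_ground:
  fixes \<mu> :: "('a::euclidean_space \<times> 'm::{second_countable_topology, t2_space}) measure"
  assumes "sets \<mu> = sets borel" "A \<in> sets borel"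
  shows "emeasure (ground \<mu>) A = emeasure \<mu> (A \<times> UNIV)" "A \<times> (UNIV :: 'm set) \<in> sets borel"
proof -
  have m: "fst \<in> measurable \<mu> borel" using measurable_fst_borel measurable_cong_sets[OF assms(1) refl] by blast
  have sp: "space \<mu> = UNIV" using sets_eq_imp_space_eq[OF assms(1)] by simp
  have e: "fst -` A \<inter> space \<mu> = A \<times> UNIV" using sp by auto
  show "emeasure (ground \<mu>) A = emeasure \<mu> (A \<times> UNIV)"
    unfolding ground_def emeasure_distr[OF m assms(2)] e ..
  show "A \<times> (UNIV :: 'm set) \<in> sets borel" using measurable_sets[OF m assms(2)] e assms(1) by simp
qed

text \<open>Over each position the ground measure has mass at most 1, so an atom of the marked
  measure has mass exactly 1 and no second atom shares its position. Hence the measure of a Borel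
  set over \<Lambda> is a cardinality.\<close>

lemma marked_points_counting:
  fixes \<mu> :: "('a::euclidean_space \<times> 'm::{second_countable_topology, t2_space}) measure"
  assumes \<mu>: "\<mu> \<in> counting_measures euclidean" and \<Lambda>: "\<Lambda> \<in> sets borel" and fin: "emeasure (ground \<mu>) \<Lambda> < \<infinity>"
    and simple: "\<And>x. emeasure (ground \<mu>) {x} \<le> 1"
  shows "finite_simple_marked_set (marked_points \<mu> \<Lambda>)"
    "B \<in> sets borel \<Longrightarrow> B \<subseteq> \<Lambda> \<times> UNIV \<Longrightarrow> emeasure \<mu> B = of_nat (card (marked_points \<mu> \<Lambda> \<inter> B))"
proof -
  note m = counting_measures_euclideanD[OF \<mu>]
  let ?LM = "\<Lambda> \<times> (UNIV :: 'm set)" and ?X = "marked_points \<mu> \<Lambda>"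
  note LM = emeasure_ground[OF m(1) \<Lambda>]
  \<comment> \<open>Restriction by a density keeps the Borel sigma-algebra of the whole space, on
    which \<open>counting_measure_atomic\<close> is formulated.\<close>
  define \<nu> where "\<nu> = density \<mu> (indicator ?LM)"
  have e: "emeasure \<nu> A = emeasure \<mu> (?LM \<inter> A)" if "A \<in> sets borel" for A
    unfolding \<nu>_def using LM(2) that m(1) by (intro emeasure_restricted) auto
  have s: "sets \<nu> = sets borel" by (simp add: \<nu>_def m(1))
  have int: "\<exists>k. emeasure \<nu> A = ennreal_of_enat k" if "A \<in> sets borel" for A
    unfolding e[OF that] by (rule m(3)) (use LM(2) that in auto)
  have finU: "emeasure \<nu> UNIV < \<infinity>" using fin LM(1) e[of UNIV] by simp
  have X: "{z. emeasure \<nu> {z} \<noteq> 0} = ?X"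
  proof -
    have "emeasure \<nu> {z} = (if fst z \<in> \<Lambda> then emeasure \<mu> {z} else 0)" for z
    proof -
      have "?LM \<inter> {z} = (if fst z \<in> \<Lambda> then {z} else {})" by (cases z) auto
      then show ?thesis using e[of "{z}"] by simp
    qed
    then show ?thesis by (auto simp: marked_points_def)
  qed
  note at = counting_measure_atomic[OF s finU int, unfolded X]
  have one: "emeasure \<mu> {z} = 1" if z: "z \<in> ?X" for z
  proof (rule antisym)
    have "emeasure \<mu> {z} \<le> emeasure \<mu> ({fst z} \<times> UNIV)"
      by (rule emeasure_mono) (use emeasure_ground(2)[OF m(1), of "{fst z}"] m(1) in \<open>auto simp: mem_Times_iff\<close>)
    also have "\<dots> = emeasure (ground \<mu>) {fst z}" by (rule emeasure_ground(1)[OF m(1), symmetric]) simp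
    also have "\<dots> \<le> 1" by (rule simple)
    finally show "emeasure \<mu> {z} \<le> 1" .
    obtain k where k: "emeasure \<mu> {z} = ennreal_of_enat k" using m(3)[of "{z}"] by auto
    have "emeasure \<mu> {z} \<noteq> 0" using z by (simp add: marked_points_def)
    then show "1 \<le> emeasure \<mu> {z}" using enat_less_1[of k] k by (metis not_less)
  qed
  have "inj_on fst ?X"
  proof (rule inj_onI, rule ccontr)
    fix z w assume zw: "z \<in> ?X" "w \<in> ?X" "fst z = fst w" "z \<noteq> w"
    have "2 = emeasure \<mu> {z} + emeasure \<mu> {w}" using one zw(1,2) by simp
    also have "\<dots> = emeasure \<mu> ({z} \<union> {w})" by (rule plus_emeasure) (use zw m(1) in auto)
    also have "\<dots> \<le> emeasure \<mu> ({fst z} \<times> UNIV)"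
      by (rule emeasure_mono) (use emeasure_ground(2)[OF m(1), of "{fst z}"] m(1) zw(3) in \<open>auto simp: mem_Times_iff\<close>)
    also have "\<dots> = emeasure (ground \<mu>) {fst z}" by (rule emeasure_ground(1)[OF m(1), symmetric]) simp
    also have "\<dots> \<le> 1" by (rule simple)
    finally show False by simp
  qed
  then show "finite_simple_marked_set ?X" using at(1) by (simp add: finite_simple_marked_set_def)
  show "emeasure \<mu> B = of_nat (card (?X \<inter> B))" if B: "B \<in> sets borel" "B \<subseteq> ?LM"
  proof -
    have Xm: "?X \<in> sets borel" using at(1) by (simp add: borel_closed finite_imp_closed)
    have "emeasure \<mu> B = emeasure \<nu> B" using e[OF B(1)] B(2) by (simp add: Int_absorb1)
    also have "\<dots> = emeasure \<nu> (?X \<inter> B) + emeasure \<nu> (B - ?X)"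
      by (subst plus_emeasure) (use B(1) Xm s in \<open>auto intro!: arg_cong[where f="emeasure \<nu>"]\<close>)
    also have "emeasure \<nu> (B - ?X) = 0"
    proof -
      have "emeasure \<nu> (B - ?X) \<le> emeasure \<nu> (- ?X)" by (rule emeasure_mono) (use Xm s in auto)
      then show ?thesis using at(2) by simp
    qed
    also have "emeasure \<nu> (?X \<inter> B) = (\<Sum>z\<in>?X \<inter> B. emeasure \<nu> {z})"
      by (rule emeasure_eq_sum_singleton) (use at(1) s in auto)
    also have "\<dots> = (\<Sum>z\<in>?X \<inter> B. 1)"
    proof (rule sum.cong)
      fix z assume z: "z \<in> ?X \<inter> B"
      then have "?LM \<inter> {z} = {z}" by (auto simp: marked_points_def)
      then show "emeasure \<nu> {z} = 1" using e[of "{z}"] one z by simp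
    qed simp
    finally show ?thesis by simp
  qed
qed

lemma marked_point_processD:
  assumes "marked_point_process P \<Phi>" "\<omega> \<in> space P"
  shows "\<Phi> \<omega> \<in> counting_measures euclidean" "ground (\<Phi> \<omega>) \<in> counting_measures euclidean"
    "bounded \<Lambda> \<Longrightarrow> emeasure (ground (\<Phi> \<omega>)) \<Lambda> < \<infinity>"
proof -
  show "\<Phi> \<omega> \<in> counting_measures euclidean" "ground (\<Phi> \<omega>) \<in> counting_measures euclidean"
    using assms measurable_space[of _ P "counting_space euclidean" \<omega>]
    by (force simp: marked_point_process_def point_process_def space_counting_space)+
  then have g: "emeasure (ground (\<Phi> \<omega>)) (closure \<Lambda>) < \<infinity>" if "bounded \<Lambda>"
    using counting_measures_euclideanD(2)[of "ground (\<Phi> \<omega>)" "closure \<Lambda>"] that by (simp add: compact_closure)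
  show "emeasure (ground (\<Phi> \<omega>)) \<Lambda> < \<infinity>" if "bounded \<Lambda>"
  proof -
    have "emeasure (ground (\<Phi> \<omega>)) \<Lambda> \<le> emeasure (ground (\<Phi> \<omega>)) (closure \<Lambda>)"
      by (rule emeasure_mono) (auto simp: ground_def closure_subset)
    then show ?thesis using g[OF that] by (rule le_less_trans)
  qed
qed

lemma closed_ereal_order_pairs: "closed {p :: ereal \<times> ereal. 0 \<le> fst p \<and> fst p \<le> snd p}"
  unfolding Collect_conj_eq by (intro closed_Int closed_Collect_le continuous_intros)

lemma Delta'_eq: "Delta' = {p. 0 \<le> fst p \<and> fst p \<le> snd p} - {(\<infinity>, \<infinity>)}"
  by (auto simp: Delta'_def)

lemma sets_borel_of_Delta'_subset:
  assumes "A \<in> sets (borel_of Delta'_top)"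
  shows "A \<in> sets borel"
proof -
  have "Delta' \<in> sets borel" unfolding Delta'_eq using closed_ereal_order_pairs by (intro sets.Diff borel_closed) auto
  then show ?thesis using assms unfolding sets_borel_of_top_of_set by (auto simp: sets_restrict_space)
qed

text \<open>The number of points over \<Lambda> is measurable, and on the event that it equals
  \<open>n\<close> the diagram is read off any injective \<open>n\<close>-tuple of atoms. The
  existence of a tuple with a prescribed diagram count is a measurable event by
  \<open>measurable_exists_atom_tuple\<close>. Almost sure equality is what simplicity of the ground
  process allows.\<close>

lemma verbose_process_AE_measurable:
  fixes \<Phi> :: "'w \<Rightarrow> (('a::euclidean_space) \<times> 'm::{second_countable_topology, t2_space}) measure"
    and F :: "'f::field itself"
  assumes lc: "locally_compact_space (euclidean :: 'm topology)" and \<Phi>: "marked_point_process P \<Phi>"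
    and \<kappa>: "measurable_set_function \<kappa>" "\<forall>\<sigma>\<in>finite_subsets. \<kappa> \<sigma> < \<infinity>"
    and \<Lambda>: "\<Lambda> \<in> sets borel" "bounded \<Lambda>" and A: "A \<in> sets (borel_of Delta'_top)"
  shows "\<exists>h\<in>borel_measurable P. AE \<omega> in P. emeasure (verbose_process F \<kappa> \<Phi> q \<Lambda> \<omega>) A = h \<omega>"
proof -
  let ?LM = "\<Lambda> \<times> (UNIV :: 'm set)"
  have lcp: "locally_compact_space (euclidean :: ('a \<times> 'm) topology)"
  proof -
    have "locally_compact_space (prod_topology (euclidean :: 'a topology) (euclidean :: 'm topology))"
      unfolding locally_compact_space_prod_topology using lc locally_compact_space_euclidean[where 'a='a] by simp
    then show ?thesis by simp
  qed
  have \<Phi>m: "\<Phi> \<in> measurable P (counting_space euclidean)" using \<Phi> by (simp add: marked_point_process_def point_process_def)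
  have ev: "(\<lambda>\<omega>. emeasure (\<Phi> \<omega>) B) \<in> borel_measurable P" if "B \<in> sets borel" for B
    by (rule measurable_compose[OF \<Phi>m measurable_emeasure_euclidean[OF lcp that]])
  note c1 = marked_point_processD(1)[OF \<Phi>]
  have cs: "sets (\<Phi> \<omega>) = sets borel" if "\<omega> \<in> space P" for \<omega> by (rule counting_measures_euclideanD(1)[OF c1[OF that]])
  have "fst \<in> measurable (borel :: ('a \<times> 'm) measure) borel" by (rule measurable_fst_borel)
  from measurable_sets[OF this \<Lambda>(1)] have LM: "?LM \<in> sets borel" by (simp add: vimage_fst)
  define c where "c \<omega> = emeasure (\<Phi> \<omega>) ?LM" for \<omega>
  have cm: "c \<in> borel_measurable P" unfolding c_def by (rule ev[OF LM])
  have cf: "c \<omega> < \<infinity>" if w: "\<omega> \<in> space P" for \<omega>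
    using marked_point_processD(3)[OF \<Phi> w \<Lambda>(2)] emeasure_ground(1)[OF cs[OF w] \<Lambda>(1)] by (simp add: c_def)
  define \<nu> where "\<nu> \<omega> = density (\<Phi> \<omega>) (indicator ?LM)" for \<omega>
  have \<nu>: "sets (\<nu> \<omega>) = sets borel" "B \<in> sets borel \<Longrightarrow> emeasure (\<nu> \<omega>) B = emeasure (\<Phi> \<omega>) (?LM \<inter> B)"
    if w: "\<omega> \<in> space P" for \<omega> B
    using cs[OF w] LM by (auto simp: \<nu>_def intro!: emeasure_restricted)
  have \<nu>at: "finite {y. emeasure (\<nu> \<omega>) {y} \<noteq> 0}" "emeasure (\<nu> \<omega>) (- {y. emeasure (\<nu> \<omega>) {y} \<noteq> 0}) = 0"
    if w: "\<omega> \<in> space P" for \<omega>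
  proof -
    have "\<exists>k. emeasure (\<nu> \<omega>) B = ennreal_of_enat k" if "B \<in> sets borel" for B
      unfolding \<nu>(2)[OF w that] by (rule counting_measures_euclideanD(3)[OF c1[OF w]]) (use LM that in auto)
    moreover have "emeasure (\<nu> \<omega>) UNIV < \<infinity>" using cf[OF w] \<nu>(2)[OF w, of UNIV] by (simp add: c_def)
    ultimately show "finite {y. emeasure (\<nu> \<omega>) {y} \<noteq> 0}" "emeasure (\<nu> \<omega>) (- {y. emeasure (\<nu> \<omega>) {y} \<noteq> 0}) = 0"
      using counting_measure_atomic[OF \<nu>(1)[OF w]] by blast+
  qed
  \<comment> \<open>Normalised to mass at most 1, since kernels are taken in
    \<open>subprob_algebra\<close>, and set to zero off the event of having exactly \<open>n\<close>
    points. For \<open>n = 0\<close> the factor is infinite but multiplies a measure without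
    mass.\<close>
  define U where "U n \<omega> = (if c \<omega> = of_nat n then scale_measure (1 / of_nat n) (\<nu> \<omega>) else null_measure borel)" for n :: nat and \<omega>
  have Us: "sets (U n \<omega>) = sets borel" if "\<omega> \<in> space P" for n \<omega> using \<nu>(1)[OF that] by (simp add: U_def)
  have Ue: "emeasure (U n \<omega>) B = (if c \<omega> = of_nat n then (1 / of_nat n) * emeasure (\<Phi> \<omega>) (?LM \<inter> B) else 0)"
    if "\<omega> \<in> space P" "B \<in> sets borel" for n \<omega> B using \<nu>(2)[OF that] by (simp add: U_def)
  have Um: "U n \<in> measurable P (subprob_algebra borel)" for n
  proof (rule measurable_subprob_algebra)
    fix \<omega> assume w: "\<omega> \<in> space P"
    show "sets (U n \<omega>) = sets borel" by (rule Us[OF w])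
    have sp: "space (U n \<omega>) = UNIV" using sets_eq_imp_space_eq[OF Us[OF w]] by simp
    have "emeasure (U n \<omega>) UNIV \<le> 1"
    proof (cases "c \<omega> = of_nat n")
      case True
      then have "emeasure (U n \<omega>) UNIV = (1 / of_nat n) * of_nat n" using Ue[OF w, of UNIV n] by (simp add: c_def)
      also have "\<dots> \<le> 1"
      proof (cases "n = 0")
        case False
        have "(1 / of_nat n) * of_nat n = (of_nat n / of_nat n :: ennreal)" by (simp add: divide_ennreal_def mult.commute)
        also have "\<dots> = 1" by (rule ennreal_divide_self) (use False of_nat_less_top[of n] in auto)
        finally show ?thesis by simp
      qed simp
      finally show ?thesis .
    next
      case False
      then show ?thesis using Ue[OF w, of UNIV n] by simp
    qed
    then show "subprob_space (U n \<omega>)" by (intro subprob_spaceI) (simp_all add: sp)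
  next
    fix B :: "('a \<times> 'm) set" assume B: "B \<in> sets borel"
    have "(\<lambda>\<omega>. if c \<omega> = of_nat n then (1 / of_nat n) * emeasure (\<Phi> \<omega>) (?LM \<inter> B) else 0) \<in> borel_measurable P"
    proof (rule measurable_If)
      show "{\<omega> \<in> space P. c \<omega> = of_nat n} \<in> sets P" using cm by (intro borel_measurable_eq borel_measurable_const)
      show "(\<lambda>\<omega>. 1 / of_nat n * emeasure (\<Phi> \<omega>) (?LM \<inter> B)) \<in> borel_measurable P"
        using ev[of "?LM \<inter> B"] LM B by (intro borel_measurable_times_ennreal borel_measurable_const) auto
    qed simp
    then show "(\<lambda>\<omega>. emeasure (U n \<omega>) B) \<in> borel_measurable P"
      by (rule measurable_cong[THEN iffD1, rotated]) (simp add: Ue[OF _ B])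
  qed
  have Uat: "{y. emeasure (U n \<omega>) {y} \<noteq> 0} = (if c \<omega> = of_nat n then {y. emeasure (\<nu> \<omega>) {y} \<noteq> 0} else {})"
    if w: "\<omega> \<in> space P" for n \<omega>
    using Ue[OF w, of "{_}" n] \<nu>(2)[OF w, of "{_}"] by (auto simp: ennreal_divide_eq_0_iff)
  have Ufin: "finite {y. emeasure (U n \<omega>) {y} \<noteq> 0}" if w: "\<omega> \<in> space P" for n \<omega>
    unfolding Uat[OF w] using \<nu>at(1)[OF w] by simp
  have U0: "emeasure (U n \<omega>) (- {y. emeasure (U n \<omega>) {y} \<noteq> 0}) = 0" if w: "\<omega> \<in> space P" for n \<omega>
    unfolding Uat[OF w] using \<nu>at(2)[OF w] by (simp add: U_def)
  define D where "D X = verbose_diagram F (kappa_filtration \<kappa> X) q" for X :: "('a \<times> 'm) set"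
  define cnt where "cnt X = size {#p \<in># D X. p \<in> A#}" for X
  define N where "N n = PiM {..<n::nat} (\<lambda>_. borel :: ('a \<times> 'm) measure)" for n
  define H where "H n j = {x \<in> space (N n). inj_on x {..<n} \<and> cnt (x ` {..<n}) = j}" for n j
  have Hm: "H n j \<in> sets (N n)" for n j
  proof -
    define W where "W = {x \<in> space (N n). inj_on x {..<n}}"
    have "{x \<in> space (N n). \<forall>i\<in>{..<n}. \<forall>k\<in>{..<n}. x i = x k \<longrightarrow> i = k} \<in> sets (N n)"
    proof (intro sets.sets_Collect_finite_All finite_lessThan)
      fix i k assume "i \<in> {..<n}" "k \<in> {..<n}"
      then have "(\<lambda>x. (x i, x k)) \<in> borel_measurable (N n)"
        unfolding N_def by (intro borel_measurable_Pair measurable_component_singleton)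
      moreover have "{p :: ('a \<times> 'm) \<times> ('a \<times> 'm). fst p = snd p} \<in> sets borel"
        by (intro borel_closed closed_Collect_eq continuous_intros)
      ultimately have "(\<lambda>x. (x i, x k)) -` {p. fst p = snd p} \<inter> space (N n) \<in> sets (N n)" by (rule measurable_sets)
      moreover have "(\<lambda>x. (x i, x k)) -` {p. fst p = snd p} \<inter> space (N n) = {x \<in> space (N n). x i = x k}" by auto
      ultimately have "{x \<in> space (N n). x i = x k} \<in> sets (N n)" by simp
      then have "{x \<in> space (N n). \<not> x i = x k} \<in> sets (N n)" by (rule sets.sets_Collect_neg)
      then show "{x \<in> space (N n). x i = x k \<longrightarrow> i = k} \<in> sets (N n)" by (cases "i = k") simp_all
    qed
    then have Wm: "W \<in> sets (N n)" by (simp add: W_def inj_on_def)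
    have "(\<lambda>x. of_nat (cnt (x ` {..<n})) :: ennreal) \<in> borel_measurable (restrict_space (N n) W)"
      unfolding cnt_def D_def N_def W_def by (rule measurable_diagram_count[OF \<kappa> sets_borel_of_Delta'_subset[OF A]])
    then have "{x \<in> space (restrict_space (N n) W). of_nat (cnt (x ` {..<n})) = (of_nat j :: ennreal)} \<in> sets (restrict_space (N n) W)"
      by (intro borel_measurable_eq borel_measurable_const)
    moreover have "{x \<in> space (restrict_space (N n) W). of_nat (cnt (x ` {..<n})) = (of_nat j :: ennreal)} = H n j"
      by (auto simp: space_restrict_space H_def W_def)
    moreover have "W \<inter> space (N n) \<in> sets (N n)" using Wm by auto
    ultimately show ?thesis using sets_restrict_space_iff by metis
  qed
  \<comment> \<open>The event that there are \<open>n\<close> points and that some injective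
    enumeration of them has \<open>j\<close> diagram points in \<open>A\<close>. Any such
    enumeration exhausts the points, so its choice does not influence \<open>j\<close>.\<close>
  define S where "S n j = {\<omega> \<in> space P. c \<omega> = of_nat n \<and>
    (\<exists>x\<in>PiE {..<n} (\<lambda>_. {y. emeasure (U n \<omega>) {y} \<noteq> 0}). 0 < (indicator (H n j) x :: ennreal))}" for n j
  have Sm: "S n j \<in> sets P" for n j
  proof -
    have "(\<lambda>z. indicator (H n j) (snd z) :: ennreal) \<in> borel_measurable (P \<Otimes>\<^sub>M N n)"
      using Hm by (intro measurable_compose[OF measurable_snd] borel_measurable_indicator)
    from measurable_exists_atom_tuple[OF Um Ufin U0 this[unfolded N_def]]
    have "{\<omega> \<in> space P. \<exists>x\<in>PiE {..<n} (\<lambda>_. {y. emeasure (U n \<omega>) {y} \<noteq> 0}). 0 < (indicator (H n j) x :: ennreal)} \<in> sets P"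
      by simp
    moreover have "{\<omega> \<in> space P. c \<omega> = of_nat n} \<in> sets P" using cm by (intro borel_measurable_eq borel_measurable_const)
    moreover have "S n j = {\<omega> \<in> space P. c \<omega> = of_nat n} \<inter> {\<omega> \<in> space P. \<exists>x\<in>PiE {..<n} (\<lambda>_. {y. emeasure (U n \<omega>) {y} \<noteq> 0}). 0 < (indicator (H n j) x :: ennreal)}"
      by (auto simp: S_def)
    ultimately show ?thesis by simp
  qed
  \<comment> \<open>For almost every outcome exactly one pair \<open>(n, j)\<close> has its event
    satisfied, so the double supremum returns the corresponding \<open>j\<close>.\<close>
  define h where "h \<omega> = (SUP n. SUP j. of_nat j * indicator (S n j) \<omega> :: ennreal)" for \<omega>
  have hm: "h \<in> borel_measurable P" unfolding h_def
    using Sm by (intro borel_measurable_SUP borel_measurable_times_ennreal borel_measurable_const borel_measurable_indicator) auto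
  have "AE \<omega> in P. \<forall>x. emeasure (ground (\<Phi> \<omega>)) {x} \<le> 1"
    using \<Phi> by (simp add: marked_point_process_def simple_process_def)
  then have "AE \<omega> in P. emeasure (verbose_process F \<kappa> \<Phi> q \<Lambda> \<omega>) A = h \<omega>"
  proof (rule AE_mp, intro AE_I2 impI)
    fix \<omega> assume w: "\<omega> \<in> space P" and simple: "\<forall>x. emeasure (ground (\<Phi> \<omega>)) {x} \<le> 1"
    let ?X = "marked_points (\<Phi> \<omega>) \<Lambda>"
    note X = marked_points_counting[OF c1[OF w] \<Lambda>(1) marked_point_processD(3)[OF \<Phi> w \<Lambda>(2)], OF simple[rule_format]]
    have finX: "finite ?X" using X(1) by (simp add: finite_simple_marked_set_def)
    have XLM: "?X \<inter> ?LM = ?X" by (auto simp: marked_points_def)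
    have cX: "c \<omega> = of_nat (card ?X)" using X(2)[OF LM] XLM by (simp add: c_def)
    have atX: "{y. emeasure (\<nu> \<omega>) {y} \<noteq> 0} = ?X"
    proof -
      have "emeasure (\<nu> \<omega>) {z} = (if fst z \<in> \<Lambda> then emeasure (\<Phi> \<omega>) {z} else 0)" for z
      proof -
        have "?LM \<inter> {z} = (if fst z \<in> \<Lambda> then {z} else {})" by (cases z) auto
        then show ?thesis using \<nu>(2)[OF w, of "{z}"] by simp
      qed
      then show ?thesis by (auto simp: marked_points_def)
    qed
    have ip: "0 < (indicator B x :: ennreal) \<longleftrightarrow> x \<in> B" for B and x :: "nat \<Rightarrow> 'a \<times> 'm"
      by (simp add: indicator_def)
    have iff: "\<omega> \<in> S n j \<longleftrightarrow> n = card ?X \<and> j = cnt ?X" for n j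
    proof
      assume S: "\<omega> \<in> S n j"
      then have cn: "c \<omega> = of_nat n" by (simp add: S_def)
      then have n: "n = card ?X" using cX by (metis of_nat_eq_iff)
      have at: "{y. emeasure (U n \<omega>) {y} \<noteq> 0} = ?X" using Uat[OF w, of n] cn atX by simp
      have "\<exists>x\<in>PiE {..<n} (\<lambda>_. ?X). x \<in> H n j"
        using S unfolding S_def mem_Collect_eq at ip by blast
      then obtain x where x: "x \<in> PiE {..<n} (\<lambda>_. ?X)" "inj_on x {..<n}" "cnt (x ` {..<n}) = j" by (auto simp: H_def)
      have "x ` {..<n} = ?X"
      proof (rule card_subset_eq[OF finX])
        show "x ` {..<n} \<subseteq> ?X" using PiE_mem[OF x(1)] by auto
        show "card (x ` {..<n}) = card ?X" using card_image[OF x(2)] n by simp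
      qed
      then show "n = card ?X \<and> j = cnt ?X" using x n by simp
    next
      assume nj: "n = card ?X \<and> j = cnt ?X"
      obtain e where e: "bij_betw e {0..<card ?X} ?X" using ex_bij_betw_nat_finite[OF finX] by blast
      define x where "x = restrict e {..<n}"
      have b: "bij_betw x {..<n} ?X"
      proof -
        have "bij_betw e {..<n} ?X" using e nj by (simp add: lessThan_atLeast0)
        moreover have "bij_betw x {..<n} ?X = bij_betw e {..<n} ?X" by (rule bij_betw_cong) (simp add: x_def)
        ultimately show ?thesis by simp
      qed
      have "x \<in> PiE {..<n} (\<lambda>_. ?X)" using b by (auto simp: x_def bij_betw_def)
      moreover have "x \<in> H n j" using b nj by (auto simp: H_def bij_betw_def N_def space_PiM x_def)
      ultimately show "\<omega> \<in> S n j" using w nj cX atX Uat[OF w, of n] by (auto simp: S_def ip)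
    qed
    have "h \<omega> = of_nat (cnt ?X)"
    proof (rule antisym)
      show "h \<omega> \<le> of_nat (cnt ?X)" unfolding h_def
        by (intro SUP_least) (use iff in \<open>auto simp: indicator_def\<close>)
      have "of_nat (cnt ?X) = (of_nat (cnt ?X) * indicator (S (card ?X) (cnt ?X)) \<omega> :: ennreal)" using iff by simp
      also have "\<dots> \<le> (SUP j. of_nat j * indicator (S (card ?X) j) \<omega>)" by (rule SUP_upper) simp
      also have "\<dots> \<le> h \<omega>" unfolding h_def by (rule SUP_upper) simp
      finally show "of_nat (cnt ?X) \<le> h \<omega>" .
    qed
    then show "emeasure (verbose_process F \<kappa> \<Phi> q \<Lambda> \<omega>) A = h \<omega>"
      by (simp add: verbose_process_def emeasure_diagram_measure[OF A] cnt_def D_def)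
  qed
  then show ?thesis using hm by blast
qed

section \<open>Size and shape of diagrams\<close>

lemma size_filter_mset_less:
  assumes "p \<in># D" "Q p" "\<not> R p" "\<And>x. R x \<Longrightarrow> Q x"
  shows "size {#x \<in># D. R x#} < size {#x \<in># D. Q x#}"
proof -
  have "{#x \<in># D. R x#} \<subset># {#x \<in># D. Q x#}"
  proof (rule subset_mset.neq_le_trans)
    have "count {#x \<in># D. R x#} p = 0" "count {#x \<in># D. Q x#} p \<noteq> 0" using assms(1-3) by auto
    then show "{#x \<in># D. R x#} \<noteq> {#x \<in># D. Q x#}" by metis
    show "{#x \<in># D. R x#} \<subseteq># {#x \<in># D. Q x#}" using assms(4) by (simp add: mset_subset_eqI count_filter_mset)
  qed
  then show ?thesis by (rule mset_subset_size)
qed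

lemma size_filter_mset_eq_0_D: "size {#x \<in># D. Q x#} = 0 \<Longrightarrow> p \<in># D \<Longrightarrow> \<not> Q p"
proof
  assume 0: "size {#x \<in># D. Q x#} = 0" "p \<in># D" and "Q p"
  then have "p \<in># {#x \<in># D. Q x#}" by simp
  moreover have "{#x \<in># D. Q x#} = {#}" using 0(1) by (simp only: size_eq_0_iff_empty)
  ultimately show False by (metis empty_iff set_mset_empty)
qed

lemma ex_filter_mset_if_pos:
  assumes "0 < size {#x \<in># D. Q x#}"
  shows "\<exists>p. p \<in># D \<and> Q p"
proof -
  have "{#x \<in># D. Q x#} \<noteq> {#}"
  proof
    assume e: "{#x \<in># D. Q x#} = {#}"
    from assms show False unfolding e by simp
  qed
  then obtain p where "p \<in># {#x \<in># D. Q x#}" by (rule multiset_nonemptyE)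
  then show ?thesis by auto
qed

lemma kappa_complex_mono: "a \<le> b \<Longrightarrow> kappa_complex \<kappa> X a \<subseteq> kappa_complex \<kappa> X b"
  by (auto simp: kappa_complex_def)

lemma kappa_complex_subset_full: "kappa_complex \<kappa> X a \<subseteq> full_complex X"
  by (auto simp: kappa_complex_def full_complex_def)

lemma finite_kappa_complex: "finite X \<Longrightarrow> finite (kappa_complex \<kappa> X a)"
  using finite_subset[OF kappa_complex_subset_full finite_full_complex] .

lemma cycles_mono: "K \<subseteq> L \<Longrightarrow> cycles K q \<subseteq> cycles L q"
  unfolding cycles_def by (auto dest: subsetD[OF chains_mono])

text \<open>All points are counted by the cycles at threshold \<infinity>, which live on the
  simplices with \<open>Suc q\<close> vertices. The polynomial bound is what makes moments of the
  ground process control mean diagrams.\<close>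

lemma size_verbose_diagram_le:
  fixes F :: "'f::field itself"
  assumes X: "finite X" and \<kappa>: "\<forall>\<sigma>\<in>finite_subsets. \<kappa> \<sigma> < \<infinity>"
  shows "size (verbose_diagram F (kappa_filtration \<kappa> X) q) \<le> card X ^ Suc q"
proof -
  have "size (verbose_diagram F (kappa_filtration \<kappa> X) q) = chain.dim (cycles (kappa_complex \<kappa> X \<infinity>) q :: ('a set \<Rightarrow>\<^sub>0 'f) set)"
    using kappa_diagram_counts(2)[OF X \<kappa>, where F=F and q=q and a=\<infinity>] by simp
  also have "\<dots> \<le> card {\<sigma> \<in> kappa_complex \<kappa> X \<infinity>. card \<sigma> = Suc q}"
    by (rule chain_dim_le_card[OF finite_kappa_complex[OF X]]) (auto simp: cycles_def)
  also have "\<dots> \<le> card {\<sigma>. \<sigma> \<subseteq> X \<and> card \<sigma> = Suc q}"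
    by (rule card_mono) (use X in \<open>auto simp: kappa_complex_def\<close>)
  also have "\<dots> = card X choose Suc q" by (rule n_subsets[OF X])
  also have "\<dots> \<le> card X ^ Suc q"
    by (cases "Suc q \<le> card X") (simp_all add: binomial_le_pow binomial_eq_0 del: power_Suc binomial_Suc_Suc)
  finally show ?thesis .
qed

lemma verbose_diagram_empty:
  assumes "\<forall>\<sigma>\<in>finite_subsets. \<kappa> \<sigma> < \<infinity>"
  shows "verbose_diagram F (kappa_filtration \<kappa> {}) q = {#}"
  using size_verbose_diagram_le[of "{}" \<kappa> F q] assms by simp

text \<open>Suppose the death \<open>b\<close> were below the birth \<open>a\<close>. Monotonicity
  of \<kappa> makes the complex at \<open>b\<close> simplicial, so what bounds at \<open>b\<close>
  is already a cycle at \<open>b\<close>, and the counts with births up to \<open>a\<close> and up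
  to \<open>b\<close> coincide; yet the point in question is seen by the first only. For the sign of
  births, the complex below 0 is empty.\<close>

lemma verbose_diagram_birth_le_death:
  fixes F :: "'f::field itself"
  assumes X: "finite X" and \<kappa>: "\<forall>\<sigma>\<in>finite_subsets. \<kappa> \<sigma> < \<infinity>"
    and mono: "\<And>\<sigma> \<tau>. \<sigma> \<in> finite_subsets \<Longrightarrow> \<tau> \<in> finite_subsets \<Longrightarrow> \<sigma> \<subseteq> \<tau> \<Longrightarrow> \<kappa> \<sigma> \<le> \<kappa> \<tau>"
    and p: "p \<in># verbose_diagram F (kappa_filtration \<kappa> X) q"
  shows "0 \<le> fst p" "fst p \<le> snd p"
proof -
  let ?D = "verbose_diagram F (kappa_filtration \<kappa> X) q"
  show "0 \<le> fst p"
  proof (rule ccontr)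
    assume neg: "\<not> 0 \<le> fst p"
    have "kappa_complex \<kappa> X (fst p) = {}"
    proof -
      have "\<not> enn2ereal (\<kappa> \<sigma>) \<le> fst p" for \<sigma> using neg enn2ereal_nonneg[of "\<kappa> \<sigma>"] order_trans by blast
      then show ?thesis by (auto simp: kappa_complex_def)
    qed
    then have "chain.dim (cycles (kappa_complex \<kappa> X (fst p)) q :: ('a set \<Rightarrow>\<^sub>0 'f) set) \<le> card {\<sigma> \<in> {} :: 'a set set. card \<sigma> = Suc q}"
      by (intro chain_dim_le_card) (auto simp: cycles_def)
    then have "size {#x \<in># ?D. fst x \<le> fst p#} = 0" using kappa_diagram_counts(2)[OF X \<kappa>, where F=F and q=q and a="fst p"] by simp
    from size_filter_mset_eq_0_D[OF this p] show False by simp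
  qed
  show "fst p \<le> snd p"
  proof (rule ccontr)
    assume lt: "\<not> fst p \<le> snd p"
    define a b where "a = fst p" and "b = snd p"
    have ba: "b < a" "b \<noteq> \<infinity>" using lt by (auto simp: a_def b_def)
    have "simplicial (kappa_complex \<kappa> X b)" unfolding simplicial_def
    proof (intro ballI allI impI)
      fix \<sigma> \<tau> :: "'a set" assume s: "\<sigma> \<in> kappa_complex \<kappa> X b" "\<tau> \<noteq> {}" "\<tau> \<subseteq> \<sigma>"
      then have f: "finite \<sigma>" "finite \<tau>" using finite_subset[OF _ X] by (auto simp: kappa_complex_def)
      have "\<kappa> \<tau> \<le> \<kappa> \<sigma>" by (rule mono) (use s f in \<open>auto simp: finite_subsets_def kappa_complex_def\<close>)
      then have "enn2ereal (\<kappa> \<tau>) \<le> enn2ereal (\<kappa> \<sigma>)" by (simp add: less_eq_ennreal.rep_eq)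
      then show "\<tau> \<in> kappa_complex \<kappa> X b" using s by (auto simp: kappa_complex_def)
    qed
    note bc = boundaries_subset_cycles[OF this, of q, where 'b='f]
    have "kappa_rank F \<kappa> X q a b = kappa_rank F \<kappa> X q b b"
    proof -
      have "cycles (kappa_complex \<kappa> X b) q \<subseteq> (cycles (kappa_complex \<kappa> X a) q :: ('a set \<Rightarrow>\<^sub>0 'f) set)"
        by (rule cycles_mono[OF kappa_complex_mono]) (use ba in simp)
      then have "cycles (kappa_complex \<kappa> X a) q \<inter> boundaries (kappa_complex \<kappa> X b) q =
        (cycles (kappa_complex \<kappa> X b) q \<inter> boundaries (kappa_complex \<kappa> X b) q :: ('a set \<Rightarrow>\<^sub>0 'f) set)"
        using bc by auto
      then show ?thesis by (simp add: kappa_rank_def)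
    qed
    then have "size {#x \<in># ?D. fst x \<le> a \<and> snd x \<le> b#} = size {#x \<in># ?D. fst x \<le> b \<and> snd x \<le> b#}"
      by (simp only: kappa_diagram_counts(1)[OF X \<kappa> ba(2)])
    moreover have "size {#x \<in># ?D. fst x \<le> b \<and> snd x \<le> b#} < size {#x \<in># ?D. fst x \<le> a \<and> snd x \<le> b#}"
      by (rule size_filter_mset_less[OF p]) (use ba in \<open>auto simp: a_def b_def\<close>)
    ultimately show False by simp
  qed
qed

text \<open>At a finite threshold the complex is the full simplex, where every cycle of positive
  degree bounds. So the points with death up to that threshold already account for all
  births.\<close>

lemma verbose_diagram_death_finite:
  fixes F :: "'f::field itself"
  assumes X: "finite X" and \<kappa>: "\<forall>\<sigma>\<in>finite_subsets. \<kappa> \<sigma> < \<infinity>" and q: "0 < q"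
    and p: "p \<in># verbose_diagram F (kappa_filtration \<kappa> X) q"
  shows "snd p \<noteq> \<infinity>"
proof
  assume inf: "snd p = \<infinity>"
  let ?D = "verbose_diagram F (kappa_filtration \<kappa> X) q"
  obtain b where b: "b \<noteq> \<infinity>" "kappa_complex \<kappa> X b = full_complex X"
  proof -
    \<comment> \<open>The largest value is attained and hence finite; for empty \<open>X\<close> the
      supremum is \<open>-\<infinity>\<close>, which serves as well.\<close>
    define b where "b = (SUP \<sigma>\<in>full_complex X. enn2ereal (\<kappa> \<sigma>))"
    have "b \<noteq> \<infinity>"
    proof (cases "full_complex X = {}")
      case True
      then show ?thesis by (simp add: b_def bot_ereal_def)
    next
      case False
      have "b = Max ((\<lambda>\<sigma>. enn2ereal (\<kappa> \<sigma>)) ` full_complex X)" unfolding b_def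
        by (rule Max_Sup[symmetric]) (use False finite_full_complex[OF X] in auto)
      also have "\<dots> \<in> (\<lambda>\<sigma>. enn2ereal (\<kappa> \<sigma>)) ` full_complex X"
        by (rule Max_in) (use False finite_full_complex[OF X] in auto)
      finally obtain \<sigma> where s: "\<sigma> \<in> full_complex X" "b = enn2ereal (\<kappa> \<sigma>)" by auto
      then have "\<sigma> \<in> finite_subsets" using finite_subset[OF _ X] by (auto simp: full_complex_def finite_subsets_def)
      then have "\<kappa> \<sigma> \<noteq> \<infinity>" using \<kappa> by auto
      then show ?thesis using s by (cases "\<kappa> \<sigma>") auto
    qed
    moreover have "kappa_complex \<kappa> X b = full_complex X"
      unfolding kappa_complex_def full_complex_def b_def by (auto intro!: SUP_upper simp: full_complex_def)
    ultimately show ?thesis using that by blast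
  qed
  have "cycles (kappa_complex \<kappa> X (fst p)) q \<inter> boundaries (kappa_complex \<kappa> X b) q = (cycles (kappa_complex \<kappa> X (fst p)) q :: ('a set \<Rightarrow>\<^sub>0 'f) set)"
    using full_complex_acyclic[OF X q, where 'f='f] cycles_mono[OF kappa_complex_subset_full[of \<kappa> X "fst p"], of q, where 'b='f]
    unfolding b(2) by auto
  then have "size {#x \<in># ?D. fst x \<le> fst p \<and> snd x \<le> b#} = size {#x \<in># ?D. fst x \<le> fst p#}"
    using kappa_diagram_counts[OF X \<kappa>, where F=F and q=q and a="fst p"] b(1) by (simp add: kappa_rank_def)
  moreover have "size {#x \<in># ?D. fst x \<le> fst p \<and> snd x \<le> b#} < size {#x \<in># ?D. fst x \<le> fst p#}"
    by (rule size_filter_mset_less[OF p]) (use inf b(1) in auto)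
  ultimately show False by simp
qed

text \<open>In degree 0 every chain is a cycle, and all vertices enter at \<open>k0\<close>; the
  number of births up to \<open>a\<close> therefore jumps only there.\<close>

lemma verbose_diagram_degree_0_birth:
  fixes F :: "'f::field itself"
  assumes X: "finite X" and \<kappa>: "\<forall>\<sigma>\<in>finite_subsets. \<kappa> \<sigma> < \<infinity>"
    and single: "\<And>z. z \<in> X \<Longrightarrow> enn2ereal (\<kappa> {z}) = k0"
    and p: "p \<in># verbose_diagram F (kappa_filtration \<kappa> X) 0"
  shows "fst p = k0"
proof -
  let ?D = "verbose_diagram F (kappa_filtration \<kappa> X) 0"
  have ch: "cycles (kappa_complex \<kappa> X a) 0 = (if k0 \<le> a then chains ((\<lambda>z. {z}) ` X) 0 else (chains {} 0 :: ('a set \<Rightarrow>\<^sub>0 'f) set))" for a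
  proof -
    have "\<sigma> \<in> kappa_complex \<kappa> X a \<longleftrightarrow> k0 \<le> a \<and> \<sigma> \<in> (\<lambda>z. {z}) ` X" if c1: "card \<sigma> = 1" for \<sigma>
    proof -
      obtain z where "\<sigma> = {z}" using c1 by (rule card_1_singletonE)
      then show ?thesis using single[of z] by (auto simp: kappa_complex_def)
    qed
    then have eq: "(\<forall>\<sigma>\<in>Poly_Mapping.keys c. \<sigma> \<in> kappa_complex \<kappa> X a \<and> card \<sigma> = Suc 0) \<longleftrightarrow>
      (\<forall>\<sigma>\<in>Poly_Mapping.keys c. (k0 \<le> a \<and> \<sigma> \<in> (\<lambda>z. {z}) ` X) \<and> card \<sigma> = Suc 0)" for c :: "'a set \<Rightarrow>\<^sub>0 'f"
      by (metis One_nat_def)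
    show ?thesis
    proof (cases "k0 \<le> a")
      case True
      show ?thesis unfolding cycles_def boundary_0 chains_def mem_Collect_eq eq by (simp add: True)
    next
      case False
      show ?thesis unfolding cycles_def boundary_0 chains_def mem_Collect_eq eq by (simp add: False)
    qed
  qed
  have le: "k0 \<le> fst p"
  proof (rule ccontr)
    assume "\<not> k0 \<le> fst p"
    then have "chain.dim (cycles (kappa_complex \<kappa> X (fst p)) 0 :: ('a set \<Rightarrow>\<^sub>0 'f) set) \<le> card {\<sigma> \<in> {} :: 'a set set. card \<sigma> = Suc 0}"
      unfolding ch by (intro chain_dim_le_card) auto
    then have "size {#x \<in># ?D. fst x \<le> fst p#} = 0" using kappa_diagram_counts(2)[OF X \<kappa>, where F=F and q=0 and a="fst p"] by simp
    from size_filter_mset_eq_0_D[OF this p] show False by simp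
  qed
  show ?thesis
  proof (rule ccontr)
    assume "fst p \<noteq> k0"
    with le have lt: "k0 < fst p" by simp
    have "size {#x \<in># ?D. fst x \<le> k0#} = size {#x \<in># ?D. fst x \<le> fst p#}"
      using le by (simp add: kappa_diagram_counts(2)[OF X \<kappa>] ch)
    moreover have "size {#x \<in># ?D. fst x \<le> k0#} < size {#x \<in># ?D. fst x \<le> fst p#}"
      by (rule size_filter_mset_less[OF p]) (use lt in auto)
    ultimately show False by simp
  qed
qed

text \<open>The only edge enters at the value of \<kappa> on the pair. Before that nothing bounds,
  and at that time the boundary of the edge, whose coefficients are signs, is a nonzero bounding
  cycle.\<close>

lemma verbose_diagram_two_points:
  fixes F :: "'f::field itself"
  assumes uv: "u \<noteq> v" and \<kappa>: "\<forall>\<sigma>\<in>finite_subsets. \<kappa> \<sigma> < \<infinity>"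
  shows "\<exists>p. p \<in># verbose_diagram F (kappa_filtration \<kappa> {u, v}) 0 \<and> snd p = enn2ereal (\<kappa> {u, v})"
proof -
  let ?X = "{u, v}" and ?s = "enn2ereal (\<kappa> {u, v})"
  have X: "finite ?X" by simp
  have c2: "card ?X = Suc (Suc 0)" using uv by simp
  have edge: "\<sigma> = ?X" if "\<sigma> \<subseteq> ?X" "card \<sigma> = Suc (Suc 0)" for \<sigma>
    using card_subset_eq[OF X that(1)] that(2) c2 by simp
  have s: "?s \<noteq> \<infinity>"
  proof -
    have "\<kappa> ?X \<noteq> \<infinity>" using bspec[OF \<kappa>, of ?X] by (auto simp: finite_subsets_def)
    then show ?thesis by (cases "\<kappa> ?X") auto
  qed
  let ?D = "verbose_diagram F (kappa_filtration \<kappa> {u, v}) 0"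
  have low: "size {#x \<in># ?D. fst x \<le> \<infinity> \<and> snd x \<le> b#} = 0" if b: "b < ?s" for b
  proof -
    have bi: "b \<noteq> \<infinity>" using b by auto
    have "chains (kappa_complex \<kappa> ?X b) (Suc 0) = ({0} :: ('a set \<Rightarrow>\<^sub>0 'f) set)"
    proof -
      have "Poly_Mapping.keys c = {}" if "c \<in> chains (kappa_complex \<kappa> ?X b) (Suc 0)" for c :: "'a set \<Rightarrow>\<^sub>0 'f"
      proof (rule equals0I)
        fix \<sigma> assume "\<sigma> \<in> Poly_Mapping.keys c"
        then have "\<sigma> \<in> kappa_complex \<kappa> ?X b" "card \<sigma> = Suc (Suc 0)" using that by (auto simp: chains_def)
        moreover from this have "\<sigma> = ?X" by (intro edge) (auto simp: kappa_complex_def)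
        ultimately show False using b by (auto simp: kappa_complex_def)
      qed
      then show ?thesis by (auto simp: chains_def)
    qed
    then have "boundaries (kappa_complex \<kappa> ?X b) 0 = ({0} :: ('a set \<Rightarrow>\<^sub>0 'f) set)"
      by (simp add: boundaries_def boundary_Suc lin_ext_def)
    then have "kappa_rank F \<kappa> ?X 0 \<infinity> b \<le> chain.dim ({0} :: ('a set \<Rightarrow>\<^sub>0 'f) set)"
      unfolding kappa_rank_def
      by (intro chain_dim_mono[OF finite_kappa_complex[OF X, of \<kappa> b], of _ _ 0]) (auto simp: chains_def)
    also have "\<dots> = chain.dim (chain.span {} :: ('a set \<Rightarrow>\<^sub>0 'f) set)" by simp
    also have "\<dots> = 0" by (subst chain.dim_span_eq_card_independent) (simp_all add: chain.independent_empty)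
    finally show ?thesis by (simp only: kappa_diagram_counts(1)[OF X \<kappa> bi])
  qed
  have "0 < size {#x \<in># ?D. fst x \<le> \<infinity> \<and> snd x \<le> ?s#}"
  proof -
    define e where "e = (Poly_Mapping.single ?X 1 :: 'a set \<Rightarrow>\<^sub>0 'f)"
    define z where "z = boundary (Suc 0) e"
    have ze: "z = face_sum ?X" by (simp add: z_def e_def boundary_Suc)
    have "Poly_Mapping.lookup z {v} \<noteq> 0"
    proof -
      have "{u, v} - {u} = {v}" "{u, v} - {v} = {u}" using uv by auto
      then have "Poly_Mapping.lookup z {v} = (-1) ^ vertex_position ?X u"
        using uv by (simp add: ze face_sum_def lookup_add lookup_single when_def)
      then show ?thesis by simp
    qed
    then have z0: "z \<noteq> 0" by auto
    have eK: "e \<in> chains (kappa_complex \<kappa> ?X ?s) (Suc 0)" using c2 by (simp add: e_def chains_def kappa_complex_def)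
    then have zB: "z \<in> boundaries (kappa_complex \<kappa> ?X ?s) 0" by (auto simp: boundaries_def z_def)
    have "Poly_Mapping.keys z \<subseteq> (\<lambda>w. ?X - {w}) ` ?X" unfolding ze by (rule keys_face_sum)
    then have "z \<in> chains (kappa_complex \<kappa> ?X \<infinity>) 0" using uv by (auto simp: chains_def kappa_complex_def)
    then have "z \<in> cycles (kappa_complex \<kappa> ?X \<infinity>) 0" by (simp add: cycles_def boundary_0)
    then have sub: "{z} \<subseteq> cycles (kappa_complex \<kappa> ?X \<infinity>) 0 \<inter> boundaries (kappa_complex \<kappa> ?X ?s) 0" using zB by simp
    have "chain.independent {z}" using z0 by (simp add: chain.independent_insert chain.independent_empty)
    from chain.dim_eq_card_independent[OF this] have "chain.dim {z} = 1" by simp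
    moreover have "chain.dim {z} \<le> kappa_rank F \<kappa> ?X 0 \<infinity> ?s" unfolding kappa_rank_def
      by (rule chain_dim_mono[OF finite_kappa_complex[OF X, of \<kappa> \<infinity>] sub]) (auto simp: cycles_def)
    ultimately show ?thesis unfolding kappa_diagram_counts(1)[OF X \<kappa> s] by simp
  qed
  from ex_filter_mset_if_pos[OF this] obtain p where p: "p \<in># ?D" "snd p \<le> ?s" by auto
  have "\<not> snd p < ?s" using size_filter_mset_eq_0_D[OF low p(1)] by auto
  then show ?thesis using p by (intro exI[of _ p]) auto
qed

section \<open>Patterns in tiles\<close>

lemma hausdorff_dist_le:
  assumes "A \<noteq> {}" "B \<noteq> {}" "\<And>a. a \<in> A \<Longrightarrow> \<exists>b\<in>B. dist a b \<le> r" "\<And>b. b \<in> B \<Longrightarrow> \<exists>a\<in>A. dist b a \<le> r"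
  shows "hausdorff_dist A B \<le> r"
proof -
  have "(SUP a\<in>A. infdist a B) \<le> r"
    by (rule cSUP_least) (use assms infdist_le2 in blast)+
  moreover have "(SUP b\<in>B. infdist b A) \<le> r"
    by (rule cSUP_least) (use assms infdist_le2 in blast)+
  ultimately show ?thesis by (simp add: hausdorff_dist_def)
qed

lemma enn2ereal_le_iff_enn2real:
  assumes "x < \<infinity>"
  shows "enn2ereal x \<le> ereal t \<longleftrightarrow> enn2real x \<le> t"
  using assms by (cases x) auto

text \<open>Translating by \<open>v\<close> leaves \<kappa> unchanged, and moving positions by at
  most \<delta> changes it by at most \<open>c * \<delta>\<close>, less than its distance to each
  threshold. So no simplex changes sides. The marks of \<open>f z\<close> may be arbitrary, because
  the Lipschitz bound sees positions only.\<close>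

lemma box_count_perturbation:
  fixes \<kappa> :: "('a::euclidean_space \<times> 'm) set \<Rightarrow> ennreal"
  assumes fin: "\<forall>\<sigma>\<in>finite_subsets. \<kappa> \<sigma> < \<infinity>"
    and inv: "\<forall>\<sigma>\<in>finite_subsets. \<forall>x. \<kappa> ((\<lambda>(y, m). (y + x, m)) ` \<sigma>) = \<kappa> \<sigma>"
    and lip: "\<And>\<sigma> \<sigma>'. \<sigma> \<in> finite_subsets \<Longrightarrow> \<sigma>' \<in> finite_subsets \<Longrightarrow>
           \<bar>enn2real (\<kappa> \<sigma>) - enn2real (\<kappa> \<sigma>')\<bar> \<le> c * hausdorff_dist (fst ` \<sigma>) (fst ` \<sigma>')"
    and c: "0 < c" and X: "finite X" and f: "inj_on f X"
    and close: "\<And>z. z \<in> X \<Longrightarrow> dist (fst (f z)) (fst z + v) \<le> \<delta>"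
    and gap: "\<And>\<sigma> t. \<sigma> \<subseteq> X \<Longrightarrow> \<sigma> \<noteq> {} \<Longrightarrow> t \<in> {a1, a2, b1, b2} \<Longrightarrow> c * \<delta> < \<bar>enn2real (\<kappa> \<sigma>) - t\<bar>"
    and ab: "a1 \<le> a2" "b1 \<le> b2"
  shows "box_count F \<kappa> (f ` X) q (ereal a1) (ereal a2) (ereal b1) (ereal b2) = box_count F \<kappa> X q (ereal a1) (ereal a2) (ereal b1) (ereal b2)"
proof (rule box_count_relabel[OF X fin fin f])
  fix \<sigma> s assume s: "\<sigma> \<subseteq> X" "\<sigma> \<noteq> {}" "s \<in> {ereal a1, ereal a2, ereal b1, ereal b2}"
  then obtain t where t: "s = ereal t" "t \<in> {a1, a2, b1, b2}" by auto
  have fs: "finite \<sigma>" using s(1) X by (rule finite_subset)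
  \<comment> \<open>The exact translate with the original marks mediates between the pattern and its
    perturbed copy.\<close>
  let ?\<tau> = "(\<lambda>(y, m). (y + v, m)) ` \<sigma>"
  have F: "\<sigma> \<in> finite_subsets" "f ` \<sigma> \<in> finite_subsets" "?\<tau> \<in> finite_subsets"
    using fs s(2) by (auto simp: finite_subsets_def)
  have ft: "fst ` ?\<tau> = (\<lambda>z. fst z + v) ` \<sigma>" by (force simp: image_image split_beta)
  have "hausdorff_dist (fst ` f ` \<sigma>) (fst ` ?\<tau>) \<le> \<delta>" unfolding ft
  proof (rule hausdorff_dist_le)
    show "fst ` f ` \<sigma> \<noteq> {}" "(\<lambda>z. fst z + v) ` \<sigma> \<noteq> {}" using s(2) by auto
    show "\<exists>b\<in>(\<lambda>z. fst z + v) ` \<sigma>. dist a b \<le> \<delta>" if a: "a \<in> fst ` f ` \<sigma>" for a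
    proof -
      obtain z where z: "z \<in> \<sigma>" "a = fst (f z)" using a by blast
      then have "dist a (fst z + v) \<le> \<delta>" using close[of z] s(1) by blast
      then show ?thesis using z(1) by blast
    qed
    show "\<exists>a\<in>fst ` f ` \<sigma>. dist b a \<le> \<delta>" if b: "b \<in> (\<lambda>z. fst z + v) ` \<sigma>" for b
    proof -
      obtain z where z: "z \<in> \<sigma>" "b = fst z + v" using b by blast
      then have "dist b (fst (f z)) \<le> \<delta>" using close[of z] subsetD[OF s(1) z(1)] by (simp add: dist_commute)
      then show ?thesis using z(1) by blast
    qed
  qed
  then have "c * hausdorff_dist (fst ` f ` \<sigma>) (fst ` ?\<tau>) \<le> c * \<delta>" using c by simp
  then have "\<bar>enn2real (\<kappa> (f ` \<sigma>)) - enn2real (\<kappa> ?\<tau>)\<bar> \<le> c * \<delta>" using lip[OF F(2,3)] by linarith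
  moreover have "\<kappa> ?\<tau> = \<kappa> \<sigma>" using inv F(1) by blast
  ultimately have "enn2real (\<kappa> (f ` \<sigma>)) \<le> t \<longleftrightarrow> enn2real (\<kappa> \<sigma>) \<le> t" using gap[OF s(1,2) t(2)] by auto
  then show "enn2ereal (\<kappa> (f ` \<sigma>)) \<le> s \<longleftrightarrow> enn2ereal (\<kappa> \<sigma>) \<le> s"
    unfolding t(1) using fin F by (simp add: enn2ereal_le_iff_enn2real)
qed (use ab in auto)

section \<open>Tiling of large cubes\<close>

definition grid_shift :: "real \<Rightarrow> ('n::finite \<Rightarrow> nat) \<Rightarrow> real ^ 'n" where
  "grid_shift R k = (\<chi> i. 2 * R * real (k i))"

text \<open>Side length \<open>2 * R\<close>, the spacing of the grid. The tiles are closed and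
  neighbours share faces; later the clusters stay away from the faces, so this overlap does not
  matter.\<close>

definition tile :: "real \<Rightarrow> (real ^ 'n::finite) set" where
  "tile R = cbox (\<chi> i. - R) (\<chi> i. R)"

text \<open>For positive \<open>R\<close> and \<open>m\<close>, this is the union of the tiles
  centred at \<open>grid_shift R k\<close> with all \<open>k i < m\<close>: the first begins at
  \<open>-R\<close>, the last ends at \<open>2 * R * (m - 1) + R\<close>.\<close>

definition big_cube :: "real \<Rightarrow> nat \<Rightarrow> (real ^ 'n::finite) set" where
  "big_cube R m = cbox (\<chi> i. - R) (\<chi> i. (2 * real m - 1) * R)"

lemma mem_tile: "x \<in> tile R \<longleftrightarrow> (\<forall>i. \<bar>x $ i\<bar> \<le> R)"
  by (auto simp: tile_def mem_box_cart abs_le_iff) (metis minus_le_iff)+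

lemma tile_in_big_cube:
  assumes "0 < R" "\<And>i. k i < m" "x - grid_shift R k \<in> tile R"
  shows "x \<in> big_cube R m"
  unfolding big_cube_def mem_box_cart
proof
  fix i
  have "\<bar>x $ i - 2 * R * real (k i)\<bar> \<le> R" using assms(3) by (simp add: mem_tile grid_shift_def)
  moreover have "0 \<le> 2 * R * real (k i)" using assms(1) by simp
  moreover have "2 * R * real (k i) \<le> 2 * R * (real m - 1)"
    using assms(1) assms(2)[of i] by (intro mult_left_mono) auto
  moreover have "2 * R * (real m - 1) + R = (2 * real m - 1) * R" by (simp add: algebra_simps)
  ultimately have "- R \<le> x $ i" "x $ i \<le> (2 * real m - 1) * R" by linarith+
  then show "(\<chi> i. - R) $ i \<le> x $ i \<and> x $ i \<le> (\<chi> i. (2 * real m - 1) * R) $ i" by simp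
qed

lemma card_grid: "finite {k :: 'n::finite \<Rightarrow> nat. \<forall>i. k i < m}" "card {k :: 'n::finite \<Rightarrow> nat. \<forall>i. k i < m} = m ^ CARD('n)"
proof -
  have "{k :: 'n \<Rightarrow> nat. \<forall>i. k i < m} = PiE UNIV (\<lambda>_. {..<m})" by auto
  then show "finite {k :: 'n::finite \<Rightarrow> nat. \<forall>i. k i < m}" "card {k :: 'n::finite \<Rightarrow> nat. \<forall>i. k i < m} = m ^ CARD('n)"
    by (simp_all add: finite_PiE card_PiE)
qed

lemma emeasure_big_cube:
  assumes "0 < R" "0 < m"
  shows "emeasure lborel (big_cube R m :: (real ^ 'n::finite) set) = ennreal ((2 * real m * R) ^ CARD('n))"
proof -
  let ?l = "(\<chi> i. - R) :: real ^ 'n" and ?u = "(\<chi> i. (2 * real m - 1) * R) :: real ^ 'n"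
  have b: "(?u - ?l) \<bullet> b = 2 * real m * R" if "b \<in> Basis" for b
    using that by (auto simp: Basis_vec_def inner_axis algebra_simps)
  have le: "?l \<bullet> b \<le> ?u \<bullet> b" if "b \<in> Basis" for b
  proof -
    have "0 \<le> (?u - ?l) \<bullet> b" unfolding b[OF that] using assms by simp
    then show ?thesis by (simp add: inner_diff_left)
  qed
  have "emeasure lborel (cbox ?l ?u) = (\<Prod>b\<in>Basis. (?u - ?l) \<bullet> b)" by (rule emeasure_lborel_cbox[OF le])
  also have "(\<Prod>b\<in>Basis. (?u - ?l) \<bullet> b) = (\<Prod>b\<in>(Basis :: (real ^ 'n) set). 2 * real m * R)" by (rule prod.cong) (simp_all add: b)
  finally show ?thesis by (simp add: big_cube_def)
qed

lemma convex_averaging_sequence_big_cube: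
  assumes R: "0 < R"
  shows "convex_averaging_sequence (\<lambda>n. big_cube R (Suc n) :: (real ^ 'n::finite) set)"
  unfolding convex_averaging_sequence_def
proof (intro conjI allI)
  fix n
  show "bounded (big_cube R (Suc n) :: (real ^ 'n) set)" "convex (big_cube R (Suc n) :: (real ^ 'n) set)"
    "big_cube R (Suc n) \<in> sets (borel :: (real ^ 'n) measure)"
    by (simp_all add: big_cube_def bounded_cbox)
  show "mono (\<lambda>n. big_cube R (Suc n) :: (real ^ 'n) set)"
  proof (rule monoI)
    fix m n :: nat assume "m \<le> n"
    then have "(2 * real (Suc m) - 1) * R \<le> (2 * real (Suc n) - 1) * R" using R by (intro mult_right_mono) auto
    then show "big_cube R (Suc m) \<subseteq> (big_cube R (Suc n) :: (real ^ 'n) set)"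
      unfolding big_cube_def by (force simp: mem_box_cart simp del: of_nat_Suc intro: order_trans[OF _ \<open>_ \<le> (2 * real (Suc n) - 1) * R\<close>])
  qed
  have inr: "ennreal (real (Suc n) * R) \<le> inradius (big_cube R (Suc n) :: (real ^ 'n) set)" for n
    unfolding inradius_def
  proof (rule Sup_upper, intro CollectI exI conjI)
    show "0 < real (Suc n) * R" using R by simp
    \<comment> \<open>This is the ball about the centre of the cube whose radius is half the side
      length.\<close>
    show "ball (\<chi> i. real n * R) (real (Suc n) * R) \<subseteq> (big_cube R (Suc n) :: (real ^ 'n) set)"
    proof
      fix x :: "real ^ 'n" assume "x \<in> ball (\<chi> i. real n * R) (real (Suc n) * R)"
      then have d: "norm (x - (\<chi> i. real n * R)) < real (Suc n) * R" by (simp add: dist_norm norm_minus_commute)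
      have cb: "\<bar>x $ i - real n * R\<bar> \<le> real (Suc n) * R" for i
        using component_le_norm_cart[of "x - (\<chi> i. real n * R)" i] d by simp
      have "- R \<le> x $ i \<and> x $ i \<le> (2 * real (Suc n) - 1) * R" for i
      proof -
        have "\<bar>x $ i - real n * R\<bar> \<le> real n * R + R"
          using cb[of i] by (simp add: algebra_simps)
        moreover have "(2 * real (Suc n) - 1) * R = 2 * (real n * R) + R" by (simp add: algebra_simps)
        ultimately show ?thesis by linarith
      qed
      then show "x \<in> big_cube R (Suc n)" by (simp add: big_cube_def mem_box_cart)
    qed
  qed simp
  show "(SUP n. inradius (big_cube R (Suc n) :: (real ^ 'n) set)) = \<infinity>"
  proof (rule ccontr)
    assume "(SUP n. inradius (big_cube R (Suc n) :: (real ^ 'n) set)) \<noteq> \<infinity>"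
    then obtain B where B: "0 \<le> B" "(SUP n. inradius (big_cube R (Suc n) :: (real ^ 'n) set)) = ennreal B"
      by (cases "SUP n. inradius (big_cube R (Suc n) :: (real ^ 'n) set)") auto
    have "ennreal (real (Suc n) * R) \<le> ennreal B" for n
      using inr[of n] SUP_upper[of n UNIV "\<lambda>n. inradius (big_cube R (Suc n) :: (real ^ 'n) set)"] B(2) by (metis UNIV_I order_trans)
    then have "real (Suc n) * R \<le> B" for n using B(1) by (simp add: ennreal_le_iff)
    moreover obtain n where "B < real n * R" using reals_Archimedean3[OF R] by blast
    ultimately show False using R by (metis Suc_n_not_le_n linorder_not_less mult_le_cancel_right of_nat_le_iff order_less_le_trans nle_le order_trans)
  qed
qed

text \<open>The event is formulated for the marked measure, although it constrains positions only,
  because stationarity is a property of the marked process. Membership in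
  \<open>counting_measures\<close> makes it a subset of the space that carries the law.\<close>

definition configuration ::
  "'a::euclidean_space set \<Rightarrow> real \<Rightarrow> 'a set \<Rightarrow> 'a \<Rightarrow> ('a \<times> 'm::topological_space) measure set" where
  "configuration D \<delta> S v = {\<mu> \<in> counting_measures euclidean.
     (\<forall>x\<in>D. emeasure \<mu> {z. fst z - v \<in> ball x \<delta>} = 1) \<and>
     emeasure \<mu> {z. fst z - v \<in> S - (\<Union>x\<in>D. ball x \<delta>)} = 0}"

lemma sets_shifted:
  fixes A :: "'a::euclidean_space set"
  assumes "A \<in> sets borel"
  shows "{z :: 'a \<times> 'm::{second_countable_topology, t2_space}. fst z - v \<in> A} \<in> sets borel"
proof -
  have "(\<lambda>z :: 'a \<times> 'm. fst z - v) \<in> borel_measurable borel"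
    by (rule borel_measurable_continuous_onI) (intro continuous_intros)
  from measurable_sets[OF this assms] show ?thesis by (simp add: vimage_def)
qed

text \<open>A configuration of points close to a translate of \<open>\<Xi>\<close>, with nothing else in the surrounding
  cube, forms a separate cluster up to the threshold \<open>T\<close> and contributes to the box.\<close>

lemma configurations_le_box_count:
  fixes \<kappa> :: "((real ^ 'n) \<times> 'm::{second_countable_topology, t2_space}) set \<Rightarrow> ennreal"
  assumes fin: "\<forall>\<sigma>\<in>finite_subsets. \<kappa> \<sigma> < \<infinity>"
    and mono: "\<forall>\<sigma>\<in>finite_subsets. \<forall>\<tau>\<in>finite_subsets. \<sigma> \<subseteq> \<tau> \<longrightarrow> \<kappa> \<sigma> \<le> \<kappa> \<tau>"
    and inv: "\<forall>\<sigma>\<in>finite_subsets. \<forall>x. \<kappa> ((\<lambda>(y, m). (y + x, m)) ` \<sigma>) = \<kappa> \<sigma>"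
    and lip: "\<And>\<sigma> \<sigma>'. \<sigma> \<in> finite_subsets \<Longrightarrow> \<sigma>' \<in> finite_subsets \<Longrightarrow>
           \<bar>enn2real (\<kappa> \<sigma>) - enn2real (\<kappa> \<sigma>')\<bar> \<le> c * hausdorff_dist (fst ` \<sigma>) (fst ` \<sigma>')"
    and c: "0 < c" and \<Xi>: "finite_simple_marked_set \<Xi>" and \<delta>: "0 < \<delta>"
    and gap: "\<And>\<sigma> t. \<sigma> \<subseteq> \<Xi> \<Longrightarrow> \<sigma> \<noteq> {} \<Longrightarrow> t \<in> {a1, a2, b1, b2} \<Longrightarrow> c * \<delta> < \<bar>enn2real (\<kappa> \<sigma>) - t\<bar>"
    and ab: "a1 \<le> a2" "b1 \<le> b2" "a2 \<le> T" "b2 \<le> T"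
    and reach: "\<And>z w. \<kappa> {z, w} \<le> ennreal T \<Longrightarrow> norm (fst z - fst w) \<le> \<rho>"
    and far: "\<And>z. z \<in> \<Xi> \<Longrightarrow> norm (fst z) + \<delta> + \<rho> < R" and \<rho>: "0 \<le> \<rho>" and R: "0 < R"
    and disj: "disjoint_family_on (\<lambda>x. ball x \<delta>) (fst ` \<Xi>)"
    and pos: "0 < box_count F \<kappa> \<Xi> q (ereal a1) (ereal a2) (ereal b1) (ereal b2)"
    and \<mu>: "\<mu> \<in> counting_measures euclidean" and fing: "emeasure (ground \<mu>) (big_cube R m) < \<infinity>"
    and simple: "\<And>x. emeasure (ground \<mu>) {x} \<le> 1"
  shows "card {k :: 'n \<Rightarrow> nat. (\<forall>i. k i < m) \<and> \<mu> \<in> configuration (fst ` \<Xi>) \<delta> (tile R) (grid_shift R k)}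
    \<le> box_count F \<kappa> (marked_points \<mu> (big_cube R m)) q (ereal a1) (ereal a2) (ereal b1) (ereal b2)"
proof -
  let ?I = "{k :: 'n \<Rightarrow> nat. (\<forall>i. k i < m) \<and> \<mu> \<in> configuration (fst ` \<Xi>) \<delta> (tile R) (grid_shift R k)}"
  let ?L = "big_cube R m :: (real ^ 'n) set"
  let ?X = "marked_points \<mu> ?L"
  let ?s = "grid_shift R :: ('n \<Rightarrow> nat) \<Rightarrow> real ^ 'n"
  have Lb: "?L \<in> sets borel" by (simp add: big_cube_def)
  note cnt = marked_points_counting[OF \<mu> Lb fing simple]
  have finX: "finite ?X" using cnt(1) by (simp add: finite_simple_marked_set_def)
  have fin\<Xi>: "finite \<Xi>" "inj_on fst \<Xi>" using \<Xi> by (auto simp: finite_simple_marked_set_def)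
  have finI: "finite ?I" by (rule finite_subset[OF _ card_grid(1)[of m]]) auto
  define Y where "Y k = {z \<in> ?X. fst z - ?s k \<in> tile R}" for k
  have ballt: "u \<in> tile R" if "z \<in> \<Xi>" "dist (fst z) u < \<delta>" for z u
  proof -
    have "norm u \<le> norm (fst z) + dist (fst z) u" by (metis dist_norm norm_triangle_sub norm_minus_commute)
    then have "norm u \<le> R" using far[OF that(1)] that(2) \<rho> by linarith
    then show ?thesis unfolding mem_tile using component_le_norm_cart order_trans by blast
  qed
  \<comment> \<open>One point over each ball gives the map, disjointness of the balls its
    injectivity, and the absence of points over the rest of the tile its surjectivity onto the
    cluster.\<close>
  have near: "\<exists>f. inj_on f \<Xi> \<and> f ` \<Xi> = Y k \<and> (\<forall>z\<in>\<Xi>. dist (fst z) (fst (f z) - ?s k) < \<delta>)" if k: "k \<in> ?I" for k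
  proof -
    have cfg: "\<And>x. x \<in> fst ` \<Xi> \<Longrightarrow> emeasure \<mu> {z. fst z - ?s k \<in> ball x \<delta>} = 1"
      "emeasure \<mu> {z. fst z - ?s k \<in> tile R - (\<Union>x\<in>fst ` \<Xi>. ball x \<delta>)} = 0" and km: "\<And>i. k i < m"
      using k by (auto simp: configuration_def)
    have inL: "u \<in> ?L" if "u - ?s k \<in> tile R" for u by (rule tile_in_big_cube[OF R km that])
    have one: "\<exists>!y. y \<in> ?X \<and> dist (fst z) (fst y - ?s k) < \<delta>" if z: "z \<in> \<Xi>" for z
    proof -
      have "{y. fst y - ?s k \<in> ball (fst z) \<delta>} \<subseteq> ?L \<times> (UNIV :: 'm set)"
        using inL ballt[OF z] by (auto simp: mem_Times_iff)
      from cnt(2)[OF sets_shifted this] have "of_nat (card (?X \<inter> {y. fst y - ?s k \<in> ball (fst z) \<delta>})) = (1 :: ennreal)"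
        using cfg(1)[of "fst z"] z by simp
      then have "card (?X \<inter> {y. fst y - ?s k \<in> ball (fst z) \<delta>}) = 1" by (metis of_nat_1 of_nat_eq_iff)
      then obtain y where "?X \<inter> {y. fst y - ?s k \<in> ball (fst z) \<delta>} = {y}" by (rule card_1_singletonE)
      then have "w \<in> ?X \<inter> {y. fst y - ?s k \<in> ball (fst z) \<delta>} \<longleftrightarrow> w = y" for w by simp
      then have "w \<in> ?X \<and> dist (fst z) (fst w - ?s k) < \<delta> \<longleftrightarrow> w = y" for w by (simp only: Int_iff mem_Collect_eq mem_ball)
      then show ?thesis by simp
    qed
    define f :: "(real ^ 'n) \<times> 'm \<Rightarrow> (real ^ 'n) \<times> 'm" where "f z = (THE y. y \<in> ?X \<and> dist (fst z) (fst y - ?s k) < \<delta>)" for z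
    have f: "f z \<in> ?X" "dist (fst z) (fst (f z) - ?s k) < \<delta>" if "z \<in> \<Xi>" for z
      using theI'[OF one[OF that]] by (auto simp: f_def)
    have fu: "y = f z" if "z \<in> \<Xi>" "y \<in> ?X" "dist (fst z) (fst y - ?s k) < \<delta>" for y z
      using one[OF that(1)] f[OF that(1)] that by blast
    have "inj_on f \<Xi>"
    proof (rule inj_onI, rule ccontr)
      fix z w assume zw: "z \<in> \<Xi>" "w \<in> \<Xi>" "f z = f w" "z \<noteq> w"
      then have "fst z \<noteq> fst w" using fin\<Xi>(2) by (auto simp: inj_on_def)
      then have "ball (fst z) \<delta> \<inter> ball (fst w) \<delta> = {}" using disj zw(1,2) by (auto simp: disjoint_family_on_def)
      moreover have "fst (f z) - ?s k \<in> ball (fst z) \<delta> \<inter> ball (fst w) \<delta>" using f(2)[OF zw(1)] f(2)[OF zw(2)] zw(3) by simp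
      ultimately show False by blast
    qed
    moreover have "f ` \<Xi> = Y k"
    proof (intro equalityI subsetI)
      fix y assume "y \<in> f ` \<Xi>"
      then show "y \<in> Y k" using f ballt by (auto simp: Y_def)
    next
      fix y assume y: "y \<in> Y k"
      have sub: "{y. fst y - ?s k \<in> tile R - (\<Union>x\<in>fst ` \<Xi>. ball x \<delta>)} \<subseteq> ?L \<times> (UNIV :: 'm set)"
        using inL by (auto simp: mem_Times_iff)
      have "tile R - (\<Union>x\<in>fst ` \<Xi>. ball x \<delta>) \<in> sets borel"
        by (intro sets.Diff borel_closed[of "tile R"] borel_open open_UN) (auto simp: tile_def closed_cbox)
      from cnt(2)[OF sets_shifted[OF this] sub] have "card (?X \<inter> {y. fst y - ?s k \<in> tile R - (\<Union>x\<in>fst ` \<Xi>. ball x \<delta>)}) = 0"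
        using cfg(2) by simp
      then have "?X \<inter> {y. fst y - ?s k \<in> tile R - (\<Union>x\<in>fst ` \<Xi>. ball x \<delta>)} = {}"
        using finX by simp
      then have "fst y - ?s k \<in> (\<Union>x\<in>fst ` \<Xi>. ball x \<delta>)" using y by (auto simp: Y_def)
      then obtain z where z: "z \<in> \<Xi>" "dist (fst z) (fst y - ?s k) < \<delta>" by auto
      then have "y = f z" using y by (intro fu) (auto simp: Y_def)
      then show "y \<in> f ` \<Xi>" using z(1) by blast
    qed
    ultimately show ?thesis using f(2) by blast
  qed
  have deep: "\<exists>z\<in>\<Xi>. dist (fst z) (fst y - ?s k) < \<delta>" if "k \<in> ?I" "y \<in> Y k" for k y
    using near[OF that(1)] that(2) by (metis imageE)
  \<comment> \<open>This is the margin: a point of a cluster is farther than \<rho> from the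
    boundary of its tile.\<close>
  have deepn: "norm (fst y - ?s k) + \<rho> < R" if ky: "k \<in> ?I" "y \<in> Y k" for k y
  proof -
    obtain z where z: "z \<in> \<Xi>" "dist (fst z) (fst y - ?s k) < \<delta>" using deep[OF ky] by blast
    have "norm (fst y - ?s k) \<le> norm (fst z) + dist (fst z) (fst y - ?s k)" by (metis dist_norm norm_triangle_sub norm_minus_commute)
    then show ?thesis using far[OF z(1)] z(2) by linarith
  qed
  have YX: "Y k \<subseteq> ?X" for k by (auto simp: Y_def)
  have dY: "disjoint_family_on Y ?I"
    unfolding disjoint_family_on_def
  proof (intro ballI impI, rule ccontr)
    fix k k' assume k: "k \<in> ?I" "k' \<in> ?I" "k \<noteq> k'" and "Y k \<inter> Y k' \<noteq> {}"
    then obtain y where y: "y \<in> Y k" "y \<in> Y k'" by blast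
    \<comment> \<open>A common point would lie strictly inside both tiles, so the two centres would
      differ by less than \<open>2 * R\<close> in coordinate \<open>i\<close>; distinct grid centres
      differ by at least that much there.\<close>
    obtain i where i: "k i \<noteq> k' i" using k(3) by auto
    have "\<bar>(fst y - ?s k) $ i\<bar> < R" "\<bar>(fst y - ?s k') $ i\<bar> < R"
      using component_le_norm_cart[of "fst y - ?s k" i] component_le_norm_cart[of "fst y - ?s k'" i]
        deepn[OF k(1) y(1)] deepn[OF k(2) y(2)] \<rho> by linarith+
    then have lt: "\<bar>2 * R * real (k i) - 2 * R * real (k' i)\<bar> < 2 * R" by (simp add: grid_shift_def abs_less_iff)
    have "1 \<le> \<bar>real (k i) - real (k' i)\<bar>" using i by linarith
    then have "2 * R * 1 \<le> 2 * R * \<bar>real (k i) - real (k' i)\<bar>" using R by (intro mult_left_mono) auto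
    also have "\<dots> = \<bar>2 * R * real (k i) - 2 * R * real (k' i)\<bar>" using R by (simp add: abs_mult flip: right_diff_distrib)
    finally show False using lt by simp
  qed
  \<comment> \<open>By monotonicity each pair of vertices of such a simplex has \<kappa> at most
    \<open>T\<close>, hence distance at most \<rho>. By the margin, one vertex in the cluster keeps
    all the others inside the tile, and every point of the tile belongs to the cluster.\<close>
  have sep: "\<sigma> \<subseteq> Y k \<or> \<sigma> \<inter> Y k = {}" if k: "k \<in> ?I" and \<sigma>: "\<sigma> \<in> kappa_complex \<kappa> ?X (ereal T)" for k \<sigma>
  proof (cases "\<sigma> \<inter> Y k = {}")
    case False
    then obtain y where y: "y \<in> \<sigma>" "y \<in> Y k" by blast
    have "w \<in> Y k" if w: "w \<in> \<sigma>" for w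
    proof -
      have s: "\<sigma> \<subseteq> ?X" "enn2ereal (\<kappa> \<sigma>) \<le> ereal T" using \<sigma> by (auto simp: kappa_complex_def)
      have fs: "\<sigma> \<in> finite_subsets" "{y, w} \<in> finite_subsets" using s(1) finX y(1) finite_subset by (auto simp: finite_subsets_def)
      have "\<kappa> {y, w} \<le> \<kappa> \<sigma>" using mono fs y(1) w by auto
      also have "\<kappa> \<sigma> \<le> ennreal T"
      proof -
        have "enn2real (\<kappa> \<sigma>) \<le> T" using s(2) fin fs(1) by (simp add: enn2ereal_le_iff_enn2real)
        then show ?thesis using fin fs(1) by (metis ennreal_enn2real_if ennreal_leI infinity_ennreal_def less_irrefl)
      qed
      finally have "norm (fst y - fst w) \<le> \<rho>" by (rule reach)
      moreover have "norm (fst w - ?s k) \<le> norm (fst y - ?s k) + norm (fst y - fst w)"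
        using norm_triangle_ineq4[of "fst y - ?s k" "fst y - fst w"] by simp
      ultimately have "norm (fst w - ?s k) \<le> R" using deepn[OF k y(2)] by linarith
      then have "fst w - ?s k \<in> tile R" unfolding mem_tile using component_le_norm_cart order_trans by blast
      then show ?thesis using w s(1) by (auto simp: Y_def)
    qed
    then show ?thesis by blast
  qed simp
  have one: "1 \<le> box_count F \<kappa> (Y k) q (ereal a1) (ereal a2) (ereal b1) (ereal b2)" if k: "k \<in> ?I" for k
  proof -
    obtain f where f: "inj_on f \<Xi>" "f ` \<Xi> = Y k" "\<forall>z\<in>\<Xi>. dist (fst z) (fst (f z) - ?s k) < \<delta>" using near[OF k] by blast
    have "dist (fst (f z)) (fst z + ?s k) \<le> \<delta>" if "z \<in> \<Xi>" for z
    proof -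
      have "fst z - (fst (f z) - ?s k) = - (fst (f z) - (fst z + ?s k))" by simp
      then have "dist (fst z) (fst (f z) - ?s k) = dist (fst (f z)) (fst z + ?s k)" unfolding dist_norm by (metis norm_minus_cancel)
      then show ?thesis using f(3) that by fastforce
    qed
    from box_count_perturbation[OF fin inv lip c fin\<Xi>(1) f(1) this gap ab(1,2), where F=F and q=q]
    show ?thesis using pos f(2) by simp
  qed
  have "card ?I \<le> (\<Sum>k\<in>?I. box_count F \<kappa> (Y k) q (ereal a1) (ereal a2) (ereal b1) (ereal b2))"
    using sum_mono[of ?I "\<lambda>_. 1" "\<lambda>k. box_count F \<kappa> (Y k) q (ereal a1) (ereal a2) (ereal b1) (ereal b2)"] one by simp
  also have "\<dots> \<le> box_count F \<kappa> ?X q (ereal a1) (ereal a2) (ereal b1) (ereal b2)"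
    by (rule box_count_superadditive[OF finI finX fin _ _ _ _ _ YX dY sep]) (use ab in auto)
  finally show ?thesis .
qed

section \<open>The limiting measure\<close>

text \<open>The order triangle in the square of extended reals is compact, and \<open>Delta'\<close>
  is obtained by removing one point, hence open in it.\<close>

lemma locally_compact_Delta': "locally_compact_space Delta'_top"
proof -
  let ?C = "{p :: ereal \<times> ereal. 0 \<le> fst p \<and> fst p \<le> snd p}"
  have "compact (UNIV \<times> UNIV :: (ereal \<times> ereal) set)" by (intro compact_Times compact_UNIV)
  then have "compact (UNIV \<inter> ?C)" by (intro compact_Int_closed closed_ereal_order_pairs) simp
  then have "locally_compact_space (top_of_set ?C)"
    by (intro compact_imp_locally_compact_space) (simp add: compact_space_subtopology compactin_euclidean_iff)
  moreover have "openin (top_of_set ?C) Delta'"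
    unfolding Delta'_eq by (rule openin_delete) simp
  ultimately have "locally_compact_space (subtopology (top_of_set ?C) Delta')"
    by (intro locally_compact_space_open_subset[of "top_of_set ?C"] disjI1 Hausdorff_space_top_of_set)
  moreover have "?C \<inter> Delta' = Delta'" by (auto simp: Delta'_eq)
  ultimately show ?thesis by (simp add: subtopology_subtopology)
qed

lemma AE_finite_simple:
  fixes \<Phi> :: "'w \<Rightarrow> (('a::euclidean_space) \<times> 'm::{second_countable_topology, t2_space}) measure"
  assumes \<Phi>: "marked_point_process P \<Phi>" and \<Lambda>: "bounded \<Lambda>"
  shows "AE \<omega> in P. \<Phi> \<omega> \<in> counting_measures euclidean \<and> emeasure (ground (\<Phi> \<omega>)) \<Lambda> < \<infinity> \<and>
    (\<forall>x. emeasure (ground (\<Phi> \<omega>)) {x} \<le> 1)"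
proof -
  have "AE \<omega> in P. \<forall>x. emeasure (ground (\<Phi> \<omega>)) {x} \<le> 1"
    using \<Phi> by (simp add: marked_point_process_def simple_process_def)
  then show ?thesis
    by (rule AE_mp) (intro AE_I2 impI conjI marked_point_processD[OF \<Phi>] \<Lambda>; simp)
qed

text \<open>Integrals of functions that are not known to be measurable need not be additive. For
  countably many sets, measurable versions agree with the masses simultaneously almost surely; this
  gives the countable additivity that lets \<open>measure_of\<close> return the intended
  values.\<close>

lemma
  fixes \<Phi> :: "'w \<Rightarrow> (('a::euclidean_space) \<times> 'm::{second_countable_topology, t2_space}) measure"
    and F :: "'f::field itself"
  assumes lc: "locally_compact_space (euclidean :: 'm topology)" and \<Phi>: "marked_point_process P \<Phi>"
    and \<kappa>: "measurable_set_function \<kappa>" "\<forall>\<sigma>\<in>finite_subsets. \<kappa> \<sigma> < \<infinity>"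
    and \<Lambda>: "\<Lambda> \<in> sets borel" "bounded \<Lambda>"
  shows sets_expected_verbose: "sets (expected_measure P Delta'_top (verbose_process F \<kappa> \<Phi> q \<Lambda>)) = sets (borel_of Delta'_top)"
    and emeasure_expected_verbose: "A \<in> sets (borel_of Delta'_top) \<Longrightarrow>
      emeasure (expected_measure P Delta'_top (verbose_process F \<kappa> \<Phi> q \<Lambda>)) A
        = (\<integral>\<^sup>+\<omega>. emeasure (verbose_process F \<kappa> \<Phi> q \<Lambda> \<omega>) A \<partial>P)"
proof -
  let ?\<xi> = "verbose_process F \<kappa> \<Phi> q \<Lambda>"
  let ?E = "expected_measure P Delta'_top ?\<xi>"
  have sub: "sets (borel_of Delta'_top) \<subseteq> Pow (topspace Delta'_top)"
    using sets.space_closed[of "borel_of Delta'_top"] by simp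
  have sa: "sigma_algebra (topspace Delta'_top) (sets (borel_of Delta'_top))"
    using sets.sigma_algebra_axioms[of "borel_of Delta'_top"] by simp
  show s: "sets ?E = sets (borel_of Delta'_top)"
    unfolding expected_measure_def using sets_measure_of[OF sub] sigma_algebra.sigma_sets_eq[OF sa] by simp
  have \<xi>s: "sets (?\<xi> \<omega>) = sets (borel_of Delta'_top)" for \<omega> by (simp add: verbose_process_def sets_diagram_measure)
  have add: "countably_additive (sets ?E) (\<lambda>A. \<integral>\<^sup>+\<omega>. emeasure (?\<xi> \<omega>) A \<partial>P)"
    unfolding countably_additive_def
  proof (intro allI impI)
    fix A :: "nat \<Rightarrow> (ereal \<times> ereal) set"
    assume A: "range A \<subseteq> sets ?E" "disjoint_family A" "\<Union> (range A) \<in> sets ?E"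
    have "\<forall>i. \<exists>h. h \<in> borel_measurable P \<and> (AE \<omega> in P. emeasure (?\<xi> \<omega>) (A i) = h \<omega>)"
    proof
      fix i
      have "A i \<in> sets (borel_of Delta'_top)" using A(1) s by auto
      from verbose_process_AE_measurable[OF lc \<Phi> \<kappa> \<Lambda> this, where F=F and q=q]
      show "\<exists>h. h \<in> borel_measurable P \<and> (AE \<omega> in P. emeasure (?\<xi> \<omega>) (A i) = h \<omega>)" by blast
    qed
    then obtain h where h: "\<And>i. h i \<in> borel_measurable P" "\<And>i. AE \<omega> in P. emeasure (?\<xi> \<omega>) (A i) = h i \<omega>"
      by metis
    have all: "AE \<omega> in P. \<forall>i. emeasure (?\<xi> \<omega>) (A i) = h i \<omega>" using h(2) by (simp add: AE_all_countable)
    have "suminf (\<lambda>i. \<integral>\<^sup>+\<omega>. emeasure (?\<xi> \<omega>) (A i) \<partial>P) = suminf (\<lambda>i. \<integral>\<^sup>+\<omega>. h i \<omega> \<partial>P)"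
      by (intro suminf_cong nn_integral_cong_AE h(2))
    also have "\<dots> = (\<integral>\<^sup>+\<omega>. suminf (\<lambda>i. h i \<omega>) \<partial>P)" by (rule nn_integral_suminf[symmetric]) (rule h(1))
    also have "\<dots> = (\<integral>\<^sup>+\<omega>. emeasure (?\<xi> \<omega>) (\<Union> (range A)) \<partial>P)"
    proof (rule nn_integral_cong_AE, rule AE_mp[OF all], rule AE_I2, rule impI)
      fix \<omega> assume "\<forall>i. emeasure (?\<xi> \<omega>) (A i) = h i \<omega>"
      then have "suminf (\<lambda>i. h i \<omega>) = suminf (\<lambda>i. emeasure (?\<xi> \<omega>) (A i))" by simp
      also have "\<dots> = emeasure (?\<xi> \<omega>) (\<Union> (range A))" by (rule suminf_emeasure) (use A s \<xi>s in auto)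
      finally show "suminf (\<lambda>i. h i \<omega>) = emeasure (?\<xi> \<omega>) (\<Union> (range A))" .
    qed
    finally show "suminf (\<lambda>i. \<integral>\<^sup>+\<omega>. emeasure (?\<xi> \<omega>) (A i) \<partial>P) = (\<integral>\<^sup>+\<omega>. emeasure (?\<xi> \<omega>) (\<Union> (range A)) \<partial>P)" .
  qed
  show "emeasure ?E A = (\<integral>\<^sup>+\<omega>. emeasure (?\<xi> \<omega>) A \<partial>P)" if "A \<in> sets (borel_of Delta'_top)"
    by (rule emeasure_measure_of[OF expected_measure_def sub _ add]) (simp_all add: positive_def s that)
qed

text \<open>The diagram has at most as many points as the power \<open>Suc q\<close> of the number
  of marked points in the window, so the moment of that order bounds the mean.\<close>

lemma expected_verbose_finite:
  fixes \<Phi> :: "'w \<Rightarrow> (('a::euclidean_space) \<times> 'm::{second_countable_topology, t2_space}) measure"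
    and F :: "'f::field itself"
  assumes lc: "locally_compact_space (euclidean :: 'm topology)" and \<Phi>: "marked_point_process P \<Phi>"
    and mom: "ground_finite_moments P \<Phi>"
    and \<kappa>: "measurable_set_function \<kappa>" "\<forall>\<sigma>\<in>finite_subsets. \<kappa> \<sigma> < \<infinity>"
    and \<Lambda>: "\<Lambda> \<in> sets borel" "bounded \<Lambda>" and A: "A \<in> sets (borel_of Delta'_top)"
  shows "emeasure (expected_measure P Delta'_top (verbose_process F \<kappa> \<Phi> q \<Lambda>)) A < \<infinity>"
proof -
  have "(\<integral>\<^sup>+\<omega>. emeasure (verbose_process F \<kappa> \<Phi> q \<Lambda> \<omega>) A \<partial>P) \<le> (\<integral>\<^sup>+\<omega>. emeasure (ground (\<Phi> \<omega>)) \<Lambda> ^ Suc q \<partial>P)"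
  proof (rule nn_integral_mono_AE, rule AE_mp[OF AE_finite_simple[OF \<Phi> \<Lambda>(2)]], rule AE_I2, rule impI, elim conjE)
    fix \<omega> assume good: "\<Phi> \<omega> \<in> counting_measures euclidean" "emeasure (ground (\<Phi> \<omega>)) \<Lambda> < \<infinity>" "\<forall>x. emeasure (ground (\<Phi> \<omega>)) {x} \<le> 1"
    let ?X = "marked_points (\<Phi> \<omega>) \<Lambda>" and ?D = "verbose_diagram F (kappa_filtration \<kappa> (marked_points (\<Phi> \<omega>) \<Lambda>)) q"
    note cnt = marked_points_counting[OF good(1) \<Lambda>(1) good(2) good(3)[rule_format]]
    have fX: "finite ?X" using cnt(1) by (simp add: finite_simple_marked_set_def)
    have sb: "sets (\<Phi> \<omega>) = sets borel" by (rule counting_measures_euclideanD(1)[OF good(1)])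
    have "emeasure (ground (\<Phi> \<omega>)) \<Lambda> = of_nat (card (?X \<inter> \<Lambda> \<times> UNIV))"
      using cnt(2)[OF emeasure_ground(2)[OF sb \<Lambda>(1)]] emeasure_ground(1)[OF sb \<Lambda>(1)] by simp
    also have "?X \<inter> \<Lambda> \<times> UNIV = ?X" by (auto simp: marked_points_def)
    finally have g: "emeasure (ground (\<Phi> \<omega>)) \<Lambda> = of_nat (card ?X)" .
    have "size {#p \<in># ?D. p \<in> A#} \<le> card ?X ^ Suc q"
      using size_filter_mset_lesseq size_verbose_diagram_le[OF fX \<kappa>(2)] by (rule order_trans)
    then have "(of_nat (size {#p \<in># ?D. p \<in> A#}) :: ennreal) \<le> of_nat (card ?X ^ Suc q)" by (rule of_nat_mono)
    then show "emeasure (verbose_process F \<kappa> \<Phi> q \<Lambda> \<omega>) A \<le> emeasure (ground (\<Phi> \<omega>)) \<Lambda> ^ Suc q"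
      by (simp add: verbose_process_def emeasure_diagram_measure[OF A] g)
  qed
  also have "\<dots> < \<infinity>" using mom \<Lambda> unfolding ground_finite_moments_def by (metis One_nat_def Suc_le_mono le0)
  finally show ?thesis by (simp add: emeasure_expected_verbose[OF lc \<Phi> \<kappa> \<Lambda> A])
qed

lemma sets_configuration:
  fixes S :: "'a::euclidean_space set"
  assumes lc: "locally_compact_space (euclidean :: 'm::{second_countable_topology, t2_space} topology)"
    and D: "finite D" and S: "S \<in> sets borel"
  shows "(configuration D \<delta> S v :: ('a \<times> 'm) measure set) \<in> sets (counting_space euclidean)"
proof -
  have lcp: "locally_compact_space (euclidean :: ('a \<times> 'm) topology)"
  proof -
    have "locally_compact_space (prod_topology (euclidean :: 'a topology) (euclidean :: 'm topology))"
      unfolding locally_compact_space_prod_topology using lc locally_compact_space_euclidean[where 'a='a] by simp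
    then show ?thesis by (simp add: prod_topology_euclidean)
  qed
  have eq: "{\<mu> \<in> space (counting_space euclidean). emeasure \<mu> {z :: 'a \<times> 'm. fst z - v \<in> B} = k} \<in> sets (counting_space euclidean)"
    if "B \<in> sets borel" for B k
    using measurable_sets[OF measurable_emeasure_euclidean[OF lcp sets_shifted[OF that, of v]], of "{k}"]
    by (simp add: vimage_def Int_def conj_commute)
  have "S - (\<Union>x\<in>D. ball x \<delta>) \<in> sets borel"
    by (rule sets.Diff[OF S]) (intro borel_open open_UN, simp)
  then have "{\<mu> \<in> space (counting_space euclidean). (\<forall>x\<in>D. emeasure \<mu> {z :: 'a \<times> 'm. fst z - v \<in> ball x \<delta>} = 1) \<and>
     emeasure \<mu> {z. fst z - v \<in> S - (\<Union>x\<in>D. ball x \<delta>)} = 0} \<in> sets (counting_space euclidean)"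
    by (intro sets.sets_Collect_conj sets.sets_Collect_finite_All' sets.sets_Collect_finite_All eq D) auto
  then show ?thesis by (simp add: configuration_def space_counting_space)
qed

text \<open>The configuration about \<open>v\<close> is the preimage under
  \<open>translate v\<close> of the configuration about 0, and the law is invariant under that
  map.\<close>

lemma stationary_configuration:
  fixes \<Phi> :: "'w \<Rightarrow> (('a::euclidean_space) \<times> 'm::{second_countable_topology, t2_space}) measure"
  assumes lc: "locally_compact_space (euclidean :: 'm topology)" and \<Phi>: "marked_point_process P \<Phi>" and st: "stationary P \<Phi>"
    and D: "finite D" and S: "S \<in> sets borel"
  shows "{\<omega>\<in>space P. \<Phi> \<omega> \<in> configuration D \<delta> S v} \<in> sets P"
    and "emeasure P {\<omega>\<in>space P. \<Phi> \<omega> \<in> configuration D \<delta> S v} = emeasure P {\<omega>\<in>space P. \<Phi> \<omega> \<in> configuration D \<delta> S 0}"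
proof -
  let ?C = "\<lambda>v. configuration D \<delta> S v :: ('a \<times> 'm) measure set"
  let ?CS = "counting_space (euclidean :: ('a \<times> 'm) topology)"
  have m: "\<Phi> \<in> measurable P ?CS" using \<Phi> by (simp add: marked_point_process_def point_process_def)
  note sC = sets_configuration[OF lc D S]
  have e: "\<Phi> -` ?C v \<inter> space P = {\<omega>\<in>space P. \<Phi> \<omega> \<in> ?C v}" for v by auto
  show "{\<omega>\<in>space P. \<Phi> \<omega> \<in> ?C v} \<in> sets P" using measurable_sets[OF m sC[of \<delta> v]] unfolding e .
  have law: "emeasure (law P euclidean \<Phi>) (?C v) = emeasure P {\<omega>\<in>space P. \<Phi> \<omega> \<in> ?C v}" for v
    unfolding law_def by (simp add: emeasure_distr[OF m sC] e)
  have t: "translate v \<in> measurable (law P euclidean \<Phi>) ?CS"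
    unfolding law_def using measurable_translate[of v] by simp
  have "translate v -` ?C 0 \<inter> space (law P euclidean \<Phi>) = ?C v"
  proof -
    have "translate v \<mu> \<in> ?C 0 \<longleftrightarrow> \<mu> \<in> ?C v" if \<mu>: "\<mu> \<in> counting_measures euclidean" for \<mu>
    proof -
      have "translate v \<mu> \<in> counting_measures euclidean"
        using measurable_space[OF measurable_translate[of v], of \<mu>] \<mu> by (simp add: space_counting_space)
      note tr = this
      have e: "emeasure (translate v \<mu>) {z. fst z - 0 \<in> B} = emeasure \<mu> {z. fst z - v \<in> B}" if "B \<in> sets borel" for B
        using translate_properties[OF counting_measures_euclideanD(1)[OF \<mu>] sets_shifted[OF that, of 0], of v]
        by (simp add: case_prod_unfold)
      have SD: "S - (\<Union>x\<in>D. ball x \<delta>) \<in> sets borel" by (rule sets.Diff[OF S]) (intro borel_open open_UN, simp)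
      have "ball x \<delta> \<in> sets borel" for x :: 'a by simp
      from e[OF this] show ?thesis unfolding configuration_def mem_Collect_eq e[OF SD] by (simp only: tr \<mu> simp_thms)
    qed
    moreover have "?C v \<subseteq> counting_measures euclidean" by (auto simp: configuration_def)
    ultimately show ?thesis by (auto simp: law_def space_counting_space)
  qed
  then have "emeasure (distr (law P euclidean \<Phi>) ?CS (translate v)) (?C 0) = emeasure (law P euclidean \<Phi>) (?C v)"
    by (simp add: emeasure_distr[OF t sC])
  moreover have "distr (law P euclidean \<Phi>) ?CS (translate v) = law P euclidean \<Phi>" using st unfolding stationary_def by blast
  ultimately show "emeasure P {\<omega>\<in>space P. \<Phi> \<omega> \<in> ?C v} = emeasure P {\<omega>\<in>space P. \<Phi> \<omega> \<in> ?C 0}" by (simp add: law)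
qed

lemma finite_positive_lower_bound:
  fixes A :: "real set"
  assumes "finite A" "\<And>a. a \<in> A \<Longrightarrow> 0 < a"
  obtains g where "0 < g" "\<And>a. a \<in> A \<Longrightarrow> g \<le> a"
proof
  \<comment> \<open>The added 1 serves the case of an empty set.\<close>
  show "0 < Min (insert 1 A)" using assms by (subst Min_gr_iff) auto
  show "Min (insert 1 A) \<le> a" if "a \<in> A" for a using assms(1) that by (intro Min_le) auto
qed

text \<open>All that the argument keeps from the comparison with the Poisson process is
  \<open>configuration_positive\<close>, in which neither the Poisson process nor the densities
  occur.\<close>

locale limiting_diagram =
  fixes P :: "'w measure"
    and \<Phi> :: "'w \<Rightarrow> ((real ^ 'n) \<times> 'm::{second_countable_topology, t2_space}) measure"
    and \<kappa> :: "((real ^ 'n) \<times> 'm) set \<Rightarrow> ennreal" and c :: real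
    and F :: "'f::field itself" and q :: nat and \<nu> :: "(ereal \<times> ereal) measure"
  assumes lc: "locally_compact_space (euclidean :: 'm topology)"
    and prob: "prob_space P" and marked: "marked_point_process P \<Phi>" and stationary: "stationary P \<Phi>"
    and moments: "ground_finite_moments P \<Phi>"
    and filtration: "filtration_function \<kappa>"
    and finite_kappa: "\<forall>\<sigma>\<in>finite_subsets. \<kappa> \<sigma> < \<infinity>"
    and c_pos: "0 < c"
    and lipschitz: "\<And>\<sigma> \<sigma>'. \<sigma> \<in> finite_subsets \<Longrightarrow> \<sigma>' \<in> finite_subsets \<Longrightarrow>
           \<bar>enn2real (\<kappa> \<sigma>) - enn2real (\<kappa> \<sigma>')\<bar> \<le> c * hausdorff_dist (fst ` \<sigma>) (fst ` \<sigma>')"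
    and limiting: "is_limiting_measure F \<kappa> P \<Phi> q \<nu>"
    and configuration_positive: "\<And>D \<delta> R. finite D \<Longrightarrow> 0 < \<delta> \<Longrightarrow> disjoint_family_on (\<lambda>x. ball x \<delta>) D \<Longrightarrow>
           (\<And>x. x \<in> D \<Longrightarrow> ball x \<delta> \<subseteq> tile R) \<Longrightarrow>
           0 < emeasure P {\<omega>\<in>space P. \<Phi> \<omega> \<in> configuration D \<delta> (tile R) 0}"
begin

lemma kappa_measurable: "measurable_set_function \<kappa>"
  and kappa_mono: "\<forall>\<sigma>\<in>finite_subsets. \<forall>\<tau>\<in>finite_subsets. \<sigma> \<subseteq> \<tau> \<longrightarrow> \<kappa> \<sigma> \<le> \<kappa> \<tau>"
  and kappa_translate: "\<forall>\<sigma>\<in>finite_subsets. \<forall>x. \<kappa> ((\<lambda>(y, m). (y + x, m)) ` \<sigma>) = \<kappa> \<sigma>"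
  by (rule filtration[unfolded filtration_function_def, THEN conjunct1]
      filtration[unfolded filtration_function_def, THEN conjunct2, THEN conjunct1]
      filtration[unfolded filtration_function_def, THEN conjunct2, THEN conjunct2, THEN conjunct1])+

text \<open>The control function of the filtration is finite at the finite value
  \<open>ennreal T\<close>, so it can be replaced there by a real number.\<close>

lemma diameter_bound:
  obtains \<rho> where "0 \<le> \<rho>" "\<And>z w. \<kappa> {z, w} \<le> ennreal T \<Longrightarrow> norm (fst z - fst w) \<le> \<rho>"
proof -
  obtain \<rho> :: "ennreal \<Rightarrow> ennreal" where \<rho>: "mono \<rho>" "\<forall>t<\<infinity>. \<rho> t < \<infinity>"
      "\<forall>x m y n. ennreal (norm (x - y)) \<le> \<rho> (\<kappa> {(x, m), (y, n)})"
    using filtration[unfolded filtration_function_def, THEN conjunct2, THEN conjunct2, THEN conjunct2] by (elim exE conjE)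
  have fin: "\<rho> (ennreal T) < \<infinity>" using \<rho>(2) by simp
  show ?thesis
  proof (rule that)
    show "0 \<le> enn2real (\<rho> (ennreal T))" by simp
    fix z w :: "(real ^ 'n) \<times> 'm" assume "\<kappa> {z, w} \<le> ennreal T"
    then have "\<rho> (\<kappa> {z, w}) \<le> \<rho> (ennreal T)" using \<rho>(1) by (rule monoD[rotated])
    moreover have "ennreal (norm (fst z - fst w)) \<le> \<rho> (\<kappa> {z, w})" using \<rho>(3)[rule_format, of "fst z" "fst w" "snd z" "snd w"] by simp
    ultimately have "ennreal (norm (fst z - fst w)) \<le> ennreal (enn2real (\<rho> (ennreal T)))"
      using fin by (simp add: order_trans)
    then show "norm (fst z - fst w) \<le> enn2real (\<rho> (ennreal T))" by (simp add: ennreal_le_iff)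
  qed
qed

lemma big_cube_borel: "big_cube R m \<in> sets (borel :: (real ^ 'n) measure)" "bounded (big_cube R m :: (real ^ 'n) set)"
  by (simp_all add: big_cube_def bounded_cbox)

text \<open>The limiting measure is tested along these cubes only, since they can be tiled. Starting
  at \<open>Suc n\<close> makes every volume positive when \<open>R\<close> is.\<close>

definition mean_diagram :: "real \<Rightarrow> nat \<Rightarrow> (ereal \<times> ereal) measure" where
  "mean_diagram R n = scale_measure (1 / emeasure lborel (big_cube R (Suc n) :: (real ^ 'n) set))
     (expected_measure P Delta'_top (verbose_process F \<kappa> \<Phi> q (big_cube R (Suc n))))"

lemma emeasure_mean_diagram:
  assumes "0 < R" "A \<in> sets (borel_of Delta'_top)"
  shows "emeasure (mean_diagram R n) A = (1 / ennreal ((2 * real (Suc n) * R) ^ CARD('n))) *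
    (\<integral>\<^sup>+\<omega>. emeasure (verbose_process F \<kappa> \<Phi> q (big_cube R (Suc n)) \<omega>) A \<partial>P)"
  using emeasure_expected_verbose[OF lc marked kappa_measurable finite_kappa big_cube_borel[of R "Suc n"] assms(2), where F=F and q=q]
  by (simp add: mean_diagram_def emeasure_big_cube[OF assms(1)] del: of_nat_Suc)

lemma mean_diagram_radon:
  assumes R: "0 < R"
  shows "mean_diagram R n \<in> radon_measures Delta'_top"
  unfolding radon_measures_def
proof (intro CollectI conjI allI impI)
  show "sets (mean_diagram R n) = sets (borel_of Delta'_top)"
    by (simp add: mean_diagram_def sets_expected_verbose[OF lc marked kappa_measurable finite_kappa big_cube_borel])
  fix K assume "compactin Delta'_top K"
  then have K: "K \<in> sets (borel_of Delta'_top)"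
    by (intro sets_borel_of_closedin compactin_imp_closedin Hausdorff_space_top_of_set)
  have pos: "0 < (2 * real (Suc n) * R) ^ CARD('n)" using R by simp
  have "1 / ennreal ((2 * real (Suc n) * R) ^ CARD('n)) < \<infinity>"
    using pos divide_ennreal[of 1 "(2 * real (Suc n) * R) ^ CARD('n)"] by simp
  then show "emeasure (mean_diagram R n) K < \<infinity>"
    using expected_verbose_finite[OF lc marked moments kappa_measurable finite_kappa big_cube_borel K, where F=F and q=q]
    unfolding emeasure_mean_diagram[OF R K] emeasure_expected_verbose[OF lc marked kappa_measurable finite_kappa big_cube_borel K]
    by (simp add: ennreal_mult_less_top)
qed

lemma mean_diagram_limit:
  assumes "0 < R" "f \<in> Cc Delta'_top"
  shows "(\<lambda>n. integral\<^sup>L (mean_diagram R n) f) \<longlonglongrightarrow> integral\<^sup>L \<nu> f"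
  using limiting convex_averaging_sequence_big_cube[OF assms(1), where 'n='n] assms(2)
  unfolding is_limiting_measure_def vaguely_converges_def mean_diagram_def by blast

lemma nu_radon: "\<nu> \<in> radon_measures Delta'_top"
  using limiting unfolding is_limiting_measure_def by blast

section \<open>The support lies in the closure of the realizable points\<close>

lemma realizable_subset_Delta': "realizable_points F \<kappa> q \<subseteq> Delta'"
  by (auto simp: realizable_points_def)

text \<open>A bump function at a point off the closure integrates to 0 against every mean diagram,
  hence against \<open>\<nu>\<close>. It exceeds 1/2 on a neighbourhood of the point, which
  therefore is null, so the point is not in the support.\<close>

lemma support_subset_closure: "measure_support Delta'_top \<nu> \<subseteq> Delta'_top closure_of realizable_points F \<kappa> q"
proof (rule subsetI, rule ccontr)
  fix p assume p: "p \<in> measure_support Delta'_top \<nu>" "p \<notin> Delta'_top closure_of realizable_points F \<kappa> q"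
  let ?U = "topspace Delta'_top - Delta'_top closure_of realizable_points F \<kappa> q"
  have pD: "p \<in> topspace Delta'_top" using p(1) by (simp add: measure_support_def)
  have U: "openin Delta'_top ?U" by (intro openin_diff openin_topspace closedin_closure_of)
  have K: "compactin Delta'_top {p}" using pD by (rule compactin_sing[THEN iffD2])
  have "{p} \<subseteq> ?U" using p(2) pD by blast
  from ex_Cc_bump[OF locally_compact_Delta' Hausdorff_space_top_of_set K U this]
  obtain f where f: "f \<in> Cc Delta'_top" "\<forall>x\<in>topspace Delta'_top. 0 \<le> f x \<and> f x \<le> 1" "f p = 1"
      "\<forall>x\<in>topspace Delta'_top - ?U. f x = 0" by auto
  have Us: "?U \<in> sets (borel_of Delta'_top)" using U by (rule sets_borel_of_openin)
  have zero: "integral\<^sup>L (mean_diagram 1 n) f = 0" for n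
  proof -
    let ?\<Lambda> = "big_cube 1 (Suc n) :: (real ^ 'n) set"
    have R1: "(0::real) < 1" by simp
    have "AE \<omega> in P. emeasure (verbose_process F \<kappa> \<Phi> q ?\<Lambda> \<omega>) ?U = 0"
    proof (rule AE_mp[OF AE_finite_simple[OF marked big_cube_borel(2)]], rule AE_I2, rule impI, elim conjE)
      fix \<omega> assume good: "\<Phi> \<omega> \<in> counting_measures euclidean" "emeasure (ground (\<Phi> \<omega>)) ?\<Lambda> < \<infinity>" "\<forall>x. emeasure (ground (\<Phi> \<omega>)) {x} \<le> 1"
      let ?X = "marked_points (\<Phi> \<omega>) ?\<Lambda>"
      let ?D = "verbose_diagram F (kappa_filtration \<kappa> ?X) q"
      have X: "finite_simple_marked_set ?X"
        by (rule marked_points_counting(1)[OF good(1) big_cube_borel(1) good(2) good(3)[rule_format]])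
      have "p' \<notin> ?U" if p': "p' \<in># ?D" for p'
      proof
        assume pU: "p' \<in> ?U"
        \<comment> \<open>Realizability asks for a nonempty pattern; the empty one has the empty
          diagram.\<close>
        have "?X \<noteq> {}" using p' verbose_diagram_empty[OF finite_kappa, of F q] by auto
        then have "p' \<in> realizable_points F \<kappa> q" using p' X pU by (auto simp: realizable_points_def)
        then show False using pU closure_of_subset[of "realizable_points F \<kappa> q" Delta'_top] realizable_subset_Delta' by auto
      qed
      then have "set_mset {#p' \<in># ?D. p' \<in> ?U#} = {}" unfolding set_mset_filter by blast
      then have e: "{#p' \<in># ?D. p' \<in> ?U#} = {#}" by (simp only: set_mset_eq_empty_iff)
      show "emeasure (verbose_process F \<kappa> \<Phi> q ?\<Lambda> \<omega>) ?U = 0"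
        unfolding verbose_process_def emeasure_diagram_measure[OF Us] e by simp
    qed
    then have "(\<integral>\<^sup>+\<omega>. emeasure (verbose_process F \<kappa> \<Phi> q ?\<Lambda> \<omega>) ?U \<partial>P) = (\<integral>\<^sup>+\<omega>. 0 \<partial>P)" by (rule nn_integral_cong_AE)
    then have m0: "emeasure (mean_diagram 1 n) ?U = 0"
      unfolding emeasure_mean_diagram[OF R1 Us] by (simp only: nn_integral_const mult_zero_left mult_zero_right)
    have sm: "sets (mean_diagram 1 n) = sets (borel_of Delta'_top)" "space (mean_diagram 1 n) = topspace Delta'_top"
      using radon_measuresD(1,2)[OF mean_diagram_radon[OF R1]] by auto
    have "(\<integral>\<^sup>+x. ennreal (f x) \<partial>mean_diagram 1 n) \<le> (\<integral>\<^sup>+x. indicator ?U x \<partial>mean_diagram 1 n)"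
    proof (rule nn_integral_mono)
      fix x assume "x \<in> space (mean_diagram 1 n)"
      then have "x \<in> topspace Delta'_top" by (simp only: sm)
      then show "ennreal (f x) \<le> indicator ?U x"
        using f(2,4) by (cases "x \<in> ?U") (simp_all add: ennreal_le_1)
    qed
    also have "\<dots> = 0" using Us sm(1) m0 by (simp only: nn_integral_indicator)
    finally have "ennreal (integral\<^sup>L (mean_diagram 1 n) f) = 0"
      using nn_integral_Cc[OF f(1) Hausdorff_space_top_of_set mean_diagram_radon[OF R1, of n]] f(2) by simp
    moreover have "0 \<le> integral\<^sup>L (mean_diagram 1 n) f" by (rule integral_nonneg_AE) (rule AE_I2, use f(2) sm(2) in auto)
    ultimately show ?thesis by (simp add: ennreal_eq_0_iff)
  qed
  have nu0: "integral\<^sup>L \<nu> f = 0"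
    using mean_diagram_limit[OF _ f(1), of 1] by (simp add: zero LIMSEQ_const_iff)
  have ns: "sets \<nu> = sets (borel_of Delta'_top)" "space \<nu> = topspace Delta'_top"
    using radon_measuresD(1,2)[OF nu_radon] by auto
  let ?V = "{x \<in> topspace Delta'_top. f x \<in> {1/2<..}}"
  have "continuous_map Delta'_top euclideanreal f" using f(1) by (simp add: Cc_def)
  then have V: "openin Delta'_top ?V" by (rule openin_continuous_map_preimage) simp
  have "p \<in> ?V" using pD f(3) by simp
  then have "0 < emeasure \<nu> ?V" using p(1) V unfolding measure_support_def by blast
  moreover have "ennreal (1/2) * emeasure \<nu> ?V \<le> 0"
  proof -
    have "ennreal (1/2) * emeasure \<nu> ?V = (\<integral>\<^sup>+x. ennreal (1/2) * indicator ?V x \<partial>\<nu>)"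
      using sets_borel_of_openin[OF V] ns(1) by (simp only: nn_integral_cmult_indicator)
    also have "\<dots> \<le> (\<integral>\<^sup>+x. ennreal (f x) \<partial>\<nu>)"
    proof (rule nn_integral_mono)
      fix x assume "x \<in> space \<nu>"
      show "ennreal (1/2) * indicator ?V x \<le> ennreal (f x)"
      proof (cases "x \<in> ?V")
        case True
        then have "1/2 \<le> f x" by simp
        then have "ennreal (1/2) \<le> ennreal (f x)" by (rule ennreal_leI)
        then show ?thesis by (simp only: indicator_simps(1)[OF True] mult_1_right)
      next
        case False
        then show ?thesis by (simp only: indicator_simps(2)[OF False] mult_zero_right zero_le)
      qed
    qed
    also have "\<dots> = 0" using nn_integral_Cc[OF f(1) Hausdorff_space_top_of_set nu_radon] f(2) nu0 by simp
    finally show ?thesis .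
  qed
  ultimately have "ennreal (1/2) = 0 \<or> emeasure \<nu> ?V = 0" "emeasure \<nu> ?V \<noteq> 0" by (simp_all only: le_zero_eq mult_eq_0_iff less_irrefl)
  then show False by simp
qed

text \<open>The cube contains \<open>Suc n\<close> to the power N tiles, each showing the pattern
  with the same probability, and its volume is the same power times the volume of one tile. The
  quotient is a bound that does not depend on \<open>n\<close>, so it will survive the
  limit.\<close>

lemma mean_diagram_box:
  assumes \<Xi>: "finite_simple_marked_set \<Xi>" and \<delta>: "0 < \<delta>"
    and gap: "\<And>\<sigma> t. \<sigma> \<subseteq> \<Xi> \<Longrightarrow> \<sigma> \<noteq> {} \<Longrightarrow> t \<in> {a1, a2, b1, b2} \<Longrightarrow> c * \<delta> < \<bar>enn2real (\<kappa> \<sigma>) - t\<bar>"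
    and ab: "a1 \<le> a2" "b1 \<le> b2" "a2 \<le> T" "b2 \<le> T"
    and reach: "\<And>z w. \<kappa> {z, w} \<le> ennreal T \<Longrightarrow> norm (fst z - fst w) \<le> \<rho>"
    and far: "\<And>z. z \<in> \<Xi> \<Longrightarrow> norm (fst z) + \<delta> + \<rho> < R" and \<rho>: "0 \<le> \<rho>" and R: "0 < R"
    and disj: "disjoint_family_on (\<lambda>x. ball x \<delta>) (fst ` \<Xi>)"
    and pos: "0 < box_count F \<kappa> \<Xi> q (ereal a1) (ereal a2) (ereal b1) (ereal b2)"
    and K: "K \<in> sets (borel_of Delta'_top)"
      "\<And>p. p \<in> Delta' \<Longrightarrow> ereal a1 \<le> fst p \<Longrightarrow> fst p \<le> ereal a2 \<Longrightarrow> ereal b1 \<le> snd p \<Longrightarrow> snd p \<le> ereal b2 \<Longrightarrow> p \<in> K"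
  shows "emeasure P {\<omega>\<in>space P. \<Phi> \<omega> \<in> configuration (fst ` \<Xi>) \<delta> (tile R) 0} / ennreal ((2 * R) ^ CARD('n))
    \<le> emeasure (mean_diagram R n) K"
proof -
  let ?m = "Suc n"
  let ?\<Lambda> = "big_cube R ?m :: (real ^ 'n) set"
  let ?G = "{k :: 'n \<Rightarrow> nat. \<forall>i. k i < ?m}"
  let ?C = "\<lambda>v. configuration (fst ` \<Xi>) \<delta> (tile R) v :: ((real ^ 'n) \<times> 'm) measure set"
  let ?E = "\<lambda>v. {\<omega>\<in>space P. \<Phi> \<omega> \<in> ?C v}"
  have D: "finite (fst ` \<Xi>)" using \<Xi> by (simp add: finite_simple_marked_set_def)
  have S: "tile R \<in> sets (borel :: (real ^ 'n) measure)" by (simp add: tile_def)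
  note stat = stationary_configuration[OF lc marked stationary D S, of \<delta>]
  have "(\<Sum>k\<in>?G. emeasure P (?E (grid_shift R k))) = (\<Sum>k\<in>?G. emeasure P (?E 0))"
    by (rule sum.cong[OF refl stat(2)])
  then have "of_nat (?m ^ CARD('n)) * emeasure P (?E 0) = (\<Sum>k\<in>?G. emeasure P (?E (grid_shift R k)))"
    unfolding sum_constant card_grid(2) by (rule sym)
  also have "\<dots> = (\<Sum>k\<in>?G. \<integral>\<^sup>+\<omega>. indicator (?E (grid_shift R k)) \<omega> \<partial>P)"
    by (rule sum.cong[OF refl nn_integral_indicator[OF stat(1), symmetric]])
  also have "\<dots> = (\<integral>\<^sup>+\<omega>. (\<Sum>k\<in>?G. indicator (?E (grid_shift R k)) \<omega>) \<partial>P)"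
    by (rule nn_integral_sum[symmetric]) (rule borel_measurable_indicator[OF stat(1)])
  also have "\<dots> \<le> (\<integral>\<^sup>+\<omega>. emeasure (verbose_process F \<kappa> \<Phi> q ?\<Lambda> \<omega>) K \<partial>P)"
  proof (rule nn_integral_mono_AE, rule AE_mp[OF AE_finite_simple[OF marked big_cube_borel(2)]], rule AE_I2, rule impI, elim conjE)
    fix \<omega> assume w: "\<omega> \<in> space P" and good: "\<Phi> \<omega> \<in> counting_measures euclidean" "emeasure (ground (\<Phi> \<omega>)) ?\<Lambda> < \<infinity>" "\<forall>x. emeasure (ground (\<Phi> \<omega>)) {x} \<le> 1"
    let ?X = "marked_points (\<Phi> \<omega>) ?\<Lambda>"
    let ?D = "verbose_diagram F (kappa_filtration \<kappa> ?X) q"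
    have X: "finite ?X"
      using marked_points_counting(1)[OF good(1) big_cube_borel(1) good(2) good(3)[rule_format]] by (simp add: finite_simple_marked_set_def)
    have s1: "(\<Sum>k\<in>?G. indicator (?E (grid_shift R k)) \<omega> :: ennreal) = of_nat (card {k \<in> ?G. \<Phi> \<omega> \<in> ?C (grid_shift R k)})"
      using w sum.inter_filter[OF card_grid(1)[of ?m, where 'n='n], of "\<lambda>_. 1 :: ennreal" "\<lambda>k. \<Phi> \<omega> \<in> ?C (grid_shift R k)"]
      by (simp add: indicator_def of_bool_def)
    have s2: "of_nat (card {k \<in> ?G. \<Phi> \<omega> \<in> ?C (grid_shift R k)}) \<le> (of_nat (box_count F \<kappa> ?X q (ereal a1) (ereal a2) (ereal b1) (ereal b2)) :: ennreal)"
      unfolding mem_Collect_eq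
      by (rule of_nat_mono) (rule configurations_le_box_count[OF finite_kappa kappa_mono kappa_translate lipschitz c_pos \<Xi> \<delta> gap ab reach far \<rho> R disj pos good(1) good(2) good(3)[rule_format]])
    have s3: "of_nat (box_count F \<kappa> ?X q (ereal a1) (ereal a2) (ereal b1) (ereal b2)) \<le> (of_nat (size {#p \<in># ?D. p \<in> K#}) :: ennreal)"
    proof (rule of_nat_mono)
      let ?box = "\<lambda>p. ereal a1 < fst p \<and> fst p \<le> ereal a2 \<and> ereal b1 < snd p \<and> snd p \<le> ereal b2"
      have inK: "p \<in> K" if p: "p \<in># ?D" "?box p" for p
      proof -
        \<comment> \<open>The set \<open>K\<close> is described by its points in
          \<open>Delta'\<close>, so the diagram points of the box must first be placed
          there.\<close>
        have "0 \<le> fst p" "fst p \<le> snd p"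
          by (rule verbose_diagram_birth_le_death[OF X finite_kappa _ p(1)], rule kappa_mono[rule_format], assumption+)+
        then have "p \<in> Delta'" using p(2) by (auto simp: Delta'_eq)
        then show "p \<in> K" using p(2) by (intro K(2)) auto
      qed
      have "filter_mset ?box ?D = filter_mset ?box {#p \<in># ?D. p \<in> K#}"
        unfolding filter_filter_mset by (rule filter_mset_cong) (use inK in auto)
      then show "box_count F \<kappa> ?X q (ereal a1) (ereal a2) (ereal b1) (ereal b2) \<le> size {#p \<in># ?D. p \<in> K#}"
        unfolding box_count_def by (simp only: size_filter_mset_lesseq)
    qed
    show "(\<Sum>k\<in>?G. indicator (?E (grid_shift R k)) \<omega>) \<le> emeasure (verbose_process F \<kappa> \<Phi> q ?\<Lambda> \<omega>) K"
      unfolding s1 verbose_process_def emeasure_diagram_measure[OF K(1)] using s2 s3 by (rule order_trans)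
  qed
  finally have le: "of_nat (?m ^ CARD('n)) * emeasure P (?E 0) \<le> (\<integral>\<^sup>+\<omega>. emeasure (verbose_process F \<kappa> \<Phi> q ?\<Lambda> \<omega>) K \<partial>P)" .
  obtain p0 where p0: "0 \<le> p0" "emeasure P (?E 0) = ennreal p0"
    using prob_space.emeasure_le_1[OF prob, of "?E 0"] by (cases "emeasure P (?E 0)") (auto simp: top_unique)
  have pos: "0 < (2 * R) ^ CARD('n)" "0 < real ?m ^ CARD('n)" using R by simp_all
  have vol: "(2 * real ?m * R) ^ CARD('n) = real ?m ^ CARD('n) * (2 * R) ^ CARD('n)" by (simp add: power_mult_distrib del: of_nat_Suc)
  have "emeasure P (?E 0) / ennreal ((2 * R) ^ CARD('n)) = ennreal (p0 / (2 * R) ^ CARD('n))"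
    unfolding p0(2) using p0(1) pos by (simp only: divide_ennreal)
  also have "p0 / (2 * R) ^ CARD('n) = (1 / (2 * real ?m * R) ^ CARD('n)) * (real ?m ^ CARD('n) * p0)"
    unfolding vol using pos by (simp add: field_simps del: of_nat_Suc)
  also have "ennreal \<dots> = (1 / ennreal ((2 * real ?m * R) ^ CARD('n))) * (of_nat (?m ^ CARD('n)) * emeasure P (?E 0))"
  proof -
    have "ennreal (1 / (2 * real ?m * R) ^ CARD('n)) = 1 / ennreal ((2 * real ?m * R) ^ CARD('n))"
      using divide_ennreal[of 1 "(2 * real ?m * R) ^ CARD('n)"] pos unfolding vol by (simp del: of_nat_Suc)
    moreover have "ennreal (real ?m ^ CARD('n)) = of_nat (?m ^ CARD('n))"
      by (simp only: of_nat_power[symmetric] ennreal_of_nat_eq_real_of_nat)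
    moreover have "0 \<le> 1 / (2 * real ?m * R) ^ CARD('n)" using R by simp
    ultimately show ?thesis unfolding p0(2) using p0(1) by (simp only: ennreal_mult' zero_le_power of_nat_0_le_iff)
  qed
  also have "\<dots> \<le> emeasure (mean_diagram R n) K"
    unfolding emeasure_mean_diagram[OF R K(1)] by (rule mult_left_mono[OF le]) simp
  finally show ?thesis .
qed

text \<open>A small box about the point is chosen with edges off the values of \<kappa> on the
  pattern. These values leave a gap that tolerates a perturbation of size \<delta>, and then a tile
  radius is chosen. The box count yields a positive lower bound on a compact set \<open>K\<close>
  inside \<open>U\<close>, and a bump function equal to 1 on \<open>K\<close> carries it to
  \<open>\<nu>\<close>.\<close>

lemma finite_realizable_in_support:
  assumes p: "p \<in> realizable_points F \<kappa> q" "snd p \<noteq> \<infinity>" and U: "openin Delta'_top U" "p \<in> U"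
  shows "0 < emeasure \<nu> U"
proof -
  obtain \<Xi> where \<Xi>: "\<Xi> \<noteq> {}" "finite_simple_marked_set \<Xi>" "p \<in># verbose_diagram F (kappa_filtration \<kappa> \<Xi>) q"
    using p(1) by (auto simp: realizable_points_def)
  have fin\<Xi>: "finite \<Xi>" using \<Xi>(2) by (simp add: finite_simple_marked_set_def)
  have "0 \<le> fst p" "fst p \<le> snd p" using p(1) by (auto simp: realizable_points_def Delta'_eq)
  moreover obtain p1 p2 where p12: "p = (p1, p2)" by (cases p)
  ultimately obtain b d where bd: "p = (ereal b, ereal d)" "0 \<le> b" "b \<le> d"
    using p(2) by (cases p1; cases p2) auto
  obtain W where W: "open W" "U = Delta' \<inter> W" using U(1) by (auto simp: openin_open)
  have pW: "p \<in> W" using U(2) W(2) by simp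
  obtain A B where AB': "open A" "open B" "p \<in> A \<times> B" "A \<times> B \<subseteq> W" by (rule open_prod_elim[OF W(1) pW])
  then have AB: "open A" "open B" "ereal b \<in> A" "ereal d \<in> B" "A \<times> B \<subseteq> W" by (simp_all add: bd(1))
  have "open (ereal -` A)" "open (ereal -` B)" using AB(1,2) by (simp_all add: open_ereal_vimage)
  then obtain e1 e2 where e12: "0 < e1" "cball b e1 \<subseteq> ereal -` A" "0 < e2" "cball d e2 \<subseteq> ereal -` B"
    using AB(3,4) by (meson open_contains_cball vimageI)
  define V where "V = (\<lambda>\<sigma>. enn2real (\<kappa> \<sigma>)) ` {\<sigma>. \<sigma> \<subseteq> \<Xi> \<and> \<sigma> \<noteq> {}}"
  have finV: "finite V" unfolding V_def using fin\<Xi> by simp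
  \<comment> \<open>Avoiding these finitely many differences keeps the four thresholds
    \<open>b - e\<close>, \<open>b + e\<close>, \<open>d - e\<close> and \<open>d + e\<close> off
    the values of \<kappa> on the pattern.\<close>
  let ?bad = "\<Union>v\<in>V. {v - b, b - v, v - d, d - v}"
  have "finite ?bad" using finV by (rule finite_UN_I) simp
  moreover have "infinite {0<..<min e1 e2}" by (rule infinite_Ioo) (simp add: e12)
  ultimately have "{0<..<min e1 e2} - ?bad \<noteq> {}" by (intro infinite_imp_nonempty Diff_infinite_finite)
  then obtain e where e': "e \<in> {0<..<min e1 e2} - ?bad" unfolding ex_in_conv[symmetric] by (rule exE)
  have e: "0 < e" "e < e1" "e < e2" using e' by simp_all
  have avoid: "e \<noteq> v - b \<and> e \<noteq> b - v \<and> e \<noteq> v - d \<and> e \<noteq> d - v" if "v \<in> V" for v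
    using e' that by simp
  define a1 a2 b1 b2 where ab_def: "a1 = b - e" "a2 = b + e" "b1 = d - e" "b2 = d + e"
  let ?Ts = "{a1, a2, b1, b2}"
  obtain g where g: "0 < g" "\<And>x. x \<in> (\<lambda>(v, t). \<bar>v - t\<bar>) ` (V \<times> ?Ts) \<Longrightarrow> g \<le> x"
  proof (rule finite_positive_lower_bound)
    show "finite ((\<lambda>(v, t). \<bar>v - t\<bar>) ` (V \<times> ?Ts))" using finV by (intro finite_imageI finite_cartesian_product) simp_all
    show "0 < x" if x: "x \<in> (\<lambda>(v, t). \<bar>v - t\<bar>) ` (V \<times> ?Ts)" for x
    proof -
      obtain v t where vt: "v \<in> V" "t \<in> ?Ts" "x = \<bar>v - t\<bar>" using x by (auto simp del: insert_iff)
      have "v \<noteq> t" using avoid[OF vt(1)] vt(2) unfolding ab_def by auto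
      then show ?thesis using vt(3) by simp
    qed
    fix g assume "0 < g" "\<And>x. x \<in> (\<lambda>(v, t). \<bar>v - t\<bar>) ` (V \<times> ?Ts) \<Longrightarrow> g \<le> x"
    then show thesis by (rule that)
  qed
  \<comment> \<open>Half the least distance between positions; balls of at most this radius about
    them are disjoint.\<close>
  obtain s where s: "0 < s" "\<And>x. x \<in> (\<lambda>(x, y). dist x y / 2) ` {(x, y) \<in> fst ` \<Xi> \<times> fst ` \<Xi>. x \<noteq> y} \<Longrightarrow> s \<le> x"
  proof (rule finite_positive_lower_bound)
    have "finite (fst ` \<Xi> \<times> fst ` \<Xi>)" using fin\<Xi> by simp
    then show "finite ((\<lambda>(x, y). dist x y / 2) ` {(x, y) \<in> fst ` \<Xi> \<times> fst ` \<Xi>. x \<noteq> y})"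
      by (rule finite_imageI[OF finite_subset[rotated]]) auto
    show "0 < x" if "x \<in> (\<lambda>(x, y). dist x y / 2) ` {(x, y) \<in> fst ` \<Xi> \<times> fst ` \<Xi>. x \<noteq> y}" for x
      using that by auto
    fix s assume "0 < s" "\<And>x. x \<in> (\<lambda>(x, y). dist x y / 2) ` {(x, y) \<in> fst ` \<Xi> \<times> fst ` \<Xi>. x \<noteq> y} \<Longrightarrow> s \<le> x"
    then show thesis by (rule that)
  qed
  \<comment> \<open>The first term gives \<open>c * \<delta> \<le> g / 2\<close>, strictly inside
    the gap, and the second keeps the balls disjoint.\<close>
  define \<delta> where "\<delta> = min (g / (2 * c)) s"
  have \<delta>: "0 < \<delta>" using g(1) s(1) c_pos by (simp add: \<delta>_def)
  have "c * \<delta> \<le> c * (g / (2 * c))" using c_pos by (intro mult_left_mono) (simp_all add: \<delta>_def)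
  also have "\<dots> < g" using c_pos g(1) by simp
  finally have c\<delta>: "c * \<delta> < g" .
  have gap: "c * \<delta> < \<bar>enn2real (\<kappa> \<sigma>) - t\<bar>" if "\<sigma> \<subseteq> \<Xi>" "\<sigma> \<noteq> {}" "t \<in> ?Ts" for \<sigma> t
  proof -
    have "enn2real (\<kappa> \<sigma>) \<in> V" unfolding V_def using that(1,2) by blast
    then have "(enn2real (\<kappa> \<sigma>), t) \<in> V \<times> ?Ts" using that(3) by simp
    from g(2)[OF imageI[OF this]] show ?thesis using c\<delta> by simp
  qed
  have disj: "disjoint_family_on (\<lambda>x. ball x \<delta>) (fst ` \<Xi>)"
    unfolding disjoint_family_on_def
  proof (intro ballI impI)
    fix x y assume "x \<in> fst ` \<Xi>" "y \<in> fst ` \<Xi>" "x \<noteq> y"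
    then have "(x, y) \<in> {(x, y) \<in> fst ` \<Xi> \<times> fst ` \<Xi>. x \<noteq> y}" by blast
    from s(2)[OF imageI[OF this]] have "\<delta> \<le> dist x y / 2" by (simp add: \<delta>_def)
    then show "ball x \<delta> \<inter> ball y \<delta> = {}" by (intro disjoint_ballI) simp
  qed
  obtain \<rho> where \<rho>: "0 \<le> \<rho>" "\<And>z w. \<kappa> {z, w} \<le> ennreal (max a2 b2) \<Longrightarrow> norm (fst z - fst w) \<le> \<rho>"
    using diameter_bound[of "max a2 b2"] by blast
  \<comment> \<open>The sum of the norms is a crude upper bound for each of them, and the final 1
    makes the inequality strict.\<close>
  define R where "R = (\<Sum>z\<in>\<Xi>. norm (fst z)) + \<delta> + \<rho> + 1"
  have R: "0 < R" using \<delta> \<rho>(1) by (auto simp: R_def intro!: add_nonneg_pos add_nonneg_nonneg sum_nonneg)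
  have far: "norm (fst z) + \<delta> + \<rho> < R" if "z \<in> \<Xi>" for z
    using member_le_sum[OF that, of "\<lambda>z. norm (fst z)"] fin\<Xi> by (simp add: R_def)
  have pos: "0 < box_count F \<kappa> \<Xi> q (ereal a1) (ereal a2) (ereal b1) (ereal b2)"
  proof -
    have "p \<in># {#p \<in># verbose_diagram F (kappa_filtration \<kappa> \<Xi>) q. ereal a1 < fst p \<and> fst p \<le> ereal a2 \<and> ereal b1 < snd p \<and> snd p \<le> ereal b2#}"
      using \<Xi>(3) e(1) by (simp add: bd(1) ab_def)
    moreover have "0 < size M" if "x \<in># M" for x :: "ereal \<times> ereal" and M
      unfolding nonempty_has_size[symmetric] using that by auto
    ultimately show ?thesis unfolding box_count_def by blast
  qed
  let ?C = "{p :: ereal \<times> ereal. 0 \<le> fst p \<and> fst p \<le> snd p}"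
  \<comment> \<open>The closed box cut by the order triangle: compact as a closed subset of the
    compact square, and inside \<open>Delta'\<close> because its corners are finite.\<close>
  define K where "K = ?C \<inter> ({ereal a1..ereal a2} \<times> {ereal b1..ereal b2})"
  have KD: "K \<subseteq> Delta'" by (auto simp: K_def Delta'_eq)
  have "closed K" unfolding K_def by (intro closed_Int closed_ereal_order_pairs closed_Times closed_atLeastAtMost)
  moreover have "compact (UNIV \<times> UNIV :: (ereal \<times> ereal) set)" by (intro compact_Times compact_UNIV)
  ultimately have "compact K" using compact_Int_closed[of "UNIV \<times> UNIV" K] by simp
  then have Kc: "compactin Delta'_top K" using KD by (simp add: compactin_subtopology)
  then have Ks: "K \<in> sets (borel_of Delta'_top)"
    by (intro sets_borel_of_closedin compactin_imp_closedin Hausdorff_space_top_of_set)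
  have near: "x \<in> ereal -` G" if "ereal (u - e) \<le> ereal x" "ereal x \<le> ereal (u + e)" "cball u r \<subseteq> ereal -` G" "e < r" for x u r G
    using that by (auto simp: cball_def dist_real_def subset_iff)
  have KU: "K \<subseteq> U"
  proof
    fix x assume x: "x \<in> K"
    obtain x1 x2 where x12: "x = (x1, x2)" by (cases x)
    have "ereal a1 \<le> x1" "x1 \<le> ereal a2" "ereal b1 \<le> x2" "x2 \<le> ereal b2" using x by (auto simp: K_def x12)
    moreover from this obtain y1 y2 where y: "x1 = ereal y1" "x2 = ereal y2" by (cases x1; cases x2) auto
    ultimately have "y1 \<in> ereal -` A" "y2 \<in> ereal -` B"
      using near[OF _ _ e12(2) e(2)] near[OF _ _ e12(4) e(3)] by (auto simp: ab_def)
    then have "x \<in> W" using AB(5) by (auto simp: x12 y)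
    then show "x \<in> U" using W(2) KD x by blast
  qed
  let ?C0 = "configuration (fst ` \<Xi>) \<delta> (tile R) 0 :: ((real ^ 'n) \<times> 'm) measure set"
  let ?p0 = "emeasure P {\<omega>\<in>space P. \<Phi> \<omega> \<in> ?C0}"
  have "0 < ?p0"
  proof (rule configuration_positive[OF _ \<delta> disj])
    show "finite (fst ` \<Xi>)" using fin\<Xi> by simp
    show "ball x \<delta> \<subseteq> tile R" if "x \<in> fst ` \<Xi>" for x
    proof
      fix y assume "y \<in> ball x \<delta>"
      then have "norm y \<le> norm x + \<delta>" using norm_triangle_sub[of y x] by (simp add: dist_norm norm_minus_commute)
      moreover have "norm x + \<delta> + \<rho> < R" using that far by blast
      ultimately have "norm y \<le> R" using \<rho>(1) by linarith
      then show "y \<in> tile R" unfolding mem_tile using component_le_norm_cart order_trans by blast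
    qed
  qed
  moreover obtain p0 where p0: "0 \<le> p0" "?p0 = ennreal p0"
    using prob_space.emeasure_le_1[OF prob, of "{\<omega>\<in>space P. \<Phi> \<omega> \<in> ?C0}"] by (cases ?p0) (auto simp: top_unique)
  ultimately have p0_pos: "0 < p0" by simp
  \<comment> \<open>The probability of the pattern in one tile per unit of volume.\<close>
  define \<eta> where "\<eta> = p0 / (2 * R) ^ CARD('n)"
  have \<eta>: "0 < \<eta>" using p0_pos R by (simp add: \<eta>_def)
  have \<eta>e: "?p0 / ennreal ((2 * R) ^ CARD('n)) = ennreal \<eta>"
    unfolding p0(2) \<eta>_def using p0(1) R by (intro divide_ennreal) simp_all
  have low: "ennreal \<eta> \<le> emeasure (mean_diagram R n) K" for n
    unfolding \<eta>e[symmetric]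
  proof (rule mean_diagram_box[OF \<Xi>(2) \<delta> gap _ _ _ _ \<rho>(2) far \<rho>(1) R disj pos Ks])
    show "a1 \<le> a2" "b1 \<le> b2" "a2 \<le> max a2 b2" "b2 \<le> max a2 b2" using e(1) by (simp_all add: ab_def)
    show "x \<in> K" if "x \<in> Delta'" "ereal a1 \<le> fst x" "fst x \<le> ereal a2" "ereal b1 \<le> snd x" "snd x \<le> ereal b2" for x
      using that by (auto simp: K_def Delta'_eq mem_Times_iff)
  qed
  from ex_Cc_bump[OF locally_compact_Delta' Hausdorff_space_top_of_set Kc U(1) KU]
  obtain f where f: "f \<in> Cc Delta'_top" "\<forall>x\<in>topspace Delta'_top. 0 \<le> f x \<and> f x \<le> 1" "\<forall>x\<in>K. f x = 1"
      "\<forall>x\<in>topspace Delta'_top - U. f x = 0" by blast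
  have "\<eta> \<le> integral\<^sup>L (mean_diagram R n) f" for n
  proof -
    have sm: "sets (mean_diagram R n) = sets (borel_of Delta'_top)" "space (mean_diagram R n) = topspace Delta'_top"
      using radon_measuresD(1,2)[OF mean_diagram_radon[OF R]] by auto
    have "emeasure (mean_diagram R n) K = (\<integral>\<^sup>+x. indicator K x \<partial>mean_diagram R n)"
      using Ks sm(1) by (simp only: nn_integral_indicator)
    also have "\<dots> \<le> (\<integral>\<^sup>+x. ennreal (f x) \<partial>mean_diagram R n)"
      by (rule nn_integral_mono) (use f(3) in \<open>simp add: indicator_def\<close>)
    also have "\<dots> = ennreal (integral\<^sup>L (mean_diagram R n) f)"
      using nn_integral_Cc[OF f(1) Hausdorff_space_top_of_set mean_diagram_radon[OF R, of n]] f(2) by simp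
    finally have "ennreal \<eta> \<le> ennreal (integral\<^sup>L (mean_diagram R n) f)" using low[of n] by (rule order_trans[rotated])
    then show ?thesis using \<eta> by (simp add: ennreal_le_iff2)
  qed
  then have int: "\<eta> \<le> integral\<^sup>L \<nu> f"
    using LIMSEQ_le_const[OF mean_diagram_limit[OF R f(1)]] by blast
  have sn: "sets \<nu> = sets (borel_of Delta'_top)" "space \<nu> = topspace Delta'_top"
    using radon_measuresD(1,2)[OF nu_radon] by auto
  have "ennreal (integral\<^sup>L \<nu> f) = (\<integral>\<^sup>+x. ennreal (f x) \<partial>\<nu>)"
    using nn_integral_Cc[OF f(1) Hausdorff_space_top_of_set nu_radon] f(2) by simp
  also have "\<dots> \<le> (\<integral>\<^sup>+x. indicator U x \<partial>\<nu>)"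
  proof (rule nn_integral_mono)
    fix x assume "x \<in> space \<nu>"
    then have "x \<in> topspace Delta'_top" by (simp only: sn)
    then show "ennreal (f x) \<le> indicator U x"
      using f(2,4) by (cases "x \<in> U") (simp_all add: ennreal_le_1)
  qed
  also have "\<dots> = emeasure \<nu> U" using sets_borel_of_openin[OF U(1)] sn(1) by (simp only: nn_integral_indicator)
  finally have "ennreal (integral\<^sup>L \<nu> f) \<le> emeasure \<nu> U" .
  moreover have "0 < ennreal (integral\<^sup>L \<nu> f)" using int \<eta> by simp
  ultimately show ?thesis by (rule order_less_le_trans[rotated])
qed

section \<open>Points with infinite death and the reverse inclusion\<close>

lemma singletons_equal: "\<kappa> {z} = \<kappa> {w}"
proof -
  have "\<kappa> ((\<lambda>(y, m). (y + (fst w - fst z), m)) ` {z}) = \<kappa> {z}"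
    by (rule kappa_translate[rule_format]) (simp add: finite_subsets_def)
  then have "\<kappa> {z} = \<kappa> {(fst w, snd z)}" by (simp add: case_prod_unfold)
  \<comment> \<open>Translation has adjusted the position; the mark can be exchanged because the two
    singletons have the same projection, hence Hausdorff distance 0.\<close>
  moreover have "enn2real (\<kappa> {(fst w, snd z)}) = enn2real (\<kappa> {w})"
    using lipschitz[of "{(fst w, snd z)}" "{w}"] by (simp add: finite_subsets_def hausdorff_dist_def)
  moreover have "\<kappa> {(fst w, snd z)} < \<infinity>" "\<kappa> {w} < \<infinity>" using finite_kappa by (simp_all add: finite_subsets_def)
  ultimately show ?thesis by (cases "\<kappa> {(fst w, snd z)}"; cases "\<kappa> {w}") auto
qed

text \<open>Infinite deaths occur in degree 0 only, all births there being equal; two points far apart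
  realize large finite deaths.\<close>

lemma realizable_near_infinite_death:
  assumes p: "p \<in> realizable_points F \<kappa> q" "snd p = \<infinity>" and U: "openin Delta'_top U" "p \<in> U"
  shows "\<exists>p'\<in>realizable_points F \<kappa> q. snd p' \<noteq> \<infinity> \<and> p' \<in> U"
proof -
  obtain \<Xi> where \<Xi>: "\<Xi> \<noteq> {}" "finite_simple_marked_set \<Xi>" "p \<in># verbose_diagram F (kappa_filtration \<kappa> \<Xi>) q"
    using p(1) by (auto simp: realizable_points_def)
  have fin\<Xi>: "finite \<Xi>" using \<Xi>(2) by (simp add: finite_simple_marked_set_def)
  have q: "q = 0" using verbose_diagram_death_finite[OF fin\<Xi> finite_kappa _ \<Xi>(3)] p(2) by auto
  obtain z0 where z0: "z0 \<in> \<Xi>" using \<Xi>(1) by blast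
  define k0 where "k0 = enn2ereal (\<kappa> {z0})"
  have single: "enn2ereal (\<kappa> {z}) = k0" for z unfolding k0_def by (subst singletons_equal[of z z0]) simp
  have fstp: "fst p = k0" using verbose_diagram_degree_0_birth[OF fin\<Xi> finite_kappa single] \<Xi>(3) q by blast
  obtain W where W: "open W" "U = Delta' \<inter> W" using U(1) by (auto simp: openin_open)
  have pk: "p = (k0, \<infinity>)" using fstp p(2) by (simp add: prod_eq_iff)
  have pW: "p \<in> W" using U(2) W(2) by simp
  obtain A B where AB': "open A" "open B" "p \<in> A \<times> B" "A \<times> B \<subseteq> W" by (rule open_prod_elim[OF W(1) pW])
  then have AB: "open A" "open B" "k0 \<in> A" "\<infinity> \<in> B" "A \<times> B \<subseteq> W" by (simp_all add: pk)
  obtain t where t: "{ereal t<..} \<subseteq> B" using open_PInfty[OF AB(2,4)] by blast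
  \<comment> \<open>The maximum with 0 is there because \<open>ennreal\<close> truncates a negative
    \<open>t\<close>.\<close>
  obtain \<rho> where \<rho>: "0 \<le> \<rho>" "\<And>z w. \<kappa> {z, w} \<le> ennreal (max t 0) \<Longrightarrow> norm (fst z - fst w) \<le> \<rho>"
    using diameter_bound[of "max t 0"] by blast
  \<comment> \<open>All coordinates of the second position are \<open>\<rho> + 1\<close>, so the
    distance exceeds \<rho> and \<kappa> of the pair must exceed \<open>max t 0\<close>. Any mark
    would do; that of \<open>z0\<close> is at hand.\<close>
  let ?u = "(0, snd z0) :: (real ^ 'n) \<times> 'm" and ?v = "(\<chi> i. \<rho> + 1, snd z0) :: (real ^ 'n) \<times> 'm"
  have nv: "\<rho> + 1 \<le> norm (\<chi> i. \<rho> + 1 :: real ^ 'n)"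
    using component_le_norm_cart[of "\<chi> i. \<rho> + 1 :: real ^ 'n" undefined] by simp
  have "\<not> \<kappa> {?u, ?v} \<le> ennreal (max t 0)" using \<rho>(2)[of ?u ?v] nv by auto
  then have big: "ennreal (max t 0) < \<kappa> {?u, ?v}" by simp
  have fin: "\<kappa> {?u, ?v} < \<infinity>" using finite_kappa by (simp add: finite_subsets_def)
  have "fst ?u \<noteq> fst ?v" using nv \<rho>(1) by (auto simp: vec_eq_iff)
  then have uv: "?u \<noteq> ?v" and fs: "finite_simple_marked_set {?u, ?v}" by (auto simp: finite_simple_marked_set_def)
  obtain p' where p': "p' \<in># verbose_diagram F (kappa_filtration \<kappa> {?u, ?v}) 0" "snd p' = enn2ereal (\<kappa> {?u, ?v})"
    using verbose_diagram_two_points[OF uv finite_kappa] by blast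
  have fst': "fst p' = k0" by (rule verbose_diagram_degree_0_birth[OF _ finite_kappa single p'(1)]) simp
  have le: "0 \<le> fst p'" "fst p' \<le> snd p'"
    by (rule verbose_diagram_birth_le_death[OF _ finite_kappa _ p'(1)], simp, rule kappa_mono[rule_format], assumption+)+
  have s: "ereal t < snd p'" "snd p' \<noteq> \<infinity>"
  proof -
    have "ereal t < enn2ereal x \<and> enn2ereal x \<noteq> \<infinity>" if "ennreal (max t 0) < x" "x < \<infinity>" for x :: ennreal
      using that by (cases x) (auto, meson ennreal_leI not_less)
    from this[OF big fin] show "ereal t < snd p'" "snd p' \<noteq> \<infinity>" unfolding p'(2) by (rule conjunct1, rule conjunct2)
  qed
  have D: "p' \<in> Delta'" using le s(2) by (auto simp: Delta'_eq)
  have "snd p' \<in> B" using t by (rule subsetD) (simp add: s(1))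
  then have "p' \<in> A \<times> B" using AB(3) fst' by (simp add: mem_Times_iff)
  then have "p' \<in> W" using AB(5) by (rule subsetD[rotated])
  then have "p' \<in> U" using D W(2) by simp
  moreover have "p' \<in> realizable_points F \<kappa> q" unfolding realizable_points_def
    by (intro CollectI conjI exI[of _ "{?u, ?v}"] D fs) (simp_all only: p'(1) q insert_not_empty not_False_eq_True)
  ultimately show ?thesis using s(2) by blast
qed

lemma closure_subset_support: "Delta'_top closure_of realizable_points F \<kappa> q \<subseteq> measure_support Delta'_top \<nu>"
proof
  fix p assume p: "p \<in> Delta'_top closure_of realizable_points F \<kappa> q"
  have "0 < emeasure \<nu> U" if U: "openin Delta'_top U" "p \<in> U" for U
  proof -
    obtain r where r: "r \<in> realizable_points F \<kappa> q" "r \<in> U" using p U unfolding in_closure_of by blast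
    then obtain r' where "r' \<in> realizable_points F \<kappa> q" "snd r' \<noteq> \<infinity>" "r' \<in> U"
      using realizable_near_infinite_death[OF r(1) _ U(1) r(2)] by (cases "snd r = \<infinity>") blast+
    then show ?thesis using finite_realizable_in_support U(1) by blast
  qed
  moreover have "p \<in> topspace Delta'_top" using p by (rule in_closure_of[THEN iffD1, THEN conjunct1])
  ultimately show "p \<in> measure_support Delta'_top \<nu>" unfolding measure_support_def by blast
qed

end

theorem theorem4p3:
  fixes P :: "'w measure"
    and \<Phi> :: "'w \<Rightarrow> ((real ^ 'n) \<times> 'm::{second_countable_topology, t2_space}) measure"
    and Q :: "'u measure" and \<Psi> :: "'u \<Rightarrow> (real ^ 'n) measure" and l :: real
    and \<kappa> :: "((real ^ 'n) \<times> 'm) set \<Rightarrow> ennreal" and c :: real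
    and F :: "'f::field itself" and q :: nat and \<nu> :: "(ereal \<times> ereal) measure"
  assumes "locally_compact_space (euclidean :: 'm topology)"
    and "prob_space P" and "marked_point_process P \<Phi>" and "stationary P \<Phi>"
    and "ground_finite_moments P \<Phi>"
    and "prob_space Q" and "0 < l" and "homogeneous_poisson_process Q l \<Psi>"
    and "\<And>\<Lambda>. compact \<Lambda> \<Longrightarrow> absolutely_continuous
           (law Q (top_of_set \<Lambda>) (\<lambda>\<omega>. restrict_space (\<Psi> \<omega>) \<Lambda>))
           (law P (top_of_set \<Lambda>) (\<lambda>\<omega>. restrict_space (ground (\<Phi> \<omega>)) \<Lambda>))"
    and "\<And>\<Lambda>. compact \<Lambda> \<Longrightarrow>
           AE \<mu> in law Q (top_of_set \<Lambda>) (\<lambda>\<omega>. restrict_space (\<Psi> \<omega>) \<Lambda>).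
             0 < RN_deriv (law Q (top_of_set \<Lambda>) (\<lambda>\<omega>. restrict_space (\<Psi> \<omega>) \<Lambda>))
                   (law P (top_of_set \<Lambda>) (\<lambda>\<omega>. restrict_space (ground (\<Phi> \<omega>)) \<Lambda>)) \<mu>"
    and "filtration_function \<kappa>"
    and "\<And>\<sigma>. \<sigma> \<in> finite_subsets \<Longrightarrow> \<kappa> \<sigma> < \<infinity>"
    and "0 < c"
    and "\<And>\<sigma> \<sigma>'. \<sigma> \<in> finite_subsets \<Longrightarrow> \<sigma>' \<in> finite_subsets \<Longrightarrow>
           \<bar>enn2real (\<kappa> \<sigma>) - enn2real (\<kappa> \<sigma>')\<bar> \<le> c * hausdorff_dist (fst ` \<sigma>) (fst ` \<sigma>')"
    and "is_limiting_measure F \<kappa> P \<Phi> q \<nu>"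
  shows "measure_support Delta'_top \<nu> = Delta'_top closure_of (realizable_points F \<kappa> q)"
proof -
  \<comment> \<open>A configuration about 0 is a condition on the ground measure alone, on a compact
    tile, which is where the comparison with the Poisson process is available.\<close>
  have pos: "0 < emeasure P {\<omega>\<in>space P. \<Phi> \<omega> \<in> configuration D \<delta> (tile R) 0}"
    if D: "finite D" "0 < \<delta>" "disjoint_family_on (\<lambda>x. ball x \<delta>) D" "\<And>x. x \<in> D \<Longrightarrow> ball x \<delta> \<subseteq> tile R" for D \<delta> R
  proof -
    let ?S = "tile R :: (real ^ 'n) set"
    have S: "compact ?S" by (simp add: tile_def compact_cbox)
    have \<Gamma>: "point_process P euclidean (\<lambda>\<omega>. ground (\<Phi> \<omega>))" using assms(3) by (simp add: marked_point_process_def)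
    have "\<Phi> \<omega> \<in> configuration D \<delta> ?S 0 \<longleftrightarrow>
      (\<forall>x\<in>D. emeasure (ground (\<Phi> \<omega>)) (ball x \<delta>) = 1) \<and> emeasure (ground (\<Phi> \<omega>)) (?S - (\<Union>x\<in>D. ball x \<delta>)) = 0"
      if w: "\<omega> \<in> space P" for \<omega>
    proof -
      have cm: "\<Phi> \<omega> \<in> counting_measures euclidean" by (rule marked_point_processD(1)[OF assms(3) w])
      have g: "emeasure (\<Phi> \<omega>) {z. fst z - 0 \<in> B} = emeasure (ground (\<Phi> \<omega>)) B" if "B \<in> sets borel" for B
      proof -
        have "{z. fst z - 0 \<in> B} = B \<times> (UNIV :: 'm set)" by auto
        then show ?thesis using emeasure_ground(1)[OF counting_measures_euclideanD(1)[OF cm] that] by simp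
      qed
      have SD: "?S - (\<Union>x\<in>D. ball x \<delta>) \<in> sets borel"
        by (rule sets.Diff) (simp add: tile_def, intro borel_open open_UN, simp)
      have "ball x \<delta> \<in> sets borel" for x :: "real ^ 'n" by simp
      from g[OF this] show ?thesis unfolding configuration_def mem_Collect_eq g[OF SD] by (simp only: cm simp_thms)
    qed
    then have "{\<omega>\<in>space P. \<Phi> \<omega> \<in> configuration D \<delta> ?S 0} = {\<omega>\<in>space P.
      (\<forall>x\<in>D. emeasure (ground (\<Phi> \<omega>)) (ball x \<delta>) = 1) \<and> emeasure (ground (\<Phi> \<omega>)) (?S - (\<Union>x\<in>D. ball x \<delta>)) = 0}"
      by blast
    then show ?thesis
      using configuration_prob_positive[OF assms(6-8,2) \<Gamma> S assms(9)[OF S] assms(10)[OF S] D] by simp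
  qed
  interpret limiting_diagram P \<Phi> \<kappa> c F q \<nu>
    by (rule limiting_diagram.intro) (use assms(1-5,11-15) pos in blast)+
  show ?thesis using support_subset_closure closure_subset_support by (rule equalityI)
qed

end
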